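(* Let $\alpha\in\mathbb{R}$ with $|\alpha|<1$ and $I=(0,1)$. There exist constants $\epsilon>0$ and $C>0$, with $C$ independent of $\epsilon$, such that for every $\varphi\in C^1(\mathbb{R})$ with $\|\varphi\|_{C^1(\mathbb{R})}\le\epsilon$, the system $$\begin{cases} u_t+u_{xxx}-u_{xxxxx}+uu_x=0, & (x,t)\in I\times\mathbb{R},\\ u(0,t)=\varphi(t),\quad u(1,t)=u_x(1,t)=u_x(0,t)=0, & t\in\mathbb{R},\\ u_{xx}(1,t)=\alpha u_{xx}(0,t), & t\in\mathbb{R},\end{cases}$$ admits a unique (mild) solution $u$ with $\|u\|_X\le C\epsilon$, and, if $\varphi$ and $\varphi'$ are almost periodic functions, then this solution $u$ is almost periodic (as a map $t\mapsto u(\cdot,t)\in H^2(I)$).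
   Context: $C^1(\mathbb{R})$: continuously differentiable complex-valued functions on $\mathbb{R}$, $\|\varphi\|_{C^1(\mathbb{R})}=\sup_{\mathbb{R}}|\varphi|+\sup_{\mathbb{R}}|\varphi'|$. $L^2(I)$ and $H^2(I)$ consist of complex-valued functions. $X=C_b(\mathbb{R},H^2(I))$ is the space of bounded continuous functions $\mathbb{R}\to H^2(I)$, with $\|u\|_X=\sup_{t\in\mathbb{R}}\|u(t)\|_{H^2(I)}$. $\{S(t)\}_{t\ge0}$ is the $C_0$-semigroup of contractions on $L^2(I)$ generated by the operator $v\mapsto -v_{xxx}+v_{xxxxx}$ with domain $\{v\in H^5(I): v(0)=v(1)=v_x(0)=v_x(1)=0,\ v_{xx}(1)=\alpha v_{xx}(0)\}$. Notion of solution. Put $A(x)=\frac{\alpha-1}{\alpha+1}x^2+\frac{2}{\alpha+1}x-1$, $a(x,t)=-A(x)\varphi(t)$, $b(x,t)=-A'(x)\varphi(t)$, $f(x,t)=A(x)\varphi'(t)-A(x)A'(x)\varphi(t)^2$. A function $u\in X$ is a (mild) solution of the system if $y(x,t)=u(x,t)+A(x)\varphi(t)$ satisfies $$y(t)=S(t-r)y(r)+\int_r^t S(t-s)\,(-yy_x-ay_x-by+f)(s)\,ds\qquad\text{for all } r\in\mathbb{R},\ t\ge r.$$ The boundary conditions are understood only through this integral equation. Almost periodicity. Let $(Y,d)$ be a separable complete metric space. A continuous map $g:\mathbb{R}\to Y$ is almost periodic if for every $\delta>0$ there is a constant $l(\delta)>0$ such that any interval of length $l(\delta)$ contains at least one number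 $\tau$ with $\sup_{t\in\mathbb{R}}d(g(t+\tau),g(t))<\delta$. *)

theory Defs
  imports "HOL-Analysis.Analysis" "HOL-Computational_Algebra.Polynomial"
begin

section \<open>The complex Hilbert space of square-integrable functions on (0,1)\<close>

abbreviation I_leb :: "real measure" where
  "I_leb \<equiv> lebesgue_on {0<..<1}"

definition sq_int :: "(real \<Rightarrow> complex) \<Rightarrow> bool" where
  "sq_int f \<longleftrightarrow> f \<in> borel_measurable I_leb \<and> integrable I_leb (\<lambda>x. (norm (f x))\<^sup>2)"

definition l2rel :: "(real \<Rightarrow> complex) \<Rightarrow> (real \<Rightarrow> complex) \<Rightarrow> bool" where
  "l2rel f g \<longleftrightarrow> sq_int f \<and> sq_int g \<and> (AE x in I_leb. f x = g x)"

lemma sq_int_0: "sq_int (\<lambda>x. 0)"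
  by (simp add: sq_int_def)

lemma sq_int_mult_integrable:
  assumes "sq_int f" "sq_int g"
  shows "integrable I_leb (\<lambda>x. f x * g x)"
proof (rule Bochner_Integration.integrable_bound)
  show "integrable I_leb (\<lambda>x. (norm (f x))\<^sup>2 + (norm (g x))\<^sup>2)"
    using assms by (simp add: sq_int_def)
  show "(\<lambda>x. f x * g x) \<in> borel_measurable I_leb"
    using assms by (auto simp: sq_int_def)
  have "norm (f x * g x) \<le> norm ((norm (f x))\<^sup>2 + (norm (g x))\<^sup>2)" for x
  proof -
    have "2 * (norm (f x) * norm (g x)) \<le> (norm (f x))\<^sup>2 + (norm (g x))\<^sup>2"
      using sum_squares_bound[of "norm (f x)" "norm (g x)"] by simp
    moreover have "0 \<le> norm (f x) * norm (g x)" by simp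
    ultimately have "norm (f x) * norm (g x) \<le> (norm (f x))\<^sup>2 + (norm (g x))\<^sup>2" by linarith
    then show ?thesis by (simp add: norm_mult)
  qed
  then show "AE x in I_leb. norm (f x * g x) \<le> norm ((norm (f x))\<^sup>2 + (norm (g x))\<^sup>2)" by simp
qed

lemma sq_int_cnj: "sq_int f \<Longrightarrow> sq_int (\<lambda>x. cnj (f x))"
  unfolding sq_int_def
  using borel_measurable_continuous_on[of cnj f I_leb] by (auto intro: continuous_intros)

lemma sq_int_cmult: "sq_int f \<Longrightarrow> sq_int (\<lambda>x. c * f x)"
  unfolding sq_int_def by (auto simp: norm_mult power_mult_distrib)

lemma sq_int_add:
  assumes "sq_int f" "sq_int g" shows "sq_int (\<lambda>x. f x + g x)"
  unfolding sq_int_def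
proof
  show m: "(\<lambda>x. f x + g x) \<in> borel_measurable I_leb"
    using assms by (auto simp: sq_int_def)
  show "integrable I_leb (\<lambda>x. (norm (f x + g x))\<^sup>2)"
  proof (rule Bochner_Integration.integrable_bound)
    show "integrable I_leb (\<lambda>x. 2 * (norm (f x))\<^sup>2 + 2 * (norm (g x))\<^sup>2)"
      using assms by (simp add: sq_int_def)
    show "(\<lambda>x. (norm (f x + g x))\<^sup>2) \<in> borel_measurable I_leb" using m by measurable
    have "(norm (f x + g x))\<^sup>2 \<le> 2 * (norm (f x))\<^sup>2 + 2 * (norm (g x))\<^sup>2" for x
    proof -
      have "(norm (f x + g x))\<^sup>2 \<le> (norm (f x) + norm (g x))\<^sup>2"
        by (simp add: norm_triangle_ineq power_mono)
      also have "\<dots> \<le> 2 * (norm (f x))\<^sup>2 + 2 * (norm (g x))\<^sup>2"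
        using sum_squares_bound[of "norm (f x)" "norm (g x)"] by (simp add: power2_sum)
      finally show ?thesis .
    qed
    then show "AE x in I_leb. norm ((norm (f x + g x))\<^sup>2)
        \<le> norm (2 * (norm (f x))\<^sup>2 + 2 * (norm (g x))\<^sup>2)" by simp
  qed
qed

text \<open>\<open>abs_l2\<close> is the almost-everywhere class (meaningful for square-integrable arguments only);
  \<open>rep_l2\<close> picks an arbitrary representative.\<close>

quotient_type l2 = "real \<Rightarrow> complex" / partial: l2rel
proof (rule part_equivpI)
  show "\<exists>x. l2rel x x" using sq_int_0 by (auto simp: l2rel_def)
  show "symp l2rel" by (auto simp: l2rel_def intro!: sympI)
  show "transp l2rel" by (rule transpI) (auto simp: l2rel_def)
qed

instantiation l2 :: real_vector
begin

lift_definition zero_l2 :: l2 is "\<lambda>x. 0"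
  by (simp add: l2rel_def sq_int_0)

lift_definition plus_l2 :: "l2 \<Rightarrow> l2 \<Rightarrow> l2" is "\<lambda>f g x. f x + g x"
  by (auto simp: l2rel_def sq_int_add)

lift_definition uminus_l2 :: "l2 \<Rightarrow> l2" is "\<lambda>f x. - f x"
  using sq_int_cmult[of _ "-1"] by (auto simp: l2rel_def)

definition minus_l2 :: "l2 \<Rightarrow> l2 \<Rightarrow> l2" where "minus_l2 u v = u + (- v)"

lift_definition scaleR_l2 :: "real \<Rightarrow> l2 \<Rightarrow> l2" is "\<lambda>c f x. c *\<^sub>R f x"
  using sq_int_cmult by (auto simp: l2rel_def scaleR_conv_of_real)

instance
proof
  fix u v w :: l2 and a b :: real
  show "u + v + w = u + (v + w)" by transfer (auto simp: l2rel_def sq_int_add algebra_simps)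
  show "u + v = v + u" by transfer (auto simp: l2rel_def sq_int_add algebra_simps)
  show "0 + u = u" by transfer (auto simp: l2rel_def)
  show "- u + u = 0" by transfer (auto simp: l2rel_def sq_int_0)
  show "u - v = u + - v" by (simp add: minus_l2_def)
  show "a *\<^sub>R (u + v) = a *\<^sub>R u + a *\<^sub>R v"
    by transfer (auto simp: l2rel_def sq_int_add sq_int_cmult scaleR_conv_of_real distrib_left)
  show "(a + b) *\<^sub>R u = a *\<^sub>R u + b *\<^sub>R u"
    by transfer (auto simp: l2rel_def sq_int_add sq_int_cmult scaleR_conv_of_real distrib_right)
  show "a *\<^sub>R b *\<^sub>R u = (a * b) *\<^sub>R u"
    by transfer (auto simp: l2rel_def sq_int_cmult scaleR_conv_of_real simp flip: mult.assoc of_real_mult)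
  show "1 *\<^sub>R u = u" by transfer (auto simp: l2rel_def)
qed

end

instantiation l2 :: real_inner
begin

lift_definition inner_l2 :: "l2 \<Rightarrow> l2 \<Rightarrow> real" is
  "\<lambda>f g. Re (integral\<^sup>L I_leb (\<lambda>x. f x * cnj (g x)))"
proof -
  fix f f' g g' assume "l2rel f f'" "l2rel g g'"
  then have "integral\<^sup>L I_leb (\<lambda>x. f x * cnj (g x)) = integral\<^sup>L I_leb (\<lambda>x. f' x * cnj (g' x))"
    by (intro integral_cong_AE)
      (auto simp: l2rel_def intro!: borel_measurable_integrable sq_int_mult_integrable sq_int_cnj)
  then show "Re (integral\<^sup>L I_leb (\<lambda>x. f x * cnj (g x))) = Re (integral\<^sup>L I_leb (\<lambda>x. f' x * cnj (g' x)))"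
    by simp
qed

definition norm_l2 :: "l2 \<Rightarrow> real" where "norm_l2 u = sqrt (inner u u)"
definition dist_l2 :: "l2 \<Rightarrow> l2 \<Rightarrow> real" where "dist_l2 u v = norm (u - v)"
definition sgn_l2 :: "l2 \<Rightarrow> l2" where "sgn_l2 u = u /\<^sub>R norm u"
definition uniformity_l2 :: "(l2 \<times> l2) filter" where
  "uniformity_l2 = (INF e\<in>{0 <..}. principal {(u, v). dist u v < e})"
definition open_l2 :: "l2 set \<Rightarrow> bool" where
  "open_l2 U \<longleftrightarrow> (\<forall>u\<in>U. \<forall>\<^sub>F (u', v) in uniformity. u' = u \<longrightarrow> v \<in> U)"

lemma inner_l2_self:
  assumes "sq_int f"
  shows "Re (integral\<^sup>L I_leb (\<lambda>x. f x * cnj (f x))) = integral\<^sup>L I_leb (\<lambda>x. (norm (f x))\<^sup>2)"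
proof -
  have "(\<lambda>x. f x * cnj (f x)) = (\<lambda>x. complex_of_real ((norm (f x))\<^sup>2))"
    by (simp only: complex_norm_square)
  then show ?thesis by (simp only: integral_complex_of_real Re_complex_of_real)
qed

instance
proof
  fix u v w :: l2 and a :: real
  show "sgn u = u /\<^sub>R norm u" by (simp add: sgn_l2_def)
  show "dist u v = norm (u - v)" by (simp add: dist_l2_def)
  show "uniformity = (INF e\<in>{0 <..}. principal {(u::l2, v). dist u v < e})"
    by (simp add: uniformity_l2_def)
  show "open U \<longleftrightarrow> (\<forall>u\<in>U. \<forall>\<^sub>F (u', v) in uniformity. u' = u \<longrightarrow> v \<in> U)" for U :: "l2 set"
    by (simp add: open_l2_def)
  show "inner u v = inner v u"
  proof transfer
    fix f g assume "l2rel f f" "l2rel g g"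
    have "integral\<^sup>L I_leb (\<lambda>x. f x * cnj (g x)) = integral\<^sup>L I_leb (\<lambda>x. cnj (g x * cnj (f x)))"
      by (simp add: mult.commute)
    also have "\<dots> = cnj (integral\<^sup>L I_leb (\<lambda>x. g x * cnj (f x)))" by (rule Bochner_Integration.integral_cnj)
    finally show "Re (integral\<^sup>L I_leb (\<lambda>x. f x * cnj (g x)))
        = Re (integral\<^sup>L I_leb (\<lambda>x. g x * cnj (f x)))" by simp
  qed
  show "inner (u + v) w = inner u w + inner v w"
    by transfer (simp add: l2rel_def distrib_right sq_int_mult_integrable sq_int_cnj)
  show "inner (a *\<^sub>R u) v = a * inner u v"
    by transfer (simp add: l2rel_def scaleR_conv_of_real mult.assoc sq_int_mult_integrable sq_int_cnj)
  show "0 \<le> inner u u" by transfer (simp add: l2rel_def inner_l2_self)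
  show "inner u u = 0 \<longleftrightarrow> u = 0"
  proof transfer
    fix f assume f: "l2rel f f"
    then have i: "integrable I_leb (\<lambda>x. (norm (f x))\<^sup>2)" by (simp add: l2rel_def sq_int_def)
    have "Re (integral\<^sup>L I_leb (\<lambda>x. f x * cnj (f x))) = 0 \<longleftrightarrow> (AE x in I_leb. (norm (f x))\<^sup>2 = 0)"
      using f integral_nonneg_eq_0_iff_AE[OF i] by (simp add: l2rel_def inner_l2_self)
    then show "(Re (integral\<^sup>L I_leb (\<lambda>x. f x * cnj (f x))) = 0) = l2rel f (\<lambda>x. 0)"
      using f by (simp add: l2rel_def sq_int_0)
  qed
  show "norm u = sqrt (inner u u)" by (simp add: norm_l2_def)
qed

end

lift_definition scaleC_l2 :: "complex \<Rightarrow> l2 \<Rightarrow> l2" is "\<lambda>c f x. c * f x"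
  by (auto simp: l2rel_def sq_int_cmult)


section \<open>Weak derivatives and Sobolev spaces on (0,1)\<close>

text \<open>Real-valued test functions suffice for complex-valued distributions, by linearity.\<close>

definition test_fun :: "(real \<Rightarrow> real) \<Rightarrow> bool" where
  "test_fun \<theta> \<longleftrightarrow> (\<forall>k. (deriv ^^ k) \<theta> differentiable_on UNIV) \<and>
     (\<exists>K. compact K \<and> K \<subseteq> {0<..<1} \<and> (\<forall>x. x \<notin> K \<longrightarrow> \<theta> x = 0))"

text \<open>\<open>v\<close> is the \<open>k\<close>-th distributional derivative of \<open>u\<close> on \<open>(0,1)\<close>; \<open>sobolev m\<close> is \<open>H\<^sup>m(0,1)\<close>.\<close>

definition is_wderiv :: "nat \<Rightarrow> l2 \<Rightarrow> l2 \<Rightarrow> bool" where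
  "is_wderiv k u v \<longleftrightarrow> (\<forall>\<theta>. test_fun \<theta> \<longrightarrow>
     integral\<^sup>L I_leb (\<lambda>x. (deriv ^^ k) \<theta> x *\<^sub>R rep_l2 u x) =
     (-1) ^ k * integral\<^sup>L I_leb (\<lambda>x. \<theta> x *\<^sub>R rep_l2 v x))"

definition sobolev :: "nat \<Rightarrow> l2 set" where
  "sobolev m = {u. \<forall>k\<le>m. \<exists>v. is_wderiv k u v}"

definition wderiv :: "nat \<Rightarrow> l2 \<Rightarrow> l2" where
  "wderiv k u = (THE v. is_wderiv k u v)"

subsection \<open>Uniqueness of weak derivatives\<close>

definition flat_fun :: "real \<Rightarrow> real poly \<Rightarrow> real \<Rightarrow> real" where
  "flat_fun c P x = (if x > 0 then poly P (1 / x) * exp (- c / x) else 0)"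

lemma tendsto_poly_exp_0:
  assumes "c > 0"
  shows "((\<lambda>s. s ^ k * poly P s * exp (- c * s)) \<longlongrightarrow> (0::real)) at_top"
proof (induction P arbitrary: k)
  case 0
  then show ?case by simp
next
  case (pCons a P)
  have "filterlim (\<lambda>s. c * s) at_top at_top"
    using assms by (intro filterlim_tendsto_pos_mult_at_top[OF tendsto_const _ filterlim_ident])
  then have "((\<lambda>s. (c * s) ^ k / exp (c * s)) \<longlongrightarrow> 0) at_top"
    by (rule filterlim_compose[OF tendsto_power_div_exp_0])
  then have "((\<lambda>s. (a / c ^ k) * ((c * s) ^ k / exp (c * s))) \<longlongrightarrow> (a / c ^ k) * 0) at_top"
    by (intro tendsto_intros)
  moreover have "(a / c ^ k) * ((c * s) ^ k / exp (c * s)) = a * (s ^ k * exp (- c * s))" for s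
    using assms by (simp add: power_mult_distrib exp_minus field_simps)
  ultimately have "((\<lambda>s. a * (s ^ k * exp (- c * s))) \<longlongrightarrow> 0) at_top" by simp
  from tendsto_add[OF this pCons.IH[of "Suc k"]] show ?case
    by (simp add: algebra_simps)
qed

lemma flat_fun_deriv:
  assumes c: "c > 0"
  shows "(flat_fun c P has_field_derivative
      flat_fun c ([:0, 0, 1:] * (smult c P - pderiv P)) x) (at x)"
proof -
  consider "x > 0" | "x < 0" | "x = 0" by linarith
  then show ?thesis
  proof cases
    case 1
    have "((\<lambda>x. poly P (1 / x) * exp (- c / x)) has_field_derivative
        poly ([:0, 0, 1:] * (smult c P - pderiv P)) (1 / x) * exp (- c / x)) (at x)"
      using 1 by (auto intro!: derivative_eq_intros simp: field_simps power2_eq_square)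
    then have "((\<lambda>x. poly P (1 / x) * exp (- c / x)) has_field_derivative
        flat_fun c ([:0, 0, 1:] * (smult c P - pderiv P)) x) (at x)"
      using 1 by (simp add: flat_fun_def)
    then show ?thesis
      by (rule has_field_derivative_transform_within_open[of _ _ _ "{0<..}"])
        (use 1 in \<open>auto simp: flat_fun_def\<close>)
  next
    case 2
    have "((\<lambda>x. 0) has_field_derivative
        flat_fun c ([:0, 0, 1:] * (smult c P - pderiv P)) x) (at x)"
      using 2 by (simp add: flat_fun_def)
    then show ?thesis
      by (rule has_field_derivative_transform_within_open[of _ _ _ "{..<0}"])
        (use 2 in \<open>auto simp: flat_fun_def\<close>)
  next
    case 3
    have "((\<lambda>h. (flat_fun c P (0 + h) - flat_fun c P 0) / h) \<longlongrightarrow> 0) (at 0)"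
    proof (rule filterlim_split_at)
      show "((\<lambda>h. (flat_fun c P (0 + h) - flat_fun c P 0) / h) \<longlongrightarrow> 0) (at_left 0)"
        by (rule tendsto_eventually) (auto simp: flat_fun_def eventually_at_filter)
      have "((\<lambda>h. inverse h ^ 1 * poly P (inverse h) * exp (- c * inverse h)) \<longlongrightarrow> 0) (at_right 0)"
        by (rule filterlim_compose[OF tendsto_poly_exp_0[OF c] filterlim_inverse_at_top_right])
      then show "((\<lambda>h. (flat_fun c P (0 + h) - flat_fun c P 0) / h) \<longlongrightarrow> 0) (at_right 0)"
        by (rule Lim_transform_eventually)
          (auto simp: flat_fun_def eventually_at_filter field_simps)
    qed
    then show ?thesis
      using 3 by (simp add: DERIV_def flat_fun_def)
  qed
qed

lemma flat_fun_1_bounds: "c > 0 \<Longrightarrow> 0 \<le> flat_fun c 1 x \<and> flat_fun c 1 x \<le> 1"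
  by (simp add: flat_fun_def)

inductive_set bumps :: "real \<Rightarrow> real \<Rightarrow> real \<Rightarrow> (real \<Rightarrow> real) set" for a b c where
  basic: "(\<lambda>x. flat_fun c P (x - a) * flat_fun c Q (b - x)) \<in> bumps a b c"
| add: "f \<in> bumps a b c \<Longrightarrow> g \<in> bumps a b c \<Longrightarrow> (\<lambda>x. f x + g x) \<in> bumps a b c"

lemma flat_fun_uminus: "- flat_fun c P x = flat_fun c (- P) x"
  by (simp add: flat_fun_def)

lemma bumps_deriv:
  assumes "f \<in> bumps a b c" "c > 0"
  shows "\<exists>f'\<in>bumps a b c. \<forall>x. (f has_field_derivative f' x) (at x)"
  using assms(1)
proof induction
  case (basic P Q)
  define P' where "P' = [:0, 0, 1:] * (smult c P - pderiv P)"
  define Q' where "Q' = [:0, 0, 1:] * (smult c Q - pderiv Q)"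
  let ?f' = "\<lambda>x. flat_fun c P' (x - a) * flat_fun c Q (b - x) +
    flat_fun c P (x - a) * flat_fun c (- Q') (b - x)"
  have "?f' \<in> bumps a b c" by (intro bumps.intros)
  moreover have "((\<lambda>x. flat_fun c P (x - a) * flat_fun c Q (b - x)) has_field_derivative ?f' x) (at x)" for x
  proof -
    have 1: "((\<lambda>x. flat_fun c P (x - a)) has_field_derivative flat_fun c P' (x - a) * 1) (at x)"
      unfolding P'_def by (rule DERIV_chain2[OF flat_fun_deriv[OF \<open>c > 0\<close>]]) (auto intro!: derivative_eq_intros)
    have 2: "((\<lambda>x. flat_fun c Q (b - x)) has_field_derivative flat_fun c Q' (b - x) * (-1)) (at x)"
      unfolding Q'_def by (rule DERIV_chain2[OF flat_fun_deriv[OF \<open>c > 0\<close>]]) (auto intro!: derivative_eq_intros)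
    show ?thesis
      using DERIV_mult[OF 1 2] by (simp flip: flat_fun_uminus add: algebra_simps)
  qed
  ultimately show ?case by (intro bexI[of _ ?f']) auto
next
  case (add f g)
  then obtain f' g' where "f' \<in> bumps a b c" "g' \<in> bumps a b c"
    "\<forall>x. (f has_field_derivative f' x) (at x)" "\<forall>x. (g has_field_derivative g' x) (at x)" by blast
  then show ?case
    by (intro bexI[of _ "\<lambda>x. f' x + g' x"]) (auto intro: DERIV_add bumps.add)
qed

lemma bumps_higher_deriv:
  assumes "f \<in> bumps a b c" "c > 0"
  shows "(deriv ^^ k) f \<in> bumps a b c"
proof (induction k)
  case 0
  then show ?case using assms by simp
next
  case (Suc k)
  obtain f' where f': "f' \<in> bumps a b c" "\<forall>x. ((deriv ^^ k) f has_field_derivative f' x) (at x)"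
    using bumps_deriv[OF Suc assms(2)] by blast
  then have "deriv ((deriv ^^ k) f) = f'" by (auto intro: DERIV_imp_deriv)
  then show ?case using f' by simp
qed

lemma test_fun_bump:
  assumes "0 < a" "b < 1" "c > 0"
  shows "test_fun (\<lambda>x. flat_fun c 1 (x - a) * flat_fun c 1 (b - x))" (is "test_fun ?f")
  unfolding test_fun_def
proof (intro conjI allI exI[of _ "{a..b}"] impI)
  fix k
  have "(deriv ^^ k) ?f \<in> bumps a b c"
    by (rule bumps_higher_deriv[OF bumps.basic \<open>c > 0\<close>])
  then show "(deriv ^^ k) ?f differentiable_on UNIV"
    using bumps_deriv[OF _ \<open>c > 0\<close>]
    by (metis differentiable_at_imp_differentiable_on field_differentiable_def field_differentiable_imp_differentiable)
qed (use assms in \<open>auto simp: flat_fun_def\<close>)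

lemma test_integrals_0_imp_interval:
  fixes g :: "real \<Rightarrow> real"
  assumes g: "integrable I_leb g"
    and 0: "\<And>\<theta>. test_fun \<theta> \<Longrightarrow> integral\<^sup>L I_leb (\<lambda>x. \<theta> x * g x) = 0"
    and "0 \<le> a"
  shows "integral\<^sup>L I_leb (\<lambda>x. indicator {a<..} x * g x) = 0"
proof -
  define c :: "nat \<Rightarrow> real" where "c n = inverse (real (Suc n))" for n
  have c: "c n > 0" for n by (simp add: c_def)
  have c0: "c \<longlonglongrightarrow> 0" unfolding c_def by (rule LIMSEQ_inverse_real_of_nat)
  define \<theta> where "\<theta> n x = flat_fun (c n) 1 (x - (a + c n)) * flat_fun (c n) 1 ((1 - c n) - x)" for n x
  have test: "test_fun (\<theta> n)" for n
    unfolding \<theta>_def using c[of n] \<open>0 \<le> a\<close> by (intro test_fun_bump) auto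
  have m: "\<theta> n \<in> borel_measurable I_leb" for n
  proof -
    have "\<theta> n differentiable_on UNIV" using test[of n] unfolding test_fun_def by (metis funpow_0)
    then have "continuous_on {0<..<1} (\<theta> n)"
      using differentiable_imp_continuous_on continuous_on_subset by blast
    then show ?thesis by (rule continuous_imp_measurable_on_sets_lebesgue) auto
  qed
  have "(\<lambda>n. integral\<^sup>L I_leb (\<lambda>x. \<theta> n x * g x)) \<longlonglongrightarrow> integral\<^sup>L I_leb (\<lambda>x. indicator {a<..} x * g x)"
  proof (rule integral_dominated_convergence)
    have i: "indicator {a<..} \<in> borel_measurable I_leb"
      by (intro measurable_restrict_space1 borel_measurable_indicator sets_completionI_sets) auto
    show "(\<lambda>x. indicator {a<..} x * g x) \<in> borel_measurable I_leb"
      using i g by (intro borel_measurable_times) auto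
    show "(\<lambda>x. \<theta> n x * g x) \<in> borel_measurable I_leb" for n
      using m g by (intro borel_measurable_times) auto
    show "integrable I_leb (\<lambda>x. norm (g x))" using g by simp
    have "0 \<le> \<theta> n x \<and> \<theta> n x \<le> 1" for n x
      unfolding \<theta>_def using flat_fun_1_bounds[OF c] by (simp add: mult_le_one)
    then have "norm (\<theta> n x * g x) \<le> norm (g x)" for n x
      by (simp add: abs_mult mult_left_le_one_le)
    then show "AE x in I_leb. norm (\<theta> n x * g x) \<le> norm (g x)" for n by simp
    have "(\<lambda>n. \<theta> n x) \<longlonglongrightarrow> indicator {a<..} x" if x: "x \<in> {0<..<1}" for x
    proof (cases "a < x")
      case True
      have lim: "(\<lambda>n. flat_fun (c n) 1 (d - c n)) \<longlonglongrightarrow> 1" if "d > 0" for d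
      proof -
        have "(\<lambda>n. exp (- c n / (d - c n))) \<longlonglongrightarrow> exp (- 0 / (d - 0))"
          using that by (intro tendsto_intros c0) auto
        then have "(\<lambda>n. exp (- c n / (d - c n))) \<longlonglongrightarrow> 1" by simp
        moreover have "\<forall>\<^sub>F n in sequentially. exp (- c n / (d - c n)) = flat_fun (c n) 1 (d - c n)"
          using order_tendstoD(2)[OF c0 that] by eventually_elim (simp add: flat_fun_def)
        ultimately show ?thesis by (rule Lim_transform_eventually)
      qed
      have "(\<lambda>n. flat_fun (c n) 1 ((x - a) - c n) * flat_fun (c n) 1 ((1 - x) - c n)) \<longlonglongrightarrow> 1 * 1"
        using True x by (intro tendsto_mult lim) auto
      then show ?thesis using True by (simp add: \<theta>_def algebra_simps)
    next
      case False
      then have "\<theta> n x = 0" for n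
        using c[of n] by (auto simp: \<theta>_def flat_fun_def)
      then show ?thesis using False by simp
    qed
    then show "AE x in I_leb. (\<lambda>n. \<theta> n x * g x) \<longlonglongrightarrow> indicator {a<..} x * g x"
      by (intro AE_I2 tendsto_intros) simp_all
  qed
  then have "(\<lambda>n. 0) \<longlonglongrightarrow> integral\<^sup>L I_leb (\<lambda>x. indicator {a<..} x * g x)"
    using 0[OF test] by simp
  then show ?thesis by (simp add: LIMSEQ_const_iff)
qed

lemma test_integrals_0_imp_AE_0_real:
  fixes g :: "real \<Rightarrow> real"
  assumes g: "integrable I_leb g"
    and 0: "\<And>\<theta>. test_fun \<theta> \<Longrightarrow> integral\<^sup>L I_leb (\<lambda>x. \<theta> x * g x) = 0"
  shows "AE x in I_leb. g x = 0"
proof -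
  define G where "G x = (if x \<in> {0<..<1} then g x else 0)" for x
  have G: "integrable lebesgue G"
    unfolding G_def using g by (subst Lebesgue_Measure.integrable_restrict_UNIV) auto
  obtain H where H[measurable]: "H \<in> borel_measurable lborel" and GH: "AE x in lborel. G x = H x"
    using completion_ex_borel_measurable_real[of G lborel] G by auto
  have "integrable lebesgue H"
    using G by (rule Bochner_Integration.integrable_cong_AE_imp) (use AE_completion[OF GH] in \<open>auto intro: measurable_completion\<close>)
  then have Hi: "integrable lborel H" using integrable_completion[OF H] by simp
  have HI: "integral\<^sup>L lborel (\<lambda>x. H x * indicator {a<..} x) = 0" for a
  proof -
    have "integral\<^sup>L lborel (\<lambda>x. H x * indicator {a<..} x) = integral\<^sup>L lebesgue (\<lambda>x. H x * indicator {a<..} x)"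
      by (rule integral_completion[symmetric]) measurable
    also have "\<dots> = integral\<^sup>L lebesgue (\<lambda>x. if x \<in> {0<..<1} then indicator {max a 0<..} x * g x else 0)"
    proof (rule integral_cong_AE)
      have [measurable]: "indicat_real {a<..} \<in> borel_measurable lebesgue" for a :: real
        by (intro borel_measurable_indicator sets_completionI_sets) auto
      have *: "(\<lambda>x. if x \<in> {0<..<1} then indicator {max a 0<..} x * g x else 0)
          = (\<lambda>x. indicat_real {max a 0<..} x * G x)"
        by (auto simp: G_def)
      show "(\<lambda>x. if x \<in> {0<..<1} then indicator {max a 0<..} x * g x else 0) \<in> borel_measurable lebesgue"
        unfolding * using G by (intro borel_measurable_times) auto
      show "(\<lambda>x. H x * indicator {a<..} x) \<in> borel_measurable lebesgue"
        by (intro measurable_completion) measurable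
      show "AE x in lebesgue. H x * indicator {a<..} x =
          (if x \<in> {0<..<1} then indicator {max a 0<..} x * g x else 0)"
        using AE_completion[OF GH] by eventually_elim (auto simp: G_def indicator_def split: if_splits)
    qed
    also have "\<dots> = integral\<^sup>L I_leb (\<lambda>x. indicator {max a 0<..} x * g x)"
      by (rule Lebesgue_Measure.integral_restrict_UNIV) auto
    also have "\<dots> = 0"
      by (rule test_integrals_0_imp_interval[OF g 0]) auto
    finally show ?thesis .
  qed
  have fin: "(\<integral>\<^sup>+x. ennreal (H x) * indicator {a<..} x \<partial>lborel) < \<infinity>"
      "(\<integral>\<^sup>+x. ennreal (- H x) * indicator {a<..} x \<partial>lborel) < \<infinity>"
    and eq: "(\<integral>\<^sup>+x. ennreal (H x) * indicator {a<..} x \<partial>lborel) =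
      (\<integral>\<^sup>+x. ennreal (- H x) * indicator {a<..} x \<partial>lborel)" for a
  proof -
    have i: "integrable lborel (\<lambda>x. H x * indicator {a<..} x)"
      using Hi by (intro integrable_real_mult_indicator) auto
    have *: "ennreal (H x * indicator {a<..} x) = ennreal (H x) * indicator {a<..} x"
      "ennreal (- (H x * indicator {a<..} x)) = ennreal (- H x) * indicator {a<..} x" for x
      by (auto simp: indicator_def)
    show 1: "(\<integral>\<^sup>+x. ennreal (H x) * indicator {a<..} x \<partial>lborel) < \<infinity>"
      and 2: "(\<integral>\<^sup>+x. ennreal (- H x) * indicator {a<..} x \<partial>lborel) < \<infinity>"
      using i unfolding real_integrable_def * by (auto simp: less_top)
    have "enn2real (\<integral>\<^sup>+x. ennreal (H x) * indicator {a<..} x \<partial>lborel) =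
      enn2real (\<integral>\<^sup>+x. ennreal (- H x) * indicator {a<..} x \<partial>lborel)"
      using real_lebesgue_integral_def[OF i] HI[of a] unfolding * by simp
    then show "(\<integral>\<^sup>+x. ennreal (H x) * indicator {a<..} x \<partial>lborel) =
      (\<integral>\<^sup>+x. ennreal (- H x) * indicator {a<..} x \<partial>lborel)"
      using 1 2 by (metis ennreal_enn2real infinity_ennreal_def)
  qed
  have "density lborel (\<lambda>x. ennreal (H x)) = density lborel (\<lambda>x. ennreal (- H x))"
    by (rule measure_eqI_lessThan) (use fin eq in \<open>auto simp: emeasure_density\<close>)
  then have "AE x in lborel. ennreal (H x) = ennreal (- H x)"
    by (intro sigma_finite_measure.density_unique[OF sigma_finite_lborel]) auto
  with GH have "AE x in lborel. G x = 0"
    by eventually_elim (metis ennreal_eq_0_iff ennreal_neg linorder_linear neg_le_0_iff_le order_antisym)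
  then have "AE x in lebesgue. G x = 0" by (rule AE_completion)
  then show ?thesis
    by (subst AE_restrict_space_iff) (auto simp: G_def)
qed

lemma sq_int_rep: "sq_int (rep_l2 u)"
  using Quotient3_rep_reflp[OF Quotient3_l2, of u] by (simp add: l2rel_def)

lemma rep_abs_l2: "sq_int f \<Longrightarrow> AE x in I_leb. rep_l2 (abs_l2 f) x = f x"
  using Quotient3_rep_abs[OF Quotient3_l2, of f] by (simp add: l2rel_def)

lemma l2_eqI: "(AE x in I_leb. rep_l2 u x = rep_l2 v x) \<Longrightarrow> u = v"
  using Quotient3_rel_rep[OF Quotient3_l2, of u v] by (simp add: l2rel_def sq_int_rep)

lemma rep_add: "AE x in I_leb. rep_l2 (u + v) x = rep_l2 u x + rep_l2 v x"
proof -
  have "u + v = abs_l2 (\<lambda>x. rep_l2 u x + rep_l2 v x)"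
    using Quotient3_abs_rep[OF Quotient3_l2]
    by (metis plus_l2.abs_eq Quotient3_rep_reflp[OF Quotient3_l2])
  then show ?thesis using rep_abs_l2 sq_int_add sq_int_rep by metis
qed

lemma rep_scaleR: "AE x in I_leb. rep_l2 (c *\<^sub>R u) x = c *\<^sub>R rep_l2 u x"
proof -
  have "c *\<^sub>R u = abs_l2 (\<lambda>x. c *\<^sub>R rep_l2 u x)"
    using Quotient3_abs_rep[OF Quotient3_l2]
    by (metis scaleR_l2.abs_eq Quotient3_rep_reflp[OF Quotient3_l2])
  then show ?thesis using rep_abs_l2[OF sq_int_cmult[OF sq_int_rep, of "of_real c" u]]
    by (simp add: scaleR_conv_of_real)
qed

lemma test_fun_integrable:
  assumes "test_fun \<theta>"
  shows "integrable I_leb (\<lambda>x. (deriv ^^ k) \<theta> x *\<^sub>R rep_l2 u x)"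
proof -
  let ?f = "\<lambda>x. complex_of_real ((deriv ^^ k) \<theta> x)"
  have c: "continuous_on S ?f" for S
    using assms unfolding test_fun_def
    by (intro continuous_intros) (meson differentiable_imp_continuous_on continuous_on_subset subset_UNIV)
  have m: "?f \<in> borel_measurable I_leb"
    by (intro continuous_imp_measurable_on_sets_lebesgue c) auto
  have "compact (?f ` {0..1})" by (intro compact_continuous_image c) auto
  then obtain B where B: "\<And>x. x \<in> {0..1} \<Longrightarrow> norm (?f x) \<le> B"
    by (metis compact_imp_bounded bounded_iff imageI)
  have "integrable I_leb (\<lambda>x. B\<^sup>2)"
    by (intro finite_measure.integrable_const finite_measure_lebesgue_on) auto
  then have "integrable I_leb (\<lambda>x. (norm (?f x))\<^sup>2)"
  proof (rule Bochner_Integration.integrable_bound)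
    show "AE x in I_leb. norm ((norm (?f x))\<^sup>2) \<le> norm (B\<^sup>2)"
    proof (rule AE_I2)
      fix x :: real assume "x \<in> space I_leb"
      then have "norm (?f x) \<le> B" using B by simp
      then have "(norm (?f x))\<^sup>2 \<le> B\<^sup>2" by (rule power_mono) simp
      then show "norm ((norm (?f x))\<^sup>2) \<le> norm (B\<^sup>2)" by simp
    qed
  qed (use m in measurable)
  with m have "sq_int ?f" by (simp add: sq_int_def)
  from sq_int_mult_integrable[OF this sq_int_rep[of u]] show ?thesis
    by (simp add: scaleR_conv_of_real)
qed

lemma test_integral_add:
  assumes "test_fun \<theta>"
  shows "integral\<^sup>L I_leb (\<lambda>x. (deriv ^^ k) \<theta> x *\<^sub>R rep_l2 (u + v) x) =
    integral\<^sup>L I_leb (\<lambda>x. (deriv ^^ k) \<theta> x *\<^sub>R rep_l2 u x) +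
    integral\<^sup>L I_leb (\<lambda>x. (deriv ^^ k) \<theta> x *\<^sub>R rep_l2 v x)"
proof -
  have "integral\<^sup>L I_leb (\<lambda>x. (deriv ^^ k) \<theta> x *\<^sub>R rep_l2 (u + v) x) =
    integral\<^sup>L I_leb (\<lambda>x. (deriv ^^ k) \<theta> x *\<^sub>R rep_l2 u x + (deriv ^^ k) \<theta> x *\<^sub>R rep_l2 v x)"
    by (intro integral_cong_AE borel_measurable_integrable Bochner_Integration.integrable_add
        test_fun_integrable[OF assms]) (use rep_add[of u v] in \<open>eventually_elim, simp add: algebra_simps\<close>)
  then show ?thesis
    by (simp add: Bochner_Integration.integral_add test_fun_integrable[OF assms])
qed

lemma test_integral_scaleR:
  assumes "test_fun \<theta>"
  shows "integral\<^sup>L I_leb (\<lambda>x. (deriv ^^ k) \<theta> x *\<^sub>R rep_l2 (c *\<^sub>R u) x) =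
    c *\<^sub>R integral\<^sup>L I_leb (\<lambda>x. (deriv ^^ k) \<theta> x *\<^sub>R rep_l2 u x)"
proof -
  have "integral\<^sup>L I_leb (\<lambda>x. (deriv ^^ k) \<theta> x *\<^sub>R rep_l2 (c *\<^sub>R u) x) =
    integral\<^sup>L I_leb (\<lambda>x. c *\<^sub>R ((deriv ^^ k) \<theta> x *\<^sub>R rep_l2 u x))"
    by (intro integral_cong_AE borel_measurable_integrable Bochner_Integration.integrable_scaleR_right
        test_fun_integrable[OF assms]) (use rep_scaleR[of c u] in \<open>eventually_elim, simp add: algebra_simps\<close>)
  then show ?thesis by (simp only: Bochner_Integration.integral_scaleR_right)
qed

lemma test_integrals_0_imp_0:
  assumes 0: "\<And>\<theta>. test_fun \<theta> \<Longrightarrow> integral\<^sup>L I_leb (\<lambda>x. \<theta> x *\<^sub>R rep_l2 w x) = 0"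
  shows "w = 0"
proof -
  have "integrable I_leb (rep_l2 w)"
    using sq_int_mult_integrable[OF _ sq_int_rep[of w], of "\<lambda>x. 1"] finite_measure_lebesgue_on[of "{0<..<1::real}"]
    by (auto simp: sq_int_def finite_measure.integrable_const)
  then have iR: "integrable I_leb (\<lambda>x. Re (rep_l2 w x))" and iI: "integrable I_leb (\<lambda>x. Im (rep_l2 w x))"
    by auto
  have "integral\<^sup>L I_leb (\<lambda>x. \<theta> x * Re (rep_l2 w x)) = 0 \<and> integral\<^sup>L I_leb (\<lambda>x. \<theta> x * Im (rep_l2 w x)) = 0"
    if \<theta>: "test_fun \<theta>" for \<theta>
    using integral_Re[OF test_fun_integrable[OF \<theta>, of 0 w]] integral_Im[OF test_fun_integrable[OF \<theta>, of 0 w]] 0[OF \<theta>]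
    by simp
  then have "AE x in I_leb. Re (rep_l2 w x) = 0" "AE x in I_leb. Im (rep_l2 w x) = 0"
    using test_integrals_0_imp_AE_0_real iR iI by blast+
  moreover have "AE x in I_leb. rep_l2 0 x = 0"
    using rep_abs_l2[OF sq_int_0] by (simp add: zero_l2_def)
  ultimately have "AE x in I_leb. rep_l2 w x = rep_l2 0 x"
    by eventually_elim (simp add: complex_eq_iff)
  then show ?thesis by (rule l2_eqI)
qed

lemma is_wderiv_add: "is_wderiv k u v \<Longrightarrow> is_wderiv k u' v' \<Longrightarrow> is_wderiv k (u + u') (v + v')"
  using test_integral_add[where k = 0] by (simp add: is_wderiv_def test_integral_add distrib_left)

lemma is_wderiv_scaleR: "is_wderiv k u v \<Longrightarrow> is_wderiv k (c *\<^sub>R u) (c *\<^sub>R v)"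
  using test_integral_scaleR[where k = 0] by (simp add: is_wderiv_def test_integral_scaleR)

lemma is_wderiv_unique:
  assumes "is_wderiv k u v" "is_wderiv k u v'" shows "v = v'"
proof -
  define w where "w = (-1) *\<^sub>R v'"
  have "integral\<^sup>L I_leb (\<lambda>x. \<theta> x *\<^sub>R rep_l2 (v + w) x) = 0" if "test_fun \<theta>" for \<theta>
    using assms that test_integral_add[OF that, of 0 v w] test_integral_scaleR[OF that, of 0 "-1" v', folded w_def]
    by (simp add: is_wderiv_def)
  then have "v + w = 0" by (rule test_integrals_0_imp_0)
  then show ?thesis by (simp add: w_def)
qed

lemma wderiv_eqI: "is_wderiv k u v \<Longrightarrow> wderiv k u = v"
  unfolding wderiv_def by (blast intro: is_wderiv_unique)

lemma is_wderiv_wderiv: "u \<in> sobolev m \<Longrightarrow> k \<le> m \<Longrightarrow> is_wderiv k u (wderiv k u)"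
  unfolding sobolev_def using wderiv_eqI by fastforce

lemma wderiv_0: "wderiv 0 u = u"
  by (rule wderiv_eqI) (simp add: is_wderiv_def)

lemma wderiv_add:
  "u \<in> sobolev m \<Longrightarrow> v \<in> sobolev m \<Longrightarrow> k \<le> m \<Longrightarrow> wderiv k (u + v) = wderiv k u + wderiv k v"
  by (intro wderiv_eqI is_wderiv_add is_wderiv_wderiv)

lemma wderiv_scaleR: "u \<in> sobolev m \<Longrightarrow> k \<le> m \<Longrightarrow> wderiv k (c *\<^sub>R u) = c *\<^sub>R wderiv k u"
  by (intro wderiv_eqI is_wderiv_scaleR is_wderiv_wderiv)

lemma sobolev_add: "u \<in> sobolev m \<Longrightarrow> v \<in> sobolev m \<Longrightarrow> u + v \<in> sobolev m"
  unfolding sobolev_def using is_wderiv_add by blast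

lemma sobolev_scaleR: "u \<in> sobolev m \<Longrightarrow> c *\<^sub>R u \<in> sobolev m"
  unfolding sobolev_def using is_wderiv_scaleR by blast

lemma sobolev_0: "0 \<in> sobolev m"
proof -
  have "is_wderiv k (0 *\<^sub>R 0) (0 *\<^sub>R 0)" for k
    using test_integral_scaleR[where c = 0 and u = 0] test_integral_scaleR[where c = 0 and u = 0 and k = 0]
    by (simp add: is_wderiv_def)
  then show ?thesis by (auto simp: sobolev_def)
qed

subsection \<open>The second-order Sobolev space as a type\<close>

typedef h2 = "sobolev 2"
  morphisms rep_h2 abs_h2
  using sobolev_0 by blast

setup_lifting type_definition_h2

instantiation h2 :: real_vector
begin

lift_definition zero_h2 :: h2 is 0 by (rule sobolev_0)
lift_definition plus_h2 :: "h2 \<Rightarrow> h2 \<Rightarrow> h2" is "(+)" by (rule sobolev_add)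
lift_definition uminus_h2 :: "h2 \<Rightarrow> h2" is uminus
  using sobolev_scaleR[of _ 2 "-1"] by simp
lift_definition minus_h2 :: "h2 \<Rightarrow> h2 \<Rightarrow> h2" is "(-)"
  using sobolev_add sobolev_scaleR[of _ 2 "-1"] by fastforce
lift_definition scaleR_h2 :: "real \<Rightarrow> h2 \<Rightarrow> h2" is "(*\<^sub>R)" by (rule sobolev_scaleR)

instance
  by standard (transfer; simp add: algebra_simps)+

end

instantiation h2 :: real_inner
begin

definition inner_h2 :: "h2 \<Rightarrow> h2 \<Rightarrow> real" where
  "inner_h2 u v = (\<Sum>k\<le>2. inner (wderiv k (rep_h2 u)) (wderiv k (rep_h2 v)))"

definition norm_h2 :: "h2 \<Rightarrow> real" where "norm_h2 u = sqrt (inner u u)"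
definition dist_h2 :: "h2 \<Rightarrow> h2 \<Rightarrow> real" where "dist_h2 u v = norm (u - v)"
definition sgn_h2 :: "h2 \<Rightarrow> h2" where "sgn_h2 u = u /\<^sub>R norm u"
definition uniformity_h2 :: "(h2 \<times> h2) filter" where
  "uniformity_h2 = (INF e\<in>{0 <..}. principal {(u, v). dist u v < e})"
definition open_h2 :: "h2 set \<Rightarrow> bool" where
  "open_h2 U \<longleftrightarrow> (\<forall>u\<in>U. \<forall>\<^sub>F (u', v) in uniformity. u' = u \<longrightarrow> v \<in> U)"

instance
proof
  fix u v w :: h2 and a :: real
  show "sgn u = u /\<^sub>R norm u" by (simp add: sgn_h2_def)
  show "dist u v = norm (u - v)" by (simp add: dist_h2_def)
  show "uniformity = (INF e\<in>{0 <..}. principal {(u::h2, v). dist u v < e})"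
    by (simp add: uniformity_h2_def)
  show "open U \<longleftrightarrow> (\<forall>u\<in>U. \<forall>\<^sub>F (u', v) in uniformity. u' = u \<longrightarrow> v \<in> U)" for U :: "h2 set"
    by (simp add: open_h2_def)
  show "inner u v = inner v u" by (simp add: inner_h2_def inner_commute)
  show "inner (u + v) w = inner u w + inner v w"
    by (simp add: inner_h2_def plus_h2.rep_eq wderiv_add[OF rep_h2 rep_h2] inner_add_left sum.distrib)
  show "inner (a *\<^sub>R u) v = a * inner u v"
    by (simp add: inner_h2_def scaleR_h2.rep_eq wderiv_scaleR[OF rep_h2] sum_distrib_left)
  show "0 \<le> inner u u" by (simp add: inner_h2_def sum_nonneg)
  show "inner u u = 0 \<longleftrightarrow> u = 0"
  proof
    assume "inner u u = 0"
    then have "\<forall>k\<in>{..2}. inner (wderiv k (rep_h2 u)) (wderiv k (rep_h2 u)) = 0"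
      unfolding inner_h2_def by (subst (asm) sum_nonneg_eq_0_iff) auto
    then have "wderiv 0 (rep_h2 u) = 0" by auto
    then show "u = 0" by (simp add: wderiv_0 rep_h2_inject[symmetric] zero_h2.rep_eq)
  next
    assume "u = 0"
    moreover have "wderiv k (rep_h2 0) = 0" if "k \<le> 2" for k
      using wderiv_scaleR[OF sobolev_0 that, of 0] by (simp add: zero_h2.rep_eq)
    ultimately show "inner u u = 0" by (simp add: inner_h2_def)
  qed
  show "norm u = sqrt (inner u u)" by (simp add: norm_h2_def)
qed

end


section \<open>The semigroup of the linear problem\<close>

text \<open>\<open>point_value v p\<close> is the value at \<open>p\<close> (possibly an endpoint) of the continuous
  representative of \<open>v\<close> on \<open>[0,1]\<close>; it exists whenever \<open>v\<close> has a weak derivative in \<open>L\<^sup>2\<close>.\<close>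

definition point_value :: "l2 \<Rightarrow> real \<Rightarrow> complex" where
  "point_value v p = (THE c. \<exists>g. continuous_on {0..1} g \<and> (AE x in I_leb. rep_l2 v x = g x) \<and> c = g p)"

definition kawahara_dom :: "real \<Rightarrow> l2 set" where
  "kawahara_dom \<alpha> = {v \<in> sobolev 5.
     point_value v 0 = 0 \<and> point_value v 1 = 0 \<and>
     point_value (wderiv 1 v) 0 = 0 \<and> point_value (wderiv 1 v) 1 = 0 \<and>
     point_value (wderiv 2 v) 1 = complex_of_real \<alpha> * point_value (wderiv 2 v) 0}"

definition kawahara_op :: "l2 \<Rightarrow> l2" where
  "kawahara_op v = - wderiv 3 v + wderiv 5 v"

definition contraction_C0_semigroup :: "(real \<Rightarrow> l2 \<Rightarrow> l2) \<Rightarrow> bool" where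
  "contraction_C0_semigroup S \<longleftrightarrow>
     (\<forall>t\<ge>0. bounded_linear (S t) \<and> (\<forall>c v. S t (scaleC_l2 c v) = scaleC_l2 c (S t v)) \<and>
        (\<forall>v. norm (S t v) \<le> norm v)) \<and>
     (\<forall>v. S 0 v = v) \<and>
     (\<forall>s\<ge>0. \<forall>t\<ge>0. \<forall>v. S (s + t) v = S s (S t v)) \<and>
     (\<forall>v. ((\<lambda>t. S t v) \<longlongrightarrow> v) (at_right 0))"

text \<open>The infinitesimal generator as a graph.\<close>

definition generator :: "(real \<Rightarrow> l2 \<Rightarrow> l2) \<Rightarrow> (l2 \<times> l2) set" where
  "generator S = {(v, w). ((\<lambda>h. (S h v - v) /\<^sub>R h) \<longlongrightarrow> w) (at_right 0)}"

text \<open>The choice below only concerns the irrelevant values at negative times: a \<open>C\<^sub>0\<close>-semigroup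
  is determined on \<open>[0,\<infinity>)\<close> by its generator.\<close>

definition kawahara_semigroup :: "real \<Rightarrow> real \<Rightarrow> l2 \<Rightarrow> l2" where
  "kawahara_semigroup \<alpha> = (SOME S. contraction_C0_semigroup S \<and>
     generator S = {(v, kawahara_op v) | v. v \<in> kawahara_dom \<alpha>})"


section \<open>Mild solutions\<close>

definition lift_A :: "real \<Rightarrow> real \<Rightarrow> real" where
  "lift_A \<alpha> x = (\<alpha> - 1) / (\<alpha> + 1) * x\<^sup>2 + 2 / (\<alpha> + 1) * x - 1"

definition coeff_a :: "real \<Rightarrow> (real \<Rightarrow> complex) \<Rightarrow> real \<Rightarrow> real \<Rightarrow> complex" where
  "coeff_a \<alpha> \<phi> x t = - (complex_of_real (lift_A \<alpha> x) * \<phi> t)"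

definition coeff_b :: "real \<Rightarrow> (real \<Rightarrow> complex) \<Rightarrow> real \<Rightarrow> real \<Rightarrow> complex" where
  "coeff_b \<alpha> \<phi> x t = - (complex_of_real (deriv (lift_A \<alpha>) x) * \<phi> t)"

definition source_f :: "real \<Rightarrow> (real \<Rightarrow> complex) \<Rightarrow> real \<Rightarrow> real \<Rightarrow> complex" where
  "source_f \<alpha> \<phi> x t = complex_of_real (lift_A \<alpha> x) * vector_derivative \<phi> (at t)
     - complex_of_real (lift_A \<alpha> x * deriv (lift_A \<alpha>) x) * (\<phi> t)\<^sup>2"

definition lifted :: "real \<Rightarrow> (real \<Rightarrow> complex) \<Rightarrow> (real \<Rightarrow>\<^sub>C h2) \<Rightarrow> real \<Rightarrow> l2" where
  "lifted \<alpha> \<phi> u t = rep_h2 (u t) + abs_l2 (\<lambda>x. complex_of_real (lift_A \<alpha> x) * \<phi> t)"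

definition rhs :: "real \<Rightarrow> (real \<Rightarrow> complex) \<Rightarrow> (real \<Rightarrow> l2) \<Rightarrow> real \<Rightarrow> l2" where
  "rhs \<alpha> \<phi> y s = abs_l2 (\<lambda>x.
     - rep_l2 (y s) x * rep_l2 (wderiv 1 (y s)) x
     - coeff_a \<alpha> \<phi> x s * rep_l2 (wderiv 1 (y s)) x
     - coeff_b \<alpha> \<phi> x s * rep_l2 (y s) x
     + source_f \<alpha> \<phi> x s)"

text \<open>The integrand is continuous in \<open>s\<close>, so its \<open>L\<^sup>2\<close>-valued integral is an ordinary
  (Riemann) integral of a continuous function.\<close>

definition mild_solution :: "real \<Rightarrow> (real \<Rightarrow> complex) \<Rightarrow> (real \<Rightarrow>\<^sub>C h2) \<Rightarrow> bool" where
  "mild_solution \<alpha> \<phi> u \<longleftrightarrow> (\<forall>r t. r \<le> t \<longrightarrow>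
     ((\<lambda>s. kawahara_semigroup \<alpha> (t - s) (rhs \<alpha> \<phi> (lifted \<alpha> \<phi> u) s)) has_integral
       (lifted \<alpha> \<phi> u t - kawahara_semigroup \<alpha> (t - r) (lifted \<alpha> \<phi> u r))) {r..t})"


section \<open>Norm of the boundary datum and almost periodicity\<close>

text \<open>Extended-real suprema, so that unbounded functions have infinite norm.\<close>

definition C1_norm :: "(real \<Rightarrow> complex) \<Rightarrow> ereal" where
  "C1_norm \<phi> = (SUP t. ereal (norm (\<phi> t))) + (SUP t. ereal (norm (vector_derivative \<phi> (at t))))"

definition almost_periodic :: "(real \<Rightarrow> 'a::metric_space) \<Rightarrow> bool" where
  "almost_periodic g \<longleftrightarrow> continuous_on UNIV g \<and>
     (\<forall>\<delta>>0. \<exists>l>0. \<forall>a. \<exists>\<tau>\<in>{a..a + l}. (SUP t. ereal (dist (g (t + \<tau>)) (g t))) < ereal \<delta>)"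

end

theory Submission
  imports Defs
begin

text \<open>With \<open>\<kappa> = 1 - \<alpha>\<^sup>2\<close>, pairing the linear equation with \<open>(1 + \<kappa> x) v\<close> shows that the Kawahara
  operator \<open>A\<close> is dissipative and that the weighted energy \<open>E\<close> decays exponentially with a gain of
  \<open>\<parallel>v\<^sub>x\<^sub>x\<parallel>\<^sup>2\<close> (Kato smoothing). The semigroup exists by the Lumer--Phillips theorem, proved with Yosida
  approximations. The interpolation inequality
  \<open>\<parallel>A v\<parallel>\<^sup>2 \<le> C (\<delta>\<^sup>-\<^sup>4 \<parallel>v\<^sub>x\<^sub>x\<parallel>\<^sup>2 + \<delta>\<^sup>2 \<parallel>(A v)\<^sub>x\<^sub>x\<parallel>\<^sup>2)\<close> makes
  \<open>\<delta> t\<^sup>3 E(A S(t) v) + E(S(t) v)\<close> nonincreasing on \<open>[0, 1]\<close> for some \<open>\<delta>\<close>, so \<open>\<parallel>A S(t)\<parallel>\<close> is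
  at most \<open>C t\<close> to the power \<open>-3/2\<close>, and the norm of \<open>S(t)\<close> from \<open>L\<^sup>2\<close> to \<open>H\<^sup>2\<close> is at most
  \<open>C t\<close> to the power \<open>-3/4\<close>, which is integrable. Hence bounded mild solutions are exactly the
  fixed points of the convolution of the right-hand side with \<open>S\<close> over \<open>(-\<infinity>, t]\<close>, which is
  a contraction for small data. Comparing a solution with its translates bounds their distance by the
  distance of the corresponding boundary data, which gives almost periodicity.\<close>

text \<open>The product of a function with its derivative maps \<open>H^2\<close> to
  \<open>L^2\<close>, so the convolution has to regain two derivatives at every single time.
  Dissipation controls \<open>v_xx\<close> only in mean square over time, which is too little for a
  right-hand side that is merely bounded; this is why a pointwise rate for \<open>A S(t)\<close> is
  needed. The rate into \<open>H^2\<close> is half of it, because the squared norm of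
  \<open>v_xx\<close> is bounded by the product of the norms of \<open>A v\<close> and
  \<open>v\<close>.

  On the whole line boundedness replaces an initial value: as the initial time tends to
  -\<infinity>, its contribution is lost through exponential decay. Decay, coercivity and smoothing
  all rest on \<kappa>, which is positive exactly because the modulus of \<alpha> is less than 1.

  The semigroup is given only as some contraction semigroup with the prescribed generator. Once
  existence is settled, its estimates come from the generator: they are proved on the domain of
  \<open>A\<close> or of its square, where orbits can be differentiated, and extended by density.
  The constant \<open>C = 5 q\<close> depends on \<alpha> alone.\<close>

section \<open>Density of subspaces of a Hilbert space\<close>

lemma dense_subspace:
  fixes M :: "'a::{real_inner, complete_space} set"
  assumes M: "subspace M" and orth: "\<And>v. (\<And>m. m \<in> M \<Longrightarrow> inner v m = 0) \<Longrightarrow> v = 0"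
  shows "closure M = UNIV"
proof -
  have "x \<in> closure M" for x
  proof -
    define D where "D = (\<lambda>m. (norm (x - m))\<^sup>2) ` M"
    have M0: "0 \<in> M" using M by (rule subspace_0)
    have bdd: "bdd_below D" unfolding D_def by (rule bdd_belowI[of _ 0]) auto
    define d where "d = Inf D"
    have d_le: "d \<le> (norm (x - m))\<^sup>2" if "m \<in> M" for m
      unfolding d_def using that bdd by (intro cInf_lower) (auto simp: D_def)
    have "\<exists>m\<in>M. (norm (x - m))\<^sup>2 < d + 1 / real (Suc n)" for n
    proof -
      have "\<exists>y\<in>D. y < d + 1 / real (Suc n)"
        using cInf_lessD[of D "d + 1 / real (Suc n)"] M0 by (auto simp: d_def D_def)
      then show ?thesis by (auto simp: D_def)
    qed
    then obtain m where m: "\<And>n. m n \<in> M" and md: "\<And>n. (norm (x - m n))\<^sup>2 < d + 1 / real (Suc n)"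
      by metis
    \<comment> \<open>Parallelogram identity: the midpoint of \<open>m n\<close> and
      \<open>m k\<close> lies in \<open>M\<close>, hence is at squared distance at least
      \<open>d\<close> from \<open>x\<close>. This makes the minimizing sequence Cauchy.\<close>
    have par: "(norm (m n - m k))\<^sup>2 \<le> 2 / real (Suc n) + 2 / real (Suc k)" for n k
    proof -
      have "(1/2) *\<^sub>R (m n + m k) \<in> M" using m M by (simp add: subspace_add subspace_scale)
      then have "d \<le> (norm (x - (1/2) *\<^sub>R (m n + m k)))\<^sup>2" by (rule d_le)
      moreover have "(norm (m n - m k))\<^sup>2 =
          2 * (norm (x - m n))\<^sup>2 + 2 * (norm (x - m k))\<^sup>2 - 4 * (norm (x - (1/2) *\<^sub>R (m n + m k)))\<^sup>2"
        by (simp add: power2_norm_eq_inner inner_simps inner_commute algebra_simps)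
      ultimately show ?thesis using md[of n] md[of k] by simp
    qed
    have "Cauchy m"
    proof (rule metric_CauchyI)
      fix e :: real assume "e > 0"
      then obtain N where N: "4 / e\<^sup>2 < real (Suc N)"
        by (metis reals_Archimedean2 less_trans lessI of_nat_less_iff)
      have "dist (m n) (m k) < e" if "n \<ge> N" "k \<ge> N" for n k
      proof -
        have "2 / real (Suc n) \<le> 2 / real (Suc N)" "2 / real (Suc k) \<le> 2 / real (Suc N)"
          using that by (auto intro!: divide_left_mono)
        moreover have "4 / real (Suc N) < e\<^sup>2" using N \<open>e > 0\<close> by (simp add: field_simps)
        ultimately have "(norm (m n - m k))\<^sup>2 < e\<^sup>2" using par[of n k] by simp
        then show ?thesis using \<open>e > 0\<close> by (simp add: dist_norm power_less_imp_less_base)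
      qed
      then show "\<exists>N. \<forall>n\<ge>N. \<forall>k\<ge>N. dist (m n) (m k) < e" by blast
    qed
    then obtain p where p: "m \<longlonglongrightarrow> p" using Cauchy_convergent_iff convergent_def by blast
    have "(\<lambda>n. (norm (x - m n))\<^sup>2) \<longlonglongrightarrow> (norm (x - p))\<^sup>2" by (intro tendsto_intros p)
    moreover have "(\<lambda>n. d + 1 / real (Suc n)) \<longlonglongrightarrow> d + 0"
      by (intro tendsto_intros LIMSEQ_Suc[OF lim_1_over_n])
    ultimately have "(norm (x - p))\<^sup>2 \<le> d + 0"
    proof (rule LIMSEQ_le)
      show "\<exists>N. \<forall>n\<ge>N. (norm (x - m n))\<^sup>2 \<le> d + 1 / real (Suc n)"
        by (intro exI allI impI less_imp_le md)
    qed
    then have xp: "(norm (x - p))\<^sup>2 \<le> d" by simp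
    have "inner (x - p) v = 0" if v: "v \<in> M" for v
    proof (rule ccontr)
      assume ne: "inner (x - p) v \<noteq> 0"
      then have vv: "inner v v > 0" by auto
      \<comment> \<open>The minimizer of the quadratic polynomial in \<open>t\<close> computed
        below; moving from \<open>p\<close> along \<open>v\<close> by this amount would beat the
        infimum unless the residual is orthogonal to \<open>v\<close>.\<close>
      define t where "t = inner (x - p) v / inner v v"
      have "d \<le> (norm (x - (p + t *\<^sub>R v)))\<^sup>2"
      proof (rule LIMSEQ_le_const)
        show "(\<lambda>n. (norm (x - (m n + t *\<^sub>R v)))\<^sup>2) \<longlonglongrightarrow> (norm (x - (p + t *\<^sub>R v)))\<^sup>2"
          by (intro tendsto_intros p)
        show "\<exists>N. \<forall>n\<ge>N. d \<le> (norm (x - (m n + t *\<^sub>R v)))\<^sup>2"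
          using d_le m v M by (auto simp: subspace_add subspace_scale)
      qed
      also have "(norm (x - (p + t *\<^sub>R v)))\<^sup>2 = (norm (x - p))\<^sup>2 - 2 * t * inner (x - p) v + t\<^sup>2 * inner v v"
        unfolding power2_norm_eq_inner by (simp add: inner_simps inner_commute algebra_simps power2_eq_square)
      also have "\<dots> = (norm (x - p))\<^sup>2 - (inner (x - p) v)\<^sup>2 / inner v v"
        using vv by (simp add: t_def power2_eq_square field_simps)
      also have "\<dots> < (norm (x - p))\<^sup>2" using ne vv by simp
      finally show False using xp by simp
    qed
    then have "x - p = 0" by (rule orth)
    then show "x \<in> closure M" using p m by (auto simp: closure_sequential)
  qed
  then show ?thesis by blast
qed

section \<open>Square-integrable functions and their classes\<close>

lemma abs_rep_l2: "abs_l2 (rep_l2 u) = u"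
  by (rule Quotient3_abs_rep[OF Quotient3_l2])

lemma abs_l2_eqI:
  assumes "sq_int f" "AE x in I_leb. rep_l2 u x = f x"
  shows "u = abs_l2 f"
proof (rule l2_eqI)
  show "AE x in I_leb. rep_l2 u x = rep_l2 (abs_l2 f) x"
    using rep_abs_l2[OF assms(1)] assms(2) by eventually_elim simp
qed

lemma abs_l2_cong:
  assumes "sq_int f" "sq_int g" "AE x in I_leb. f x = g x"
  shows "abs_l2 f = abs_l2 g"
proof (rule abs_l2_eqI[OF assms(2)])
  show "AE x in I_leb. rep_l2 (abs_l2 f) x = g x"
    using rep_abs_l2[OF assms(1)] assms(3) by eventually_elim simp
qed

lemma abs_l2_add: "sq_int f \<Longrightarrow> sq_int g \<Longrightarrow> abs_l2 (\<lambda>x. f x + g x) = abs_l2 f + abs_l2 g"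
  by (simp add: plus_l2.abs_eq l2rel_def)

lemma abs_l2_scaleR: "sq_int f \<Longrightarrow> abs_l2 (\<lambda>x. c *\<^sub>R f x) = c *\<^sub>R abs_l2 f"
  by (simp add: scaleR_l2.abs_eq l2rel_def)

lemma abs_l2_scaleC: "sq_int f \<Longrightarrow> abs_l2 (\<lambda>x. c * f x) = scaleC_l2 c (abs_l2 f)"
  by (simp add: scaleC_l2.abs_eq l2rel_def)

lemma abs_l2_uminus: "sq_int f \<Longrightarrow> abs_l2 (\<lambda>x. - f x) = - abs_l2 f"
  by (simp add: uminus_l2.abs_eq l2rel_def)

lemma sq_int_uminus: "sq_int f \<Longrightarrow> sq_int (\<lambda>x. - f x)"
  using sq_int_cmult[of f "-1"] by simp

lemma sq_int_diff: "sq_int f \<Longrightarrow> sq_int g \<Longrightarrow> sq_int (\<lambda>x. f x - g x)"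
  using sq_int_add[OF _ sq_int_uminus] by fastforce

lemma abs_l2_diff: "sq_int f \<Longrightarrow> sq_int g \<Longrightarrow> abs_l2 (\<lambda>x. f x - g x) = abs_l2 f - abs_l2 g"
  using abs_l2_add[of f "\<lambda>x. - g x"] by (simp add: sq_int_uminus abs_l2_uminus)

lemma abs_l2_0: "abs_l2 (\<lambda>x. 0) = 0"
  by (simp add: zero_l2_def)

lemma rep_scaleC: "AE x in I_leb. rep_l2 (scaleC_l2 c u) x = c * rep_l2 u x"
proof -
  have "scaleC_l2 c u = abs_l2 (\<lambda>x. c * rep_l2 u x)"
    by (simp add: abs_l2_scaleC sq_int_rep abs_rep_l2)
  then show ?thesis using rep_abs_l2[OF sq_int_cmult[OF sq_int_rep, of c u]] by simp
qed

lemma integrable_inner_sq_int: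
  assumes "sq_int f" "sq_int g"
  shows "integrable I_leb (\<lambda>x. inner (f x) (g x))"
proof -
  have "integrable I_leb (\<lambda>x. Re (f x * cnj (g x)))"
    using sq_int_mult_integrable[OF assms(1) sq_int_cnj[OF assms(2)]] by (rule integrable_Re)
  then show ?thesis by (simp add: inner_complex_def)
qed

lemma inner_abs_l2:
  assumes "sq_int f" "sq_int g"
  shows "inner (abs_l2 f) (abs_l2 g) = integral\<^sup>L I_leb (\<lambda>x. inner (f x) (g x))"
proof -
  have "inner (abs_l2 f) (abs_l2 g) = Re (integral\<^sup>L I_leb (\<lambda>x. f x * cnj (g x)))"
    using assms by (simp add: inner_l2.abs_eq l2rel_def)
  also have "\<dots> = integral\<^sup>L I_leb (\<lambda>x. Re (f x * cnj (g x)))"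
    by (rule integral_Re[OF sq_int_mult_integrable[OF assms(1) sq_int_cnj[OF assms(2)]], symmetric])
  finally show ?thesis by (simp add: inner_complex_def)
qed

lemma norm_abs_l2: "sq_int f \<Longrightarrow> (norm (abs_l2 f))\<^sup>2 = integral\<^sup>L I_leb (\<lambda>x. (norm (f x))\<^sup>2)"
  by (simp add: power2_norm_eq_inner inner_abs_l2)

lemma norm_l2_sq: "(norm u)\<^sup>2 = integral\<^sup>L I_leb (\<lambda>x. (norm (rep_l2 u x))\<^sup>2)"
  using norm_abs_l2[OF sq_int_rep, of u] by (simp add: abs_rep_l2)

lemma sq_int_norm: "sq_int f \<Longrightarrow> sq_int (\<lambda>x. complex_of_real (norm (f x)))"
  unfolding sq_int_def by (auto intro: borel_measurable_norm)

text \<open>Cauchy-Schwarz in \<open>l2\<close>, applied to the moduli of \<open>f\<close> and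
  \<open>g\<close> regarded as complex-valued functions with the same norms.\<close>

lemma integral_norm_mult_le:
  assumes "sq_int f" "sq_int g"
  shows "integrable I_leb (\<lambda>x. norm (f x) * norm (g x))"
    and "integral\<^sup>L I_leb (\<lambda>x. norm (f x) * norm (g x)) \<le> norm (abs_l2 f) * norm (abs_l2 g)"
proof -
  let ?f = "\<lambda>x. complex_of_real (norm (f x))" and ?g = "\<lambda>x. complex_of_real (norm (g x))"
  have eq: "inner (?f x) (?g x) = norm (f x) * norm (g x)" for x by (simp add: inner_complex_def)
  show "integrable I_leb (\<lambda>x. norm (f x) * norm (g x))"
    using integrable_inner_sq_int[OF sq_int_norm[OF assms(1)] sq_int_norm[OF assms(2)]] by (simp add: eq)
  have n: "norm (abs_l2 (\<lambda>x. complex_of_real (norm (h x)))) = norm (abs_l2 h)" if "sq_int h" for h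
  proof -
    have "(norm (abs_l2 (\<lambda>x. complex_of_real (norm (h x)))))\<^sup>2 = (norm (abs_l2 h))\<^sup>2"
      using that by (simp add: norm_abs_l2 sq_int_norm)
    then show ?thesis by simp
  qed
  have "integral\<^sup>L I_leb (\<lambda>x. norm (f x) * norm (g x)) = inner (abs_l2 ?f) (abs_l2 ?g)"
    using assms by (simp add: inner_abs_l2 sq_int_norm eq)
  also have "\<dots> \<le> norm (abs_l2 ?f) * norm (abs_l2 ?g)" by (rule norm_cauchy_schwarz)
  finally show "integral\<^sup>L I_leb (\<lambda>x. norm (f x) * norm (g x)) \<le> norm (abs_l2 f) * norm (abs_l2 g)"
    using assms by (simp add: n)
qed

lemma prob_I: "measure I_leb (space I_leb) = 1" "finite_measure I_leb"
  by (auto simp: measure_restrict_space intro: finite_measure_lebesgue_on)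

lemma sq_int_const: "sq_int (\<lambda>x. c)"
  using prob_I(2) by (simp add: sq_int_def finite_measure.integrable_const)

lemma sq_int_bounded:
  assumes "f \<in> borel_measurable I_leb" "\<And>x. x \<in> {0<..<1} \<Longrightarrow> norm (f x) \<le> B"
  shows "sq_int f" "norm (abs_l2 f) \<le> B"
proof -
  have i: "integrable I_leb (\<lambda>x. B\<^sup>2)" using prob_I(2) by (simp add: finite_measure.integrable_const)
  have le: "(norm (f x))\<^sup>2 \<le> B\<^sup>2" if "x \<in> space I_leb" for x
    using assms(2)[of x] that by (intro power_mono) auto
  show *: "sq_int f"
    unfolding sq_int_def
  proof
    show "integrable I_leb (\<lambda>x. (norm (f x))\<^sup>2)"
      by (rule Bochner_Integration.integrable_bound[OF i]) (use assms(1) le in auto)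
  qed (rule assms(1))
  have "(norm (abs_l2 f))\<^sup>2 \<le> integral\<^sup>L I_leb (\<lambda>x. B\<^sup>2)"
    unfolding norm_abs_l2[OF *] using * i le by (intro integral_mono) (auto simp: sq_int_def)
  also have "\<dots> = B\<^sup>2" using prob_I by simp
  finally have "(norm (abs_l2 f))\<^sup>2 \<le> B\<^sup>2" .
  moreover have "B \<ge> 0" using order_trans[OF norm_ge_zero assms(2)[of "1/2"]] by simp
  ultimately show "norm (abs_l2 f) \<le> B" by (rule power2_le_imp_le)
qed

lemma integrable_sq_int: "sq_int f \<Longrightarrow> integrable I_leb f"
  using sq_int_mult_integrable[OF _ sq_int_const[of 1]] by simp

lemma norm_integral_mult_le:
  assumes "sq_int f" "sq_int g"
  shows "norm (integral\<^sup>L I_leb (\<lambda>x. f x * g x)) \<le> norm (abs_l2 f) * norm (abs_l2 g)"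
proof -
  have "norm (integral\<^sup>L I_leb (\<lambda>x. f x * g x)) \<le> integral\<^sup>L I_leb (\<lambda>x. norm (f x * g x))"
    by (rule integral_norm_bound)
  also have "\<dots> \<le> norm (abs_l2 f) * norm (abs_l2 g)"
    using integral_norm_mult_le[OF assms] by (simp add: norm_mult)
  finally show ?thesis .
qed

subsection \<open>Completeness\<close>

text \<open>Riesz-Fischer: on an interval of length 1 the \<open>L^1\<close> norm is at most the
  \<open>L^2\<close> norm, so the series of moduli has finite integral and the series converges
  almost everywhere. Fatou's lemma then shows that the pointwise sum is also the limit in
  \<open>L^2\<close>.\<close>

lemma l2_summable_norm_imp_convergent:
  fixes d :: "nat \<Rightarrow> l2"
  assumes s: "summable (\<lambda>n. norm (d n))"
  shows "\<exists>u. (\<lambda>N. \<Sum>n<N. d n) \<longlonglongrightarrow> u"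
proof -
  let ?f = "\<lambda>n x. rep_l2 (d n) x"
  have m[measurable]: "?f n \<in> borel_measurable I_leb" for n using sq_int_rep[of "d n"] by (simp add: sq_int_def)
  have "integral\<^sup>L I_leb (\<lambda>x. norm (?f n x)) \<le> norm (d n)" for n
    using integral_norm_mult_le(2)[OF sq_int_rep[of "d n"] sq_int_const[of 1]]
      sq_int_bounded(2)[of "\<lambda>x. 1" 1] by (simp add: abs_rep_l2) (smt (verit) mult_left_le norm_ge_zero)
  moreover have "(\<integral>\<^sup>+x. ennreal (norm (?f n x)) \<partial>I_leb) = ennreal (integral\<^sup>L I_leb (\<lambda>x. norm (?f n x)))" for n
    by (rule nn_integral_eq_integral) (auto intro: integrable_sq_int sq_int_rep)
  ultimately have le: "(\<integral>\<^sup>+x. ennreal (norm (?f n x)) \<partial>I_leb) \<le> ennreal (norm (d n))" for n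
    by (simp add: ennreal_leI)
  have "(\<integral>\<^sup>+x. (\<Sum>n. ennreal (norm (?f n x))) \<partial>I_leb) = (\<Sum>n. \<integral>\<^sup>+x. ennreal (norm (?f n x)) \<partial>I_leb)"
    by (rule nn_integral_suminf) measurable
  also have "\<dots> \<le> (\<Sum>n. ennreal (norm (d n)))" by (intro suminf_le le) auto
  also have "\<dots> = ennreal (\<Sum>n. norm (d n))" by (rule suminf_ennreal2) (use s in auto)
  finally have "(\<integral>\<^sup>+x. (\<Sum>n. ennreal (norm (?f n x))) \<partial>I_leb) \<noteq> \<infinity>"
    by (metis ennreal_less_top infinity_ennreal_def leD)
  then have "AE x in I_leb. (\<Sum>n. ennreal (norm (?f n x))) \<noteq> \<infinity>"
    by (intro nn_integral_PInf_AE) auto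
  then have AEs: "AE x in I_leb. summable (\<lambda>n. ?f n x)"
  proof eventually_elim
    case (elim x)
    then have "summable (\<lambda>n. norm (?f n x))" by (intro summable_suminf_not_top) auto
    then show ?case by (rule summable_norm_cancel)
  qed
  define F where "F x = (\<Sum>n. ?f n x)" for x
  define S where "S N = (\<Sum>n<N. d n)" for N
  have mF[measurable]: "F \<in> borel_measurable I_leb" unfolding F_def by measurable
  have rS: "AE x in I_leb. rep_l2 (S N) x = (\<Sum>n<N. ?f n x)" for N
  proof (induction N)
    case 0
    then show ?case using rep_abs_l2[OF sq_int_0] by (simp add: S_def zero_l2_def)
  next
    case (Suc N)
    then show ?case using rep_add[of "S N" "d N"] by eventually_elim (simp add: S_def)
  qed
  have "AE x in I_leb. \<forall>N. rep_l2 (S N) x = (\<Sum>n<N. ?f n x)" using rS by (simp add: AE_all_countable)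
  with AEs have lim: "AE x in I_leb. (\<lambda>N. rep_l2 (S N) x) \<longlonglongrightarrow> F x"
  proof eventually_elim
    case (elim x)
    then show ?case using summable_LIMSEQ[OF elim(1)] by (simp add: F_def)
  qed
  have "Cauchy S"
  proof -
    have *: "norm (S M - S N) \<le> \<bar>(\<Sum>n<M. norm (d n)) - (\<Sum>n<N. norm (d n))\<bar>" for M N
    proof (induction M N rule: linorder_wlog)
      case (le M N)
      have "S N - S M = (\<Sum>n\<in>{M..<N}. d n)"
        unfolding S_def using le by (simp add: sum_diff_nat_ivl lessThan_atLeast0)
      moreover have "(\<Sum>n<N. norm (d n)) - (\<Sum>n<M. norm (d n)) = (\<Sum>n\<in>{M..<N}. norm (d n))"
        using le by (simp add: sum_diff_nat_ivl lessThan_atLeast0)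
      ultimately have "norm (S N - S M) \<le> \<bar>(\<Sum>n<N. norm (d n)) - (\<Sum>n<M. norm (d n))\<bar>"
        using norm_sum[of d "{M..<N}"] by simp
      then show ?case by (simp only: norm_minus_commute[of "S M"] abs_minus_commute[of "\<Sum>n<M. norm (d n)"])
    qed (simp only: norm_minus_commute abs_minus_commute)
    have "Cauchy (\<lambda>N. \<Sum>n<N. norm (d n))" using s summable_iff_convergent convergent_Cauchy by blast
    then have C: "\<exists>M. \<forall>m\<ge>M. \<forall>n\<ge>M. \<bar>(\<Sum>n<m. norm (d n)) - (\<Sum>k<n. norm (d k))\<bar> < e" if "e > 0" for e
      using that by (auto simp: Cauchy_def dist_real_def)
    show ?thesis
    proof (rule metric_CauchyI)
      fix e :: real assume "e > 0"
      then obtain M where "\<And>m n. m \<ge> M \<Longrightarrow> n \<ge> M \<Longrightarrow> \<bar>(\<Sum>n<m. norm (d n)) - (\<Sum>k<n. norm (d k))\<bar> < e"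
        using C by blast
      then have "dist (S m) (S n) < e" if "m \<ge> M" "n \<ge> M" for m n
        unfolding dist_norm by (rule order_le_less_trans[OF *]) (use that in auto)
      then show "\<exists>M. \<forall>m\<ge>M. \<forall>n\<ge>M. dist (S m) (S n) < e" by blast
    qed
  qed
  \<comment> \<open>Fatou's lemma in the index \<open>M\<close>: the squared distance of
    \<open>F\<close> to \<open>S N\<close> is at most the lower limit of the squared distances of
    \<open>S M\<close> to \<open>S N\<close>.\<close>
  have key: "\<exists>N0. \<forall>N\<ge>N0. (\<integral>\<^sup>+x. ennreal ((norm (F x - rep_l2 (S N) x))\<^sup>2) \<partial>I_leb) \<le> ennreal (e\<^sup>2)" if "e > 0" for e
  proof -
    obtain N0 where N0: "\<And>M N. M \<ge> N0 \<Longrightarrow> N \<ge> N0 \<Longrightarrow> norm (S M - S N) < e"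
      using \<open>Cauchy S\<close> \<open>e > 0\<close> unfolding Cauchy_def dist_norm by blast
    have "(\<integral>\<^sup>+x. ennreal ((norm (F x - rep_l2 (S N) x))\<^sup>2) \<partial>I_leb) \<le> ennreal (e\<^sup>2)" if N: "N \<ge> N0" for N
    proof -
      have mS[measurable]: "rep_l2 (S N) \<in> borel_measurable I_leb" for N using sq_int_rep[of "S N"] by (simp add: sq_int_def)
      have "(\<integral>\<^sup>+x. ennreal ((norm (F x - rep_l2 (S N) x))\<^sup>2) \<partial>I_leb) =
        (\<integral>\<^sup>+x. liminf (\<lambda>M. ennreal ((norm (rep_l2 (S M) x - rep_l2 (S N) x))\<^sup>2)) \<partial>I_leb)"
      proof (rule nn_integral_cong_AE)
        show "AE x in I_leb. ennreal ((norm (F x - rep_l2 (S N) x))\<^sup>2) =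
          liminf (\<lambda>M. ennreal ((norm (rep_l2 (S M) x - rep_l2 (S N) x))\<^sup>2))"
          using lim
        proof eventually_elim
          case (elim x)
          have "(\<lambda>M. ennreal ((norm (rep_l2 (S M) x - rep_l2 (S N) x))\<^sup>2)) \<longlonglongrightarrow> ennreal ((norm (F x - rep_l2 (S N) x))\<^sup>2)"
            by (intro tendsto_ennrealI tendsto_intros elim)
          from lim_imp_Liminf[OF _ this] show ?case by simp
        qed
      qed
      also have "\<dots> \<le> liminf (\<lambda>M. \<integral>\<^sup>+x. ennreal ((norm (rep_l2 (S M) x - rep_l2 (S N) x))\<^sup>2) \<partial>I_leb)"
        by (rule nn_integral_liminf) measurable
      also have "\<dots> = liminf (\<lambda>M. ennreal ((norm (S M - S N))\<^sup>2))"
      proof -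
        have "(\<integral>\<^sup>+x. ennreal ((norm (rep_l2 (S M) x - rep_l2 (S N) x))\<^sup>2) \<partial>I_leb) = ennreal ((norm (S M - S N))\<^sup>2)" for M
        proof -
          have "(\<integral>\<^sup>+x. ennreal ((norm (rep_l2 (S M) x - rep_l2 (S N) x))\<^sup>2) \<partial>I_leb)
            = ennreal (integral\<^sup>L I_leb (\<lambda>x. (norm (rep_l2 (S M) x - rep_l2 (S N) x))\<^sup>2))"
            using sq_int_diff[OF sq_int_rep[of "S M"] sq_int_rep[of "S N"]]
            by (intro nn_integral_eq_integral) (auto simp: sq_int_def)
          also have "integral\<^sup>L I_leb (\<lambda>x. (norm (rep_l2 (S M) x - rep_l2 (S N) x))\<^sup>2) = (norm (S M - S N))\<^sup>2"
            using norm_abs_l2[OF sq_int_diff[OF sq_int_rep[of "S M"] sq_int_rep[of "S N"]]]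
            by (simp add: abs_l2_diff sq_int_rep abs_rep_l2)
          finally show ?thesis .
        qed
        then show ?thesis by simp
      qed
      also have "\<dots> \<le> ennreal (e\<^sup>2)"
      proof (rule Liminf_le)
        show "\<forall>\<^sub>F M in sequentially. ennreal ((norm (S M - S N))\<^sup>2) \<le> ennreal (e\<^sup>2)"
          unfolding eventually_sequentially
          by (intro exI[of _ N0] allI impI ennreal_leI power_mono less_imp_le[OF N0[OF _ N]]) auto
      qed simp
      finally show ?thesis .
    qed
    then show ?thesis by blast
  qed
  have mS[measurable]: "rep_l2 (S N) \<in> borel_measurable I_leb" for N using sq_int_rep[of "S N"] by (simp add: sq_int_def)
  have fin: "sq_int (\<lambda>x. F x - rep_l2 (S N) x)"
    if "(\<integral>\<^sup>+x. ennreal ((norm (F x - rep_l2 (S N) x))\<^sup>2) \<partial>I_leb) \<le> ennreal (e\<^sup>2)" for N e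
    unfolding sq_int_def
  proof
    show "integrable I_leb (\<lambda>x. (norm (F x - rep_l2 (S N) x))\<^sup>2)"
      by (rule integrableI_nonneg) (use le_less_trans[OF that ennreal_less_top] in auto)
  qed measurable
  have sF: "sq_int F"
  proof -
    obtain N where "(\<integral>\<^sup>+x. ennreal ((norm (F x - rep_l2 (S N) x))\<^sup>2) \<partial>I_leb) \<le> ennreal (1\<^sup>2)" using key[of 1] by auto
    from sq_int_add[OF fin[OF this] sq_int_rep[of "S N"]] show ?thesis by simp
  qed
  have "S \<longlonglongrightarrow> abs_l2 F"
  proof (rule metric_LIMSEQ_I)
    fix e :: real assume "e > 0"
    then obtain N0 where N0: "\<And>N. N \<ge> N0 \<Longrightarrow> (\<integral>\<^sup>+x. ennreal ((norm (F x - rep_l2 (S N) x))\<^sup>2) \<partial>I_leb) \<le> ennreal ((e/2)\<^sup>2)"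
      using key[of "e/2"] by auto
    have "dist (S N) (abs_l2 F) < e" if "N \<ge> N0" for N
    proof -
      have i: "integrable I_leb (\<lambda>x. (norm (F x - rep_l2 (S N) x))\<^sup>2)"
        using fin[OF N0[OF that]] by (simp add: sq_int_def)
      have "abs_l2 F - S N = abs_l2 (\<lambda>x. F x - rep_l2 (S N) x)"
        using sF by (simp add: abs_l2_diff sq_int_rep abs_rep_l2)
      then have "(norm (abs_l2 F - S N))\<^sup>2 = integral\<^sup>L I_leb (\<lambda>x. (norm (F x - rep_l2 (S N) x))\<^sup>2)"
        using norm_abs_l2[OF fin[OF N0[OF that]]] by simp
      also have "ennreal \<dots> \<le> ennreal ((e/2)\<^sup>2)"
        using N0[OF that] nn_integral_eq_integral[OF i] by simp
      then have "integral\<^sup>L I_leb (\<lambda>x. (norm (F x - rep_l2 (S N) x))\<^sup>2) \<le> (e/2)\<^sup>2" by (simp add: ennreal_le_iff)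
      finally have "norm (abs_l2 F - S N) \<le> e/2" by (rule power2_le_imp_le) (use \<open>e > 0\<close> in simp)
      then show ?thesis using \<open>e > 0\<close> by (simp add: dist_norm norm_minus_commute)
    qed
    then show "\<exists>N0. \<forall>N\<ge>N0. dist (S N) (abs_l2 F) < e" by blast
  qed
  then show ?thesis unfolding S_def by blast
qed

instance l2 :: complete_space
proof
  fix X :: "nat \<Rightarrow> l2" assume X: "Cauchy X"
  \<comment> \<open>A subsequence with geometrically small increments is an absolutely convergent
    telescoping series, to which the previous lemma applies.\<close>
  have "\<exists>r. strict_mono r \<and> (\<forall>n. norm (X (r (Suc n)) - X (r n)) < (1/2) ^ n)"
  proof -
    have "\<exists>N. \<forall>m\<ge>N. \<forall>k\<ge>N. norm (X m - X k) < (1/2) ^ n" for n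
      using X unfolding Cauchy_def dist_norm by (meson half_gt_zero_iff zero_less_one zero_less_power)
    then obtain N where N: "\<And>n m k. m \<ge> N n \<Longrightarrow> k \<ge> N n \<Longrightarrow> norm (X m - X k) < (1/2) ^ n" by metis
    define r where "r = rec_nat (N 0) (\<lambda>n k. max (Suc k) (N (Suc n)))"
    have r0: "r 0 = N 0" and rS: "r (Suc n) = max (Suc (r n)) (N (Suc n))" for n by (auto simp: r_def)
    have sm: "strict_mono r" by (rule strict_monoI_Suc) (simp add: rS)
    have "r n \<ge> N n" for n by (cases n) (auto simp: r0 rS)
    then have "norm (X (r (Suc n)) - X (r n)) < (1/2) ^ n" for n
      using N[of n "r (Suc n)" "r n"] order_trans[of "N n" "r n" "r (Suc n)"] sm by (simp add: rS)
    with sm show ?thesis by blast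
  qed
  then obtain r where r: "strict_mono r" "\<And>n. norm (X (r (Suc n)) - X (r n)) < (1/2) ^ n" by blast
  have "summable (\<lambda>n. norm (X (r (Suc n)) - X (r n)))"
    by (rule summable_comparison_test'[of "\<lambda>n. (1/2)^n" 0]) (use less_imp_le[OF r(2)] in \<open>auto simp: summable_geometric\<close>)
  from l2_summable_norm_imp_convergent[OF this] obtain u where
    "(\<lambda>N. \<Sum>n<N. X (r (Suc n)) - X (r n)) \<longlonglongrightarrow> u" by blast
  moreover have "(\<Sum>n<N. X (r (Suc n)) - X (r n)) = X (r N) - X (r 0)" for N
    by (rule sum_lessThan_telescope)
  ultimately have "(\<lambda>N. X (r N) - X (r 0)) \<longlonglongrightarrow> u" by simp
  from tendsto_add[OF this tendsto_const[of "X (r 0)"]] have "(X \<circ> r) \<longlonglongrightarrow> u + X (r 0)" by (simp add: o_def)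
  then have "X \<longlonglongrightarrow> u + X (r 0)" by (rule Cauchy_converges_subseq[OF X r(1)])
  then show "convergent X" by (auto simp: convergent_def)
qed

instance l2 :: banach ..

section \<open>Smooth functions and test functions\<close>

text \<open>Being \<open>k\<close> times differentiable, with no continuity asked of the last
  derivative. The recursion through \<open>deriv f\<close> lets the sum and product rules be proved
  by induction on the order.\<close>

primrec Ck :: "nat \<Rightarrow> (real \<Rightarrow> real) \<Rightarrow> bool" where
  "Ck 0 f \<longleftrightarrow> True"
| "Ck (Suc k) f \<longleftrightarrow> f differentiable_on UNIV \<and> Ck k (deriv f)"

lemma Ck_iff: "Ck k f \<longleftrightarrow> (\<forall>j<k. (deriv ^^ j) f differentiable_on UNIV)"
proof (induction k arbitrary: f)
  case (Suc k)
  have "Ck (Suc k) f \<longleftrightarrow> f differentiable_on UNIV \<and> (\<forall>j<k. (deriv ^^ Suc j) f differentiable_on UNIV)"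
    using Suc.IH[of "deriv f"] by (simp add: funpow_swap1)
  also have "\<dots> \<longleftrightarrow> (\<forall>j<Suc k. (deriv ^^ j) f differentiable_on UNIV)"
    by (simp only: All_less_Suc2 funpow_0)
  finally show ?case .
qed simp

lemma smooth_iff_Ck: "(\<forall>k. (deriv ^^ k) f differentiable_on UNIV) \<longleftrightarrow> (\<forall>k. Ck k f)"
  unfolding Ck_iff by blast

lemma Ck_mono: "Ck (Suc k) f \<Longrightarrow> Ck k f"
  by (simp add: Ck_iff)

lemma differentiable_on_UNIV_DERIV:
  fixes f :: "real \<Rightarrow> real"
  shows "f differentiable_on UNIV \<Longrightarrow> (f has_real_derivative deriv f x) (at x)"
  by (simp add: differentiable_on_def DERIV_deriv_iff_real_differentiable)

lemma Ck_add: "Ck k f \<Longrightarrow> Ck k g \<Longrightarrow> Ck k (\<lambda>x. f x + g x)"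
proof (induction k arbitrary: f g)
  case (Suc k)
  then have f: "f differentiable_on UNIV" "Ck k (deriv f)" and g: "g differentiable_on UNIV" "Ck k (deriv g)" by auto
  have "deriv (\<lambda>x. f x + g x) = (\<lambda>x. deriv f x + deriv g x)"
    by (intro ext DERIV_imp_deriv DERIV_add differentiable_on_UNIV_DERIV f g)
  then show ?case using Suc.IH[OF f(2) g(2)] f(1) g(1) by (simp add: differentiable_on_add)
qed simp

lemma Ck_mult: "Ck k f \<Longrightarrow> Ck k g \<Longrightarrow> Ck k (\<lambda>x. f x * g x)"
proof (induction k arbitrary: f g)
  case (Suc k)
  then have f: "f differentiable_on UNIV" "Ck k (deriv f)" "Ck k f" and g: "g differentiable_on UNIV" "Ck k (deriv g)" "Ck k g"
    using Ck_mono by auto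
  have "deriv (\<lambda>x. f x * g x) = (\<lambda>x. deriv f x * g x + deriv g x * f x)"
    by (intro ext DERIV_imp_deriv DERIV_mult differentiable_on_UNIV_DERIV f g)
  then show ?case using Ck_add[OF Suc.IH[OF f(2) g(3)] Suc.IH[OF g(2) f(3)]] f(1) g(1)
    by (simp add: differentiable_on_mult)
qed simp

lemma Ck_const: "Ck k (\<lambda>x. c)"
  by (induction k arbitrary: c) (auto simp: deriv_const)

lemma Ck_ident: "Ck k (\<lambda>x. x)"
  by (cases k) (auto simp: deriv_ident Ck_const)

definition smooth :: "(real \<Rightarrow> real) \<Rightarrow> bool" where
  "smooth f \<longleftrightarrow> (\<forall>k. Ck k f)"

lemma smooth_add: "smooth f \<Longrightarrow> smooth g \<Longrightarrow> smooth (\<lambda>x. f x + g x)"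
  and smooth_mult: "smooth f \<Longrightarrow> smooth g \<Longrightarrow> smooth (\<lambda>x. f x * g x)"
  and smooth_const: "smooth (\<lambda>x. c)"
  and smooth_ident: "smooth (\<lambda>x. x)"
  by (auto simp: smooth_def Ck_add Ck_mult Ck_const Ck_ident)

lemma smooth_deriv: "smooth f \<Longrightarrow> smooth (deriv f)"
  by (auto simp: smooth_def) (metis Ck.simps(2))

lemma smooth_DERIV: "smooth f \<Longrightarrow> (f has_real_derivative deriv f x) (at x)"
  unfolding smooth_def by (metis Ck.simps(2) differentiable_on_UNIV_DERIV)

lemma smooth_continuous: "smooth f \<Longrightarrow> continuous_on S f"
  by (meson DERIV_continuous_on has_field_derivative_at_within smooth_DERIV)

lemma smoothI_deriv: "(\<And>x. (F has_real_derivative f x) (at x)) \<Longrightarrow> smooth f \<Longrightarrow> smooth F"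
proof -
  assume F: "\<And>x. (F has_real_derivative f x) (at x)" and f: "smooth f"
  have "deriv F = f" using F by (intro ext DERIV_imp_deriv)
  moreover have "F differentiable_on UNIV"
    using F by (auto simp: differentiable_on_def real_differentiable_def)
  ultimately have "Ck k F" for k using f by (cases k) (auto simp: smooth_def)
  then show "smooth F" by (simp add: smooth_def)
qed

lemma test_fun_iff: "test_fun \<theta> \<longleftrightarrow> smooth \<theta> \<and>
    (\<exists>a b. 0 < a \<and> a \<le> b \<and> b < 1 \<and> (\<forall>x. x \<notin> {a..b} \<longrightarrow> \<theta> x = 0))"
proof -
  have "(\<exists>K. compact K \<and> K \<subseteq> {0<..<1} \<and> (\<forall>x. x \<notin> K \<longrightarrow> \<theta> x = 0)) \<longleftrightarrow>
    (\<exists>a b. 0 < a \<and> a \<le> b \<and> b < 1 \<and> (\<forall>x. x \<notin> {a..b} \<longrightarrow> \<theta> x = 0))" (is "?L \<longleftrightarrow> ?R")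
  proof
    assume ?L
    then obtain K where K: "compact K" "K \<subseteq> {0<..<1}" "\<And>x. x \<notin> K \<Longrightarrow> \<theta> x = 0" by blast
    \<comment> \<open>Adding the midpoint makes the support set nonempty, so that it has a least and
      a greatest element even when \<theta> vanishes identically.\<close>
    define K' where "K' = insert (1/2) K"
    have "compact K'" "K' \<noteq> {}" using K(1) by (auto simp: K'_def)
    then obtain a b where a: "a \<in> K'" "\<And>x. x \<in> K' \<Longrightarrow> a \<le> x" and b: "b \<in> K'" "\<And>x. x \<in> K' \<Longrightarrow> x \<le> b"
      using compact_attains_inf[of K'] compact_attains_sup[of K'] by blast
    have "0 < a" "a \<le> b" "b < 1" "\<forall>x. x \<notin> {a..b} \<longrightarrow> \<theta> x = 0"
      using a b K by (auto simp: K'_def)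
    then show ?R by blast
  next
    assume ?R
    then obtain a b where "0 < a" "a \<le> b" "b < 1" "\<forall>x. x \<notin> {a..b} \<longrightarrow> \<theta> x = 0" by blast
    then show ?L by (intro exI[of _ "{a..b}"]) auto
  qed
  then show ?thesis by (simp add: test_fun_def smooth_iff_Ck smooth_def)
qed

lemma test_fun_smooth: "test_fun \<theta> \<Longrightarrow> smooth \<theta>"
  by (simp add: test_fun_iff)

lemma test_fun_zero: "test_fun \<theta> \<Longrightarrow> x \<le> 0 \<or> x \<ge> 1 \<Longrightarrow> \<theta> x = 0"
  unfolding test_fun_iff by (metis atLeastAtMost_iff not_less order_trans)

lemma test_fun_mult: "test_fun \<theta> \<Longrightarrow> smooth g \<Longrightarrow> test_fun (\<lambda>x. g x * \<theta> x)"
  unfolding test_fun_iff by (metis smooth_mult mult_zero_right)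

lemma test_fun_deriv:
  assumes "test_fun \<theta>" shows "test_fun (deriv \<theta>)"
proof -
  obtain a b where ab: "0 < a" "a \<le> b" "b < 1" "\<And>x. x \<notin> {a..b} \<Longrightarrow> \<theta> x = 0"
    using assms by (auto simp: test_fun_iff)
  have "deriv \<theta> x = 0" if "x \<notin> {a..b}" for x
  proof (rule DERIV_imp_deriv)
    show "(\<theta> has_real_derivative 0) (at x)"
      by (rule has_field_derivative_transform_within_open[of "\<lambda>x. 0" _ _ "- {a..b}"]) (use that ab(4) in auto)
  qed
  then show ?thesis using ab smooth_deriv[of \<theta>] assms by (auto simp: test_fun_iff)
qed

lemma test_fun_add: "test_fun \<theta> \<Longrightarrow> test_fun \<eta> \<Longrightarrow> test_fun (\<lambda>x. \<theta> x + \<eta> x)"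
proof -
  assume t: "test_fun \<theta>" "test_fun \<eta>"
  obtain a b where ab: "0 < a" "a \<le> b" "b < 1" "\<And>x. x \<notin> {a..b} \<Longrightarrow> \<theta> x = 0"
    using t by (auto simp: test_fun_iff)
  obtain c d where cd: "0 < c" "c \<le> d" "d < 1" "\<And>x. x \<notin> {c..d} \<Longrightarrow> \<eta> x = 0"
    using t by (auto simp: test_fun_iff)
  have z: "\<theta> x + \<eta> x = 0" if "x \<notin> {min a c..max b d}" for x
  proof -
    have "x \<notin> {a..b}" "x \<notin> {c..d}" using that by auto
    then show ?thesis using ab(4) cd(4) by simp
  qed
  have "0 < min a c" "min a c \<le> max b d" "max b d < 1"
    using ab cd by auto
  then show ?thesis using z smooth_add[OF t[THEN test_fun_smooth]] unfolding test_fun_iff by blast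
qed

text \<open>The primitive vanishes to the left of the support by construction and to the right of it
  because the mean is zero. This is the ingredient of the du Bois-Reymond argument below.\<close>

lemma test_fun_primitive:
  assumes "test_fun \<theta>" "integral {0..1} \<theta> = 0"
  shows "\<exists>\<Theta>. test_fun \<Theta> \<and> deriv \<Theta> = \<theta>"
proof -
  obtain a b where ab: "0 < a" "a \<le> b" "b < 1" "\<And>x. x \<notin> {a..b} \<Longrightarrow> \<theta> x = 0"
    using assms by (auto simp: test_fun_iff)
  have c: "continuous_on S \<theta>" for S using assms by (simp add: test_fun_smooth smooth_continuous)
  have i: "\<theta> integrable_on {u..v}" for u v by (rule integrable_continuous_real[OF c])
  \<comment> \<open>The base point -1 lies to the left of the support. For \<open>x < -1\<close> the
    interval is empty and the integral is 0, which is the correct value.\<close>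
  define \<Theta> where "\<Theta> x = integral {-1..x} \<theta>" for x
  have z: "\<Theta> x = 0" if "x < a" for x
    unfolding \<Theta>_def by (subst Henstock_Kurzweil_Integration.integral_cong[where g = "\<lambda>_. 0"]) (use that ab(4) in auto)
  have z': "\<Theta> x = 0" if "b < x" for x
  proof -
    have x: "-1 \<le> b" "b \<le> x" "-1 \<le> (0::real)" "(0::real) \<le> 1" using that ab by auto
    have zi: "integral {b..v} \<theta> = 0" for v
      using integral_spike[of "{b}" "{b..v}" "\<lambda>_. 0" \<theta>] ab by auto
    have "\<Theta> x = integral {-1..b} \<theta> + integral {b..x} \<theta>"
      unfolding \<Theta>_def by (rule Henstock_Kurzweil_Integration.integral_combine[OF x(1,2) i, symmetric])
    also have "\<dots> = integral {-1..b} \<theta> + integral {b..1} \<theta>" by (simp add: zi)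
    also have "\<dots> = integral {-1..1} \<theta>"
      by (rule Henstock_Kurzweil_Integration.integral_combine[OF _ _ i]) (use ab in auto)
    also have "\<dots> = integral {-1..0} \<theta> + integral {0..1} \<theta>"
      by (rule Henstock_Kurzweil_Integration.integral_combine[OF x(3,4) i, symmetric])
    also have "integral {-1..0} \<theta> = integral {-1..0} (\<lambda>_::real. 0)"
      by (rule Henstock_Kurzweil_Integration.integral_cong) (use ab in auto)
    finally show ?thesis using assms(2) by simp
  qed
  have d: "(\<Theta> has_real_derivative \<theta> x) (at x)" for x
  proof -
    consider "x < a" | "b < x" | "-1 < x" "x < 2" using ab by linarith
    then show ?thesis
    proof cases
      case 1
      have "\<theta> x = 0" using 1 ab by auto
      then show ?thesis
        using has_field_derivative_transform_within_open[of "\<lambda>x. 0" 0 x "{..<a}" \<Theta>] 1 z by auto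
    next
      case 2
      have "\<theta> x = 0" using 2 ab by auto
      then show ?thesis
        using has_field_derivative_transform_within_open[of "\<lambda>x. 0" 0 x "{b<..}" \<Theta>] 2 z' by auto
    next
      case 3
      have "(\<Theta> has_real_derivative \<theta> x) (at x within {-1..2})"
        unfolding \<Theta>_def by (rule integral_has_real_derivative[OF c]) (use 3 in auto)
      then have "(\<Theta> has_real_derivative \<theta> x) (at x within {-1<..<2})"
        by (rule DERIV_subset) auto
      then show ?thesis using 3 by (simp add: at_within_open[of x "{-1<..<2}"])
    qed
  qed
  then have "deriv \<Theta> = \<theta>" by (intro ext DERIV_imp_deriv)
  moreover have "smooth \<Theta>" by (rule smoothI_deriv[OF d test_fun_smooth[OF assms(1)]])
  moreover have "\<forall>x. x \<notin> {a..b} \<longrightarrow> \<Theta> x = 0" using z z' by (meson atLeastAtMost_iff not_le)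
  ultimately show ?thesis using ab(1-3) unfolding test_fun_iff by blast
qed

subsection \<open>Continuous functions in \<open>L\<^sup>2\<close>\<close>

lemma continuous_borel_measurable_I:
  fixes f :: "real \<Rightarrow> 'a::euclidean_space"
  assumes "continuous_on {0..1} f" shows "f \<in> borel_measurable I_leb"
  by (rule continuous_imp_measurable_on_sets_lebesgue[OF continuous_on_subset[OF assms]]) auto

lemma continuous_bounded_I:
  fixes f :: "real \<Rightarrow> 'a::real_normed_vector"
  assumes "continuous_on {0..1} f"
  obtains B where "B > 0" "\<And>x. x \<in> {0..1} \<Longrightarrow> norm (f x) \<le> B"
proof -
  have "compact (f ` {0..1})" using assms by (rule compact_continuous_image) simp
  then have "bounded (f ` {0..1})" by (rule compact_imp_bounded)
  then show ?thesis using that unfolding bounded_pos by auto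
qed

lemma sq_int_continuous:
  assumes "continuous_on {0..1} f" shows "sq_int f"
proof -
  obtain B where "\<And>x. x \<in> {0..1} \<Longrightarrow> norm (f x) \<le> B" using continuous_bounded_I[OF assms] by metis
  then show ?thesis by (intro sq_int_bounded(1)[OF continuous_borel_measurable_I[OF assms], of B]) auto
qed

lemma norm_abs_l2_continuous_le:
  assumes "continuous_on {0..1} f" "\<And>x. x \<in> {0<..<1} \<Longrightarrow> norm (f x) \<le> B"
  shows "norm (abs_l2 f) \<le> B"
  by (rule sq_int_bounded(2)[OF continuous_borel_measurable_I[OF assms(1)] assms(2)])

lemma integral_I_continuous:
  fixes f :: "real \<Rightarrow> 'a::euclidean_space"
  assumes "continuous_on {0..1} f"
  shows "integrable I_leb f" "integral\<^sup>L I_leb f = integral {0..1} f"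
proof -
  have m: "f \<in> borel_measurable I_leb" by (rule continuous_borel_measurable_I[OF assms])
  obtain B where B: "\<And>x. x \<in> {0..1} \<Longrightarrow> norm (f x) \<le> B" using continuous_bounded_I[OF assms] by metis
  show i: "integrable I_leb f"
    by (rule finite_measure.integrable_const_bound[OF prob_I(2), of _ B]) (use B m in auto)
  have "integral\<^sup>L I_leb f = integral {0<..<1} f"
    by (rule lebesgue_integral_eq_integral[OF i]) simp
  also have "\<dots> = integral {0..1} f"
    using integral_open_interval[of 0 1 f] by simp
  finally show "integral\<^sup>L I_leb f = integral {0..1} f" .
qed

lemma continuous_eq_of_abs_l2_eq:
  assumes f: "continuous_on {0..1} f" and g: "continuous_on {0..1} g" and eq: "abs_l2 f = abs_l2 g" and x: "x \<in> {0..1}"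
  shows "f x = g x"
proof -
  have c: "continuous_on {0..1} (\<lambda>x. (norm (f x - g x))\<^sup>2)" by (intro continuous_intros f g)
  have "abs_l2 (\<lambda>x. f x - g x) = 0" using eq by (simp add: abs_l2_diff sq_int_continuous f g)
  then have "integral\<^sup>L I_leb (\<lambda>x. (norm (f x - g x))\<^sup>2) = 0"
    using norm_abs_l2[OF sq_int_diff[OF sq_int_continuous[OF f] sq_int_continuous[OF g]]] by simp
  then have "integral {0..1} (\<lambda>x. (norm (f x - g x))\<^sup>2) = 0" using integral_I_continuous[OF c] by simp
  then have "(norm (f x - g x))\<^sup>2 = 0"
    using integral_eq_0_iff[OF c] x by auto
  then show ?thesis by simp
qed

text \<open>A class orthogonal to all continuous functions is tested against a test function times
  its own integral \<open>?J\<close>. The pairing equals \<open>inner ?J ?J\<close>, so the real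
  inner product suffices to annihilate a complex number.\<close>

lemma dense_continuous: "closure {abs_l2 f | f. continuous_on {0..1} f} = UNIV" (is "closure ?M = UNIV")
proof (rule dense_subspace)
  show "subspace ?M"
    unfolding subspace_def
  proof (intro conjI ballI allI)
    show "0 \<in> ?M" by (auto intro!: exI[of _ "\<lambda>x. 0"] simp: abs_l2_0)
    show "u + v \<in> ?M" if "u \<in> ?M" "v \<in> ?M" for u v
    proof -
      obtain f g where "u = abs_l2 f" "v = abs_l2 g" "continuous_on {0..1} f" "continuous_on {0..1} g"
        using \<open>u \<in> ?M\<close> \<open>v \<in> ?M\<close> by blast
      then show ?thesis
        by (auto intro!: exI[of _ "\<lambda>x. f x + g x"] continuous_intros simp: abs_l2_add sq_int_continuous)
    qed
    show "c *\<^sub>R u \<in> ?M" if "u \<in> ?M" for c u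
    proof -
      obtain f where "u = abs_l2 f" "continuous_on {0..1} f" using \<open>u \<in> ?M\<close> by blast
      then show ?thesis
        by (auto intro!: exI[of _ "\<lambda>x. c *\<^sub>R f x"] continuous_intros simp: abs_l2_scaleR sq_int_continuous)
    qed
  qed
  fix v assume v: "\<And>m. m \<in> ?M \<Longrightarrow> inner v m = 0"
  show "v = 0"
  proof (rule test_integrals_0_imp_0)
    fix \<theta> assume \<theta>: "test_fun \<theta>"
    let ?J = "integral\<^sup>L I_leb (\<lambda>x. \<theta> x *\<^sub>R rep_l2 v x)"
    have c: "continuous_on {0..1} (\<lambda>x. \<theta> x *\<^sub>R c)" for c :: complex
      by (intro continuous_intros smooth_continuous test_fun_smooth \<theta>)
    have i: "integrable I_leb (\<lambda>x. \<theta> x *\<^sub>R rep_l2 v x)"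
      using test_fun_integrable[OF \<theta>, of 0 v] by simp
    have "inner v (abs_l2 (\<lambda>x. \<theta> x *\<^sub>R ?J)) = integral\<^sup>L I_leb (\<lambda>x. inner (rep_l2 v x) (\<theta> x *\<^sub>R ?J))"
      using inner_abs_l2[OF sq_int_rep sq_int_continuous[OF c]] by (simp add: abs_rep_l2)
    also have "\<dots> = integral\<^sup>L I_leb (\<lambda>x. inner (\<theta> x *\<^sub>R rep_l2 v x) ?J)" by simp
    also have "\<dots> = inner ?J ?J" by (rule integral_inner_left[OF i])
    finally have "inner ?J ?J = 0" using v[of "abs_l2 (\<lambda>x. \<theta> x *\<^sub>R ?J)"] c[of ?J] by auto
    then show "?J = 0" by simp
  qed
qed

subsection \<open>Primitives and integration by parts\<close>

text \<open>Pairing with an indicator keeps the value at every point a bounded linear functional of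
  the class \<open>h\<close>, so that identities for primitives extend by density.\<close>

definition prim :: "l2 \<Rightarrow> real \<Rightarrow> complex" where
  "prim h x = integral\<^sup>L I_leb (\<lambda>s. indicator {..x} s * rep_l2 h s)"

lemma indicator_measurable_I:
  fixes a :: real
  shows "(indicator {a..b} :: real \<Rightarrow> complex) \<in> borel_measurable I_leb"
    "(indicator {..b} :: real \<Rightarrow> complex) \<in> borel_measurable I_leb"
  by (intro measurable_restrict_space1 borel_measurable_indicator sets_completionI_sets; simp)+

lemma sq_int_indicator: "sq_int (indicator {..b})" "sq_int (indicator {a..b})"
  by (rule sq_int_bounded(1)[OF indicator_measurable_I(2), of _ 1]; simp add: indicator_def)
    (rule sq_int_bounded(1)[OF indicator_measurable_I(1), of _ _ 1]; simp add: indicator_def)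

lemma prim_integrable: "integrable I_leb (\<lambda>s. indicator {..x} s * rep_l2 h s)"
  by (rule sq_int_mult_integrable[OF sq_int_indicator(1) sq_int_rep])

lemma prim_add: "prim (h + k) x = prim h x + prim k x"
proof -
  have "prim (h + k) x = integral\<^sup>L I_leb (\<lambda>s. indicator {..x} s * rep_l2 h s + indicator {..x} s * rep_l2 k s)"
    unfolding prim_def
    by (intro integral_cong_AE borel_measurable_integrable prim_integrable Bochner_Integration.integrable_add)
      (use rep_add[of h k] in \<open>eventually_elim, simp add: algebra_simps\<close>)
  then show ?thesis by (simp add: prim_def prim_integrable)
qed

lemma prim_scaleC: "prim (scaleC_l2 c h) x = c * prim h x"
proof -
  have "prim (scaleC_l2 c h) x = integral\<^sup>L I_leb (\<lambda>s. c * (indicator {..x} s * rep_l2 h s))"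
    unfolding prim_def
    by (intro integral_cong_AE borel_measurable_integrable prim_integrable integrable_mult_right)
      (use rep_scaleC[of c h] in \<open>eventually_elim, simp add: algebra_simps\<close>)
  then show ?thesis by (simp add: prim_def)
qed

lemma scaleC_of_real: "scaleC_l2 (complex_of_real c) h = c *\<^sub>R h"
  using abs_l2_scaleR[OF sq_int_rep, of c h] abs_l2_scaleC[OF sq_int_rep, of "complex_of_real c" h]
  by (simp add: abs_rep_l2 scaleR_conv_of_real)

lemma prim_scaleR: "prim (c *\<^sub>R h) x = c *\<^sub>R prim h x"
  using prim_scaleC[of "complex_of_real c" h x] by (simp add: scaleC_of_real scaleR_conv_of_real)

lemma norm_indicator_l2:
  assumes "a \<le> b" shows "norm (abs_l2 (indicator {a..b})) \<le> sqrt (b - a)"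
proof -
  have "(norm (abs_l2 (indicator {a..b})))\<^sup>2 = integral\<^sup>L I_leb (\<lambda>x. (norm (indicator {a..b} x :: complex))\<^sup>2)"
    by (rule norm_abs_l2[OF sq_int_indicator(2)])
  also have "\<dots> = integral\<^sup>L I_leb (\<lambda>x. indicator {a..b} x)"
    by (rule Bochner_Integration.integral_cong) (auto simp: indicator_def)
  also have "\<dots> = integral\<^sup>L lebesgue (\<lambda>x. indicator {0<..<1} x *\<^sub>R indicator {a..b} x)"
    by (rule integral_restrict_space) simp
  also have "(\<lambda>x. indicator {0<..<1} x *\<^sub>R indicator {a..b} x :: real) = indicator ({0<..<1} \<inter> {a..b})"
    by (auto simp: indicator_def)
  also have "integral\<^sup>L lebesgue \<dots> = measure lebesgue ({0<..<1} \<inter> {a..b})" by simp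
  also have "\<dots> \<le> measure lebesgue {a..b}"
    by (rule measure_mono_fmeasurable) auto
  also have "\<dots> = b - a" using assms by simp
  finally show ?thesis by (rule real_le_rsqrt)
qed

text \<open>Cauchy-Schwarz against the indicator of \<open>{x..y}\<close>: primitives of
  \<open>L^2\<close> functions are Hoelder continuous with exponent 1/2.\<close>

lemma prim_diff_le:
  assumes "x \<le> y" shows "norm (prim h y - prim h x) \<le> sqrt (y - x) * norm h"
proof -
  have "prim h y - prim h x = integral\<^sup>L I_leb (\<lambda>s. indicator {..y} s * rep_l2 h s - indicator {..x} s * rep_l2 h s)"
    by (simp add: prim_def prim_integrable)
  also have "\<dots> = integral\<^sup>L I_leb (\<lambda>s. indicator {x..y} s * rep_l2 h s)"
  proof (rule integral_cong_AE)
    show "(\<lambda>s. indicator {..y} s * rep_l2 h s - indicator {..x} s * rep_l2 h s) \<in> borel_measurable I_leb"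
      by (intro borel_measurable_integrable Bochner_Integration.integrable_diff prim_integrable)
    show "(\<lambda>s. indicator {x..y} s * rep_l2 h s) \<in> borel_measurable I_leb"
      by (intro borel_measurable_integrable sq_int_mult_integrable sq_int_indicator sq_int_rep)
    \<comment> \<open>The difference of the two indicators is that of a half-open interval; it
      differs from the closed one only at the null set \<open>{x}\<close>.\<close>
    have "AE s in lebesgue. s \<noteq> x" by (rule AE_completion[OF AE_lborel_singleton])
    then have "AE s in I_leb. s \<noteq> x" by (simp add: AE_restrict_space_iff eventually_mono)
    then show "AE s in I_leb. indicator {..y} s * rep_l2 h s - indicator {..x} s * rep_l2 h s = indicator {x..y} s * rep_l2 h s"
      by eventually_elim (use assms in \<open>auto simp: indicator_def\<close>)
  qed
  finally have "norm (prim h y - prim h x) \<le> norm (abs_l2 (indicator {x..y})) * norm h"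
    using norm_integral_mult_le[OF sq_int_indicator(2) sq_int_rep, of x y h] by (simp add: abs_rep_l2)
  also have "\<dots> \<le> sqrt (y - x) * norm h"
    by (intro mult_right_mono norm_indicator_l2 assms norm_ge_zero)
  finally show ?thesis .
qed

lemma prim_0: "prim h 0 = 0"
proof -
  have "prim h 0 = integral\<^sup>L I_leb (\<lambda>s. 0)"
    unfolding prim_def by (rule Bochner_Integration.integral_cong) auto
  then show ?thesis by simp
qed

lemma norm_prim_le: "0 \<le> x \<Longrightarrow> norm (prim h x) \<le> sqrt x * norm h"
  using prim_diff_le[of 0 x h] by (simp add: prim_0)

lemma norm_prim_le1: "x \<in> {0..1} \<Longrightarrow> norm (prim h x) \<le> norm h"
  using norm_prim_le[of x h] mult_right_mono[of "sqrt x" 1 "norm h"] by simp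

lemma continuous_on_prim: "continuous_on S (prim h)"
proof -
  have "isCont (prim h) x" for x
    unfolding isCont_def
  proof (rule LIM_zero_cancel, rule Lim_null_comparison)
    show "\<forall>\<^sub>F y in at x. norm (prim h y - prim h x) \<le> sqrt \<bar>y - x\<bar> * norm h"
    proof (rule always_eventually, rule allI)
      fix y show "norm (prim h y - prim h x) \<le> sqrt \<bar>y - x\<bar> * norm h"
        using prim_diff_le[of x y h] prim_diff_le[of y x h] by (cases "x \<le> y") (auto simp: norm_minus_commute)
    qed
    have "((\<lambda>y. sqrt \<bar>y - x\<bar> * norm h) \<longlongrightarrow> sqrt \<bar>x - x\<bar> * norm h) (at x)" by (intro tendsto_intros)
    then show "((\<lambda>y. sqrt \<bar>y - x\<bar> * norm h) \<longlongrightarrow> 0) (at x)" by simp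
  qed
  then show ?thesis by (simp add: continuous_at_imp_continuous_on)
qed

definition prim_l2 :: "l2 \<Rightarrow> l2" where "prim_l2 h = abs_l2 (prim h)"
definition const_l2 :: "complex \<Rightarrow> l2" where "const_l2 c = abs_l2 (\<lambda>_. c)"

lemma sq_int_prim: "sq_int (prim h)"
  by (rule sq_int_continuous[OF continuous_on_prim])

lemma norm_prim_l2_le: "norm (prim_l2 h) \<le> norm h"
  unfolding prim_l2_def by (rule norm_abs_l2_continuous_le[OF continuous_on_prim]) (simp add: norm_prim_le1)

lemma bounded_linear_prim_l2: "bounded_linear prim_l2"
proof (rule bounded_linear_intro[where K = 1])
  show "prim_l2 (h + k) = prim_l2 h + prim_l2 k" for h k
    by (simp add: prim_l2_def prim_add[abs_def] abs_l2_add sq_int_prim)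
  show "prim_l2 (c *\<^sub>R h) = c *\<^sub>R prim_l2 h" for c h
    by (simp add: prim_l2_def prim_scaleR[abs_def] abs_l2_scaleR sq_int_prim)
qed (simp add: norm_prim_l2_le)

lemma bounded_linear_prim: "x \<in> {0..1} \<Longrightarrow> bounded_linear (\<lambda>h. prim h x)"
  by (rule bounded_linear_intro[where K = 1]) (simp_all add: prim_add prim_scaleR norm_prim_le1)

text \<open>Integrating \<open>x\<close> over the unit interval gives the factor 1/2. Two
  applications make the square of \<open>prim_l2\<close> a contraction with factor 1/2, which drives
  the Volterra equation for the fifth-order problem.\<close>

lemma norm_prim_l2_sq_le: "(norm (prim_l2 h))\<^sup>2 \<le> 1/2 * (norm h)\<^sup>2"
proof -
  have c: "continuous_on {0..1} (\<lambda>x. (norm (prim h x))\<^sup>2)" "continuous_on {0..1} (\<lambda>x. x * (norm h)\<^sup>2)"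
    by (intro continuous_intros continuous_on_prim)+
  have "(norm (prim_l2 h))\<^sup>2 = integral {0..1} (\<lambda>x. (norm (prim h x))\<^sup>2)"
    by (simp add: prim_l2_def norm_abs_l2 sq_int_prim integral_I_continuous[OF c(1)])
  also have "\<dots> \<le> integral {0..1} (\<lambda>x. x * (norm h)\<^sup>2)"
  proof (rule integral_le)
    fix x :: real assume x: "x \<in> {0..1}"
    have "(norm (prim h x))\<^sup>2 \<le> (sqrt x * norm h)\<^sup>2"
      using norm_prim_le[of x h] x by (intro power_mono) auto
    then show "(norm (prim h x))\<^sup>2 \<le> x * (norm h)\<^sup>2" using x by (simp add: power_mult_distrib)
  qed (intro integrable_continuous_real c)+
  also have "\<dots> = integral {0..1} (\<lambda>x::real. x) * (norm h)\<^sup>2" by simp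
  also have "integral {0..1} (\<lambda>x::real. x) = 1/2"
    using integral_unique[OF ident_has_integral[of 0 "1::real"]] by simp
  finally show ?thesis .
qed

lemma const_l2_add: "const_l2 (a + b) = const_l2 a + const_l2 b" and const_l2_scaleC: "const_l2 (c * a) = scaleC_l2 c (const_l2 a)"
  and const_l2_scaleR: "const_l2 (r *\<^sub>R a) = r *\<^sub>R const_l2 a"
  by (simp_all add: const_l2_def abs_l2_add abs_l2_scaleC abs_l2_scaleR sq_int_const)

lemma norm_const_l2: "norm (const_l2 c) = norm c"
proof -
  have "(norm (const_l2 c))\<^sup>2 = (norm c)\<^sup>2"
    using prob_I by (simp add: const_l2_def norm_abs_l2 sq_int_const)
  then show ?thesis by simp
qed

lemma bounded_linear_const_l2: "bounded_linear const_l2"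
  by (rule bounded_linear_intro[where K = 1]) (simp_all add: const_l2_add const_l2_scaleR norm_const_l2)

lemma const_l2_prim_l2_eq: "const_l2 c + prim_l2 h = abs_l2 (\<lambda>x. c + prim h x)"
  by (simp add: const_l2_def prim_l2_def abs_l2_add sq_int_const sq_int_prim)

lemma prim_continuous:
  assumes f: "continuous_on {0..1} f" and x: "x \<in> {0..1}"
  shows "prim (abs_l2 f) x = integral {0..x} f"
proof -
  have i: "integrable I_leb (\<lambda>s. indicator {..x} s * f s)"
    by (rule sq_int_mult_integrable[OF sq_int_indicator(1) sq_int_continuous[OF f]])
  have "prim (abs_l2 f) x = integral\<^sup>L I_leb (\<lambda>s. indicator {..x} s * f s)"
    unfolding prim_def
    by (intro integral_cong_AE borel_measurable_integrable prim_integrable i)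
      (use rep_abs_l2[OF sq_int_continuous[OF f]] in \<open>eventually_elim, simp\<close>)
  also have "\<dots> = integral {0<..<1} (\<lambda>s. indicator {..x} s * f s)"
    by (rule lebesgue_integral_eq_integral[OF i]) simp
  also have "\<dots> = integral {0..1} (\<lambda>s. indicator {..x} s * f s)"
    using integral_open_interval[of 0 1 "\<lambda>s. indicator {..x} s * f s"] by simp
  also have "\<dots> = integral {0..1} (\<lambda>s. if s \<in> {0..x} then f s else 0)"
    by (rule Henstock_Kurzweil_Integration.integral_cong) (auto simp: indicator_def)
  also have "\<dots> = integral ({0..1} \<inter> {0..x}) f"
    by (subst Int_commute) (rule Henstock_Kurzweil_Integration.integral_restrict_Int)
  also have "{0..1} \<inter> {0..x} = {0..x}" using x by auto
  finally show ?thesis .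
qed

lemma prim_FTC:
  assumes g: "continuous_on {0..1} g" and d: "\<And>x. x \<in> {0..1} \<Longrightarrow> (f has_vector_derivative g x) (at x within {0..1})"
    and x: "x \<in> {0..1}"
  shows "prim (abs_l2 g) x = f x - f 0"
proof -
  have "(g has_integral (f x - f 0)) {0..x}"
  proof (rule fundamental_theorem_of_calculus)
    show "(f has_vector_derivative g y) (at y within {0..x})" if "y \<in> {0..x}" for y
      by (rule has_vector_derivative_within_subset[OF d]) (use that x in auto)
  qed (use x in simp)
  then show ?thesis by (simp add: prim_continuous[OF g x] integral_unique)
qed

lemma FTC_abs_l2:
  assumes g: "continuous_on {0..1} g" and d: "\<And>x. x \<in> {0..1} \<Longrightarrow> (f has_vector_derivative g x) (at x within {0..1})"
  shows "abs_l2 f = const_l2 (f 0) + prim_l2 (abs_l2 g)"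
proof -
  have f: "continuous_on {0..1} f"
    unfolding continuous_on_eq_continuous_within using d has_vector_derivative_continuous by blast
  have eq: "f x = f 0 + prim (abs_l2 g) x" if "x \<in> space I_leb" for x
    using prim_FTC[OF g d, of x] that by simp
  show ?thesis
    unfolding const_l2_prim_l2_eq
    by (intro abs_l2_cong sq_int_continuous[OF f] sq_int_add[OF sq_int_const sq_int_prim] AE_I2 eq)
qed

lemma ibp_continuous:
  assumes f: "continuous_on {0..1} f" and g: "continuous_on {0..1} g"
  shows "inner (abs_l2 f) (const_l2 b + prim_l2 (abs_l2 g)) + inner (const_l2 a + prim_l2 (abs_l2 f)) (abs_l2 g) =
    inner (a + prim (abs_l2 f) 1) (b + prim (abs_l2 g) 1) - inner a b"
proof -
  let ?F = "\<lambda>x. a + prim (abs_l2 f) x" and ?G = "\<lambda>x. b + prim (abs_l2 g) x"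
  have D: "((\<lambda>x. c + prim (abs_l2 h) x) has_vector_derivative h x) (at x within {0..1})"
    if h: "continuous_on {0..1} h" and x: "x \<in> {0..1}" for h c x
  proof -
    have "((\<lambda>x. integral {0..x} h) has_vector_derivative h x) (at x within {0..1})"
      by (rule integral_has_vector_derivative[OF h x])
    then have "((\<lambda>x. c + integral {0..x} h) has_vector_derivative (0 + h x)) (at x within {0..1})"
      by (intro has_vector_derivative_add has_vector_derivative_const)
    then have *: "((\<lambda>x. c + integral {0..x} h) has_vector_derivative h x) (at x within {0..1})" by simp
    show ?thesis
      by (rule has_vector_derivative_transform[OF x _ *]) (simp add: prim_continuous[OF h])
  qed
  have cF: "continuous_on {0..1} ?F" and cG: "continuous_on {0..1} ?G"
    by (intro continuous_intros continuous_on_prim)+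
  have c: "continuous_on {0..1} (\<lambda>x. inner (f x) (?G x) + inner (?F x) (g x))"
    by (intro continuous_intros f g cF cG)
  have "((\<lambda>x. inner (f x) (?G x) + inner (?F x) (g x)) has_integral (inner (?F 1) (?G 1) - inner (?F 0) (?G 0))) {0..1}"
  proof (rule fundamental_theorem_of_calculus)
    show "((\<lambda>x. inner (?F x) (?G x)) has_vector_derivative inner (f x) (?G x) + inner (?F x) (g x)) (at x within {0..1})"
      if "x \<in> {0..1}" for x
      using bounded_bilinear.has_vector_derivative[OF bounded_bilinear_inner D[OF f that, of a] D[OF g that, of b]]
      by (simp add: add.commute)
  qed simp
  then have "integral\<^sup>L I_leb (\<lambda>x. inner (f x) (?G x) + inner (?F x) (g x)) = inner (?F 1) (?G 1) - inner a b"
    by (simp add: integral_I_continuous(2)[OF c] integral_unique prim_0)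
  moreover have "integral\<^sup>L I_leb (\<lambda>x. inner (f x) (?G x) + inner (?F x) (g x)) =
      inner (abs_l2 f) (abs_l2 ?G) + inner (abs_l2 ?F) (abs_l2 g)"
    using sq_int_continuous[OF f] sq_int_continuous[OF g] sq_int_continuous[OF cF] sq_int_continuous[OF cG]
    by (simp add: inner_abs_l2 integrable_inner_sq_int)
  ultimately show ?thesis by (simp add: const_l2_prim_l2_eq)
qed

text \<open>Both sides are continuous in \<open>h\<close> and in \<open>k\<close> separately, so the
  classical identity extends from continuous functions by density, in one variable at a
  time.\<close>

lemma ibp_prim:
  "inner h (const_l2 b + prim_l2 k) + inner (const_l2 a + prim_l2 h) k = inner (a + prim h 1) (b + prim k 1) - inner a b"
proof -
  note [continuous_intros] = linear_continuous_on[OF bounded_linear_prim_l2] 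
    linear_continuous_on[OF bounded_linear_prim[of 1]]
  let ?C = "{abs_l2 f | f. continuous_on {0..1} f}"
  have step1: "inner h (const_l2 b + prim_l2 k) + inner (const_l2 a + prim_l2 h) k = inner (a + prim h 1) (b + prim k 1) - inner a b"
    if k: "k \<in> ?C" for h k
  proof -
    let ?S = "{h. inner h (const_l2 b + prim_l2 k) + inner (const_l2 a + prim_l2 h) k = inner (a + prim h 1) (b + prim k 1) - inner a b}"
    have "closed ?S" by (intro closed_Collect_eq continuous_intros) auto
    moreover have "?C \<subseteq> ?S" using k ibp_continuous by auto
    ultimately have "closure ?C \<subseteq> ?S" by (rule closure_minimal[rotated])
    then show ?thesis using dense_continuous by auto
  qed
  let ?S = "{k. inner h (const_l2 b + prim_l2 k) + inner (const_l2 a + prim_l2 h) k = inner (a + prim h 1) (b + prim k 1) - inner a b}"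
  have "closed ?S" by (intro closed_Collect_eq continuous_intros) auto
  moreover have "?C \<subseteq> ?S" using step1 by blast
  ultimately have "closure ?C \<subseteq> ?S" by (rule closure_minimal[rotated])
  then show ?thesis using dense_continuous by auto
qed

subsection \<open>Weak derivatives of first order\<close>

lemma test_pairing:
  assumes "test_fun \<theta>"
  shows "inner u (abs_l2 (\<lambda>x. \<theta> x *\<^sub>R c)) = inner (integral\<^sup>L I_leb (\<lambda>x. \<theta> x *\<^sub>R rep_l2 u x)) c"
proof -
  have c: "continuous_on {0..1} (\<lambda>x. \<theta> x *\<^sub>R c)" for c :: complex
    by (intro continuous_intros smooth_continuous test_fun_smooth assms)
  have i: "integrable I_leb (\<lambda>x. \<theta> x *\<^sub>R rep_l2 u x)"
    using test_fun_integrable[OF assms, of 0 u] by simp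
  have "inner u (abs_l2 (\<lambda>x. \<theta> x *\<^sub>R c)) = integral\<^sup>L I_leb (\<lambda>x. inner (rep_l2 u x) (\<theta> x *\<^sub>R c))"
    using inner_abs_l2[OF sq_int_rep sq_int_continuous[OF c]] by (simp add: abs_rep_l2)
  also have "\<dots> = integral\<^sup>L I_leb (\<lambda>x. inner (\<theta> x *\<^sub>R rep_l2 u x) c)" by simp
  also have "\<dots> = inner (integral\<^sup>L I_leb (\<lambda>x. \<theta> x *\<^sub>R rep_l2 u x)) c"
    by (rule integral_inner_left[OF i])
  finally show ?thesis .
qed

text \<open>Letting \<open>c\<close> range over all complex numbers recovers the complex integral
  from the real inner product. In this form weak derivatives pass to limits and combine with
  adjoints of multiplication operators.\<close>

lemma is_wderiv_1_iff_inner: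
  "is_wderiv 1 u v \<longleftrightarrow> (\<forall>\<theta> c. test_fun \<theta> \<longrightarrow>
     inner u (abs_l2 (\<lambda>x. deriv \<theta> x *\<^sub>R c)) = - inner v (abs_l2 (\<lambda>x. \<theta> x *\<^sub>R c)))"
proof -
  have "integral\<^sup>L I_leb (\<lambda>x. deriv \<theta> x *\<^sub>R rep_l2 u x) = - integral\<^sup>L I_leb (\<lambda>x. \<theta> x *\<^sub>R rep_l2 v x) \<longleftrightarrow>
    (\<forall>c. inner u (abs_l2 (\<lambda>x. deriv \<theta> x *\<^sub>R c)) = - inner v (abs_l2 (\<lambda>x. \<theta> x *\<^sub>R c)))"
    if "test_fun \<theta>" for \<theta>
    unfolding test_pairing[OF that] test_pairing[OF test_fun_deriv[OF that]]
    by (simp only: inner_minus_left[symmetric] vector_eq_rdot)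
  then show ?thesis unfolding is_wderiv_def by auto
qed

lemma test_abs_l2_prim_l2:
  assumes "test_fun \<theta>"
  shows "abs_l2 (\<lambda>x. \<theta> x *\<^sub>R c) = prim_l2 (abs_l2 (\<lambda>x. deriv \<theta> x *\<^sub>R c))"
    "prim (abs_l2 (\<lambda>x. deriv \<theta> x *\<^sub>R c)) 1 = 0"
proof -
  have c: "continuous_on {0..1} (\<lambda>x. deriv \<theta> x *\<^sub>R c)"
    by (intro continuous_intros smooth_continuous smooth_deriv test_fun_smooth assms)
  have d: "((\<lambda>x. \<theta> x *\<^sub>R c) has_vector_derivative deriv \<theta> x *\<^sub>R c) (at x within {0..1})" for x
  proof -
    have "(\<theta> has_vector_derivative deriv \<theta> x) (at x within {0..1})"
      using smooth_DERIV[OF test_fun_smooth[OF assms], of x]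
      by (simp add: has_real_derivative_iff_has_vector_derivative has_vector_derivative_at_within)
    from bounded_linear.has_vector_derivative[OF bounded_linear_scaleR_left this] show ?thesis .
  qed
  show "abs_l2 (\<lambda>x. \<theta> x *\<^sub>R c) = prim_l2 (abs_l2 (\<lambda>x. deriv \<theta> x *\<^sub>R c))"
    using FTC_abs_l2[OF c d] test_fun_zero[OF assms, of 0] by (simp add: const_l2_def abs_l2_0)
  show "prim (abs_l2 (\<lambda>x. deriv \<theta> x *\<^sub>R c)) 1 = 0"
    using prim_FTC[OF c d, of 1] test_fun_zero[OF assms] by simp
qed

lemma is_wderiv_const_l2_prim_l2: "is_wderiv 1 (const_l2 c + prim_l2 h) h"
  unfolding is_wderiv_1_iff_inner
proof (intro allI impI)
  fix \<theta> d assume \<theta>: "test_fun \<theta>"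
  show "inner (const_l2 c + prim_l2 h) (abs_l2 (\<lambda>x. deriv \<theta> x *\<^sub>R d)) = - inner h (abs_l2 (\<lambda>x. \<theta> x *\<^sub>R d))"
    using ibp_prim[of h 0 "abs_l2 (\<lambda>x. deriv \<theta> x *\<^sub>R d)" c] test_abs_l2_prim_l2[OF \<theta>, of d]
    by (simp add: const_l2_def abs_l2_0)
qed

text \<open>Du Bois-Reymond: a test function of mean zero is the derivative of a test function, so
  \<open>u\<close> annihilates it. A general test function differs from such a one by a multiple of
  a fixed bump \<rho>, and the pairing with \<rho> determines the constant.\<close>

lemma is_wderiv_0_imp_const_l2:
  assumes "is_wderiv 1 u 0" shows "\<exists>c. u = const_l2 c"
proof -
  define \<rho> :: "real \<Rightarrow> real" where "\<rho> x = flat_fun 1 1 (x - 1/4) * flat_fun 1 1 (3/4 - x)" for x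
  have \<rho>: "test_fun \<rho>" unfolding \<rho>_def by (rule test_fun_bump) auto
  have c\<rho>: "continuous_on {0..1} \<rho>" by (rule smooth_continuous[OF test_fun_smooth[OF \<rho>]])
  define m where "m = integral {0..1} \<rho>"
  have "m \<noteq> 0"
  proof
    assume "m = 0"
    then have 0: "integral {0..1} \<rho> = 0" by (simp add: m_def)
    have "\<rho> x \<ge> 0" for x unfolding \<rho>_def using flat_fun_1_bounds[of 1] by simp
    then have "\<forall>x\<in>{0..1}. \<rho> x = 0" using integral_eq_0_iff[OF c\<rho>] 0 zero_less_one by blast
    then have "\<rho> (1/2) = 0" by simp
    then show False by (simp add: \<rho>_def flat_fun_def)
  qed
  define c where "c = integral\<^sup>L I_leb (\<lambda>x. \<rho> x *\<^sub>R rep_l2 u x) /\<^sub>R m"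
  have "u - const_l2 c = 0"
  proof (rule test_integrals_0_imp_0)
    fix \<theta> assume \<theta>: "test_fun \<theta>"
    have c\<theta>: "continuous_on {0..1} \<theta>" by (rule smooth_continuous[OF test_fun_smooth[OF \<theta>]])
    define n where "n = integral {0..1} \<theta>"
    \<comment> \<open>The multiple of \<rho> that cancels the mean of \<theta>.\<close>
    define \<eta> where "\<eta> x = \<theta> x + (- n / m) * \<rho> x" for x
    have \<eta>: "test_fun \<eta>"
      unfolding \<eta>_def by (intro test_fun_add \<theta> test_fun_mult[OF \<rho> smooth_const])
    have "integral {0..1} \<eta> = n + integral {0..1} (\<lambda>x. (- n / m) * \<rho> x)"
      unfolding \<eta>_def n_def
      by (intro Henstock_Kurzweil_Integration.integral_add integrable_continuous_real continuous_intros c\<rho> c\<theta>)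
    also have "\<dots> = n + (- n / m) * m"
      by (simp only: m_def Henstock_Kurzweil_Integration.integral_mult_right)
    finally have "integral {0..1} \<eta> = n + (- n / m) * m" .
    then have "integral {0..1} \<eta> = 0" using \<open>m \<noteq> 0\<close> by simp
    then obtain \<Theta> where \<Theta>: "test_fun \<Theta>" "deriv \<Theta> = \<eta>" using test_fun_primitive[OF \<eta>] by blast
    have u0: "inner u (abs_l2 (\<lambda>x. \<eta> x *\<^sub>R d)) = 0" for d
      using assms[unfolded is_wderiv_1_iff_inner, rule_format, OF \<Theta>(1), of d] by (simp add: \<Theta>(2))
    let ?I = "\<lambda>\<theta>. integral\<^sup>L I_leb (\<lambda>x. \<theta> x *\<^sub>R rep_l2 u x)"
    have "inner (?I \<eta>) d = 0" for d using u0[of d] test_pairing[OF \<eta>, of u d] by simp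
    then have "?I \<eta> = 0" using inner_eq_zero_iff by blast
    moreover have "?I \<eta> = ?I \<theta> + (- n / m) *\<^sub>R ?I \<rho>"
    proof -
      have i: "integrable I_leb (\<lambda>x. \<theta> x *\<^sub>R rep_l2 u x)" "integrable I_leb (\<lambda>x. \<rho> x *\<^sub>R rep_l2 u x)"
        using test_fun_integrable[OF \<theta>, of 0 u] test_fun_integrable[OF \<rho>, of 0 u] by simp_all
      have "?I \<eta> = integral\<^sup>L I_leb (\<lambda>x. \<theta> x *\<^sub>R rep_l2 u x + (- n / m) *\<^sub>R (\<rho> x *\<^sub>R rep_l2 u x))"
        unfolding \<eta>_def by (simp only: scaleR_add_left scaleR_scaleR)
      also have "\<dots> = ?I \<theta> + integral\<^sup>L I_leb (\<lambda>x. (- n / m) *\<^sub>R (\<rho> x *\<^sub>R rep_l2 u x))"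
        by (intro Bochner_Integration.integral_add Bochner_Integration.integrable_scaleR_right i)
      finally show ?thesis by (simp only: Bochner_Integration.integral_scaleR_right)
    qed
    ultimately have I\<theta>: "?I \<theta> = n *\<^sub>R c" using \<open>m \<noteq> 0\<close> by (simp add: c_def divide_inverse)
    have C: "integral\<^sup>L I_leb (\<lambda>x. \<theta> x *\<^sub>R rep_l2 (const_l2 c) x) = n *\<^sub>R c"
    proof -
      have i: "integrable I_leb \<theta>" by (rule integral_I_continuous(1)[OF c\<theta>])
      have "integral\<^sup>L I_leb (\<lambda>x. \<theta> x *\<^sub>R rep_l2 (const_l2 c) x) = integral\<^sup>L I_leb (\<lambda>x. \<theta> x *\<^sub>R c)"
        using test_fun_integrable[OF \<theta>, of 0 "const_l2 c"] i rep_abs_l2[OF sq_int_const[of c]]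
        by (intro integral_cong_AE borel_measurable_integrable Bochner_Integration.integrable_scaleR_left)
          (auto simp: const_l2_def elim: eventually_mono)
      also have "\<dots> = n *\<^sub>R c" using integral_I_continuous[OF c\<theta>] by (simp add: n_def)
      finally show ?thesis .
    qed
    have "integral\<^sup>L I_leb (\<lambda>x. \<theta> x *\<^sub>R rep_l2 (u - const_l2 c) x) =
        ?I \<theta> - integral\<^sup>L I_leb (\<lambda>x. \<theta> x *\<^sub>R rep_l2 (const_l2 c) x)"
      using test_integral_add[OF \<theta>, of 0 u "(-1) *\<^sub>R const_l2 c"] test_integral_scaleR[OF \<theta>, of 0 "-1" "const_l2 c"] by simp
    then show "integral\<^sup>L I_leb (\<lambda>x. \<theta> x *\<^sub>R rep_l2 (u - const_l2 c) x) = 0" by (simp add: I\<theta> C)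
  qed
  then show ?thesis by auto
qed

text \<open>Subtracting the primitive of \<open>v\<close> from \<open>u\<close> leaves a class with
  derivative 0, hence a constant. Traces at the end points, integration by parts and the Poincare
  inequality are all read off from this description of \<open>H^1(0,1)\<close>.\<close>

lemma is_wderiv_1_iff: "is_wderiv 1 u v \<longleftrightarrow> (\<exists>c. u = const_l2 c + prim_l2 v)"
proof
  assume u: "is_wderiv 1 u v"
  have "is_wderiv 1 (u + (-1) *\<^sub>R (const_l2 0 + prim_l2 v)) (v + (-1) *\<^sub>R v)"
    by (intro is_wderiv_add u is_wderiv_scaleR is_wderiv_const_l2_prim_l2)
  then obtain c where "u + (-1) *\<^sub>R (const_l2 0 + prim_l2 v) = const_l2 c" using is_wderiv_0_imp_const_l2 by auto
  then show "\<exists>c. u = const_l2 c + prim_l2 v" by (intro exI[of _ c]) (simp add: const_l2_def abs_l2_0 algebra_simps)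
next
  assume "\<exists>c. u = const_l2 c + prim_l2 v"
  then show "is_wderiv 1 u v" using is_wderiv_const_l2_prim_l2 by blast
qed

subsection \<open>Higher weak derivatives\<close>

text \<open>The derivative of a test function is again a test function, so one derivative can be
  shifted off at a time. It reduces higher weak derivatives to chains of first-order ones.\<close>

lemma is_wderiv_Suc_iff:
  assumes "is_wderiv j u v"
  shows "is_wderiv (Suc j) u w \<longleftrightarrow> is_wderiv 1 v w"
proof -
  have "integral\<^sup>L I_leb (\<lambda>x. (deriv ^^ Suc j) \<theta> x *\<^sub>R rep_l2 u x) =
      (-1) ^ j * integral\<^sup>L I_leb (\<lambda>x. deriv \<theta> x *\<^sub>R rep_l2 v x)" if "test_fun \<theta>" for \<theta>
    using assms test_fun_deriv[OF that] by (simp add: is_wderiv_def funpow_swap1)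
  then have "is_wderiv (Suc j) u w \<longleftrightarrow> (\<forall>\<theta>. test_fun \<theta> \<longrightarrow>
      (-1) ^ j * integral\<^sup>L I_leb (\<lambda>x. deriv \<theta> x *\<^sub>R rep_l2 v x) =
      (-1) ^ j * (- integral\<^sup>L I_leb (\<lambda>x. \<theta> x *\<^sub>R rep_l2 w x)))"
    unfolding is_wderiv_def by simp
  also have "\<dots> \<longleftrightarrow> is_wderiv 1 v w"
    unfolding is_wderiv_def mult_cancel_left by simp
  finally show ?thesis .
qed

lemma is_wderiv_Suc: "is_wderiv j u v \<Longrightarrow> is_wderiv 1 v w \<Longrightarrow> is_wderiv (Suc j) u w"
  by (simp only: is_wderiv_Suc_iff)

lemma is_wderiv_0: "is_wderiv 0 u u"
  by (simp add: is_wderiv_def)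

lemma sobolev_wderiv_Suc: "u \<in> sobolev m \<Longrightarrow> k < m \<Longrightarrow> is_wderiv 1 (wderiv k u) (wderiv (Suc k) u)"
  using is_wderiv_Suc_iff[OF is_wderiv_wderiv] is_wderiv_wderiv by (metis Suc_leI less_imp_le)

text \<open>Exhibiting candidates for all derivatives, each the first weak derivative of the one
  before, proves membership in the Sobolev space and computes the derivatives at once.\<close>

lemma wderiv_chain:
  assumes "\<And>k. k < m \<Longrightarrow> is_wderiv 1 (v k) (v (Suc k))"
  shows "v 0 \<in> sobolev m" "\<And>k. k \<le> m \<Longrightarrow> wderiv k (v 0) = v k"
proof -
  have *: "k \<le> m \<Longrightarrow> is_wderiv k (v 0) (v k)" for k
  proof (induction k)
    case (Suc k)
    then show ?case using assms[of k] by (intro is_wderiv_Suc[of k "v 0" "v k"]) auto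
  qed (rule is_wderiv_0)
  then show "v 0 \<in> sobolev m" by (auto simp: sobolev_def)
  show "wderiv k (v 0) = v k" if "k \<le> m" for k using *[OF that] by (rule wderiv_eqI)
qed

lemma is_wderiv_1_tendsto:
  assumes "\<And>n::nat. is_wderiv 1 (u n) (v n)" "u \<longlonglongrightarrow> u'" "v \<longlonglongrightarrow> v'"
  shows "is_wderiv 1 u' v'"
  unfolding is_wderiv_1_iff_inner
proof (intro allI impI)
  fix \<theta> c assume \<theta>: "test_fun \<theta>"
  let ?a = "abs_l2 (\<lambda>x. deriv \<theta> x *\<^sub>R c)" and ?b = "abs_l2 (\<lambda>x. \<theta> x *\<^sub>R c)"
  have "(\<lambda>n. inner (u n) ?a) \<longlonglongrightarrow> inner u' ?a" by (intro tendsto_intros assms)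
  moreover have "inner (u n) ?a = - inner (v n) ?b" for n using assms(1) \<theta> by (simp only: is_wderiv_1_iff_inner)
  moreover have "(\<lambda>n. - inner (v n) ?b) \<longlonglongrightarrow> - inner v' ?b" by (intro tendsto_intros assms)
  ultimately show "inner u' ?a = - inner v' ?b" using LIMSEQ_unique by simp
qed

subsection \<open>Point values\<close>

lemma point_value_abs_l2:
  assumes g: "continuous_on {0..1} g" and p: "p \<in> {0..1}"
  shows "point_value (abs_l2 g) p = g p"
  unfolding point_value_def
proof (rule the_equality)
  show "\<exists>h. continuous_on {0..1} h \<and> (AE x in I_leb. rep_l2 (abs_l2 g) x = h x) \<and> g p = h p"
    using g rep_abs_l2[OF sq_int_continuous[OF g]] by blast
  fix c assume "\<exists>h. continuous_on {0..1} h \<and> (AE x in I_leb. rep_l2 (abs_l2 g) x = h x) \<and> c = h p"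
  then obtain h where h: "continuous_on {0..1} h" "AE x in I_leb. rep_l2 (abs_l2 g) x = h x" "c = h p" by blast
  have "abs_l2 g = abs_l2 h" by (rule abs_l2_eqI[OF sq_int_continuous[OF h(1)] h(2)])
  then show "c = g p" using continuous_eq_of_abs_l2_eq[OF g h(1) _ p] h(3) by simp
qed

lemma point_value_const_l2_prim_l2: "p \<in> {0..1} \<Longrightarrow> point_value (const_l2 c + prim_l2 h) p = c + prim h p"
  unfolding const_l2_prim_l2_eq by (intro point_value_abs_l2 continuous_intros continuous_on_prim)

lemma const_l2_0: "const_l2 0 = 0" by (simp add: const_l2_def abs_l2_0)

lemma point_value_prim_l2: "p \<in> {0..1} \<Longrightarrow> point_value (prim_l2 h) p = prim h p"
  using point_value_const_l2_prim_l2[of p 0 h] by (simp add: const_l2_0)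

lemma H1_E:
  assumes "is_wderiv 1 u v"
  obtains c where "u = const_l2 c + prim_l2 v" "\<And>p. p \<in> {0..1} \<Longrightarrow> point_value u p = c + prim v p"
  using assms point_value_const_l2_prim_l2 is_wderiv_1_iff by metis

lemma abs_l2_point_value:
  assumes "is_wderiv 1 u v"
  shows "continuous_on {0..1} (point_value u)" "abs_l2 (point_value u) = u"
proof -
  obtain c where c: "u = const_l2 c + prim_l2 v" "\<And>p. p \<in> {0..1} \<Longrightarrow> point_value u p = c + prim v p"
    using H1_E[OF assms] by blast
  have cc: "continuous_on {0..1} (\<lambda>p. c + prim v p)" by (intro continuous_intros continuous_on_prim)
  then show C: "continuous_on {0..1} (point_value u)" by (rule continuous_on_eq) (simp add: c(2))
  have "abs_l2 (point_value u) = abs_l2 (\<lambda>p. c + prim v p)"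
    by (rule abs_l2_cong[OF sq_int_continuous[OF C] sq_int_continuous[OF cc] AE_I2]) (simp add: c(2))
  then show "abs_l2 (point_value u) = u" by (simp add: c(1) const_l2_prim_l2_eq)
qed

lemma AE_rep_point_value: "is_wderiv 1 u v \<Longrightarrow> AE x in I_leb. rep_l2 u x = point_value u x"
  using rep_abs_l2[OF sq_int_continuous, of "point_value u"] abs_l2_point_value by metis

lemma point_value_add:
  assumes "is_wderiv 1 u v" "is_wderiv 1 u' v'" "p \<in> {0..1}"
  shows "point_value (u + u') p = point_value u p + point_value u' p"
proof -
  have "u + u' = abs_l2 (\<lambda>x. point_value u x + point_value u' x)"
    using assms by (simp add: abs_l2_add sq_int_continuous abs_l2_point_value)
  then show ?thesis
    using point_value_abs_l2[of "\<lambda>x. point_value u x + point_value u' x" p] assms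
    by (simp add: continuous_on_add abs_l2_point_value)
qed

lemma point_value_scaleC:
  assumes "is_wderiv 1 u v" "p \<in> {0..1}"
  shows "point_value (scaleC_l2 c u) p = c * point_value u p"
proof -
  have "scaleC_l2 c u = abs_l2 (\<lambda>x. c * point_value u x)"
    using assms by (simp add: abs_l2_scaleC sq_int_continuous abs_l2_point_value)
  then show ?thesis
    using point_value_abs_l2[of "\<lambda>x. c * point_value u x" p] assms
    by (simp add: continuous_on_mult_left abs_l2_point_value)
qed

lemma is_wderiv_1_scaleC:
  assumes "is_wderiv 1 u v" shows "is_wderiv 1 (scaleC_l2 c u) (scaleC_l2 c v)"
proof -
  obtain d where "u = const_l2 d + prim_l2 v" using assms is_wderiv_1_iff by blast
  then have "scaleC_l2 c u = abs_l2 (\<lambda>x. c * (d + prim v x))"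
    using abs_l2_scaleC[OF sq_int_add[OF sq_int_const sq_int_prim]] by (simp add: const_l2_prim_l2_eq)
  also have "\<dots> = const_l2 (c * d) + prim_l2 (scaleC_l2 c v)"
    by (simp add: const_l2_prim_l2_eq prim_scaleC distrib_left)
  finally show ?thesis using is_wderiv_1_iff by blast
qed

lemma ibp:
  assumes "is_wderiv 1 u u'" "is_wderiv 1 v v'"
  shows "inner u' v + inner u v' =
    inner (point_value u 1) (point_value v 1) - inner (point_value u 0) (point_value v 0)"
proof -
  obtain a where a: "u = const_l2 a + prim_l2 u'" "\<And>p. p \<in> {0..1} \<Longrightarrow> point_value u p = a + prim u' p" using H1_E[OF assms(1)] by blast
  obtain b where b: "v = const_l2 b + prim_l2 v'" "\<And>p. p \<in> {0..1} \<Longrightarrow> point_value v p = b + prim v' p" using H1_E[OF assms(2)] by blast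
  have "point_value u 1 = a + prim u' 1" "point_value v 1 = b + prim v' 1" "point_value u 0 = a" "point_value v 0 = b"
    using a(2)[of 1] b(2)[of 1] a(2)[of 0] b(2)[of 0] by (simp_all add: prim_0)
  then show ?thesis using ibp_prim[of u' b v' a] a(1) b(1) by simp
qed

lemma norm_point_value_le:
  assumes "is_wderiv 1 u v" "p \<in> {0..1}"
  shows "norm (point_value u p) \<le> norm u + 2 * norm v"
proof -
  obtain c where c: "u = const_l2 c + prim_l2 v" "\<And>p. p \<in> {0..1} \<Longrightarrow> point_value u p = c + prim v p"
    using H1_E[OF assms(1)] by blast
  have "norm c = norm (u - prim_l2 v)" by (simp add: c(1) norm_const_l2)
  also have "\<dots> \<le> norm u + norm (prim_l2 v)" by (rule norm_triangle_ineq4)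
  also have "\<dots> \<le> norm u + norm v" by (simp add: norm_prim_l2_le)
  finally have "norm c \<le> norm u + norm v" .
  then show ?thesis using c(2)[OF assms(2)] norm_triangle_ineq[of c "prim v p"] norm_prim_le1[OF assms(2), of v] by simp
qed

lemma poincare:
  assumes "is_wderiv 1 u v" "point_value u 0 = 0"
  shows "norm u \<le> norm v"
proof -
  obtain c where c: "u = const_l2 c + prim_l2 v" "\<And>p. p \<in> {0..1} \<Longrightarrow> point_value u p = c + prim v p"
    using H1_E[OF assms(1)] by blast
  then have "c = 0" using assms(2) by (simp add: prim_0)
  then show ?thesis using c(1) norm_prim_l2_le by (simp add: const_l2_0)
qed

subsection \<open>Multiplication operators\<close>

definition mult_l2 :: "(real \<Rightarrow> complex) \<Rightarrow> l2 \<Rightarrow> l2" where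
  "mult_l2 g u = abs_l2 (\<lambda>x. g x * rep_l2 u x)"

lemma sq_int_mult_bounded:
  assumes g: "continuous_on {0..1} g" and f: "sq_int f"
  shows "sq_int (\<lambda>x. g x * f x)"
    and "(\<And>x. x \<in> {0<..<1} \<Longrightarrow> norm (g x) \<le> B) \<Longrightarrow> norm (abs_l2 (\<lambda>x. g x * f x)) \<le> B * norm (abs_l2 f)"
proof -
  have m: "(\<lambda>x. g x * f x) \<in> borel_measurable I_leb"
    using continuous_borel_measurable_I[OF g] f by (auto simp: sq_int_def)
  have if2: "integrable I_leb (\<lambda>x. (norm (f x))\<^sup>2)" using f by (simp add: sq_int_def)
  have i: "integrable I_leb (\<lambda>x. (norm (g x * f x))\<^sup>2)" and
    le: "(\<forall>x\<in>{0<..<1}. norm (g x) \<le> B) \<Longrightarrow> (norm (g x * f x))\<^sup>2 \<le> B\<^sup>2 * (norm (f x))\<^sup>2" if "x \<in> space I_leb" for x B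
  proof -
    have *: "(norm (g x * f x))\<^sup>2 \<le> B\<^sup>2 * (norm (f x))\<^sup>2"
      if "\<And>x. x \<in> {0<..<1} \<Longrightarrow> norm (g x) \<le> B" "x \<in> space I_leb" for x B
      using that(1)[of x] that(2) by (auto simp: norm_mult power_mult_distrib intro!: mult_right_mono power_mono)
    obtain C where C: "\<And>x. x \<in> {0..1} \<Longrightarrow> norm (g x) \<le> C" using continuous_bounded_I[OF g] by metis
    show "integrable I_leb (\<lambda>x. (norm (g x * f x))\<^sup>2)"
    proof (rule Bochner_Integration.integrable_bound[of _ "\<lambda>x. C\<^sup>2 * (norm (f x))\<^sup>2"])
      show "integrable I_leb (\<lambda>x. C\<^sup>2 * (norm (f x))\<^sup>2)" using if2 by simp
      show "(\<lambda>x. (norm (g x * f x))\<^sup>2) \<in> borel_measurable I_leb" using m by measurable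
      show "AE x in I_leb. norm ((norm (g x * f x))\<^sup>2) \<le> norm (C\<^sup>2 * (norm (f x))\<^sup>2)"
        using *[of C] C by (intro AE_I2) simp
    qed
    show "(norm (g x * f x))\<^sup>2 \<le> B\<^sup>2 * (norm (f x))\<^sup>2" if "\<forall>x\<in>{0<..<1}. norm (g x) \<le> B"
      using *[of B x] that \<open>x \<in> space I_leb\<close> by blast
  qed
  have i': "integrable I_leb (\<lambda>x. (norm (g x * f x))\<^sup>2)" by (rule i[of "1/2"]) simp
  then show s: "sq_int (\<lambda>x. g x * f x)" using m by (simp add: sq_int_def)
  assume B: "\<And>x. x \<in> {0<..<1} \<Longrightarrow> norm (g x) \<le> B"
  have "B \<ge> 0" using order_trans[OF norm_ge_zero B[of "1/2"]] by simp
  have "(norm (abs_l2 (\<lambda>x. g x * f x)))\<^sup>2 \<le> integral\<^sup>L I_leb (\<lambda>x. B\<^sup>2 * (norm (f x))\<^sup>2)"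
    unfolding norm_abs_l2[OF s] by (rule integral_mono[OF i']) (use le B if2 in auto)
  also have "\<dots> = (B * norm (abs_l2 f))\<^sup>2" by (simp add: norm_abs_l2[OF f] power_mult_distrib)
  finally show "norm (abs_l2 (\<lambda>x. g x * f x)) \<le> B * norm (abs_l2 f)"
    by (rule power2_le_imp_le) (use \<open>B \<ge> 0\<close> in simp)
qed

lemma norm_mult_l2_le:
  "continuous_on {0..1} g \<Longrightarrow> (\<And>x. x \<in> {0<..<1} \<Longrightarrow> norm (g x) \<le> B) \<Longrightarrow> norm (mult_l2 g u) \<le> B * norm u"
  using sq_int_mult_bounded(2)[OF _ sq_int_rep, of g B u] by (simp add: mult_l2_def abs_rep_l2)

lemma mult_l2_abs_l2:
  assumes g: "continuous_on {0..1} g" and f: "sq_int f"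
  shows "mult_l2 g (abs_l2 f) = abs_l2 (\<lambda>x. g x * f x)"
  unfolding mult_l2_def
  by (intro abs_l2_cong sq_int_mult_bounded(1) g sq_int_rep f)
    (use rep_abs_l2[OF f] in \<open>eventually_elim, simp\<close>)

lemma mult_l2_add_right: "continuous_on {0..1} g \<Longrightarrow> mult_l2 g (u + v) = mult_l2 g u + mult_l2 g v"
  using mult_l2_abs_l2[of g "\<lambda>x. rep_l2 u x + rep_l2 v x"]
    abs_l2_add[OF sq_int_mult_bounded(1)[OF _ sq_int_rep] sq_int_mult_bounded(1)[OF _ sq_int_rep], of g g u v]
  by (simp add: sq_int_add sq_int_rep abs_l2_add abs_rep_l2 mult_l2_def distrib_left)

lemma mult_l2_scaleC: "continuous_on {0..1} g \<Longrightarrow> mult_l2 g (scaleC_l2 c u) = scaleC_l2 c (mult_l2 g u)"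
  using mult_l2_abs_l2[of g "\<lambda>x. c * rep_l2 u x"]
    abs_l2_scaleC[OF sq_int_mult_bounded(1)[OF _ sq_int_rep], of g c u]
  by (simp add: sq_int_cmult sq_int_rep abs_l2_scaleC abs_rep_l2 mult_l2_def ac_simps)

lemma mult_l2_scaleR: "continuous_on {0..1} g \<Longrightarrow> mult_l2 g (c *\<^sub>R u) = c *\<^sub>R mult_l2 g u"
  using mult_l2_scaleC[of g "complex_of_real c" u] by (simp add: scaleC_of_real)

lemma bounded_linear_mult_l2: "continuous_on {0..1} g \<Longrightarrow> bounded_linear (mult_l2 g)"
proof -
  assume g: "continuous_on {0..1} g"
  obtain B where "\<And>x. x \<in> {0..1} \<Longrightarrow> norm (g x) \<le> B" using continuous_bounded_I[OF g] by metis
  then have "norm (mult_l2 g u) \<le> norm u * B" for u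
    using norm_mult_l2_le[OF g, of B u] by (simp add: mult.commute)
  then show ?thesis
    by (intro bounded_linear_intro) (auto simp: mult_l2_add_right mult_l2_scaleR g)
qed

lemma mult_l2_add_left:
  "continuous_on {0..1} g \<Longrightarrow> continuous_on {0..1} h \<Longrightarrow> mult_l2 (\<lambda>x. g x + h x) u = mult_l2 g u + mult_l2 h u"
  unfolding mult_l2_def by (simp add: distrib_right abs_l2_add sq_int_mult_bounded(1) sq_int_rep)

lemma mult_l2_cmult_left:
  "continuous_on {0..1} g \<Longrightarrow> mult_l2 (\<lambda>x. c * g x) u = scaleC_l2 c (mult_l2 g u)"
  unfolding mult_l2_def by (simp add: mult.assoc abs_l2_scaleC sq_int_mult_bounded(1) sq_int_rep)

lemma mult_l2_1: "mult_l2 (\<lambda>x. 1) u = u"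
  by (simp add: mult_l2_def abs_rep_l2)

lemma inner_mult_l2:
  fixes g :: "real \<Rightarrow> real"
  assumes g: "continuous_on {0..1} g"
  shows "inner (mult_l2 (\<lambda>x. complex_of_real (g x)) u) v = inner u (mult_l2 (\<lambda>x. complex_of_real (g x)) v)"
proof -
  have c: "continuous_on {0..1} (\<lambda>x. complex_of_real (g x))" by (intro continuous_intros g)
  have "inner (mult_l2 (\<lambda>x. complex_of_real (g x)) u) (abs_l2 (rep_l2 v)) =
    inner (abs_l2 (rep_l2 u)) (mult_l2 (\<lambda>x. complex_of_real (g x)) v)"
    unfolding mult_l2_def inner_abs_l2[OF sq_int_mult_bounded(1)[OF c sq_int_rep] sq_int_rep]
      inner_abs_l2[OF sq_int_rep sq_int_mult_bounded(1)[OF c sq_int_rep]]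
    by (rule Bochner_Integration.integral_cong) (auto simp: inner_complex_def algebra_simps)
  then show ?thesis by (simp add: abs_rep_l2)
qed

text \<open>The factor \<open>g\<close> is moved to the test function: \<open>g\<close> times a test
  function is a test function, and the classical product rule for it yields the weak one.\<close>

lemma is_wderiv_1_mult_l2:
  fixes g :: "real \<Rightarrow> real"
  assumes g: "smooth g" and u: "is_wderiv 1 u v"
  shows "is_wderiv 1 (mult_l2 (\<lambda>x. complex_of_real (g x)) u)
    (mult_l2 (\<lambda>x. complex_of_real (deriv g x)) u + mult_l2 (\<lambda>x. complex_of_real (g x)) v)"
  unfolding is_wderiv_1_iff_inner
proof (intro allI impI)
  fix \<theta> and c :: complex assume \<theta>: "test_fun \<theta>"
  let ?\<theta> = "\<lambda>x. \<theta> x *\<^sub>R c" and ?\<theta>' = "\<lambda>x. deriv \<theta> x *\<^sub>R c"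
  have cg: "continuous_on {0..1} g" "continuous_on {0..1} (deriv g)"
    by (intro smooth_continuous smooth_deriv g)+
  then have cgc: "continuous_on {0..1} (\<lambda>x. complex_of_real (g x))" "continuous_on {0..1} (\<lambda>x. complex_of_real (deriv g x))"
    by (simp_all add: continuous_on_of_real)
  have s\<theta>: "sq_int ?\<theta>" "sq_int ?\<theta>'"
    by (intro sq_int_continuous continuous_intros smooth_continuous smooth_deriv test_fun_smooth \<theta>)+
  have t: "test_fun (\<lambda>x. g x * \<theta> x)" by (rule test_fun_mult[OF \<theta> g])
  have d: "deriv (\<lambda>x. g x * \<theta> x) = (\<lambda>x. deriv g x * \<theta> x + deriv \<theta> x * g x)"
    by (intro ext DERIV_imp_deriv DERIV_mult smooth_DERIV g test_fun_smooth \<theta>)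
  have e1: "mult_l2 (\<lambda>x. complex_of_real (g x)) (abs_l2 ?\<theta>) = abs_l2 (\<lambda>x. (g x * \<theta> x) *\<^sub>R c)"
    by (subst mult_l2_abs_l2[OF cgc(1) s\<theta>(1)]) (simp add: scaleR_conv_of_real ac_simps)
  have e2: "abs_l2 (\<lambda>x. deriv (\<lambda>x. g x * \<theta> x) x *\<^sub>R c) =
      mult_l2 (\<lambda>x. complex_of_real (deriv g x)) (abs_l2 ?\<theta>) + mult_l2 (\<lambda>x. complex_of_real (g x)) (abs_l2 ?\<theta>')"
  proof -
    have "(\<lambda>x. deriv (\<lambda>x. g x * \<theta> x) x *\<^sub>R c) =
        (\<lambda>x. complex_of_real (deriv g x) * ?\<theta> x + complex_of_real (g x) * ?\<theta>' x)"
      unfolding d by (simp add: scaleR_conv_of_real algebra_simps)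
    then show ?thesis
      by (simp only: abs_l2_add mult_l2_abs_l2 cgc s\<theta> sq_int_mult_bounded(1))
  qed
  have "inner u (abs_l2 (\<lambda>x. deriv (\<lambda>x. g x * \<theta> x) x *\<^sub>R c)) = - inner v (abs_l2 (\<lambda>x. (g x * \<theta> x) *\<^sub>R c))"
    using u t unfolding is_wderiv_1_iff_inner by blast
  then show "inner (mult_l2 (\<lambda>x. complex_of_real (g x)) u) (abs_l2 ?\<theta>') =
    - inner (mult_l2 (\<lambda>x. complex_of_real (deriv g x)) u + mult_l2 (\<lambda>x. complex_of_real (g x)) v) (abs_l2 ?\<theta>)"
    unfolding e1[symmetric] e2 by (simp add: inner_mult_l2 cg inner_add_left inner_add_right)
qed

lemma point_value_mult_l2:
  assumes g: "continuous_on {0..1} g" and u: "is_wderiv 1 u v" and p: "p \<in> {0..1}"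
  shows "point_value (mult_l2 g u) p = g p * point_value u p"
proof -
  have "mult_l2 g u = abs_l2 (\<lambda>x. g x * point_value u x)"
    using mult_l2_abs_l2[OF g sq_int_continuous[OF abs_l2_point_value(1)[OF u]]] abs_l2_point_value(2)[OF u] by simp
  then show ?thesis
    using point_value_abs_l2[of "\<lambda>x. g x * point_value u x" p] abs_l2_point_value(1)[OF u] g p
    by (simp add: continuous_on_mult)
qed

subsection \<open>Completeness of \<open>H\<^sup>2\<close>\<close>

lemma norm_h2_sq: "(norm u)\<^sup>2 = (norm (rep_h2 u))\<^sup>2 + (norm (wderiv 1 (rep_h2 u)))\<^sup>2 + (norm (wderiv 2 (rep_h2 u)))\<^sup>2"
  unfolding power2_norm_eq_inner inner_h2_def by (simp add: numeral_2_eq_2 wderiv_0 atMost_Suc)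

lemma wderiv_rep_h2_le: "k \<le> 2 \<Longrightarrow> norm (wderiv k (rep_h2 u)) \<le> norm u"
proof -
  assume "k \<le> 2"
  then have "k = 0 \<or> k = 1 \<or> k = 2" by auto
  then have "(norm (wderiv k (rep_h2 u)))\<^sup>2 \<le> (norm u)\<^sup>2" by (auto simp: norm_h2_sq wderiv_0)
  then show ?thesis by (rule power2_le_imp_le) simp
qed

lemma bounded_linear_wderiv_h2: "k \<le> 2 \<Longrightarrow> bounded_linear (\<lambda>u. wderiv k (rep_h2 u))"
  by (rule bounded_linear_intro[where K = 1])
    (auto simp: plus_h2.rep_eq scaleR_h2.rep_eq wderiv_add[OF rep_h2 rep_h2] wderiv_scaleR[OF rep_h2] wderiv_rep_h2_le)

lemma bounded_linear_rep_h2: "bounded_linear rep_h2"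
  using bounded_linear_wderiv_h2[of 0] by (simp add: wderiv_0)

lemma norm_h2_le: "norm u \<le> norm (rep_h2 u) + norm (wderiv 1 (rep_h2 u)) + norm (wderiv 2 (rep_h2 u))"
proof (rule power2_le_imp_le)
  have "0 \<le> 2 * (a * b) + 2 * (b * c) + 2 * (a * c)" if "a \<ge> 0" "b \<ge> 0" "c \<ge> 0" for a b c :: real
    using that by simp
  from this[of "norm (rep_h2 u)" "norm (wderiv 1 (rep_h2 u))" "norm (wderiv 2 (rep_h2 u))"]
  show "(norm u)\<^sup>2 \<le> (norm (rep_h2 u) + norm (wderiv 1 (rep_h2 u)) + norm (wderiv 2 (rep_h2 u)))\<^sup>2"
    unfolding norm_h2_sq by (simp add: power2_eq_square algebra_simps)
qed simp

lemma rep_h2_wderiv_1: "is_wderiv 1 (rep_h2 u) (wderiv 1 (rep_h2 u))"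
  "is_wderiv 1 (wderiv 1 (rep_h2 u)) (wderiv 2 (rep_h2 u))"
  using sobolev_wderiv_Suc[OF rep_h2, of 0 u] sobolev_wderiv_Suc[OF rep_h2, of 1 u]
  by (simp_all add: wderiv_0 numeral_2_eq_2)

lemma abs_h2_chain:
  assumes "is_wderiv 1 u v" "is_wderiv 1 v w"
  shows "u \<in> sobolev 2" "rep_h2 (abs_h2 u) = u" "wderiv 1 u = v" "wderiv 2 u = w"
proof -
  define f where "f k = (if k = 0 then u else if k = 1 then v else w)" for k :: nat
  have *: "is_wderiv 1 (f k) (f (Suc k))" if "k < 2" for k
    using that assms by (cases k) (auto simp: f_def)
  show 1: "u \<in> sobolev 2" using wderiv_chain(1)[of 2 f, OF *] by (simp add: f_def)
  then show "rep_h2 (abs_h2 u) = u" by (rule abs_h2_inverse)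
  show "wderiv 1 u = v" using wderiv_chain(2)[of 2 f 1, OF *] by (simp add: f_def)
  show "wderiv 2 u = w" using wderiv_chain(2)[of 2 f 2, OF *] by (simp add: f_def)
qed

instance h2 :: complete_space
proof
  fix X :: "nat \<Rightarrow> h2" assume X: "Cauchy X"
  \<comment> \<open>Each of the three derivatives is Cauchy in \<open>l2\<close>. Since the weak
    derivative is a closed operator, the limits again form a chain.\<close>
  have "\<exists>v. (\<lambda>n. wderiv k (rep_h2 (X n))) \<longlonglongrightarrow> v" if "k \<le> 2" for k
    using bounded_linear.Cauchy[OF bounded_linear_wderiv_h2[OF that] X] Cauchy_convergent_iff convergent_def by blast
  then obtain v where v: "\<And>k. k \<le> 2 \<Longrightarrow> (\<lambda>n. wderiv k (rep_h2 (X n))) \<longlonglongrightarrow> v k" by metis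
  have "is_wderiv 1 (v k) (v (Suc k))" if "k < 2" for k
    by (rule is_wderiv_1_tendsto[of "\<lambda>n. wderiv k (rep_h2 (X n))" "\<lambda>n. wderiv (Suc k) (rep_h2 (X n))"])
      (use that v sobolev_wderiv_Suc[OF rep_h2] in auto)
  then have "is_wderiv 1 (v 0) (v 1)" "is_wderiv 1 (v 1) (v 2)" by (force simp: numeral_2_eq_2)+
  note c = abs_h2_chain[OF this]
  let ?u = "abs_h2 (v 0)"
  have diff: "wderiv k (rep_h2 (X n - ?u)) = wderiv k (rep_h2 (X n)) - wderiv k (rep_h2 ?u)" if "k \<le> 2" for k n
    by (rule linear_diff[OF bounded_linear.linear[OF bounded_linear_wderiv_h2[OF that]]])
  have "X \<longlonglongrightarrow> ?u"
  proof (rule LIM_zero_cancel, rule Lim_null_comparison)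
    let ?b = "\<lambda>n. norm (wderiv 0 (rep_h2 (X n)) - v 0) + norm (wderiv 1 (rep_h2 (X n)) - v 1) + norm (wderiv 2 (rep_h2 (X n)) - v 2)"
    show "\<forall>\<^sub>F n in sequentially. norm (X n - ?u) \<le> ?b n"
    proof (rule always_eventually, rule allI)
      fix n
      show "norm (X n - ?u) \<le> ?b n"
        using norm_h2_le[of "X n - ?u"] diff[of 0 n] diff[of 1 n] diff[of 2 n] by (simp add: c wderiv_0 del: One_nat_def)
    qed
    have "?b \<longlonglongrightarrow> norm (v 0 - v 0) + norm (v 1 - v 1) + norm (v 2 - v 2)"
      by (intro tendsto_intros v) auto
    then show "?b \<longlonglongrightarrow> 0" by simp
  qed
  then show "convergent X" by (auto simp: convergent_def)
qed

instance h2 :: banach ..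

subsection \<open>Energy identities for the Kawahara operator\<close>

abbreviation multX :: "l2 \<Rightarrow> l2" where
  "multX \<equiv> mult_l2 (\<lambda>x. complex_of_real x)"

lemma continuous_on_of_real_ident: "continuous_on S (\<lambda>x. complex_of_real x)"
  by (intro continuous_intros)

lemma multX_sym: "inner (multX u) v = inner u (multX v)"
  by (rule inner_mult_l2[of "\<lambda>x. x"]) (rule continuous_on_id)

lemma is_wderiv_multX: "is_wderiv 1 u v \<Longrightarrow> is_wderiv 1 (multX u) (u + multX v)"
  using is_wderiv_1_mult_l2[OF smooth_ident, of u v] by (simp add: deriv_ident mult_l2_1)

lemma norm_multX_le: "norm (multX u) \<le> norm u"
  using norm_mult_l2_le[OF continuous_on_of_real_ident, of 1 u] by simp

lemma norm_minus_multX_le: "norm (u - multX u) \<le> norm u"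
proof -
  have c: "continuous_on {0..1} (\<lambda>x. - 1 * complex_of_real x)" "continuous_on {0..1} (\<lambda>x. 1 :: complex)"
    by (intro continuous_intros)+
  have "mult_l2 (\<lambda>x. 1 + (-1) * complex_of_real x) u = u + scaleC_l2 (complex_of_real (-1)) (multX u)"
    by (simp only: mult_l2_add_left[OF c(2,1)] mult_l2_cmult_left[OF continuous_on_of_real_ident] mult_l2_1 of_real_minus of_real_1)
  then have "mult_l2 (\<lambda>x. 1 + (-1) * complex_of_real x) u = u - multX u"
    unfolding scaleC_of_real by simp
  moreover have "norm (mult_l2 (\<lambda>x. 1 + (-1) * complex_of_real x) u) \<le> 1 * norm u"
  proof (rule norm_mult_l2_le)
    fix x :: real assume "x \<in> {0<..<1}"
    then have "norm (complex_of_real (1 - x)) \<le> 1" by (simp only: norm_of_real) simp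
    then show "norm (1 + (-1) * complex_of_real x) \<le> 1" by simp
  qed (intro continuous_intros)
  ultimately show ?thesis by simp
qed

lemma inner_multX_nonneg: "0 \<le> inner u (multX u)"
proof -
  have "inner (abs_l2 (rep_l2 u)) (multX u) = integral\<^sup>L I_leb (\<lambda>x. inner (rep_l2 u x) (complex_of_real x * rep_l2 u x))"
    unfolding mult_l2_def by (rule inner_abs_l2[OF sq_int_rep sq_int_mult_bounded(1)[OF continuous_on_of_real_ident sq_int_rep]])
  also have "\<dots> \<ge> 0"
  proof (rule Bochner_Integration.integral_nonneg)
    fix x assume "x \<in> space I_leb"
    moreover have "inner (rep_l2 u x) (complex_of_real x * rep_l2 u x) = x * (norm (rep_l2 u x))\<^sup>2"
      using inner_scaleR_right[of "rep_l2 u x" x "rep_l2 u x"] by (simp add: scaleR_conv_of_real power2_norm_eq_inner)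
    ultimately show "0 \<le> inner (rep_l2 u x) (complex_of_real x * rep_l2 u x)" by simp
  qed
  finally show ?thesis by (simp add: abs_rep_l2)
qed

lemma kawahara_dom_sobolev: "v \<in> kawahara_dom \<alpha> \<Longrightarrow> v \<in> sobolev 5"
  by (simp add: kawahara_dom_def)

lemma sobolev_5_chain:
  assumes "v \<in> sobolev 5"
  shows "is_wderiv 1 v (wderiv 1 v)" "is_wderiv 1 (wderiv 1 v) (wderiv 2 v)" "is_wderiv 1 (wderiv 2 v) (wderiv 3 v)"
    "is_wderiv 1 (wderiv 3 v) (wderiv 4 v)" "is_wderiv 1 (wderiv 4 v) (wderiv 5 v)"
  using sobolev_wderiv_Suc[OF assms, of 0] sobolev_wderiv_Suc[OF assms, of 1] sobolev_wderiv_Suc[OF assms, of 2]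
    sobolev_wderiv_Suc[OF assms, of 3] sobolev_wderiv_Suc[OF assms, of 4] by (simp_all add: wderiv_0 eval_nat_numeral)

lemma kawahara_domE:
  assumes "v \<in> kawahara_dom \<alpha>"
  obtains "v \<in> sobolev 5" "point_value v 0 = 0" "point_value v 1 = 0"
    "point_value (wderiv 1 v) 0 = 0" "point_value (wderiv 1 v) 1 = 0"
    "point_value (wderiv 2 v) 1 = complex_of_real \<alpha> * point_value (wderiv 2 v) 0"
  using assms by (simp add: kawahara_dom_def)

text \<open>Every boundary term contains the value of \<open>z\<close> or of its first derivative,
  so only \<open>z\<close> has to satisfy boundary conditions. It is used with \<open>z = v\<close>
  for dissipativity and with \<open>z = kawahara_op v\<close> for interpolation.\<close>

lemma kawahara_op_pairing:
  assumes v: "v \<in> sobolev 5" and z: "z \<in> kawahara_dom \<alpha>"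
  shows "inner (kawahara_op v) z = inner (wderiv 3 v) (wderiv 2 z) + inner (wderiv 2 v) (wderiv 1 z)"
proof -
  note W = sobolev_5_chain[OF v] note Z = sobolev_5_chain[OF kawahara_dom_sobolev[OF z]]
  from z show ?thesis
  proof (rule kawahara_domE)
    assume bc: "point_value z 0 = 0" "point_value z 1 = 0"
      "point_value (wderiv 1 z) 0 = 0" "point_value (wderiv 1 z) 1 = 0"
    show ?thesis
      using ibp[OF W(5) Z(1)] ibp[OF W(4) Z(2)] ibp[OF W(3) Z(1)] bc
      by (simp add: kawahara_op_def inner_diff_left)
  qed
qed

text \<open>After the pairing both terms are derivatives of squares. The first-derivative traces
  vanish, and the two traces of the second derivative are linked by the factor \<alpha>.\<close>

lemma kawahara_op_inner_self:
  assumes v: "v \<in> kawahara_dom \<alpha>"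
  shows "inner (kawahara_op v) v = (\<alpha>\<^sup>2 - 1) / 2 * (norm (point_value (wderiv 2 v) 0))\<^sup>2"
  using v
proof (rule kawahara_domE)
  assume s: "v \<in> sobolev 5" and bc: "point_value v 0 = 0" "point_value v 1 = 0"
    "point_value (wderiv 1 v) 0 = 0" "point_value (wderiv 1 v) 1 = 0"
    "point_value (wderiv 2 v) 1 = complex_of_real \<alpha> * point_value (wderiv 2 v) 0"
  note W = sobolev_5_chain[OF s]
  have b: "(norm (point_value (wderiv 2 v) 1))\<^sup>2 = \<alpha>\<^sup>2 * (norm (point_value (wderiv 2 v) 0))\<^sup>2"
    by (simp add: bc norm_mult power_mult_distrib)
  show ?thesis
    using kawahara_op_pairing[OF s v] ibp[OF W(3) W(3)] ibp[OF W(2) W(2)] bc(3,4) b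
    by (simp add: power2_norm_eq_inner inner_commute field_simps)
qed

text \<open>Kato's multiplier \<open>x\<close>: the derivatives that fall on the weight produce
  negative multiples of the squared norms of the second and first derivatives. The price is a trace
  term of the wrong sign.\<close>

lemma kawahara_op_inner_multX:
  assumes v: "v \<in> kawahara_dom \<alpha>"
  shows "inner (kawahara_op v) (multX v) = \<alpha>\<^sup>2 / 2 * (norm (point_value (wderiv 2 v) 0))\<^sup>2
    - 5 / 2 * (norm (wderiv 2 v))\<^sup>2 - 3 / 2 * (norm (wderiv 1 v))\<^sup>2"
  using v
proof (rule kawahara_domE)
  assume s: "v \<in> sobolev 5" and bc: "point_value v 0 = 0" "point_value v 1 = 0"
    "point_value (wderiv 1 v) 0 = 0" "point_value (wderiv 1 v) 1 = 0"
    "point_value (wderiv 2 v) 1 = complex_of_real \<alpha> * point_value (wderiv 2 v) 0"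
  let ?D = "\<lambda>k. wderiv k v"
  note W = sobolev_5_chain[OF s]
  note Y0 = is_wderiv_multX[OF W(1)] note Y1 = is_wderiv_multX[OF W(2)] note Y2 = is_wderiv_multX[OF W(3)]
  note Y01 = is_wderiv_add[OF W(1) Y1]
  have b: "(norm (point_value (?D 2) 1))\<^sup>2 = \<alpha>\<^sup>2 * (norm (point_value (?D 2) 0))\<^sup>2"
    by (simp add: bc norm_mult power_mult_distrib)
  have p: "point_value (multX u) q = complex_of_real q * point_value u q" if "is_wderiv 1 u w" "q \<in> {0..1}" for u w q
    by (rule point_value_mult_l2[OF continuous_on_of_real_ident that])
  have p01: "point_value (v + multX (?D 1)) 0 = 0" "point_value (v + multX (?D 1)) 1 = 0"
    using point_value_add[OF W(1) Y1, of 0] point_value_add[OF W(1) Y1, of 1] bc p[OF W(2)] by simp_all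
  have e1: "inner (?D 5) (multX v) + inner (?D 4) (v + multX (?D 1)) = 0"
    using ibp[OF W(5) Y0] p[OF W(1)] bc by simp
  have e2: "inner (?D 4) (v + multX (?D 1)) + inner (?D 3) (?D 1 + (?D 1 + multX (?D 2))) = 0"
    using ibp[OF W(4) Y01] p01 by simp
  have e3: "inner (?D 3) (?D 1) + (norm (?D 2))\<^sup>2 = 0"
    using ibp[OF W(3) W(2)] bc by (simp add: power2_norm_eq_inner)
  have e4: "inner (?D 3) (multX (?D 2)) + ((norm (?D 2))\<^sup>2 + inner (?D 3) (multX (?D 2))) = (norm (point_value (?D 2) 1))\<^sup>2"
    using ibp[OF W(3) Y2] p[OF W(3)] multX_sym[of "?D 2" "?D 3"]
    by (simp add: power2_norm_eq_inner inner_add_right inner_commute)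
  have e5: "inner (?D 3) (multX v) + inner (?D 2) (v + multX (?D 1)) = 0"
    using ibp[OF W(3) Y0] p[OF W(1)] bc by simp
  have e6: "inner (?D 2) v + (norm (?D 1))\<^sup>2 = 0"
    using ibp[OF W(2) W(1)] bc by (simp add: power2_norm_eq_inner)
  have e7: "inner (?D 2) (multX (?D 1)) + ((norm (?D 1))\<^sup>2 + inner (?D 2) (multX (?D 1))) = 0"
    using ibp[OF W(2) Y1] p[OF W(2)] bc multX_sym[of "?D 1" "?D 2"]
    by (simp add: power2_norm_eq_inner inner_add_right inner_commute)
  show ?thesis
    using e1 e2 e3 e4 e5 e6 e7 b
    by (simp add: kawahara_op_def inner_diff_left inner_add_right)
qed

section \<open>The weighted energy and its dissipation\<close>

definition energy :: "real \<Rightarrow> l2 \<Rightarrow> real" where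
  "energy \<kappa> u = inner u (u + \<kappa> *\<^sub>R multX u)"

lemma energy_ge: "0 \<le> \<kappa> \<Longrightarrow> (norm u)\<^sup>2 \<le> energy \<kappa> u"
  by (simp add: energy_def inner_add_right power2_norm_eq_inner inner_multX_nonneg)

lemma energy_le: "0 \<le> \<kappa> \<Longrightarrow> \<kappa> \<le> 1 \<Longrightarrow> energy \<kappa> u \<le> 2 * (norm u)\<^sup>2"
proof -
  assume k: "0 \<le> \<kappa>" "\<kappa> \<le> 1"
  have "inner u (multX u) \<le> norm u * norm (multX u)" by (rule norm_cauchy_schwarz)
  also have "\<dots> \<le> norm u * norm u" by (intro mult_left_mono norm_multX_le norm_ge_zero)
  finally have "\<kappa> * inner u (multX u) \<le> 1 * (norm u * norm u)"
    using k inner_multX_nonneg[of u] by (intro mult_mono) auto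
  then show ?thesis by (simp add: energy_def inner_add_right power2_norm_eq_inner flip: norm_eq_sqrt_inner)
     (simp add: dot_square_norm power2_eq_square)
qed

lemma kawahara_op_dissipative:
  assumes "\<bar>\<alpha>\<bar> < 1" "v \<in> kawahara_dom \<alpha>" shows "inner (kawahara_op v) v \<le> 0"
proof -
  have "\<alpha>\<^sup>2 \<le> 1" using assms(1) by (simp add: abs_square_le_1)
  then show ?thesis unfolding kawahara_op_inner_self[OF assms(2)] by (intro mult_nonpos_nonneg) auto
qed

text \<open>The choice of the weight \<kappa> settles the sign of the trace terms: -\<kappa>/2 from
  the unweighted identity and \<open>\<kappa> \<alpha>\<^sup>2 / 2\<close> from the multiplier
  \<open>x\<close> add up to \<open>- \<kappa>\<^sup>2 / 2\<close>.\<close>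

lemma kawahara_op_energy:
  assumes \<alpha>: "\<bar>\<alpha>\<bar> < 1" and v: "v \<in> kawahara_dom \<alpha>"
  shows "inner (kawahara_op v) (v + (1 - \<alpha>\<^sup>2) *\<^sub>R multX v) \<le> - (5 / 2 * (1 - \<alpha>\<^sup>2) * (norm (wderiv 2 v))\<^sup>2)"
proof -
  let ?k = "1 - \<alpha>\<^sup>2" and ?a = "(norm (point_value (wderiv 2 v) 0))\<^sup>2"
  have k: "?k \<ge> 0" using \<alpha> by (simp add: abs_square_le_1)
  have "inner (kawahara_op v) (v + ?k *\<^sub>R multX v) = (\<alpha>\<^sup>2 - 1) / 2 * ?a +
      ?k * (\<alpha>\<^sup>2 / 2 * ?a - 5 / 2 * (norm (wderiv 2 v))\<^sup>2 - 3 / 2 * (norm (wderiv 1 v))\<^sup>2)"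
    by (simp add: inner_add_right kawahara_op_inner_self[OF v] kawahara_op_inner_multX[OF v])
  also have "\<dots> = - (?k * ?k / 2 * ?a) - 5 / 2 * ?k * (norm (wderiv 2 v))\<^sup>2 - ?k * (3 / 2 * (norm (wderiv 1 v))\<^sup>2)"
    by (simp add: field_simps)
  also have "\<dots> \<le> - (5 / 2 * ?k * (norm (wderiv 2 v))\<^sup>2)"
  proof -
    have "0 \<le> ?k * ?k / 2 * ?a" "0 \<le> ?k * (3 / 2 * (norm (wderiv 1 v))\<^sup>2)"
      using k by (auto intro!: mult_nonneg_nonneg)
    then show ?thesis by linarith
  qed
  finally show ?thesis .
qed

lemma kawahara_dom_poincare:
  assumes "v \<in> kawahara_dom \<alpha>"
  shows "norm v \<le> norm (wderiv 2 v)" "norm (wderiv 1 v) \<le> norm (wderiv 2 v)"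
proof -
  show 1: "norm (wderiv 1 v) \<le> norm (wderiv 2 v)"
    using assms sobolev_5_chain(2)[OF kawahara_dom_sobolev[OF assms]]
    by (intro poincare) (auto simp: kawahara_dom_def)
  have "norm v \<le> norm (wderiv 1 v)"
    using assms sobolev_5_chain(1)[OF kawahara_dom_sobolev[OF assms]]
    by (intro poincare) (auto simp: kawahara_dom_def)
  with 1 show "norm v \<le> norm (wderiv 2 v)" by simp
qed

text \<open>Cauchy-Schwarz in the energy inequality: the weight has norm at most 2, and the factor
  5/2 of the dissipation absorbs it. In the smoothing estimate this inequality halves the exponent
  of time.\<close>

lemma kawahara_wderiv2_bound:
  assumes \<alpha>: "\<bar>\<alpha>\<bar> < 1" and v: "v \<in> kawahara_dom \<alpha>"
  shows "(1 - \<alpha>\<^sup>2) * (norm (wderiv 2 v))\<^sup>2 \<le> norm (kawahara_op v) * norm v"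
proof -
  let ?k = "1 - \<alpha>\<^sup>2"
  have k: "0 \<le> ?k" "?k \<le> 1" using \<alpha> by (auto simp: abs_square_le_1)
  have "norm (v + ?k *\<^sub>R multX v) \<le> norm v + norm (?k *\<^sub>R multX v)" by (rule norm_triangle_ineq)
  also have "\<dots> \<le> norm v + 1 * norm v"
  proof -
    have "?k * norm (multX v) \<le> 1 * norm v" using k norm_multX_le[of v] by (intro mult_mono) auto
    then show ?thesis using k by simp
  qed
  finally have n: "norm (v + ?k *\<^sub>R multX v) \<le> 2 * norm v" by simp
  have "5 / 2 * ?k * (norm (wderiv 2 v))\<^sup>2 \<le> - inner (kawahara_op v) (v + ?k *\<^sub>R multX v)"
    using kawahara_op_energy[OF assms] by linarith
  also have "\<dots> \<le> norm (kawahara_op v) * norm (v + ?k *\<^sub>R multX v)"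
    using Cauchy_Schwarz_ineq2[of "kawahara_op v" "v + ?k *\<^sub>R multX v"] by linarith
  also have "\<dots> \<le> norm (kawahara_op v) * (2 * norm v)" by (intro mult_left_mono n norm_ge_zero)
  also have "\<dots> = 2 * (norm (kawahara_op v) * norm v)" by simp
  finally have "5 / 2 * (?k * (norm (wderiv 2 v))\<^sup>2) \<le> 2 * (norm (kawahara_op v) * norm v)"
    by (simp only: mult.assoc)
  moreover have "0 \<le> ?k * (norm (wderiv 2 v))\<^sup>2" using k by (intro mult_nonneg_nonneg) auto
  ultimately show ?thesis by linarith
qed

text \<open>Poincare's inequality in the previous bound. This lower bound at spectral parameter 0
  starts the continuation of the range condition and makes the inverse of the operator
  bounded.\<close>

lemma kawahara_op_coercive:
  assumes \<alpha>: "\<bar>\<alpha>\<bar> < 1" and v: "v \<in> kawahara_dom \<alpha>"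
  shows "(1 - \<alpha>\<^sup>2) * norm v \<le> norm (kawahara_op v)"
proof (cases "v = 0")
  case False
  have k: "0 \<le> 1 - \<alpha>\<^sup>2" using \<alpha> by (auto simp: abs_square_le_1)
  have "(1 - \<alpha>\<^sup>2) * (norm v * norm v) \<le> (1 - \<alpha>\<^sup>2) * (norm (wderiv 2 v))\<^sup>2"
    unfolding power2_eq_square[symmetric] using kawahara_dom_poincare(1)[OF v] by (intro mult_left_mono power_mono k) auto
  also have "\<dots> \<le> norm (kawahara_op v) * norm v" by (rule kawahara_wderiv2_bound[OF assms])
  finally show ?thesis using False by (simp flip: mult.assoc)
qed simp

subsection \<open>Interpolation\<close>

text \<open>The weight \<open>x\<close> vanishes at 0 and equals 1 at 1, so integrating by parts
  \<open>u\<close> against \<open>multX u\<close> isolates the trace at 1. Subtracting the identity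
  for \<open>u\<close> against itself isolates the trace at 0.\<close>

lemma point_value_trace:
  assumes u: "is_wderiv 1 u u'"
  shows "(norm (point_value u 1))\<^sup>2 \<le> (norm u)\<^sup>2 + 2 * norm u * norm u'"
    and "(norm (point_value u 0))\<^sup>2 \<le> (norm u)\<^sup>2 + 2 * norm u * norm u'"
proof -
  have e1: "(norm (point_value u 1))\<^sup>2 = (norm u)\<^sup>2 + 2 * inner u' (multX u)"
    using ibp[OF u is_wderiv_multX[OF u]] point_value_mult_l2[OF continuous_on_of_real_ident u] multX_sym[of u u']
    by (simp add: power2_norm_eq_inner inner_add_right inner_commute)
  have "inner u' (multX u) \<le> norm u' * norm (multX u)" by (rule norm_cauchy_schwarz)
  also have "\<dots> \<le> norm u' * norm u" by (intro mult_left_mono norm_multX_le norm_ge_zero)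
  finally have *: "inner u' (multX u) \<le> norm u' * norm u" .
  have comm: "2 * norm u * norm u' = 2 * (norm u' * norm u)" by (simp only: mult_ac)
  show "(norm (point_value u 1))\<^sup>2 \<le> (norm u)\<^sup>2 + 2 * norm u * norm u'" unfolding comm using e1 * by linarith
  have e0: "(norm (point_value u 0))\<^sup>2 = (norm u)\<^sup>2 - 2 * inner u' (u - multX u)"
    using ibp[OF u u] e1 by (simp add: power2_norm_eq_inner inner_diff_right inner_commute)
  have "- inner u' (u - multX u) \<le> norm u' * norm (u - multX u)"
    using Cauchy_Schwarz_ineq2[of u' "u - multX u"] by linarith
  also have "\<dots> \<le> norm u' * norm u" by (intro mult_left_mono norm_minus_multX_le norm_ge_zero)
  finally have "- inner u' (u - multX u) \<le> norm u' * norm u" .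
  then show "(norm (point_value u 0))\<^sup>2 \<le> (norm u)\<^sup>2 + 2 * norm u * norm u'" unfolding comm using e0 by linarith
qed

lemma young_eps:
  fixes a b e :: real assumes "e > 0" shows "2 * (a * b) \<le> a\<^sup>2 / e + e * b\<^sup>2"
proof -
  have "0 \<le> (a / sqrt e - sqrt e * b)\<^sup>2" by simp
  also have "\<dots> = a\<^sup>2 / e + e * b\<^sup>2 - 2 * (a * b)"
    using assms by (simp add: power2_diff power_divide power_mult_distrib)
  finally show ?thesis by simp
qed

text \<open>No boundary conditions are imposed on \<open>g\<close>, so integrating \<open>g1\<close>
  against itself by parts leaves traces at both ends. These are controlled by the trace inequality
  and reabsorbed with Young's inequality.\<close>

lemma interpolation:
  assumes g: "is_wderiv 1 g g1" "is_wderiv 1 g1 g2" and \<delta>: "0 < \<delta>" "\<delta> \<le> 1"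
  shows "norm g1 \<le> 17 * (norm g / \<delta> + \<delta> * norm g2)"
proof -
  let ?G = "norm g" and ?G1 = "norm g1" and ?G2 = "norm g2"
  let ?b = "\<lambda>p. inner (point_value g p) (point_value g1 p)"
  \<comment> \<open>With this choice the term \<open>\<nu> * ?G1\<^sup>2\<close> inside
    \<open>\<nu> * V\<close> costs at most a quarter of the left-hand side; the two cross terms cost
    an eighth each.\<close>
  define \<nu> where "\<nu> = \<delta> / 4"
  have \<nu>: "0 < \<nu>" "\<nu> \<le> 1/4" using \<delta> by (auto simp: \<nu>_def)
  define U where "U = ?G\<^sup>2 + 2 * ?G * ?G1"
  define V where "V = ?G1\<^sup>2 + 2 * ?G1 * ?G2"
  have b: "2 * \<bar>?b p\<bar> \<le> U / \<nu> + \<nu> * V" if "p = 0 \<or> p = 1" for p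
  proof -
    have "2 * \<bar>?b p\<bar> \<le> 2 * (norm (point_value g p) * norm (point_value g1 p))"
      using Cauchy_Schwarz_ineq2[of "point_value g p" "point_value g1 p"] by simp
    also have "\<dots> \<le> (norm (point_value g p))\<^sup>2 / \<nu> + \<nu> * (norm (point_value g1 p))\<^sup>2"
      by (rule young_eps[OF \<nu>(1)])
    also have "\<dots> \<le> U / \<nu> + \<nu> * V"
      using point_value_trace[OF g(1)] point_value_trace[OF g(2)] that \<nu>
      by (intro add_mono divide_right_mono mult_left_mono) (auto simp: U_def V_def)
    finally show ?thesis .
  qed
  have "?G1\<^sup>2 = ?b 1 - ?b 0 - inner g g2"
    using ibp[OF g(1,2)] by (simp add: power2_norm_eq_inner)
  also have "\<dots> \<le> \<bar>?b 1\<bar> + \<bar>?b 0\<bar> + ?G * ?G2"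
    using Cauchy_Schwarz_ineq2[of g g2] by linarith
  also have "\<dots> \<le> U / \<nu> + \<nu> * V + ?G * ?G2" using b[of 0] b[of 1] by simp
  finally have main: "?G1\<^sup>2 \<le> U / \<nu> + \<nu> * V + ?G * ?G2" .
  have y1: "2 * (?G * ?G2) \<le> ?G\<^sup>2 / \<delta>\<^sup>2 + \<delta>\<^sup>2 * ?G2\<^sup>2" by (rule young_eps) (use \<delta> in simp)
  have y2: "2 * (?G / \<nu> * ?G1) \<le> (?G / \<nu>)\<^sup>2 / (1/8) + 1/8 * ?G1\<^sup>2" by (rule young_eps) simp
  have y3: "2 * (\<nu> * ?G2 * ?G1) \<le> (\<nu> * ?G2)\<^sup>2 / (1/8) + 1/8 * ?G1\<^sup>2" by (rule young_eps) simp
  have y4: "\<nu> * ?G1\<^sup>2 \<le> 1/4 * ?G1\<^sup>2" using \<nu> by (intro mult_right_mono) auto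
  have y5: "?G\<^sup>2 / \<nu> \<le> 4 * (?G / \<delta>)\<^sup>2"
  proof -
    have "\<delta> * \<delta> \<le> \<delta> * 1" using \<delta> by (intro mult_left_mono) auto
    then have "?G\<^sup>2 / \<delta> \<le> ?G\<^sup>2 / \<delta>\<^sup>2" using \<delta> by (intro divide_left_mono) (auto simp: power2_eq_square)
    moreover have "?G\<^sup>2 / \<nu> = 4 * (?G\<^sup>2 / \<delta>)" by (simp add: \<nu>_def)
    ultimately show ?thesis unfolding power_divide by linarith
  qed
  have "U / \<nu> + \<nu> * V = ?G\<^sup>2 / \<nu> + 2 * (?G / \<nu> * ?G1) + \<nu> * ?G1\<^sup>2 + 2 * (\<nu> * ?G2 * ?G1)"
    using \<nu> by (simp add: U_def V_def field_simps power2_eq_square)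
  moreover have sq: "(?G / \<nu>)\<^sup>2 = 16 * (?G / \<delta>)\<^sup>2" "(\<nu> * ?G2)\<^sup>2 = (\<delta> * ?G2)\<^sup>2 / 16"
    "?G\<^sup>2 / \<delta>\<^sup>2 = (?G / \<delta>)\<^sup>2" "\<delta>\<^sup>2 * ?G2\<^sup>2 = (\<delta> * ?G2)\<^sup>2"
    by (simp_all add: \<nu>_def power_divide power_mult_distrib)
  \<comment> \<open>The multiples of \<open>h\<close> on the right add up to one half. Absorbing
    them leaves \<open>265 a + 2 b\<close>, and 289 = 17^2 is the next square.\<close>
  moreover have "h \<le> 289 * (a + b)"
    if "s = t1 + 2 * t2 + t3 + 2 * t4" "h \<le> s + m" "2 * m \<le> a + b" "2 * t2 \<le> 16 * a / (1/8) + 1/8 * h"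
      "2 * t4 \<le> b / 16 / (1/8) + 1/8 * h" "t3 \<le> 1/4 * h" "t1 \<le> 4 * a" "0 \<le> a" "0 \<le> b"
    for h a b s t1 t2 t3 t4 m :: real
    using that by (simp add: field_simps)
  ultimately have "?G1\<^sup>2 \<le> 289 * ((?G / \<delta>)\<^sup>2 + (\<delta> * ?G2)\<^sup>2)"
    using main y1[unfolded sq] y2[unfolded sq] y3[unfolded sq] y4 y5 zero_le_power2 by blast
  also have "\<dots> \<le> (17 * (?G / \<delta> + \<delta> * ?G2))\<^sup>2"
  proof -
    have "0 \<le> ?G / \<delta> * (\<delta> * ?G2)" using \<delta> by simp
    moreover have "289 * (a\<^sup>2 + b\<^sup>2) \<le> (17 * (a + b))\<^sup>2" if "0 \<le> a * b" for a b :: real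
      using that by (simp add: power2_eq_square algebra_simps)
    ultimately show ?thesis by blast
  qed
  finally show ?thesis by (rule power2_le_imp_le) (use \<delta> in simp)
qed

text \<open>The fifth derivative is \<open>kawahara_op v\<close> plus the third derivative. The
  fourth derivative is interpolated away first, then the third is interpolated at a scale small
  enough to reabsorb its own appearance on the right.\<close>

lemma wderiv3_interpolation:
  "\<exists>K\<ge>1. \<forall>v \<delta>. v \<in> sobolev 5 \<longrightarrow> 0 < \<delta> \<longrightarrow> \<delta> \<le> 1 \<longrightarrow>
     norm (wderiv 3 v) \<le> K * (norm (wderiv 2 v) / \<delta> + \<delta> * norm (kawahara_op v))"
proof -
  \<comment> \<open>An upper bound for 2 * 17^2 * 578 = 334084, the coefficient that appears in the
    bound for the fourth derivative.\<close>
  define L :: real where "L = 400000"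
  define K :: real where "K = 17 * (2 * L)"
  have L1: "L \<ge> 1" "K \<ge> 1" by (auto simp: K_def L_def)
  have bound: "norm (wderiv 3 v) \<le> 4 * K * K * (norm (wderiv 2 v) / \<delta> + \<delta> * norm (kawahara_op v))"
    if v: "v \<in> sobolev 5" and \<delta>: "0 < \<delta>" "\<delta> \<le> 1" for v \<delta>
  proof -
    note W = sobolev_5_chain[OF v]
    let ?G = "norm (wderiv 2 v)" and ?G1 = "norm (wderiv 3 v)" and ?G2 = "norm (wderiv 4 v)" and ?G3 = "norm (wderiv 5 v)"
    let ?n = "norm (kawahara_op v)"
    have "?G2 \<le> 17 * (?G1 + ?G3)" using interpolation[OF W(4,5), of 1] by simp
    \<comment> \<open>The scale is 1/578 because 578 = 2 * 17^2: the fourth derivative then returns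
      with factor 1/2 and can be absorbed.\<close>
    moreover have "?G1 \<le> 17 * (578 * ?G + 1/578 * ?G2)" using interpolation[OF W(3,4), of "1/578"] by (simp add: mult.commute)
    moreover have "g2 \<le> L * (g + g3)"
      if "g2 \<le> 17 * (g1 + g3)" "g1 \<le> 17 * (578 * g + 1/578 * g2)" "0 \<le> g" "0 \<le> g3" for g g1 g2 g3 :: real
      using that by (simp add: L_def field_simps)
    ultimately have G2: "?G2 \<le> L * (?G + ?G3)" by simp
    have "wderiv 5 v = kawahara_op v + wderiv 3 v" by (simp add: kawahara_op_def)
    then have G3: "?G3 \<le> ?n + ?G1" using norm_triangle_ineq[of "kawahara_op v" "wderiv 3 v"] by simp
    \<comment> \<open>Chosen so that \<open>17 * L * \<eta> = \<delta> / 4\<close>, which makes the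
      coefficient of \<open>?G1\<close> on the right at most 1/4.\<close>
    define \<eta> where "\<eta> = \<delta> / (2 * K)"
    have \<eta>: "0 < \<eta>" "\<eta> \<le> 1" using \<delta> L1 by (auto simp: \<eta>_def)
    have "?G1 \<le> 17 * (?G / \<eta> + \<eta> * (L * (?G + (?n + ?G1))))"
    proof -
      have "?G1 \<le> 17 * (?G / \<eta> + \<eta> * ?G2)" by (rule interpolation[OF W(3,4) \<eta>])
      also have "\<eta> * ?G2 \<le> \<eta> * (L * (?G + (?n + ?G1)))"
        using G2 G3 \<eta> L1 by (intro mult_left_mono order_trans[OF G2]) auto
      finally show ?thesis by simp
    qed
    also have "\<dots> = 17 * (?G / \<eta>) + 17 * L * \<eta> * ?G + 17 * L * \<eta> * ?n + 17 * L * \<eta> * ?G1"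
      by (simp add: algebra_simps)
    also have "17 * L * \<eta> = \<delta> / 4" using L1 by (simp add: \<eta>_def K_def)
    finally have "?G1 \<le> 17 * (?G / \<eta>) + \<delta> / 4 * ?G + \<delta> / 4 * ?n + \<delta> / 4 * ?G1" .
    moreover have "\<delta> / 4 * ?G1 \<le> 1/4 * ?G1" "\<delta> / 4 * ?G \<le> 1/4 * (?G / \<delta>)"
    proof -
      show "\<delta> / 4 * ?G1 \<le> 1/4 * ?G1" using \<delta> by (intro mult_right_mono) auto
      have "\<delta> * \<delta> * ?G \<le> 1 * ?G" using \<delta> by (intro mult_right_mono mult_le_one) auto
      then show "\<delta> / 4 * ?G \<le> 1/4 * (?G / \<delta>)" using \<delta> by (simp add: field_simps)
    qed
    moreover have "17 * (?G / \<eta>) = 34 * K * (?G / \<delta>)" using \<delta> L1 by (simp add: \<eta>_def)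
    ultimately have "?G1 \<le> 4/3 * (34 * K * (?G / \<delta>) + 1/4 * (?G / \<delta>) + 1/4 * (\<delta> * ?n))" by simp
    also have "\<dots> \<le> 4 * K * K * (?G / \<delta> + \<delta> * ?n)"
    proof -
      have K34: "34 * K \<le> K * K" "1 \<le> K * K" by (auto simp: K_def L_def)
      have "34 * K * (?G / \<delta>) \<le> K * K * (?G / \<delta>)" "1 * (?G / \<delta>) \<le> K * K * (?G / \<delta>)"
        "1 * (\<delta> * ?n) \<le> K * K * (\<delta> * ?n)"
        using \<delta> by (intro mult_right_mono[OF K34(1)] mult_right_mono[OF K34(2)]; simp)+
      moreover have "0 \<le> K * K * (?G / \<delta>)" "0 \<le> K * K * (\<delta> * ?n)" using \<delta> L1 by auto
      ultimately show ?thesis unfolding distrib_left by linarith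
    qed
    finally show ?thesis .
  qed
  show ?thesis
  proof (intro exI[of _ "4 * K * K"] conjI allI impI)
    show "1 \<le> 4 * K * K" by (simp add: K_def L_def)
  qed (use bound in blast)
qed

text \<open>Since \<open>kawahara_op v\<close> satisfies the boundary conditions itself, two
  derivatives can be moved onto it in its inner product with itself. The third derivative of
  \<open>v\<close> is then interpolated; the exponents come from splitting a factor
  \<open>1 / \<delta>\<close> as \<open>1 / \<delta>\<^sup>2\<close> times \<delta> before Young's
  inequality.\<close>

lemma kawahara_op_interpolation:
  "\<exists>K>0. \<forall>v \<delta>. v \<in> kawahara_dom \<alpha> \<longrightarrow> kawahara_op v \<in> kawahara_dom \<alpha> \<longrightarrow> 0 < \<delta> \<longrightarrow> \<delta> \<le> 1 \<longrightarrow>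
     (norm (kawahara_op v))\<^sup>2 \<le> K * ((norm (wderiv 2 v))\<^sup>2 / \<delta> ^ 4 + \<delta>\<^sup>2 * (norm (wderiv 2 (kawahara_op v)))\<^sup>2)"
proof -
  obtain K where K: "K \<ge> 1" and b: "\<And>v \<delta>. v \<in> sobolev 5 \<Longrightarrow> 0 < \<delta> \<Longrightarrow> \<delta> \<le> 1 \<Longrightarrow>
     norm (wderiv 3 v) \<le> K * (norm (wderiv 2 v) / \<delta> + \<delta> * norm (kawahara_op v))"
    using wderiv3_interpolation by blast
  define M where "M = 2 * K"
  have M: "M \<ge> 2" using K by (simp add: M_def)
  have bound: "(norm (kawahara_op v))\<^sup>2 \<le> (2 * M + M\<^sup>2) * ((norm (wderiv 2 v))\<^sup>2 / \<delta> ^ 4 + \<delta>\<^sup>2 * (norm (wderiv 2 (kawahara_op v)))\<^sup>2)"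
    if v: "v \<in> kawahara_dom \<alpha>" and Av: "kawahara_op v \<in> kawahara_dom \<alpha>" and \<delta>: "0 < \<delta>" "\<delta> \<le> 1" for v \<delta>
  proof -
    let ?n = "norm (kawahara_op v)" and ?p = "norm (wderiv 2 v)" and ?q = "norm (wderiv 2 (kawahara_op v))"
    have "?n\<^sup>2 = inner (wderiv 3 v) (wderiv 2 (kawahara_op v)) + inner (wderiv 2 v) (wderiv 1 (kawahara_op v))"
      using kawahara_op_pairing[OF kawahara_dom_sobolev[OF v] Av] by (simp add: power2_norm_eq_inner)
    also have "\<dots> \<le> norm (wderiv 3 v) * ?q + ?p * norm (wderiv 1 (kawahara_op v))"
      by (intro add_mono norm_cauchy_schwarz)
    also have "\<dots> \<le> norm (wderiv 3 v) * ?q + ?p * ?q"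
      using kawahara_dom_poincare(2)[OF Av] by (intro add_mono mult_left_mono) auto
    also have "\<dots> = (norm (wderiv 3 v) + ?p) * ?q" by (simp add: algebra_simps)
    also have "\<dots> \<le> (M * (?p / \<delta> + \<delta> * ?n)) * ?q"
    proof (intro mult_right_mono)
      have "\<delta> * ?p \<le> 1 * ?p" using \<delta> by (intro mult_right_mono) auto
      then have "?p * 1 \<le> ?p / \<delta>" using \<delta> by (simp add: field_simps)
      moreover have "0 \<le> \<delta> * ?n" using \<delta> by simp
      ultimately have "1 * ?p \<le> K * (?p / \<delta> + \<delta> * ?n)" using K by (intro mult_mono) auto
      then show "norm (wderiv 3 v) + ?p \<le> M * (?p / \<delta> + \<delta> * ?n)"
        using b[OF kawahara_dom_sobolev[OF v] \<delta>] unfolding M_def by linarith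
    qed simp
    also have "\<dots> = M * ((?p / \<delta>\<^sup>2) * (\<delta> * ?q)) + ?n * (M * \<delta> * ?q)"
      using \<delta> by (simp add: field_simps power2_eq_square)
    finally have 1: "?n\<^sup>2 \<le> M * ((?p / \<delta>\<^sup>2) * (\<delta> * ?q)) + ?n * (M * \<delta> * ?q)" .
    have 2: "2 * ((?p / \<delta>\<^sup>2) * (\<delta> * ?q)) \<le> (?p / \<delta>\<^sup>2)\<^sup>2 / 1 + 1 * (\<delta> * ?q)\<^sup>2" by (rule young_eps) simp
    have 3: "2 * (?n * (M * \<delta> * ?q)) \<le> ?n\<^sup>2 / 1 + 1 * (M * \<delta> * ?q)\<^sup>2" by (rule young_eps) simp
    have 4: "(?p / \<delta>\<^sup>2)\<^sup>2 = ?p\<^sup>2 / \<delta> ^ 4" "(\<delta> * ?q)\<^sup>2 = \<delta>\<^sup>2 * ?q\<^sup>2" "(M * \<delta> * ?q)\<^sup>2 = M\<^sup>2 * (\<delta>\<^sup>2 * ?q\<^sup>2)"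
      by (simp_all add: power_divide power_mult_distrib flip: power_mult)
    have "2 * (M * ((?p / \<delta>\<^sup>2) * (\<delta> * ?q))) \<le> M * (?p\<^sup>2 / \<delta> ^ 4 + \<delta>\<^sup>2 * ?q\<^sup>2)"
      using mult_left_mono[OF 2, of M] M by (simp add: 4 algebra_simps)
    then have "?n\<^sup>2 \<le> M * (?p\<^sup>2 / \<delta> ^ 4 + \<delta>\<^sup>2 * ?q\<^sup>2) + M\<^sup>2 * (\<delta>\<^sup>2 * ?q\<^sup>2)"
      using 1 3 unfolding 4 by linarith
    also have "\<dots> \<le> (2 * M + M\<^sup>2) * (?p\<^sup>2 / \<delta> ^ 4 + \<delta>\<^sup>2 * ?q\<^sup>2)"
    proof -
      have "0 \<le> M * (?p\<^sup>2 / \<delta> ^ 4 + \<delta>\<^sup>2 * ?q\<^sup>2)" "0 \<le> M\<^sup>2 * (?p\<^sup>2 / \<delta> ^ 4)" using M \<delta> by auto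
      moreover have "M * (a + b) + M\<^sup>2 * b \<le> (2 * M + M\<^sup>2) * (a + b)"
        if "0 \<le> M * (a + b)" "0 \<le> M\<^sup>2 * a" for a b :: real
        using that by (simp add: algebra_simps)
      ultimately show ?thesis by blast
    qed
    finally show ?thesis .
  qed
  have "2 * M + M\<^sup>2 > 0" using M by (intro add_pos_nonneg) auto
  then show ?thesis using bound by blast
qed

subsection \<open>Surjectivity of the Kawahara operator\<close>

text \<open>Each \<open>prim_l2\<close> contributes 1/2 to the squared norm, so the affine map is a
  contraction with factor 1/2.\<close>

lemma prim_l2_prim_l2_fixpoint: "\<exists>!w. w = prim_l2 (prim_l2 w) + f"
proof -
  have "\<forall>x y. dist (prim_l2 (prim_l2 x) + f) (prim_l2 (prim_l2 y) + f) \<le> 1/2 * dist x y"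
  proof (intro allI)
    fix x y
    have "prim_l2 (prim_l2 x) - prim_l2 (prim_l2 y) = prim_l2 (prim_l2 (x - y))"
      by (simp add: linear_diff[OF bounded_linear.linear[OF bounded_linear_prim_l2]])
    moreover have "(norm (prim_l2 (prim_l2 (x - y))))\<^sup>2 \<le> (1/2 * norm (x - y))\<^sup>2"
      using norm_prim_l2_sq_le[of "prim_l2 (x - y)"] norm_prim_l2_sq_le[of "x - y"] by (simp add: power_mult_distrib power_divide)
    then have "norm (prim_l2 (prim_l2 (x - y))) \<le> 1/2 * norm (x - y)" by (rule power2_le_imp_le) simp
    ultimately show "dist (prim_l2 (prim_l2 x) + f) (prim_l2 (prim_l2 y) + f) \<le> 1/2 * dist x y" by (simp add: dist_norm)
  qed
  from banach_fix_type[OF _ _ this] show ?thesis by (simp add: eq_commute)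
qed

definition volterra_inv :: "l2 \<Rightarrow> l2" where "volterra_inv f = (THE w. w = prim_l2 (prim_l2 w) + f)"

lemma volterra_inv_eq: "volterra_inv f = prim_l2 (prim_l2 (volterra_inv f)) + f"
  unfolding volterra_inv_def by (rule theI'[OF prim_l2_prim_l2_fixpoint])

lemma volterra_inv_unique: "w = prim_l2 (prim_l2 w) + f \<Longrightarrow> volterra_inv f = w"
  using prim_l2_prim_l2_fixpoint[of f] volterra_inv_eq[of f] by blast

lemma linear_volterra_inv: "linear volterra_inv"
proof
  note lin = bounded_linear.linear[OF bounded_linear_prim_l2]
  show "volterra_inv (f + g) = volterra_inv f + volterra_inv g" for f g
  proof (rule volterra_inv_unique)
    have "volterra_inv f + volterra_inv g = (prim_l2 (prim_l2 (volterra_inv f)) + f) + (prim_l2 (prim_l2 (volterra_inv g)) + g)"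
      by (rule arg_cong2[where f = plus, OF volterra_inv_eq volterra_inv_eq])
    also have "\<dots> = prim_l2 (prim_l2 (volterra_inv f + volterra_inv g)) + (f + g)" by (simp add: linear_add[OF lin])
    finally show "volterra_inv f + volterra_inv g = prim_l2 (prim_l2 (volterra_inv f + volterra_inv g)) + (f + g)" .
  qed
  show "volterra_inv (c *\<^sub>R f) = c *\<^sub>R volterra_inv f" for c f
  proof (rule volterra_inv_unique)
    show "c *\<^sub>R volterra_inv f = prim_l2 (prim_l2 (c *\<^sub>R volterra_inv f)) + c *\<^sub>R f"
      by (subst volterra_inv_eq) (simp add: linear_scale[OF lin] scaleR_add_right)
  qed
qed

lemma is_wderiv_prim_l2: "is_wderiv 1 (prim_l2 h) h"
  using is_wderiv_const_l2_prim_l2[of 0 h] by (simp add: const_l2_0)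

lemma is_wderiv_prim_l2_const_l2: "is_wderiv 1 (prim_l2 h + const_l2 c) h"
  using is_wderiv_const_l2_prim_l2[of c h] by (simp add: add.commute)

text \<open>For data \<open>f\<close> and parameters \<open>(a, b, c)\<close>, the function with third derivative \<open>w = trial3 f a b\<close>
  and \<open>v(0) = v'(0) = 0\<close>, \<open>v''(0) = c\<close> solves \<open>v''''' - v''' = f\<close>, because \<open>w'' - w = f\<close> means
  \<open>w = P\<^sup>2 w + P\<^sup>2 f + a + b x\<close> for the operator \<open>P = prim_l2\<close> of taking primitives. The boundary
  conditions at \<open>1\<close> then become three linear equations for \<open>(a, b, c)\<close>; they are solvable because the
  homogeneous system is injective by the energy identity.\<close>

definition trial3 :: "l2 \<Rightarrow> complex \<Rightarrow> complex \<Rightarrow> l2" where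
  "trial3 f a b = volterra_inv (prim_l2 (prim_l2 f) + const_l2 a + prim_l2 (const_l2 b))"

definition trial_bc :: "real \<Rightarrow> l2 \<Rightarrow> complex \<times> complex \<times> complex \<Rightarrow> complex \<times> complex \<times> complex" where
  "trial_bc \<alpha> f = (\<lambda>(a, b, c). (prim (prim_l2 (prim_l2 (trial3 f a b) + const_l2 c)) 1, prim (prim_l2 (trial3 f a b) + const_l2 c) 1,
     prim (trial3 f a b) 1 + c - complex_of_real \<alpha> * c))"

lemma trial3_eq: "trial3 f a b = prim_l2 (prim_l2 (trial3 f a b) + prim_l2 f + const_l2 b) + const_l2 a"
proof -
  have "trial3 f a b = prim_l2 (prim_l2 (trial3 f a b)) + (prim_l2 (prim_l2 f) + const_l2 a + prim_l2 (const_l2 b))"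
    unfolding trial3_def by (rule volterra_inv_eq)
  then show ?thesis by (simp add: linear_add[OF bounded_linear.linear[OF bounded_linear_prim_l2]] algebra_simps)
qed

lemma trial_solution:
  fixes f a b c
  defines "v \<equiv> prim_l2 (prim_l2 (prim_l2 (trial3 f a b) + const_l2 c))"
  assumes bc: "trial_bc \<alpha> f (a, b, c) = 0"
  shows "v \<in> kawahara_dom \<alpha>" "kawahara_op v = f" "wderiv 2 v = prim_l2 (trial3 f a b) + const_l2 c" "wderiv 3 v = trial3 f a b"
proof -
  note lin = bounded_linear.linear[OF bounded_linear_prim_l2]
  define t where "t = trial3 f a b"
  define w :: "nat \<Rightarrow> l2" where "w k = [v, prim_l2 (prim_l2 t + const_l2 c), prim_l2 t + const_l2 c, t, prim_l2 t + prim_l2 f + const_l2 b, t + f] ! k" for k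
  have t3: "is_wderiv 1 t (prim_l2 t + prim_l2 f + const_l2 b)"
    using is_wderiv_prim_l2_const_l2[of "prim_l2 t + prim_l2 f + const_l2 b" a] trial3_eq[of f a b] by (simp add: t_def)
  have t4: "is_wderiv 1 (prim_l2 t + prim_l2 f + const_l2 b) (t + f)"
    using is_wderiv_prim_l2_const_l2[of "t + f" b] by (simp add: linear_add[OF lin])
  have w: "is_wderiv 1 (w k) (w (Suc k))" if "k < 5" for k
  proof -
    have "k = 0 \<or> k = 1 \<or> k = 2 \<or> k = 3 \<or> k = 4" using that by auto
    then show ?thesis
      using is_wderiv_prim_l2[of "prim_l2 (prim_l2 t + const_l2 c)"] is_wderiv_prim_l2[of "prim_l2 t + const_l2 c"] is_wderiv_prim_l2_const_l2[of t c] t3 t4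
      by (auto simp: w_def v_def t_def)
  qed
  have w0: "w 0 = v" by (simp add: w_def)
  have s: "v \<in> sobolev 5" using wderiv_chain(1)[of 5 w, OF w] by (simp add: w0)
  have D: "wderiv k v = w k" if "k \<le> 5" for k using wderiv_chain(2)[of 5 w, OF w] that by (simp add: w0)
  have D1: "wderiv 1 v = prim_l2 (prim_l2 t + const_l2 c)" and D2: "wderiv 2 v = prim_l2 t + const_l2 c" and D3: "wderiv 3 v = t"
    and D5: "wderiv 5 v = t + f"
    using D[of 1] D[of 2] D[of 3] D[of 5] by (simp_all add: w_def)
  show "wderiv 2 v = prim_l2 (trial3 f a b) + const_l2 c" "wderiv 3 v = trial3 f a b" using D2 D3 by (simp_all add: t_def)
  show "kawahara_op v = f" by (simp add: kawahara_op_def D3 D5)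
  have "point_value (wderiv 2 v) p = c + prim t p" if "p \<in> {0..1}" for p
    unfolding D2 using point_value_const_l2_prim_l2[OF that, of c t] by (simp add: add.commute)
  moreover have "c + prim t 1 = complex_of_real \<alpha> * c"
    using bc by (simp add: trial_bc_def zero_prod_def t_def algebra_simps)
  ultimately show "v \<in> kawahara_dom \<alpha>"
    using bc s point_value_prim_l2[of 0 "prim_l2 (prim_l2 t + const_l2 c)"] point_value_prim_l2[of 1 "prim_l2 (prim_l2 t + const_l2 c)"]
      point_value_prim_l2[of 0 "prim_l2 t + const_l2 c"] point_value_prim_l2[of 1 "prim_l2 t + const_l2 c"]
    by (simp add: kawahara_dom_def D1[unfolded v_def, folded t_def] v_def trial_bc_def prim_0 zero_prod_def del: One_nat_def flip: t_def)
qed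

text \<open>Linearity is joint in the data and the parameters. For fixed \<open>f\<close> the
  boundary defect is therefore affine in the parameters, with linear part
  \<open>trial_bc \<alpha> 0\<close>.\<close>

lemma trial_bc_add: "trial_bc \<alpha> (f + g) (x + y) = trial_bc \<alpha> f x + trial_bc \<alpha> g y"
proof -
  note l = linear_add[OF bounded_linear.linear[OF bounded_linear_prim_l2]] linear_add[OF linear_volterra_inv] const_l2_add prim_add
  have t: "trial3 (f + g) (a + a') (b + b') = trial3 f a b + trial3 g a' b'" for a a' b b'
  proof -
    have "prim_l2 (prim_l2 (f + g)) + const_l2 (a + a') + prim_l2 (const_l2 (b + b')) =
      (prim_l2 (prim_l2 f) + const_l2 a + prim_l2 (const_l2 b)) + (prim_l2 (prim_l2 g) + const_l2 a' + prim_l2 (const_l2 b'))"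
      by (simp add: l algebra_simps)
    then show ?thesis unfolding trial3_def by (simp only: linear_add[OF linear_volterra_inv])
  qed
  show ?thesis
    by (cases x; cases y) (simp add: trial_bc_def t l algebra_simps)
qed

lemma trial_bc_scaleR: "trial_bc \<alpha> (r *\<^sub>R f) (r *\<^sub>R x) = r *\<^sub>R trial_bc \<alpha> f x"
proof -
  note l = linear_add[OF bounded_linear.linear[OF bounded_linear_prim_l2]] linear_scale[OF bounded_linear.linear[OF bounded_linear_prim_l2]]
    linear_scale[OF linear_volterra_inv] const_l2_scaleR prim_scaleR prim_add
  have t: "trial3 (r *\<^sub>R f) (r *\<^sub>R a) (r *\<^sub>R b) = r *\<^sub>R trial3 f a b" for a b
  proof -
    have "prim_l2 (prim_l2 (r *\<^sub>R f)) + const_l2 (r *\<^sub>R a) + prim_l2 (const_l2 (r *\<^sub>R b)) = r *\<^sub>R (prim_l2 (prim_l2 f) + const_l2 a + prim_l2 (const_l2 b))"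
      by (simp add: l scaleR_add_right)
    then show ?thesis unfolding trial3_def by (simp only: linear_scale[OF linear_volterra_inv])
  qed
  show ?thesis
    by (cases x) (simp add: trial_bc_def t l scaleR_add_right scaleR_diff_right)
qed

lemma kawahara_op_surj:
  assumes \<alpha>: "\<bar>\<alpha>\<bar> < 1"
  shows "\<exists>v\<in>kawahara_dom \<alpha>. kawahara_op v = f"
proof -
  let ?L = "trial_bc \<alpha> 0"
  have lin: "linear ?L"
    using trial_bc_add[of \<alpha> 0 0] trial_bc_scaleR[of \<alpha> _ 0] by (intro linearI) simp_all
  have "x = 0" if "?L x = 0" for x
  proof -
    obtain a b c where x: "x = (a, b, c)" by (cases x)
    let ?v = "prim_l2 (prim_l2 (prim_l2 (trial3 0 a b) + const_l2 c))"
    note v = trial_solution[OF that[unfolded x]]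
    have "1 - \<alpha>\<^sup>2 > 0" using \<alpha> by (simp add: abs_square_less_1)
    moreover have "(1 - \<alpha>\<^sup>2) * (norm (wderiv 2 ?v))\<^sup>2 \<le> 0"
      using kawahara_wderiv2_bound[OF \<alpha> v(1)] v(2) by simp
    ultimately have "wderiv 2 ?v = 0" by (simp add: mult_le_0_iff)
    then have z2: "prim_l2 (trial3 0 a b) + const_l2 c = 0" using v(3) by simp
    \<comment> \<open>Used twice: on the second derivative, which gives \<open>c = 0\<close> and a
      vanishing third derivative, and then on the equation for \<open>trial3\<close>, which gives
      the other two parameters.\<close>
    have uniq: "h = 0 \<and> d = 0" if "prim_l2 h + const_l2 d = 0" for h d
    proof -
      have w: "is_wderiv 1 (0::l2) h" using is_wderiv_prim_l2_const_l2[of h d] that by simp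
      have w0: "is_wderiv 1 (0::l2) 0" using is_wderiv_prim_l2[of 0] by (simp add: linear_0[OF bounded_linear.linear[OF bounded_linear_prim_l2]])
      have "h = 0" by (rule is_wderiv_unique[OF w w0])
      moreover from this that have "norm (const_l2 d) = 0" by (simp add: linear_0[OF bounded_linear.linear[OF bounded_linear_prim_l2]])
      ultimately show ?thesis by (simp add: norm_const_l2)
    qed
    have "c = 0" "trial3 0 a b = 0" using uniq[OF z2] by auto
    then have "prim_l2 (const_l2 b) + const_l2 a = 0" using trial3_eq[of 0 a b]
      by (simp add: linear_0[OF bounded_linear.linear[OF bounded_linear_prim_l2]])
    from uniq[OF this] have "norm (const_l2 b) = 0" "a = 0" by auto
    then show "x = 0" using \<open>c = 0\<close> by (simp add: x norm_const_l2 zero_prod_def)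
  qed
  then have "inj ?L" using linear_injective_0[OF lin] by blast
  then have "surj ?L" by (rule linear_inj_imp_surj[OF lin])
  then obtain x where x: "?L x = - trial_bc \<alpha> f 0" by (metis surj_def)
  have "trial_bc \<alpha> f x = trial_bc \<alpha> f 0 + ?L x" using trial_bc_add[of \<alpha> f 0 0 x] by simp
  then have "trial_bc \<alpha> f x = 0" using x by simp
  then show ?thesis using trial_solution[of \<alpha> f "fst x" "fst (snd x)" "snd (snd x)"] by auto
qed

subsection \<open>The Banach algebra of bounded operators on \<open>L\<^sup>2\<close>\<close>

text \<open>A type of its own for bounded operators, so that composition becomes ring multiplication
  and the exponential series of a Banach algebra is available.\<close>

typedef endo = "UNIV :: (l2 \<Rightarrow>\<^sub>L l2) set" morphisms blinfun_of_endo Endo ..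

setup_lifting type_definition_endo

instantiation endo :: real_algebra_1
begin

lift_definition zero_endo :: endo is 0 .
lift_definition one_endo :: endo is id_blinfun .
lift_definition plus_endo :: "endo \<Rightarrow> endo \<Rightarrow> endo" is "(+)" .
lift_definition minus_endo :: "endo \<Rightarrow> endo \<Rightarrow> endo" is "(-)" .
lift_definition uminus_endo :: "endo \<Rightarrow> endo" is uminus .
lift_definition times_endo :: "endo \<Rightarrow> endo \<Rightarrow> endo" is "(o\<^sub>L)" .
lift_definition scaleR_endo :: "real \<Rightarrow> endo \<Rightarrow> endo" is "(*\<^sub>R)" .

instance
proof
  fix u v w :: endo and a b :: real
  show "u + v + w = u + (v + w)" "u + v = v + u" "0 + u = u" "- u + u = 0" "u - v = u + - v"
    by (transfer; simp)+
  show "a *\<^sub>R (u + v) = a *\<^sub>R u + a *\<^sub>R v" "(a + b) *\<^sub>R u = a *\<^sub>R u + b *\<^sub>R u" "a *\<^sub>R b *\<^sub>R u = (a * b) *\<^sub>R u" "1 *\<^sub>R u = u"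
    by (transfer; simp add: algebra_simps)+
  show "u * v * w = u * (v * w)" "(u + v) * w = u * w + v * w" "u * (v + w) = u * v + u * w"
    "1 * u = u" "u * 1 = u" "a *\<^sub>R u * v = a *\<^sub>R (u * v)" "u * a *\<^sub>R v = a *\<^sub>R (u * v)"
    by (transfer; rule blinfun_eqI; simp add: blinfun.add_left blinfun.add_right blinfun.scaleR_left blinfun.scaleR_right)+
  show "(0::endo) \<noteq> 1"
  proof
    assume "(0::endo) = 1"
    then have "(0 :: l2 \<Rightarrow>\<^sub>L l2) = id_blinfun" by transfer
    from arg_cong[OF this, of "\<lambda>f. f (const_l2 1)"] have "norm (const_l2 1) = 0" by simp
    then show False by (simp add: norm_const_l2)
  qed
qed

end

instantiation endo :: real_normed_algebra_1
begin

lift_definition norm_endo :: "endo \<Rightarrow> real" is norm .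
definition dist_endo :: "endo \<Rightarrow> endo \<Rightarrow> real" where "dist_endo u v = norm (u - v)"
definition sgn_endo :: "endo \<Rightarrow> endo" where "sgn_endo u = u /\<^sub>R norm u"
definition uniformity_endo :: "(endo \<times> endo) filter" where
  "uniformity_endo = (INF e\<in>{0 <..}. principal {(u, v). dist u v < e})"
definition open_endo :: "endo set \<Rightarrow> bool" where
  "open_endo U \<longleftrightarrow> (\<forall>u\<in>U. \<forall>\<^sub>F (u', v) in uniformity. u' = u \<longrightarrow> v \<in> U)"

instance
proof
  fix u v w :: endo and a b :: real
  show "norm u = 0 \<longleftrightarrow> u = 0" "norm (u + v) \<le> norm u + norm v" "norm (a *\<^sub>R u) = \<bar>a\<bar> * norm u"
    by (transfer; simp add: norm_triangle_ineq)+
  show "norm (u * v) \<le> norm u * norm v" by transfer (rule norm_blinfun_compose)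
  have one: "norm (id_blinfun :: l2 \<Rightarrow>\<^sub>L l2) = 1"
  proof (rule antisym[OF norm_blinfun_id_le])
    show "1 \<le> norm (id_blinfun :: l2 \<Rightarrow>\<^sub>L l2)" using norm_blinfun[of "id_blinfun" "const_l2 1"] by (simp add: norm_const_l2)
  qed
  then show "norm (1::endo) = 1" by transfer
  show "sgn u = u /\<^sub>R norm u" by (simp add: sgn_endo_def)
  show "dist u v = norm (u - v)" by (simp add: dist_endo_def)
  show "uniformity = (INF e\<in>{0 <..}. principal {(u::endo, v). dist u v < e})"
    by (simp add: uniformity_endo_def)
  show "open U \<longleftrightarrow> (\<forall>u\<in>U. \<forall>\<^sub>F (u', v) in uniformity. u' = u \<longrightarrow> v \<in> U)" for U :: "endo set"
    by (simp add: open_endo_def)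
qed

end

lemma dist_blinfun_of_endo: "dist (blinfun_of_endo u) (blinfun_of_endo v) = dist u v"
  by (simp add: dist_norm norm_endo.rep_eq minus_endo.rep_eq)

instance endo :: banach
proof
  fix X :: "nat \<Rightarrow> endo" assume "Cauchy X"
  then have "Cauchy (\<lambda>n. blinfun_of_endo (X n))" unfolding Cauchy_def dist_blinfun_of_endo .
  then obtain L where "(\<lambda>n. blinfun_of_endo (X n)) \<longlonglongrightarrow> L" using Cauchy_convergent_iff convergent_def by blast
  then have "(\<lambda>n. blinfun_of_endo (X n)) \<longlonglongrightarrow> blinfun_of_endo (Endo L)" by (simp add: Endo_inverse)
  then have "X \<longlonglongrightarrow> Endo L" unfolding lim_sequentially dist_blinfun_of_endo .
  then show "convergent X" by (auto simp: convergent_def)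
qed

definition ap :: "endo \<Rightarrow> l2 \<Rightarrow> l2" where "ap e = blinfun_apply (blinfun_of_endo e)"

lemma bounded_bilinear_ap: "bounded_bilinear ap"
proof
  show "\<exists>K. \<forall>a b. norm (ap a b) \<le> norm a * norm b * K"
    by (intro exI[of _ 1]) (simp add: ap_def norm_endo.rep_eq norm_blinfun)
qed (simp_all add: ap_def plus_endo.rep_eq scaleR_endo.rep_eq blinfun.add_left blinfun.add_right blinfun.scaleR_left blinfun.scaleR_right)

interpretation ap: bounded_bilinear ap by (rule bounded_bilinear_ap)

lemma norm_ap_le: "norm (ap e v) \<le> norm e * norm v"
  by (simp add: ap_def norm_endo.rep_eq norm_blinfun)

lemma ap_times: "ap (a * b) v = ap a (ap b v)" and ap_one: "ap 1 v = v"
  by (simp_all add: ap_def times_endo.rep_eq one_endo.rep_eq)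

lemma ap_Endo: "bounded_linear f \<Longrightarrow> ap (Endo (Blinfun f)) = f"
  by (simp add: ap_def Endo_inverse bounded_linear_Blinfun_apply)

lemma endo_eqI: "(\<And>v. ap a v = ap b v) \<Longrightarrow> a = b"
  by (metis ap_def blinfun_eqI blinfun_of_endo_inject)

lemma norm_endo_le: "0 \<le> B \<Longrightarrow> (\<And>v. norm (ap e v) \<le> B * norm v) \<Longrightarrow> norm e \<le> B"
  unfolding ap_def norm_endo.rep_eq by (rule norm_blinfun_bound)

section \<open>Exponentials of commuting operators and a mean value bound\<close>

lemma exp_commute:
  fixes b c :: "'a::{real_normed_algebra_1,banach}"
  assumes "b * c = c * b" shows "exp b * c = c * exp b"
proof -
  have p: "b ^ n * c = c * b ^ n" for n
    by (induction n) (simp_all add: mult.assoc assms, simp add: assms flip: mult.assoc)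
  have "exp b * c = (\<Sum>n. (b ^ n /\<^sub>R fact n) * c)"
    unfolding exp_def by (rule suminf_mult2[OF summable_exp_generic])
  also have "\<dots> = (\<Sum>n. c * (b ^ n /\<^sub>R fact n))" by (simp add: p)
  also have "\<dots> = c * exp b" unfolding exp_def by (rule suminf_mult[OF summable_exp_generic])
  finally show ?thesis .
qed

lemma exp_scaleR_commute:
  fixes b c :: "'a::{real_normed_algebra_1,banach}"
  assumes "b * c = c * b" shows "exp (s *\<^sub>R b) * exp (t *\<^sub>R c) = exp (s *\<^sub>R b + t *\<^sub>R c)"
  by (rule exp_add_commuting[symmetric]) (simp add: assms)

lemma vector_mvt_bound:
  fixes f :: "real \<Rightarrow> 'x::real_normed_vector"
  assumes "0 \<le> t" and d: "\<And>s. s \<in> {0..t} \<Longrightarrow> (f has_vector_derivative f' s) (at s within {0..t})"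
    and b: "\<And>s. s \<in> {0..t} \<Longrightarrow> norm (f' s) \<le> B"
  shows "norm (f t - f 0) \<le> t * B"
proof -
  have "norm (f t - f 0) \<le> B * norm (t - 0)"
  proof (rule differentiable_bound[of "{0..t}" f "\<lambda>s h. h *\<^sub>R f' s"])
    show "(f has_derivative (\<lambda>h. h *\<^sub>R f' s)) (at s within {0..t})" if "s \<in> {0..t}" for s
      using d[OF that] by (simp add: has_vector_derivative_def)
    show "onorm (\<lambda>h. h *\<^sub>R f' s) \<le> B" if "s \<in> {0..t}" for s
    proof (rule onorm_bound)
      show "0 \<le> B" by (rule order_trans[OF norm_ge_zero b[OF that]])
      show "norm (h *\<^sub>R f' s) \<le> B * norm h" for h
        using mult_right_mono[OF b[OF that], of "norm h"] by (simp add: mult.commute)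
    qed
  qed (use assms in auto)
  then show ?thesis using assms(1) by (simp add: mult.commute)
qed

subsection \<open>The Lumer--Phillips theorem\<close>

locale m_dissipative =
  fixes D :: "l2 set" and A :: "l2 \<Rightarrow> l2"
  assumes D: "subspace D"
    and A_add: "\<And>u v. u \<in> D \<Longrightarrow> v \<in> D \<Longrightarrow> A (u + v) = A u + A v"
    and A_scale: "\<And>c u. u \<in> D \<Longrightarrow> A (c *\<^sub>R u) = c *\<^sub>R A u"
    and dissipative: "\<And>u. u \<in> D \<Longrightarrow> inner (A u) u \<le> 0"
    and range: "\<And>l f. l > 0 \<Longrightarrow> \<exists>u\<in>D. l *\<^sub>R u - A u = f"
begin

lemma A_diff: "u \<in> D \<Longrightarrow> v \<in> D \<Longrightarrow> A (u - v) = A u - A v"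
  using A_add[of u "(-1) *\<^sub>R v"] A_scale[of v "-1"] D by (simp add: subspace_neg)

lemma resolvent_bound:
  assumes "l > 0" "u \<in> D" shows "l * norm u \<le> norm (l *\<^sub>R u - A u)"
proof (cases "u = 0")
  case False
  have "l * (norm u * norm u) \<le> inner (l *\<^sub>R u - A u) u"
    using dissipative[OF assms(2)] by (simp add: inner_diff_left dot_square_norm power2_eq_square)
  also have "\<dots> \<le> norm (l *\<^sub>R u - A u) * norm u" by (rule norm_cauchy_schwarz)
  finally show ?thesis using False by (simp flip: mult.assoc)
qed simp

lemma resolvent_ex1: "l > 0 \<Longrightarrow> \<exists>!u. u \<in> D \<and> l *\<^sub>R u - A u = f"
proof (rule ex_ex1I)
  assume l: "l > 0"
  show "\<exists>u. u \<in> D \<and> l *\<^sub>R u - A u = f" using range[OF l] by blast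
  fix u v assume "u \<in> D \<and> l *\<^sub>R u - A u = f" "v \<in> D \<and> l *\<^sub>R v - A v = f"
  then have uv: "u - v \<in> D" "l *\<^sub>R (u - v) - A (u - v) = 0"
    using D by (auto simp: subspace_diff A_diff algebra_simps)
  then show "u = v" using resolvent_bound[OF l uv(1)] l by (simp add: mult_le_0_iff)
qed

definition R :: "real \<Rightarrow> l2 \<Rightarrow> l2" where "R l f = (THE u. u \<in> D \<and> l *\<^sub>R u - A u = f)"

lemma R: "l > 0 \<Longrightarrow> R l f \<in> D" "l > 0 \<Longrightarrow> l *\<^sub>R R l f - A (R l f) = f"
  unfolding R_def using theI'[OF resolvent_ex1, of l f] by blast+

lemma R_eqI: "l > 0 \<Longrightarrow> u \<in> D \<Longrightarrow> l *\<^sub>R u - A u = f \<Longrightarrow> R l f = u"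
  unfolding R_def by (rule the1_equality[OF resolvent_ex1]) auto

lemma norm_R_le: "l > 0 \<Longrightarrow> norm (R l f) \<le> 1 / l * norm f"
  using resolvent_bound[OF _ R(1), of l l f] R(2)[of l f] by (simp add: field_simps)

lemma bounded_linear_R: "l > 0 \<Longrightarrow> bounded_linear (R l)"
proof (rule bounded_linear_intro[where K = "1 / l"])
  assume l: "l > 0"
  show "R l (f + g) = R l f + R l g" for f g
    by (rule R_eqI[OF l]) (use R[OF l, of f] R[OF l, of g] D in \<open>auto simp: subspace_add A_add algebra_simps\<close>)
  show "R l (c *\<^sub>R f) = c *\<^sub>R R l f" for c f
  proof (rule R_eqI[OF l])
    show "c *\<^sub>R R l f \<in> D" using R[OF l] D by (simp add: subspace_scale)
    show "l *\<^sub>R c *\<^sub>R R l f - A (c *\<^sub>R R l f) = c *\<^sub>R f"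
      using arg_cong[OF R(2)[OF l, of f], of "(*\<^sub>R) c"] R(1)[OF l]
      by (simp add: A_scale scaleR_diff_right mult.commute)
  qed
  show "norm (R l f) \<le> norm f * (1 / l)" for f using norm_R_le[OF l, of f] by (simp add: mult.commute)
qed

lemma R_A: "l > 0 \<Longrightarrow> u \<in> D \<Longrightarrow> R l (A u) = l *\<^sub>R R l u - u"
proof -
  assume l: "l > 0" and u: "u \<in> D"
  have "R l (l *\<^sub>R u - A u) = u" by (rule R_eqI[OF l u refl])
  then have "l *\<^sub>R R l u - R l (A u) = u"
    by (simp add: linear_diff[OF bounded_linear.linear[OF bounded_linear_R[OF l]]]
        linear_scale[OF bounded_linear.linear[OF bounded_linear_R[OF l]]])
  then show ?thesis by (simp add: algebra_simps)
qed

lemma resolvent_identity: "l > 0 \<Longrightarrow> m > 0 \<Longrightarrow> R m f = R l f + (l - m) *\<^sub>R R l (R m f)"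
proof -
  assume l: "l > 0" and m: "m > 0"
  have "R l (f + (l - m) *\<^sub>R R m f) = R m f"
    by (rule R_eqI[OF l]) (use R[OF m, of f] in \<open>auto simp: algebra_simps\<close>)
  then show ?thesis
    by (simp add: linear_add[OF bounded_linear.linear[OF bounded_linear_R[OF l]]]
        linear_scale[OF bounded_linear.linear[OF bounded_linear_R[OF l]]])
qed

lemma R_commute: "l > 0 \<Longrightarrow> m > 0 \<Longrightarrow> R l (R m f) = R m (R l f)"
proof (cases "l = m")
  case False
  assume l: "l > 0" and m: "m > 0"
  have "(l - m) *\<^sub>R R l (R m f) = R m f - R l f"
    using resolvent_identity[OF l m, of f] by (simp add: algebra_simps)
  also have "\<dots> = (l - m) *\<^sub>R R m (R l f)"
    using resolvent_identity[OF m l, of f] by (simp add: algebra_simps)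
  finally show ?thesis using False by simp
qed simp

text \<open>Density is a consequence in a Hilbert space: if \<open>v\<close> is orthogonal to
  \<open>D\<close>, testing the resolvent equation for \<open>u = R 1 v\<close> with
  \<open>u\<close> itself and using dissipativity forces \<open>u = 0\<close>.\<close>

lemma dense_D: "closure D = UNIV"
proof (rule dense_subspace[OF D])
  fix v assume v: "\<And>m. m \<in> D \<Longrightarrow> inner v m = 0"
  let ?u = "R 1 v"
  have "inner (1 *\<^sub>R ?u - A ?u) ?u = 0" using v R[of 1 v] by simp
  then have "inner ?u ?u \<le> 0" using dissipative[OF R(1), of 1 v] by (simp add: inner_diff_left)
  then have "?u = 0" by (metis inner_eq_zero_iff inner_ge_zero order_antisym)
  then show "v = 0" using R(2)[of 1 v] A_scale[OF subspace_0[OF D], of 0] by simp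
qed

lemma D_approx: "e > 0 \<Longrightarrow> \<exists>w\<in>D. norm (w - v) < e"
  using dense_D closure_approachable[of v D] by (auto simp: dist_norm)

text \<open>On \<open>D\<close> the error is \<open>R l (A w)\<close>, of order
  \<open>1 / l\<close>; the operators \<open>l R l\<close> are contractions, so density gives
  convergence everywhere.\<close>

lemma lR_tendsto: "(\<lambda>n. real (Suc n) *\<^sub>R R (real (Suc n)) v) \<longlonglongrightarrow> v"
proof (rule LIMSEQ_I)
  fix e :: real assume e: "e > 0"
  then obtain w where w: "w \<in> D" "norm (w - v) < e / 3" using D_approx[of "e/3" v] by auto
  obtain N where N: "3 * norm (A w) / e < real (Suc N)"
    by (metis reals_Archimedean2 less_trans lessI of_nat_less_iff)
  have "norm (real (Suc n) *\<^sub>R R (real (Suc n)) v - v) < e" if n: "n \<ge> N" for n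
  proof -
    let ?l = "real (Suc n)"
    have l: "?l > 0" by simp
    note lin = bounded_linear.linear[OF bounded_linear_R[OF l]]
    have "norm (?l *\<^sub>R R ?l (v - w)) \<le> ?l * (1 / ?l * norm (v - w))"
      unfolding norm_scaleR abs_of_pos[OF l] by (intro mult_left_mono norm_R_le) auto
    then have 1: "norm (?l *\<^sub>R R ?l (v - w)) < e / 3" using w(2) l by (simp add: norm_minus_commute)
    have "3 * norm (A w) / e < ?l" using N n by (smt (verit) of_nat_mono Suc_le_mono)
    then have "1 / ?l * norm (A w) < e / 3" using e l by (simp add: field_simps)
    then have "norm (R ?l (A w)) < e / 3" using norm_R_le[OF l, of "A w"] by linarith
    then have 2: "norm (?l *\<^sub>R R ?l w - w) < e / 3" by (simp only: R_A[OF l w(1)])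
    have "?l *\<^sub>R R ?l v - v = ?l *\<^sub>R R ?l (v - w) + (?l *\<^sub>R R ?l w - w) + (w - v)"
      by (simp only: linear_diff[OF lin] scaleR_diff_right) simp
    from arg_cong[OF this, of norm]
    have "norm (?l *\<^sub>R R ?l v - v) \<le> norm (?l *\<^sub>R R ?l (v - w)) + norm (?l *\<^sub>R R ?l w - w) + norm (w - v)"
      using norm_triangle_ineq[of "?l *\<^sub>R R ?l (v - w) + (?l *\<^sub>R R ?l w - w)" "w - v"]
        norm_triangle_ineq[of "?l *\<^sub>R R ?l (v - w)" "?l *\<^sub>R R ?l w - w"] by linarith
    then show ?thesis using 1 2 w(2) by linarith
  qed
  then show "\<exists>N. \<forall>n\<ge>N. norm (real (Suc n) *\<^sub>R R (real (Suc n)) v - v) < e" by blast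
qed

definition Re :: "nat \<Rightarrow> endo" where "Re n = Endo (Blinfun (R (real (Suc n))))"
text \<open>The Yosida approximation \<open>l A R l\<close> at \<open>l = n + 1\<close>, written
  without \<open>A\<close> so that its boundedness is visible. The shift by one keeps the parameter
  positive.\<close>

definition Y :: "nat \<Rightarrow> endo" where "Y n = (real (Suc n))\<^sup>2 *\<^sub>R Re n - real (Suc n) *\<^sub>R 1"
definition E :: "nat \<Rightarrow> real \<Rightarrow> endo" where "E n t = exp (t *\<^sub>R Y n)"

lemma ap_Re: "ap (Re n) = R (real (Suc n))"
  unfolding Re_def by (rule ap_Endo[OF bounded_linear_R]) simp

lemma norm_Re_le: "norm (Re n) \<le> 1 / real (Suc n)"
  by (rule norm_endo_le) (use norm_R_le[of "real (Suc n)"] in \<open>auto simp: ap_Re simp del: of_nat_Suc\<close>)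

lemma Re_commute: "Re n * Re m = Re m * Re n"
  by (rule endo_eqI) (simp add: ap_times ap_Re R_commute)

lemma Y_commute: "Y n * Y m = Y m * Y n"
  unfolding Y_def using Re_commute[of n m] by (simp add: algebra_simps)

lemma ap_Y: "v \<in> D \<Longrightarrow> ap (Y n) v = real (Suc n) *\<^sub>R R (real (Suc n)) (A v)"
  by (simp add: Y_def ap.diff_left ap.scaleR_left ap_Re ap_one R_A power2_eq_square scaleR_diff_right del: of_nat_Suc)

lemma norm_ap_Y_le: "v \<in> D \<Longrightarrow> norm (ap (Y n) v) \<le> norm (A v)"
  using mult_left_mono[OF norm_R_le[of "real (Suc n)" "A v"], of "real (Suc n)"] by (simp add: ap_Y del: of_nat_Suc)

lemma Y_tendsto: "v \<in> D \<Longrightarrow> (\<lambda>n. ap (Y n) v) \<longlonglongrightarrow> A v"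
  using lR_tendsto[of "A v"] by (simp add: ap_Y)

text \<open>The scalar part of \<open>Y n\<close> is split off: with \<open>l = n + 1\<close>, the
  resolvent part contributes at most \<open>exp (t * l)\<close>, which the scalar factor cancels
  exactly. Estimating through the norm of \<open>Y n\<close> would lose contractivity.\<close>

lemma norm_E_le: "0 \<le> t \<Longrightarrow> norm (E n t) \<le> 1"
proof -
  assume t: "0 \<le> t"
  let ?l = "real (Suc n)"
  have "E n t = exp ((t * ?l\<^sup>2) *\<^sub>R Re n + (- t * ?l) *\<^sub>R 1)"
    by (simp add: E_def Y_def scaleR_diff_right)
  also have "\<dots> = exp ((t * ?l\<^sup>2) *\<^sub>R Re n) * exp ((- t * ?l) *\<^sub>R 1)"
    by (rule exp_scaleR_commute[symmetric]) simp
  also have "exp ((- t * ?l) *\<^sub>R (1::endo)) = of_real (exp (- t * ?l))"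
    using exp_of_real[of "- t * ?l", where 'a = endo] by (simp add: of_real_def)
  finally have E_eq: "E n t = exp ((t * ?l\<^sup>2) *\<^sub>R Re n) * of_real (exp (- t * ?l))" .
  have "norm (E n t) \<le> norm (exp ((t * ?l\<^sup>2) *\<^sub>R Re n)) * norm (of_real (exp (- t * ?l)) :: endo)"
    unfolding E_eq by (rule norm_mult_ineq)
  also have "\<dots> = norm (exp ((t * ?l\<^sup>2) *\<^sub>R Re n)) * exp (- t * ?l)" by simp
  also have "\<dots> \<le> exp (t * ?l) * exp (- t * ?l)"
  proof (rule mult_right_mono)
    have "norm ((t * ?l\<^sup>2) *\<^sub>R Re n) \<le> t * ?l\<^sup>2 * (1 / ?l)"
      unfolding norm_scaleR abs_of_nonneg[OF mult_nonneg_nonneg[OF t zero_le_power2]]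
      by (intro mult_left_mono norm_Re_le mult_nonneg_nonneg t zero_le_power2)
    also have "\<dots> = t * ?l" by (simp add: power2_eq_square)
    finally show "norm (exp ((t * ?l\<^sup>2) *\<^sub>R Re n)) \<le> exp (t * ?l)"
      using norm_exp[of "(t * ?l\<^sup>2) *\<^sub>R Re n"] exp_le_cancel_iff order_trans by blast
  qed simp
  also have "\<dots> = 1" by (simp flip: exp_add)
  finally show ?thesis .
qed

lemma norm_ap_E_le: "0 \<le> t \<Longrightarrow> norm (ap (E n t) v) \<le> norm v"
  using norm_ap_le[of "E n t" v] mult_right_mono[OF norm_E_le, of t "norm v" n] by simp

lemma E_0: "E n 0 = 1" by (simp add: E_def)

lemma E_add: "E n (s + t) = E n s * E n t"
  unfolding E_def using exp_scaleR_commute[of "Y n" "Y n" s t] by (simp add: scaleR_add_left)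

lemma E_derivative: "((\<lambda>s. ap (E n s) v) has_vector_derivative ap (E n s) (ap (Y n) v)) (at s within T)"
proof -
  have "((\<lambda>s. ap (E n s) v) has_vector_derivative ap (E n s * Y n) v) (at s within T)"
    unfolding E_def
    by (rule bounded_linear.has_vector_derivative[OF ap.bounded_linear_left exp_scaleR_has_vector_derivative_right])
  then show ?thesis by (simp add: ap_times)
qed

text \<open>Since the approximations commute, \<open>s \<mapsto> E m (t - s) E n s\<close> runs from
  \<open>E m t\<close> to \<open>E n t\<close>, and its derivative is a contraction applied to the
  difference of the two approximate generators.\<close>

lemma E_diff_le: "0 \<le> t \<Longrightarrow> norm (ap (E n t) v - ap (E m t) v) \<le> t * norm (ap (Y n) v - ap (Y m) v)"
proof -
  assume t: "0 \<le> t"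
  define B where "B = Y n - Y m"
  have comm: "Y m * B = B * Y m" by (simp add: B_def algebra_simps Y_commute[of m n])
  let ?f = "\<lambda>s. ap (exp (t *\<^sub>R Y m)) (ap (exp (s *\<^sub>R B)) v)"
  have f: "ap (exp (t *\<^sub>R Y m)) (ap (exp (s *\<^sub>R B)) x) = ap (E m (t - s)) (ap (E n s) x)" for s x
  proof -
    have "t *\<^sub>R Y m + s *\<^sub>R B = (t - s) *\<^sub>R Y m + s *\<^sub>R Y n" by (simp add: B_def algebra_simps)
    then have "exp (t *\<^sub>R Y m) * exp (s *\<^sub>R B) = exp ((t - s) *\<^sub>R Y m) * exp (s *\<^sub>R Y n)"
      by (simp add: exp_scaleR_commute[OF comm] exp_scaleR_commute[OF Y_commute])
    then show ?thesis by (simp add: E_def flip: ap_times)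
  qed
  have "norm (?f t - ?f 0) \<le> t * norm (ap B v)"
  proof (rule vector_mvt_bound[OF t])
    fix s assume s: "s \<in> {0..t}"
    have "((\<lambda>s. ap (exp (s *\<^sub>R B)) v) has_vector_derivative ap (exp (s *\<^sub>R B) * B) v) (at s within {0..t})"
      by (rule bounded_linear.has_vector_derivative[OF ap.bounded_linear_left exp_scaleR_has_vector_derivative_right])
    then show "(?f has_vector_derivative ap (exp (t *\<^sub>R Y m)) (ap (exp (s *\<^sub>R B)) (ap B v))) (at s within {0..t})"
      unfolding ap_times by (rule bounded_linear.has_vector_derivative[OF ap.bounded_linear_right])
    show "norm (ap (exp (t *\<^sub>R Y m)) (ap (exp (s *\<^sub>R B)) (ap B v))) \<le> norm (ap B v)"
      using s norm_ap_E_le[of "t - s" m "ap (E n s) (ap B v)"] norm_ap_E_le[of s n "ap B v"] by (simp add: f)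
  qed
  moreover have "?f t = ap (E n t) v" "?f 0 = ap (E m t) v" using f[of t v] f[of 0 v] by (simp_all add: E_0 ap_one)
  ultimately show ?thesis by (simp add: B_def ap.diff_left)
qed

lemma E_Cauchy: "0 \<le> t \<Longrightarrow> Cauchy (\<lambda>n. ap (E n t) v)"
proof (rule metric_CauchyI)
  fix e :: real assume t: "0 \<le> t" and e: "e > 0"
  obtain w where w: "w \<in> D" "norm (w - v) < e / 4" using e D_approx[of "e/4" v] by auto
  have "Cauchy (\<lambda>n. ap (Y n) w)" using Y_tendsto[OF w(1)] by (rule LIMSEQ_imp_Cauchy)
  then obtain N where N: "\<And>m n. m \<ge> N \<Longrightarrow> n \<ge> N \<Longrightarrow> dist (ap (Y m) w) (ap (Y n) w) < e / (2 * (t + 1))"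
    using metric_CauchyD[of "\<lambda>n. ap (Y n) w" "e / (2 * (t + 1))"] e t by auto
  have "dist (ap (E m t) v) (ap (E n t) v) < e" if "m \<ge> N" "n \<ge> N" for m n
  proof -
    have "norm (ap (E m t) w - ap (E n t) w) \<le> t * norm (ap (Y m) w - ap (Y n) w)" by (rule E_diff_le[OF t])
    also have "\<dots> \<le> t * (e / (2 * (t + 1)))"
      using N[OF that] t by (intro mult_left_mono) (auto simp: dist_norm)
    also have "\<dots> \<le> e / 2" using t e by (simp add: field_simps)
    finally have 1: "norm (ap (E m t) w - ap (E n t) w) \<le> e / 2" .
    have 2: "norm (ap (E k t) (v - w)) < e / 4" for k
      using norm_ap_E_le[OF t, of k "v - w"] w(2) by (simp add: norm_minus_commute)
    have "ap (E m t) v - ap (E n t) v = (ap (E m t) w - ap (E n t) w) + (ap (E m t) (v - w) - ap (E n t) (v - w))"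
      by (simp add: ap.diff_right)
    also have "norm \<dots> \<le> norm (ap (E m t) w - ap (E n t) w) + (norm (ap (E m t) (v - w)) + norm (ap (E n t) (v - w)))"
      by (intro norm_triangle_le add_left_mono norm_triangle_ineq4)
    finally show ?thesis using 1 2[of m] 2[of n] unfolding dist_norm by linarith
  qed
  then show "\<exists>N. \<forall>m\<ge>N. \<forall>n\<ge>N. dist (ap (E m t) v) (ap (E n t) v) < e" by blast
qed

definition S :: "real \<Rightarrow> l2 \<Rightarrow> l2" where "S t v = lim (\<lambda>n. ap (E n t) v)"

lemma S_lim: "0 \<le> t \<Longrightarrow> (\<lambda>n. ap (E n t) v) \<longlonglongrightarrow> S t v"
  unfolding S_def using E_Cauchy Cauchy_convergent_iff convergent_LIMSEQ_iff by blast

lemma norm_S_le: "0 \<le> t \<Longrightarrow> norm (S t v) \<le> norm v"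
  by (rule LIMSEQ_le_const2[OF tendsto_norm[OF S_lim]]) (auto simp: norm_ap_E_le)

lemma S_add_arg: "0 \<le> t \<Longrightarrow> S t (u + v) = S t u + S t v"
  using tendsto_add[OF S_lim S_lim, of t t u v] S_lim[of t "u + v"] LIMSEQ_unique
  by (simp add: ap.add_right) blast

lemma S_scaleR: "0 \<le> t \<Longrightarrow> S t (c *\<^sub>R v) = c *\<^sub>R S t v"
  using tendsto_scaleR[OF tendsto_const S_lim, of t c v] S_lim[of t "c *\<^sub>R v"] LIMSEQ_unique
  by (simp add: ap.scaleR_right) blast

lemma bounded_linear_S: "0 \<le> t \<Longrightarrow> bounded_linear (S t)"
  by (rule bounded_linear_intro[where K = 1]) (auto simp: S_add_arg S_scaleR norm_S_le)

lemma S_0: "S 0 v = v"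
  using S_lim[of 0 v] by (simp add: E_0 ap_one LIMSEQ_const_iff)

lemma S_semigroup: "0 \<le> s \<Longrightarrow> 0 \<le> t \<Longrightarrow> S (s + t) v = S s (S t v)"
proof -
  assume s: "0 \<le> s" and t: "0 \<le> t"
  have "(\<lambda>n. ap (E n s) (ap (E n t) v) - ap (E n s) (S t v)) \<longlonglongrightarrow> 0"
  proof (rule Lim_null_comparison)
    show "\<forall>\<^sub>F n in sequentially. norm (ap (E n s) (ap (E n t) v) - ap (E n s) (S t v)) \<le> norm (ap (E n t) v - S t v)"
      using norm_ap_E_le[OF s] by (auto simp flip: ap.diff_right)
    show "(\<lambda>n. norm (ap (E n t) v - S t v)) \<longlonglongrightarrow> 0" using S_lim[OF t] LIM_zero tendsto_norm_zero by blast
  qed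
  from tendsto_add[OF this S_lim[OF s, of "S t v"]] have "(\<lambda>n. ap (E n (s + t)) v) \<longlonglongrightarrow> S s (S t v)"
    by (simp add: E_add ap_times)
  then show ?thesis using S_lim[of "s + t" v] s t LIMSEQ_unique by auto
qed

lemma S_minus_id_le: "0 \<le> t \<Longrightarrow> v \<in> D \<Longrightarrow> norm (S t v - v) \<le> t * norm (A v)"
proof (rule LIMSEQ_le_const2)
  assume t: "0 \<le> t" and v: "v \<in> D"
  show "(\<lambda>n. norm (ap (E n t) v - v)) \<longlonglongrightarrow> norm (S t v - v)" by (intro tendsto_intros S_lim t)
  have "norm (ap (E n t) v - ap (E n 0) v) \<le> t * norm (A v)" for n
    by (rule vector_mvt_bound[OF t E_derivative])
      (use order_trans[OF norm_ap_E_le norm_ap_Y_le[OF v]] in auto)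
  then show "\<exists>N. \<forall>n\<ge>N. norm (ap (E n t) v - v) \<le> t * norm (A v)" by (simp add: E_0 ap_one)
qed

lemma S_strongly_continuous: "((\<lambda>t. S t v) \<longlongrightarrow> v) (at_right 0)"
proof (rule tendstoI)
  fix e :: real assume e: "e > 0"
  obtain w where w: "w \<in> D" "norm (w - v) < e / 4" using e D_approx[of "e/4" v] by auto
  define c where "c = norm (A w) + 1"
  have c: "c > 0" by (simp add: c_def add_nonneg_pos)
  define d where "d = e / (2 * c)"
  have d: "d > 0" "d * c = e / 2" using e c by (simp_all add: d_def)
  have "dist (S t v) v < e" if t: "0 < t" "t < d" for t
  proof -
    have "norm (S t w - w) \<le> t * norm (A w)" by (rule S_minus_id_le) (use t w in auto)
    also have "\<dots> \<le> d * c" unfolding c_def using t by (intro mult_mono) auto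
    also have "\<dots> = e / 2" by (rule d(2))
    finally have 1: "norm (S t w - w) \<le> e / 2" .
    have 2: "norm (S t (v - w)) < e / 4" using norm_S_le[of t "v - w"] t w(2) by (simp add: norm_minus_commute)
    have "S t v - v = S t (v - w) + (S t w - w) + (w - v)"
      using t by (simp add: linear_diff[OF bounded_linear.linear[OF bounded_linear_S]])
    also have "norm \<dots> \<le> norm (S t (v - w)) + norm (S t w - w) + norm (w - v)"
      by (intro norm_triangle_le add_right_mono norm_triangle_ineq)
    finally show ?thesis using 1 2 w(2) by (simp add: dist_norm)
  qed
  then show "\<forall>\<^sub>F t in at_right 0. dist (S t v) v < e"
    unfolding eventually_at_right_field using d(1) by blast
qed

text \<open>The remainder of first order is estimated for \<open>E n\<close> uniformly in
  \<open>n\<close> and then passed to the limit. The orbit of \<open>A v\<close> need not be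
  Lipschitz, so \<open>A v\<close> is replaced by a nearby \<open>w\<close> in
  \<open>D\<close>.\<close>

lemma S_generator_D:
  assumes v: "v \<in> D" shows "((\<lambda>h. (S h v - v) /\<^sub>R h) \<longlongrightarrow> A v) (at_right 0)"
proof (rule tendstoI)
  fix e :: real assume e: "e > 0"
  obtain w where w: "w \<in> D" "norm (w - A v) < e / 4" using e D_approx[of "e/4" "A v"] by auto
  define c where "c = norm (A w) + 1"
  have c: "c > 0" by (simp add: c_def add_nonneg_pos)
  define d where "d = e / (2 * c)"
  have d: "d > 0" "d * c = e / 2" using e c by (simp_all add: d_def)
  have "dist ((S h v - v) /\<^sub>R h) (A v) < e" if h: "0 < h" "h < d" for h
  proof -
    have bound: "norm ((ap (E n h) v - h *\<^sub>R ap (Y n) v) - (ap (E n 0) v - 0 *\<^sub>R ap (Y n) v)) \<le>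
        h * (2 * norm (ap (Y n) v - A v) + 2 * norm (A v - w) + h * norm (A w))" for n
    proof (rule vector_mvt_bound)
      fix s assume s: "s \<in> {0..h}"
      show "((\<lambda>s. ap (E n s) v - s *\<^sub>R ap (Y n) v) has_vector_derivative ap (E n s) (ap (Y n) v) - ap (Y n) v) (at s within {0..h})"
        by (rule derivative_eq_intros E_derivative refl)+ simp
      let ?y = "ap (Y n) v"
      have "norm (ap (E n s) w - ap (E n 0) w) \<le> s * norm (A w)"
        by (rule vector_mvt_bound[OF _ E_derivative])
          (use s order_trans[OF norm_ap_E_le norm_ap_Y_le[OF w(1)]] in auto)
      also have "\<dots> \<le> h * norm (A w)" using s by (intro mult_right_mono) auto
      finally have 1: "norm (ap (E n s) w - w) \<le> h * norm (A w)" by (simp add: E_0 ap_one)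
      have 2: "norm (ap (E n s) (?y - A v)) \<le> norm (?y - A v)" "norm (ap (E n s) (A v - w)) \<le> norm (A v - w)"
        by (rule norm_ap_E_le; use s in simp)+
      have "ap (E n s) ?y - ?y = ap (E n s) (?y - A v) + (ap (E n s) (A v - w) + (ap (E n s) w - w)) - (A v - w) - (?y - A v)"
        by (simp add: ap.diff_right)
      also have "norm \<dots> \<le> norm (ap (E n s) (?y - A v)) + (norm (ap (E n s) (A v - w)) + norm (ap (E n s) w - w)) + norm (A v - w) + norm (?y - A v)"
        by (intro norm_triangle_le norm_triangle_le_diff add_mono order_refl norm_triangle_ineq)
      finally show "norm (ap (E n s) ?y - ?y) \<le> 2 * norm (?y - A v) + 2 * norm (A v - w) + h * norm (A w)"
        using 1 2 by linarith
    qed (use h in simp)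
    have "norm (S h v - h *\<^sub>R A v - (v - 0)) \<le> h * (2 * 0 + 2 * norm (A v - w) + h * norm (A w))"
    proof (rule LIMSEQ_le)
      show "(\<lambda>n. norm ((ap (E n h) v - h *\<^sub>R ap (Y n) v) - (v - 0))) \<longlonglongrightarrow> norm (S h v - h *\<^sub>R A v - (v - 0))"
        using h by (intro tendsto_intros S_lim Y_tendsto v) auto
      have "(\<lambda>n. norm (ap (Y n) v - A v)) \<longlonglongrightarrow> 0" using Y_tendsto[OF v] LIM_zero tendsto_norm_zero by blast
      then show "(\<lambda>n. h * (2 * norm (ap (Y n) v - A v) + 2 * norm (A v - w) + h * norm (A w))) \<longlonglongrightarrow>
          h * (2 * 0 + 2 * norm (A v - w) + h * norm (A w))"
        by (intro tendsto_intros)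
      show "\<exists>N. \<forall>n\<ge>N. norm ((ap (E n h) v - h *\<^sub>R ap (Y n) v) - (v - 0)) \<le>
          h * (2 * norm (ap (Y n) v - A v) + 2 * norm (A v - w) + h * norm (A w))"
        using bound by (simp add: E_0 ap_one)
    qed
    moreover have "(S h v - v) /\<^sub>R h - A v = (S h v - h *\<^sub>R A v - (v - 0)) /\<^sub>R h"
      using h by (simp add: scaleR_diff_right)
    ultimately have "norm ((S h v - v) /\<^sub>R h - A v) \<le> (h * (2 * norm (A v - w) + h * norm (A w))) / h"
      using h by (simp add: divide_inverse_commute mult_left_mono)
    then have "norm ((S h v - v) /\<^sub>R h - A v) \<le> 2 * norm (A v - w) + h * norm (A w)" using h by simp
    also have "h * norm (A w) \<le> d * c" unfolding c_def using h by (intro mult_mono) auto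
    also have "d * c = e / 2" by (rule d(2))
    finally show ?thesis using w(2) by (simp add: dist_norm norm_minus_commute)
  qed
  then show "\<forall>\<^sub>F h in at_right 0. dist ((S h v - v) /\<^sub>R h) (A v) < e"
    unfolding eventually_at_right_field using d(1) by blast
qed

text \<open>The generator cannot properly extend \<open>A\<close>: for a pair \<open>(v, w)\<close>
  in it and \<open>u = R 1 (v - w)\<close>, the difference \<open>d = v - u\<close> satisfies the
  eigenvalue equation with eigenvalue 1. Contractivity makes the generator dissipative, so
  \<open>d = 0\<close>.\<close>

lemma generator_S: "generator S = {(v, A v) | v. v \<in> D}"
proof (intro equalityI subsetI)
  fix p assume "p \<in> {(v, A v) | v. v \<in> D}"
  then show "p \<in> generator S" using S_generator_D by (auto simp: generator_def)
next
  fix p assume "p \<in> generator S"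
  then obtain v w where p: "p = (v, w)" and lim: "((\<lambda>h. (S h v - v) /\<^sub>R h) \<longlongrightarrow> w) (at_right 0)"
    by (auto simp: generator_def)
  let ?u = "R 1 (v - w)"
  have u: "?u \<in> D" "?u - A ?u = v - w" using R[of 1 "v - w"] by simp_all
  define d where "d = v - ?u"
  have wd: "w - A ?u = d" using u(2) by (simp add: d_def algebra_simps)
  have "((\<lambda>h. (S h v - v) /\<^sub>R h - (S h ?u - ?u) /\<^sub>R h) \<longlongrightarrow> w - A ?u) (at_right 0)"
    by (intro tendsto_diff lim S_generator_D u)
  then have "((\<lambda>h. inner ((S h v - v) /\<^sub>R h - (S h ?u - ?u) /\<^sub>R h) d) \<longlongrightarrow> inner d d) (at_right 0)"
    unfolding wd by (intro tendsto_intros)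
  moreover have "\<forall>\<^sub>F h in at_right 0. inner ((S h v - v) /\<^sub>R h - (S h ?u - ?u) /\<^sub>R h) d \<le> 0"
    unfolding eventually_at_right_field
  proof (intro exI[of _ 1] conjI allI impI)
    fix h :: real assume h: "0 < h" "h < 1"
    have "(S h v - v) /\<^sub>R h - (S h ?u - ?u) /\<^sub>R h = (S h d - d) /\<^sub>R h"
      using h by (simp add: d_def linear_diff[OF bounded_linear.linear[OF bounded_linear_S]] algebra_simps)
    moreover have "inner (S h d) d \<le> norm (S h d) * norm d" by (rule norm_cauchy_schwarz)
    moreover have "norm (S h d) * norm d \<le> norm d * norm d" using h by (intro mult_right_mono norm_S_le) auto
    ultimately show "inner ((S h v - v) /\<^sub>R h - (S h ?u - ?u) /\<^sub>R h) d \<le> 0"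
      using h by (simp add: inner_diff_left dot_square_norm power2_eq_square mult_nonneg_nonpos)
  qed simp
  ultimately have "inner d d \<le> 0" by (rule tendsto_upperbound) simp
  then have "d = 0" by (metis inner_eq_zero_iff inner_ge_zero order_antisym)
  then have "v = ?u" "w = A ?u" using wd by (auto simp: d_def)
  then show "p \<in> {(v, A v) | v. v \<in> D}" using u(1) p by auto
qed

text \<open>An operator that commutes with \<open>A\<close> commutes with the resolvents, hence with
  their exponentials and the limit. Applied to multiplication by a complex scalar, it supplies the
  complex linearity that the real theory does not see.\<close>

lemma S_commute:
  assumes J: "bounded_linear J" and JD: "\<And>v. v \<in> D \<Longrightarrow> J v \<in> D" "\<And>v. v \<in> D \<Longrightarrow> A (J v) = J (A v)"
    and t: "0 \<le> t"
  shows "S t (J v) = J (S t v)"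
proof -
  let ?J = "Endo (Blinfun J)"
  note lin = bounded_linear.linear[OF J]
  have RJ: "R l (J f) = J (R l f)" if l: "l > 0" for l f
  proof (rule R_eqI[OF l])
    show "l *\<^sub>R J (R l f) - A (J (R l f)) = J f"
      using R[OF l, of f] by (simp add: JD linear_scale[OF lin, symmetric] linear_diff[OF lin, symmetric])
  qed (use JD R l in auto)
  have "Re n * ?J = ?J * Re n" for n by (rule endo_eqI) (simp add: ap_times ap_Re ap_Endo[OF J] RJ)
  then have "Y n * ?J = ?J * Y n" for n unfolding Y_def by (simp add: algebra_simps)
  then have "E n t * ?J = ?J * E n t" for n unfolding E_def by (intro exp_commute) simp
  then have "ap (E n t) (J v) = J (ap (E n t) v)" for n
    by (metis ap_times ap_Endo[OF J])
  then have "(\<lambda>n. ap (E n t) (J v)) \<longlonglongrightarrow> J (S t v)"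
    using bounded_linear.tendsto[OF J S_lim[OF t]] by simp
  then show ?thesis using S_lim[OF t, of "J v"] LIMSEQ_unique by blast
qed

end

subsection \<open>Existence of the Kawahara semigroup\<close>

lemma scaleC_add: "scaleC_l2 c (u + v) = scaleC_l2 c u + scaleC_l2 c v"
  by transfer (auto simp: l2rel_def sq_int_add sq_int_cmult distrib_left)

lemma scaleC_scaleR: "scaleC_l2 c (r *\<^sub>R u) = r *\<^sub>R scaleC_l2 c u"
proof transfer
  fix c r f assume "l2rel f f"
  then have "sq_int (\<lambda>x. c * (complex_of_real r * f x))" by (auto simp: l2rel_def intro!: sq_int_cmult)
  then show "l2rel (\<lambda>x. c * r *\<^sub>R f x) (\<lambda>x. r *\<^sub>R (c * f x))"
    by (simp add: l2rel_def scaleR_conv_of_real mult.left_commute)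
qed

lemma norm_scaleC: "norm (scaleC_l2 c u) = norm c * norm u"
proof -
  have "(norm (scaleC_l2 c u))\<^sup>2 = (norm c * norm u)\<^sup>2"
    using norm_abs_l2[OF sq_int_cmult[OF sq_int_rep], of c u] norm_l2_sq[of u]
    by (simp add: abs_l2_scaleC sq_int_rep abs_rep_l2 norm_mult power_mult_distrib)
  then show ?thesis by (simp add: power2_eq_iff_nonneg)
qed

lemma bounded_linear_scaleC: "bounded_linear (scaleC_l2 c)"
  by (rule bounded_linear_intro[where K = "norm c"]) (simp_all add: scaleC_add scaleC_scaleR norm_scaleC mult.commute)

lemma wderiv_scaleC:
  assumes "u \<in> sobolev m"
  shows "scaleC_l2 c u \<in> sobolev m" "k \<le> m \<Longrightarrow> wderiv k (scaleC_l2 c u) = scaleC_l2 c (wderiv k u)"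
proof -
  have *: "is_wderiv 1 (scaleC_l2 c (wderiv k u)) (scaleC_l2 c (wderiv (Suc k) u))" if "k < m" for k
    by (rule is_wderiv_1_scaleC[OF sobolev_wderiv_Suc[OF assms that]])
  show "scaleC_l2 c u \<in> sobolev m" "k \<le> m \<Longrightarrow> wderiv k (scaleC_l2 c u) = scaleC_l2 c (wderiv k u)"
    using wderiv_chain[of m "\<lambda>k. scaleC_l2 c (wderiv k u)", OF *] by (simp_all add: wderiv_0)
qed

lemma kawahara_dom_scaleC:
  assumes v: "v \<in> kawahara_dom \<alpha>"
  shows "scaleC_l2 c v \<in> kawahara_dom \<alpha>" "kawahara_op (scaleC_l2 c v) = scaleC_l2 c (kawahara_op v)"
proof -
  note s = kawahara_dom_sobolev[OF v] note W = sobolev_5_chain[OF s]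
  note lin = bounded_linear.linear[OF bounded_linear_scaleC]
  show "kawahara_op (scaleC_l2 c v) = scaleC_l2 c (kawahara_op v)"
    by (simp add: kawahara_op_def wderiv_scaleC(2)[OF s] linear_add[OF lin] linear_neg[OF lin] linear_diff[OF lin])
  show "scaleC_l2 c v \<in> kawahara_dom \<alpha>"
    using v wderiv_scaleC(2)[OF s] point_value_scaleC[OF W(1)] point_value_scaleC[OF W(2)] point_value_scaleC[OF W(3)]
    by (simp add: kawahara_dom_def wderiv_scaleC(1)[OF s])
qed

lemma kawahara_dom_add:
  assumes u: "u \<in> kawahara_dom \<alpha>" and v: "v \<in> kawahara_dom \<alpha>"
  shows "u + v \<in> kawahara_dom \<alpha>" "kawahara_op (u + v) = kawahara_op u + kawahara_op v"
proof -
  note su = kawahara_dom_sobolev[OF u] note U = sobolev_5_chain[OF su]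
  note sv = kawahara_dom_sobolev[OF v] note V = sobolev_5_chain[OF sv]
  show "kawahara_op (u + v) = kawahara_op u + kawahara_op v"
    by (simp add: kawahara_op_def wderiv_add[OF su sv])
  show "u + v \<in> kawahara_dom \<alpha>"
    using u v point_value_add[OF U(1) V(1)] point_value_add[OF U(2) V(2)] point_value_add[OF U(3) V(3)]
    by (simp add: kawahara_dom_def sobolev_add[OF su sv] wderiv_add[OF su sv] distrib_left)
qed

lemma kawahara_dom_scaleR:
  assumes v: "v \<in> kawahara_dom \<alpha>"
  shows "c *\<^sub>R v \<in> kawahara_dom \<alpha>" "kawahara_op (c *\<^sub>R v) = c *\<^sub>R kawahara_op v"
  using kawahara_dom_scaleC[OF v, of "complex_of_real c"] unfolding scaleC_of_real by auto

lemma subspace_kawahara_dom: "subspace (kawahara_dom \<alpha>)"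
proof -
  obtain v where v: "v \<in> kawahara_dom \<alpha>"
  proof
    have "point_value 0 p = 0" if "p \<in> {0..1}" for p
      using point_value_prim_l2[OF that, of 0] prim_scaleR[of 0 0 p]
      by (simp add: linear_0[OF bounded_linear.linear[OF bounded_linear_prim_l2]])
    moreover have "wderiv k (0::l2) = 0" if "k \<le> 5" for k
      using wderiv_scaleR[OF sobolev_0 that, of 0] by simp
    ultimately show "0 \<in> kawahara_dom \<alpha>" by (simp add: kawahara_dom_def sobolev_0)
  qed
  show ?thesis
    unfolding subspace_def using kawahara_dom_add(1) kawahara_dom_scaleR(1) kawahara_dom_scaleR(1)[OF v, of 0] by auto
qed

lemma kawahara_dom_diff:
  assumes u: "u \<in> kawahara_dom \<alpha>" and v: "v \<in> kawahara_dom \<alpha>"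
  shows "u - v \<in> kawahara_dom \<alpha>" "kawahara_op (u - v) = kawahara_op u - kawahara_op v"
  using kawahara_dom_add[OF u kawahara_dom_scaleR(1)[OF v, of "-1"]] kawahara_dom_scaleR(2)[OF v, of "-1"] by simp_all

text \<open>A lower bound \<open>B\<close> makes the inverse at \<open>l\<close> Lipschitz with
  constant \<open>1 / B\<close>, so Banach's fixed point theorem solves the equation for every
  parameter closer to \<open>l\<close> than \<open>B\<close>.\<close>

lemma range_perturbation:
  fixes l m B :: real
  assumes range: "\<And>f. \<exists>u\<in>kawahara_dom \<alpha>. l *\<^sub>R u - kawahara_op u = f"
    and bound: "\<And>u. u \<in> kawahara_dom \<alpha> \<Longrightarrow> B * norm u \<le> norm (l *\<^sub>R u - kawahara_op u)"
    and lm: "\<bar>l - m\<bar> < B"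
  shows "\<exists>u\<in>kawahara_dom \<alpha>. m *\<^sub>R u - kawahara_op u = f"
proof -
  have B: "B > 0" using lm by linarith
  obtain G where G: "\<And>f. G f \<in> kawahara_dom \<alpha>" "\<And>f. l *\<^sub>R G f - kawahara_op (G f) = f" using range by metis
  let ?T = "\<lambda>u. G (f + (l - m) *\<^sub>R u)"
  have "\<forall>x y. dist (?T x) (?T y) \<le> (\<bar>l - m\<bar> / B) * dist x y"
  proof (intro allI)
    fix x y
    let ?d = "?T x - ?T y"
    have "l *\<^sub>R ?d - kawahara_op ?d = (l *\<^sub>R ?T x - kawahara_op (?T x)) - (l *\<^sub>R ?T y - kawahara_op (?T y))"
      by (simp add: kawahara_dom_diff[OF G(1) G(1)] algebra_simps)
    also have "\<dots> = (l - m) *\<^sub>R (x - y)" unfolding G(2) by (simp add: algebra_simps)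
    finally have "B * norm ?d \<le> \<bar>l - m\<bar> * norm (x - y)"
      using bound[OF kawahara_dom_diff(1)[OF G(1) G(1)], of "f + (l - m) *\<^sub>R x" "f + (l - m) *\<^sub>R y"] by simp
    then show "dist (?T x) (?T y) \<le> (\<bar>l - m\<bar> / B) * dist x y"
      using B by (simp add: dist_norm field_simps)
  qed
  moreover have "0 \<le> \<bar>l - m\<bar> / B" "\<bar>l - m\<bar> / B < 1" using lm B by simp_all
  ultimately obtain u where u: "?T u = u" using banach_fix_type[of "\<bar>l - m\<bar> / B" ?T] by blast
  have "l *\<^sub>R u - kawahara_op u = f + (l - m) *\<^sub>R u" using G(2)[of "f + (l - m) *\<^sub>R u"] by (simp only: u)
  then have "m *\<^sub>R u - kawahara_op u = f" by (simp add: algebra_simps)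
  moreover have "u \<in> kawahara_dom \<alpha>" using G(1)[of "f + (l - m) *\<^sub>R u"] by (simp only: u)
  ultimately show ?thesis by blast
qed

text \<open>Continuation from \<open>l = 0\<close>, where surjectivity is known. Dissipativity gives
  no lower bound at 0, so the first step relies on coercivity; afterwards the lower bound
  \<open>l\<close> reaches all parameters in \<open>(0, 2 l)\<close>, and the geometric sequence
  exhausts the half-line.\<close>

lemma kawahara_range:
  assumes \<alpha>: "\<bar>\<alpha>\<bar> < 1" and "m > 0"
  shows "\<exists>u\<in>kawahara_dom \<alpha>. m *\<^sub>R u - kawahara_op u = f"
proof -
  define k where "k = 1 - \<alpha>\<^sup>2"
  have k: "k > 0" using \<alpha> by (simp add: k_def abs_square_less_1)
  have range0: "\<exists>u\<in>kawahara_dom \<alpha>. 0 *\<^sub>R u - kawahara_op u = f" for f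
  proof -
    obtain v where "v \<in> kawahara_dom \<alpha>" "kawahara_op v = - f" using kawahara_op_surj[OF \<alpha>] by blast
    then show ?thesis by (intro bexI[of _ v]) simp_all
  qed
  have 0: "\<exists>u\<in>kawahara_dom \<alpha>. (k/2) *\<^sub>R u - kawahara_op u = f" for f
    by (rule range_perturbation[OF range0, of k]) (use kawahara_op_coercive[OF \<alpha>] k in \<open>auto simp: k_def\<close>)
  have bound: "l * norm u \<le> norm (l *\<^sub>R u - kawahara_op u)" if "l > 0" "u \<in> kawahara_dom \<alpha>" for l u
  proof (cases "u = 0")
    case False
    have "l * (norm u * norm u) \<le> inner (l *\<^sub>R u - kawahara_op u) u"
      using kawahara_op_dissipative[OF \<alpha> that(2)] by (simp add: inner_diff_left dot_square_norm power2_eq_square)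
    also have "\<dots> \<le> norm (l *\<^sub>R u - kawahara_op u) * norm u" by (rule norm_cauchy_schwarz)
    finally show ?thesis using False by (simp flip: mult.assoc)
  qed simp
  have step: "\<exists>u\<in>kawahara_dom \<alpha>. m *\<^sub>R u - kawahara_op u = f"
    if "l > 0" "\<And>f. \<exists>u\<in>kawahara_dom \<alpha>. l *\<^sub>R u - kawahara_op u = f" "0 < m" "m < 2 * l" for l m f
    by (rule range_perturbation[OF that(2), of l]) (use bound[OF that(1)] that in auto)
  define l where "l n = k / 2 * (3/2) ^ n" for n :: nat
  have l0: "l n > 0" for n using k by (simp add: l_def)
  have all: "\<exists>u\<in>kawahara_dom \<alpha>. l n *\<^sub>R u - kawahara_op u = f" for n f
  proof (induction n arbitrary: f)
    case 0
    then show ?case using \<open>\<And>f. \<exists>u\<in>kawahara_dom \<alpha>. (k/2) *\<^sub>R u - kawahara_op u = f\<close> by (simp add: l_def)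
  next
    case (Suc n)
    show ?case by (rule step[OF l0[of n] Suc.IH l0]) (use l0[of n] in \<open>simp add: l_def\<close>)
  qed
  obtain n where "2 * m / k < (3/2) ^ n" using real_arch_pow[of "3/2" "2 * m / k"] by auto
  then have "m < l n" using k by (simp add: l_def field_simps)
  then show ?thesis using step[OF l0 all \<open>m > 0\<close>, of n f] l0[of n] by simp
qed

section \<open>Orbits of the Kawahara semigroup\<close>

locale kawahara =
  fixes \<alpha> :: real
  assumes \<alpha>: "\<bar>\<alpha>\<bar> < 1"
begin

abbreviation "Dom \<equiv> kawahara_dom \<alpha>"
abbreviation "A \<equiv> kawahara_op"
abbreviation "S \<equiv> kawahara_semigroup \<alpha>"
definition "\<kappa> = 1 - \<alpha>\<^sup>2"

lemma \<kappa>: "0 < \<kappa>" "0 \<le> \<kappa>" "\<kappa> \<le> 1"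
proof -
  have "\<alpha>\<^sup>2 < 1" using \<alpha> by (simp add: abs_square_less_1)
  then show "0 < \<kappa>" "0 \<le> \<kappa>" "\<kappa> \<le> 1" by (simp_all add: \<kappa>_def)
qed

sublocale yosida: m_dissipative Dom A
  by unfold_locales
    (simp_all add: subspace_kawahara_dom kawahara_dom_add kawahara_dom_scaleR kawahara_op_dissipative[OF \<alpha>] kawahara_range[OF \<alpha>])

text \<open>The Yosida limit only shows that the choice behind \<open>kawahara_semigroup\<close> has
  a candidate. All later properties of \<open>S\<close> come from these two facts, not from the
  construction.\<close>

lemma semigroup_spec: "contraction_C0_semigroup S" "generator S = {(v, A v) | v. v \<in> Dom}"
proof -
  have "yosida.S t (scaleC_l2 c v) = scaleC_l2 c (yosida.S t v)" if "0 \<le> t" for t c v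
    by (rule yosida.S_commute[OF bounded_linear_scaleC _ _ that]) (auto intro: kawahara_dom_scaleC)
  then have "contraction_C0_semigroup yosida.S"
    unfolding contraction_C0_semigroup_def
    by (auto simp: yosida.bounded_linear_S yosida.norm_S_le yosida.S_0 yosida.S_semigroup yosida.S_strongly_continuous)
  then have "\<exists>S. contraction_C0_semigroup S \<and> generator S = {(v, A v) | v. v \<in> Dom}"
    using yosida.generator_S by blast
  from someI_ex[OF this] show "contraction_C0_semigroup S" "generator S = {(v, A v) | v. v \<in> Dom}"
    by (simp_all add: kawahara_semigroup_def)
qed

lemma S_bounded_linear: "0 \<le> t \<Longrightarrow> bounded_linear (S t)"
  and S_norm: "0 \<le> t \<Longrightarrow> norm (S t v) \<le> norm v"
  and S_0: "S 0 v = v"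
  and S_add: "0 \<le> s \<Longrightarrow> 0 \<le> t \<Longrightarrow> S (s + t) v = S s (S t v)"
  and S_cont0: "((\<lambda>t. S t v) \<longlongrightarrow> v) (at_right 0)"
  using semigroup_spec(1) unfolding contraction_C0_semigroup_def by blast+

lemma S_linear: "0 \<le> t \<Longrightarrow> linear (S t)"
  by (rule bounded_linear.linear[OF S_bounded_linear])

lemma S_generator: "v \<in> Dom \<Longrightarrow> ((\<lambda>h. (S h v - v) /\<^sub>R h) \<longlongrightarrow> A v) (at_right 0)"
  using semigroup_spec(2) unfolding generator_def by blast

lemma S_generatorD: "((\<lambda>h. (S h v - v) /\<^sub>R h) \<longlongrightarrow> w) (at_right 0) \<Longrightarrow> v \<in> Dom \<and> w = A v"
  using semigroup_spec(2) unfolding generator_def by blast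

lemma S_Dom:
  assumes v: "v \<in> Dom" and t: "0 \<le> t"
  shows "S t v \<in> Dom" "A (S t v) = S t (A v)"
proof -
  have "((\<lambda>h. S t ((S h v - v) /\<^sub>R h)) \<longlongrightarrow> S t (A v)) (at_right 0)"
    by (rule bounded_linear.tendsto[OF S_bounded_linear[OF t] S_generator[OF v]])
  moreover have "\<forall>\<^sub>F h in at_right 0. S t ((S h v - v) /\<^sub>R h) = (S h (S t v) - S t v) /\<^sub>R h"
    unfolding eventually_at_right_field
  proof (intro exI[of _ 1] conjI allI impI)
    fix h :: real assume "0 < h" "h < 1"
    then show "S t ((S h v - v) /\<^sub>R h) = (S h (S t v) - S t v) /\<^sub>R h"
      using S_add[of t h v] S_add[of h t v] t
      by (simp add: linear_scale[OF S_linear[OF t]] linear_diff[OF S_linear[OF t]] add.commute)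
  qed simp
  ultimately have "((\<lambda>h. (S h (S t v) - S t v) /\<^sub>R h) \<longlongrightarrow> S t (A v)) (at_right 0)" by (rule Lim_transform_eventually)
  from S_generatorD[OF this] show "S t v \<in> Dom" "A (S t v) = S t (A v)" by auto
qed

lemma S_diff_time: "0 \<le> s \<Longrightarrow> 0 \<le> t \<Longrightarrow> norm (S s v - S t v) \<le> norm (S \<bar>s - t\<bar> v - v)"
proof (induction s t rule: linorder_wlog)
  case (le s t)
  have "S s v - S t v = S s (v - S (t - s) v)"
    using S_add[of s "t - s" v] le by (simp add: linear_diff[OF S_linear])
  then have "norm (S s v - S t v) \<le> norm (v - S (t - s) v)" using S_norm[OF le(2), of "v - S (t - s) v"] by simp
  then show ?case using le by (simp add: norm_minus_commute)
next
  case (sym s t)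
  then show ?case by (simp add: norm_minus_commute abs_minus_commute)
qed

lemma filterlim_abs_at_right: "filterlim (\<lambda>h::real. \<bar>h\<bar>) (at_right 0) (at 0)"
  unfolding filterlim_at
proof
  show "\<forall>\<^sub>F h in at 0. \<bar>h\<bar> \<in> {0<..} \<and> \<bar>h\<bar> \<noteq> (0::real)" by (auto simp: eventually_at_filter)
  have "((\<lambda>h::real. \<bar>h\<bar>) \<longlongrightarrow> \<bar>0\<bar>) (at 0)" by (intro tendsto_intros)
  then show "((\<lambda>h::real. \<bar>h\<bar>) \<longlongrightarrow> 0) (at 0)" by simp
qed

lemma S_continuous_time: "continuous_on {0..} (\<lambda>t. S t v)"
  unfolding continuous_on_def
proof
  fix t :: real assume t: "t \<in> {0..}"
  have "((\<lambda>h. S \<bar>h\<bar> v - v) \<longlongrightarrow> 0) (at 0)"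
    by (rule LIM_zero[OF filterlim_compose[OF S_cont0 filterlim_abs_at_right]])
  from LIM_offset_zero_cancel[OF _, of "\<lambda>s. S \<bar>s - t\<bar> v - v" t 0] this
  have "((\<lambda>s. S \<bar>s - t\<bar> v - v) \<longlongrightarrow> 0) (at t)" by simp
  then have "((\<lambda>s. S \<bar>s - t\<bar> v - v) \<longlongrightarrow> 0) (at t within {0..})" by (rule tendsto_within_subset) simp
  then have "((\<lambda>s. S s v - S t v) \<longlongrightarrow> 0) (at t within {0..})"
    by (rule Lim_null_comparison[OF _ tendsto_norm_zero, rotated])
      (use S_diff_time t in \<open>auto simp: eventually_at_filter\<close>)
  then show "((\<lambda>s. S s v) \<longlongrightarrow> S t v) (at t within {0..})" by (rule LIM_zero_cancel)
qed

lemma S_continuous_on: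
  fixes f :: "'b::topological_space \<Rightarrow> l2"
  assumes \<sigma>: "continuous_on X \<sigma>" "\<And>x. x \<in> X \<Longrightarrow> 0 \<le> \<sigma> x" and f: "continuous_on X f"
  shows "continuous_on X (\<lambda>x. S (\<sigma> x) (f x))"
  unfolding continuous_on_def
proof
  fix a assume a: "a \<in> X"
  have "continuous_on X (\<lambda>x. S (\<sigma> x) (f a))"
    by (rule continuous_on_compose2[OF S_continuous_time \<sigma>(1)]) (use \<sigma>(2) in auto)
  then have 1: "((\<lambda>x. S (\<sigma> x) (f a)) \<longlongrightarrow> S (\<sigma> a) (f a)) (at a within X)" using a by (simp add: continuous_on_def)
  have "((\<lambda>x. f x - f a) \<longlongrightarrow> 0) (at a within X)" using f a by (auto simp: continuous_on_def intro: LIM_zero)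
  then have "((\<lambda>x. S (\<sigma> x) (f x - f a)) \<longlongrightarrow> 0) (at a within X)"
    by (rule Lim_null_comparison[OF _ tendsto_norm_zero, rotated])
      (use S_norm \<sigma>(2) in \<open>auto simp: eventually_at_filter\<close>)
  from tendsto_add[OF this 1] have "((\<lambda>x. S (\<sigma> x) (f x - f a) + S (\<sigma> x) (f a)) \<longlongrightarrow> S (\<sigma> a) (f a)) (at a within X)" by simp
  then show "((\<lambda>x. S (\<sigma> x) (f x)) \<longlongrightarrow> S (\<sigma> a) (f a)) (at a within X)"
    by (rule Lim_transform_eventually) (use \<sigma>(2) in \<open>auto simp: eventually_at_filter linear_diff[OF S_linear]\<close>)
qed

lemma S_derivative:
  assumes v: "v \<in> Dom" and t: "0 < t"
  shows "((\<lambda>t. S t v) has_vector_derivative A (S t v)) (at t)"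
proof -
  have At: "A (S t v) = S t (A v)" using S_Dom[OF v] t by simp
  have b: "norm (S (t + h) v - S t v - h *\<^sub>R S t (A v)) / norm h \<le>
      norm ((S \<bar>h\<bar> v - v) /\<^sub>R \<bar>h\<bar> - A v) + norm (S \<bar>h\<bar> (A v) - A v)" if h: "h \<noteq> 0" "\<bar>h\<bar> < t" for h
  proof (cases "h > 0")
    case True
    have "S (t + h) v - S t v - h *\<^sub>R S t (A v) = h *\<^sub>R S t ((S h v - v) /\<^sub>R h - A v)"
      using True t S_add[of t h v]
      by (simp add: linear_diff[OF S_linear] linear_scale[OF S_linear] scaleR_diff_right)
    then have "norm (S (t + h) v - S t v - h *\<^sub>R S t (A v)) / norm h = norm (S t ((S h v - v) /\<^sub>R h - A v))"
      using True by simp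
    also have "\<dots> \<le> norm ((S h v - v) /\<^sub>R h - A v)" by (rule S_norm) (use t in simp)
    finally show ?thesis using True by (simp add: add_increasing2)
  next
    case False
    define k where "k = - h"
    have k: "0 < k" "k < t" "h = - k" "\<bar>h\<bar> = k" using h False by (auto simp: k_def)
    \<comment> \<open>For a negative increment the common factor is \<open>S (t - k)\<close>: the
      generator quotient appears, together with an error from moving \<open>S t (A v)\<close> back
      by time \<open>k\<close>.\<close>
    have "S (t + h) v - S t v - h *\<^sub>R S t (A v) =
        k *\<^sub>R (S t (A v) - S (t - k) (A v) - S (t - k) ((S k v - v) /\<^sub>R k - A v))"
      using k S_add[of "t - k" k v]
      by (simp add: linear_diff[OF S_linear] linear_scale[OF S_linear] scaleR_diff_right)
    then have "norm (S (t + h) v - S t v - h *\<^sub>R S t (A v)) / norm h =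
        norm (S t (A v) - S (t - k) (A v) - S (t - k) ((S k v - v) /\<^sub>R k - A v))"
      using k by simp
    also have "\<dots> \<le> norm (S t (A v) - S (t - k) (A v)) + norm (S (t - k) ((S k v - v) /\<^sub>R k - A v))"
      by (rule norm_triangle_ineq4)
    also have "norm (S t (A v) - S (t - k) (A v)) \<le> norm (S k (A v) - A v)"
      using S_diff_time[of t "t - k" "A v"] k by simp
    also have "norm (S (t - k) ((S k v - v) /\<^sub>R k - A v)) \<le> norm ((S k v - v) /\<^sub>R k - A v)"
      by (rule S_norm) (use k in simp)
    finally show ?thesis using k by simp
  qed
  have "((\<lambda>h. norm ((S h v - v) /\<^sub>R h - A v) + norm (S h (A v) - A v)) \<longlongrightarrow> norm (A v - A v) + norm (A v - A v)) (at_right 0)"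
    by (intro tendsto_intros S_generator v S_cont0)
  from filterlim_compose[OF this filterlim_abs_at_right]
  have lim: "((\<lambda>h. norm ((S \<bar>h\<bar> v - v) /\<^sub>R \<bar>h\<bar> - A v) + norm (S \<bar>h\<bar> (A v) - A v)) \<longlongrightarrow> 0) (at 0)" by simp
  have "((\<lambda>h. norm (S (t + h) v - S t v - h *\<^sub>R S t (A v)) / norm h) \<longlongrightarrow> 0) (at 0)"
  proof (rule Lim_null_comparison[OF _ lim])
    show "\<forall>\<^sub>F h in at 0. norm (norm (S (t + h) v - S t v - h *\<^sub>R S t (A v)) / norm h) \<le>
        norm ((S \<bar>h\<bar> v - v) /\<^sub>R \<bar>h\<bar> - A v) + norm (S \<bar>h\<bar> (A v) - A v)"
      unfolding eventually_at using b t by (intro exI[of _ t]) (auto simp: dist_norm)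
  qed
  then show ?thesis
    unfolding has_vector_derivative_def has_derivative_at At by (simp add: bounded_linear_scaleR_left)
qed

end

subsection \<open>Smoothing\<close>

text \<open>An integrable majorant of the operator norm of the semigroup from \<open>L\<^sup>2\<close> to \<open>H\<^sup>2\<close>,
  up to a constant: \<open>kernel\<close> is the derivative of the bounded function \<open>kernel_int\<close>.\<close>

definition kernel_int :: "real \<Rightarrow> real" where
  "kernel_int s = s powr (1/4) / (1 + s powr (1/4))"

definition kernel :: "real \<Rightarrow> real" where
  "kernel s = 1/4 * s powr (-3/4) / (1 + s powr (1/4))\<^sup>2"

lemma kernel_int_deriv: "s > 0 \<Longrightarrow> (kernel_int has_real_derivative kernel s) (at s)"
proof -
  assume s: "s > 0"
  have n: "1 + s powr (1/4) \<noteq> 0" using powr_ge_zero[of s "1/4"] by linarith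
  have p: "((\<lambda>s. s powr (1/4)) has_real_derivative 1/4 * s powr (-3/4)) (at s)"
    using has_real_derivative_powr[OF s, of "1/4"] by simp
  have "((\<lambda>s. s powr (1/4) / (1 + s powr (1/4))) has_real_derivative
      (1/4 * s powr (-3/4) * (1 + s powr (1/4)) - s powr (1/4) * (0 + 1/4 * s powr (-3/4))) /
      ((1 + s powr (1/4)) * (1 + s powr (1/4)))) (at s)"
    by (intro DERIV_divide DERIV_add DERIV_const p n)
  moreover have "1/4 * s powr (-3/4) * (1 + s powr (1/4)) - s powr (1/4) * (0 + 1/4 * s powr (-3/4)) = 1/4 * s powr (-3/4)"
    by (simp add: distrib_left)
  ultimately show ?thesis
    unfolding kernel_int_def[abs_def] kernel_def by (simp only: power2_eq_square)
qed

lemma kernel_nonneg: "0 \<le> kernel s"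
  by (simp add: kernel_def)

lemma kernel_int_bounds: "0 \<le> kernel_int s" "kernel_int s \<le> 1"
proof -
  have "0 < 1 + s powr (1/4)" by (intro add_pos_nonneg) auto
  then show "0 \<le> kernel_int s" "kernel_int s \<le> 1" by (simp_all add: kernel_int_def)
qed

lemma kernel_int_at_top: "(kernel_int \<longlongrightarrow> 1) at_top"
proof -
  have "LIM s at_top. exp (1/4 * ln s) :> (at_top :: real filter)"
    by (intro filterlim_compose[OF exp_at_top] filterlim_tendsto_pos_mult_at_top[OF tendsto_const _ ln_at_top]) simp
  moreover have "\<forall>\<^sub>F s::real in at_top. exp (1/4 * ln s) = s powr (1/4)"
    using eventually_gt_at_top[of 0] by eventually_elim (simp add: powr_def)
  ultimately have "LIM s at_top. s powr (1/4) :> (at_top :: real filter)"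
    by (rule filterlim_mono_eventually[OF _ order_refl order_refl])
  then have "LIM s at_top. 1 + s powr (1/4) :> (at_top :: real filter)"
    by (rule filterlim_tendsto_add_at_top[OF tendsto_const])
  then have "((\<lambda>s::real. inverse (1 + s powr (1/4))) \<longlongrightarrow> 0) at_top"
    by (rule filterlim_compose[OF tendsto_inverse_0_at_top, rotated]) (rule filterlim_ident)
  then have "((\<lambda>s::real. 1 - inverse (1 + s powr (1/4))) \<longlongrightarrow> 1 - 0) at_top" by (intro tendsto_intros)
  moreover have "1 - inverse (1 + s powr (1/4)) = kernel_int s" for s
  proof -
    have "0 < 1 + s powr (1/4)" by (intro add_pos_nonneg) auto
    then show ?thesis by (simp add: kernel_int_def field_simps)
  qed
  ultimately show ?thesis by simp
qed

lemma kernel_int_at_0: "((\<lambda>N. kernel_int (1 / N)) \<longlongrightarrow> 0) at_top"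
proof -
  have "((\<lambda>N::real. (1 / N) powr (1/4)) \<longlongrightarrow> 0) at_top"
  proof (rule tendsto_zero_powrI[where b = "1/4"])
    show "((\<lambda>N::real. 1 / N) \<longlongrightarrow> 0) at_top"
      using tendsto_inverse_0_at_top[OF filterlim_ident] by (simp add: divide_inverse)
    show "\<forall>\<^sub>F N in at_top. 0 \<le> 1 / (N::real)" using eventually_ge_at_top[of 0] by eventually_elim simp
  qed (auto intro: tendsto_const)
  then have "((\<lambda>N::real. (1 / N) powr (1/4) / (1 + (1 / N) powr (1/4))) \<longlongrightarrow> 0 / (1 + 0)) at_top"
    by (intro tendsto_intros) auto
  then show ?thesis by (simp add: kernel_int_def)
qed

lemma kernel_lower_small:
  assumes "0 < s" "s \<le> 1" shows "s powr (-3/4) \<le> 16 * kernel s"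
proof -
  have p: "0 \<le> s powr (1/4)" "s powr (1/4) \<le> 1" using assms powr_le1[of "1/4" s] by auto
  have "(1 + s powr (1/4))\<^sup>2 \<le> 2\<^sup>2" by (rule power_mono) (use p in auto)
  moreover have "(1 + s powr (1/4))\<^sup>2 > 0" using p by (simp add: add_nonneg_eq_0_iff)
  ultimately have "s powr (-3/4) / 4 \<le> s powr (-3/4) / (1 + s powr (1/4))\<^sup>2"
    by (intro divide_left_mono) auto
  moreover have "16 * kernel s = 4 * (s powr (-3/4) / (1 + s powr (1/4))\<^sup>2)" by (simp add: kernel_def)
  ultimately show ?thesis by linarith
qed

text \<open>For \<open>s \<ge> 1\<close> the kernel is at least \<open>s powr (-5/4) / 16\<close>.
  The weaker rate \<open>1 / s\<^sup>2\<close> is enough, because the semigroup decays exponentially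
  there.\<close>

lemma kernel_lower_large:
  assumes "1 \<le> s" shows "1 / s\<^sup>2 \<le> 16 * kernel s"
proof -
  have p: "1 \<le> s powr (1/4)" using assms by (rule ge_one_powr_ge_zero) simp
  have "(1 + s powr (1/4))\<^sup>2 \<le> (2 * s powr (1/4))\<^sup>2" by (rule power_mono) (use p in auto)
  also have "\<dots> = 4 * s powr (1/2)" using assms by (simp add: power_mult_distrib powr_power)
  finally have "(1 + s powr (1/4))\<^sup>2 \<le> 4 * s powr (1/2)" .
  moreover have "(1 + s powr (1/4))\<^sup>2 > 0" using p by (simp add: add_nonneg_eq_0_iff)
  ultimately have "s powr (-3/4) / (4 * s powr (1/2)) \<le> s powr (-3/4) / (1 + s powr (1/4))\<^sup>2"
    by (intro divide_left_mono) (use assms in auto)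
  moreover have "s powr (-3/4) / (4 * s powr (1/2)) = s powr (-5/4) / 4"
    by (simp flip: powr_diff)
  moreover have "s powr (-2) \<le> s powr (-5/4)" by (rule powr_mono) (use assms in auto)
  moreover have "s powr (-2) = 1 / s\<^sup>2" using assms by (simp add: powr_minus_divide)
  ultimately show ?thesis by (simp add: kernel_def)
qed

lemma sobolev_mono: "u \<in> sobolev m \<Longrightarrow> n \<le> m \<Longrightarrow> u \<in> sobolev n"
  by (auto simp: sobolev_def)

section \<open>Exponential decay and the smoothing estimate\<close>

context kawahara
begin

definition B :: "l2 \<Rightarrow> l2" where "B u = u + \<kappa> *\<^sub>R multX u"

lemma bounded_linear_B: "bounded_linear B"
  unfolding B_def[abs_def]
  by (intro bounded_linear_add bounded_linear_ident bounded_linear_scaleR_right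
      bounded_linear_compose[OF bounded_linear_scaleR_right bounded_linear_mult_l2] continuous_on_of_real_ident)

lemma energy_derivative:
  assumes v: "v \<in> Dom" and t: "0 < t"
  shows "((\<lambda>t. energy \<kappa> (S t v)) has_real_derivative 2 * inner (A (S t v)) (B (S t v))) (at t)"
proof -
  have "((\<lambda>t. inner (S t v) (B (S t v))) has_vector_derivative
      inner (S t v) (B (A (S t v))) + inner (A (S t v)) (B (S t v))) (at t)"
    by (intro bounded_bilinear.has_vector_derivative[OF bounded_bilinear_inner]
        bounded_linear.has_vector_derivative[OF bounded_linear_B] S_derivative v t)
  moreover have "inner (S t v) (B (A (S t v))) = inner (A (S t v)) (B (S t v))"
    using multX_sym[of "S t v" "A (S t v)"] by (simp add: B_def inner_add_right inner_commute)
  ultimately show ?thesis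
    by (simp add: has_real_derivative_iff_has_vector_derivative energy_def B_def)
qed

lemma energy_dissipation:
  assumes v: "v \<in> Dom" shows "2 * inner (A v) (B v) \<le> - (5 * \<kappa> * (norm (wderiv 2 v))\<^sup>2)"
  using kawahara_op_energy[OF \<alpha> v] by (simp add: B_def \<kappa>_def)

lemma energy_continuous: "continuous_on {0..t} (\<lambda>t. energy \<kappa> (S t v))"
proof -
  have "continuous_on {0..t} (\<lambda>t. S t v)" by (rule continuous_on_subset[OF S_continuous_time]) auto
  then show ?thesis
    unfolding energy_def B_def[symmetric]
    by (intro continuous_intros bounded_linear.continuous_on[OF bounded_linear_B])
qed

text \<open>Poincare's inequality turns the dissipation \<open>5 * \<kappa>\<close> times the
  squared norm of the second derivative into \<open>5/2 * \<kappa>\<close> times the energy, the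
  energy being at most twice the squared norm. This makes the exponentially weighted energy
  nonincreasing on the domain.\<close>

lemma S_decay:
  assumes t: "0 \<le> t"
  shows "(norm (S t v))\<^sup>2 \<le> 2 * exp (- (5/2 * \<kappa> * t)) * (norm v)\<^sup>2"
proof -
  define c where "c = 5/2 * \<kappa>"
  have dom: "(norm (S t v))\<^sup>2 \<le> 2 * exp (- (c * t)) * (norm v)\<^sup>2" if v: "v \<in> Dom" for v
  proof -
    let ?f = "\<lambda>s. - (exp (c * s) * energy \<kappa> (S s v))"
    have "?f 0 \<le> ?f t"
    proof (rule DERIV_nonneg_imp_increasing_open[OF t])
      fix s assume s: "0 < s" "s < t"
      let ?z = "S s v"
      have z: "?z \<in> Dom" using S_Dom(1)[OF v] s by simp
      have "energy \<kappa> ?z \<le> 2 * (norm ?z)\<^sup>2" by (rule energy_le) (use \<kappa> in auto)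
      also have "\<dots> \<le> 2 * (norm (wderiv 2 ?z))\<^sup>2"
        using kawahara_dom_poincare(1)[OF z] by (intro mult_left_mono power_mono) auto
      finally have "c * energy \<kappa> ?z \<le> c * (2 * (norm (wderiv 2 ?z))\<^sup>2)"
        by (rule mult_left_mono) (use \<kappa> in \<open>simp add: c_def\<close>)
      then have 1: "c * energy \<kappa> ?z + 2 * inner (A ?z) (B ?z) \<le> 0"
        using energy_dissipation[OF z] by (simp add: c_def)
      have "(?f has_real_derivative - (exp (c * s) * c * energy \<kappa> ?z + 2 * inner (A ?z) (B ?z) * exp (c * s))) (at s)"
        by (rule derivative_eq_intros energy_derivative[OF v s(1)] refl)+ simp
      moreover have "0 \<le> - (exp (c * s) * c * energy \<kappa> ?z + 2 * inner (A ?z) (B ?z) * exp (c * s))"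
      proof -
        have "exp (c * s) * (c * energy \<kappa> ?z + 2 * inner (A ?z) (B ?z)) \<le> 0"
          using 1 by (intro mult_nonneg_nonpos) auto
        then show ?thesis by (simp add: algebra_simps)
      qed
      ultimately show "\<exists>y. (?f has_real_derivative y) (at s) \<and> 0 \<le> y" by blast
    qed (intro continuous_intros energy_continuous)
    then have "exp (c * t) * energy \<kappa> (S t v) \<le> energy \<kappa> v" by (simp add: S_0)
    then have "exp (- (c * t)) * (exp (c * t) * energy \<kappa> (S t v)) \<le> exp (- (c * t)) * energy \<kappa> v"
      by (intro mult_left_mono) auto
    then have "energy \<kappa> (S t v) \<le> exp (- (c * t)) * energy \<kappa> v"
      by (simp add: mult.assoc[symmetric] flip: exp_add)
    also have "\<dots> \<le> exp (- (c * t)) * (2 * (norm v)\<^sup>2)"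
      using \<kappa> by (intro mult_left_mono energy_le) auto
    finally show ?thesis using energy_ge[OF \<kappa>(2), of "S t v"] by simp
  qed
  let ?C = "{v. (norm (S t v))\<^sup>2 \<le> 2 * exp (- (c * t)) * (norm v)\<^sup>2}"
  have "closed ?C"
    by (intro closed_Collect_le continuous_intros linear_continuous_on[OF S_bounded_linear[OF t]])
  then have "closure Dom \<subseteq> ?C" using dom by (intro closure_minimal) auto
  then show ?thesis using yosida.dense_D by (auto simp: c_def)
qed

text \<open>The domain of the square of \<open>A\<close>. On it both \<open>S t v\<close> and
  \<open>A (S t v)\<close> are differentiable in time, and the interpolation inequality applies
  along the orbit.\<close>

definition Dom2 :: "l2 set" where "Dom2 = {v \<in> Dom. A v \<in> Dom}"

lemma subspace_Dom2: "subspace Dom2"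
  using subspace_kawahara_dom[of \<alpha>] subspace_0[OF subspace_kawahara_dom, of \<alpha>] kawahara_dom_scaleR(2)[of 0 \<alpha> 0]
  by (auto simp: subspace_def Dom2_def kawahara_dom_add kawahara_dom_scaleR)

text \<open>First \<open>v\<close> is approximated by \<open>w\<close> in the domain, then
  \<open>A w\<close> by an element of the domain, which surjectivity writes as \<open>A u\<close>.
  Coercivity carries the second error back to \<open>u - w\<close>, hence the tolerance
  \<open>\<kappa> * e / 2\<close>.\<close>

lemma Dom2_dense: "closure Dom2 = UNIV"
proof -
  have "v \<in> closure Dom2" for v
    unfolding closure_approachable
  proof (intro allI impI)
    fix e :: real assume e: "e > 0"
    obtain w where w: "w \<in> Dom" "norm (w - v) < e / 2" using yosida.D_approx[of "e/2" v] e by auto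
    obtain w' where w': "w' \<in> Dom" "norm (w' - A w) < \<kappa> * e / 2" using yosida.D_approx[of "\<kappa> * e / 2" "A w"] e \<kappa> by auto
    obtain u where u: "u \<in> Dom" "A u = w'" using kawahara_op_surj[OF \<alpha>] by blast
    have "\<kappa> * norm (u - w) \<le> norm (A (u - w))"
      unfolding \<kappa>_def by (rule kawahara_op_coercive[OF \<alpha> kawahara_dom_diff(1)[OF u(1) w(1)]])
    then have "\<kappa> * norm (u - w) < \<kappa> * (e / 2)" using w'(2) by (simp add: kawahara_dom_diff(2)[OF u(1) w(1)] u(2))
    then have "norm (u - w) < e / 2" using \<kappa> by (simp only: mult_less_cancel_left_pos)
    then have "dist u v < e" using w(2) norm_triangle_ineq[of "u - w" "w - v"] by (simp add: dist_norm)
    moreover have "u \<in> Dom2" using u w' by (simp add: Dom2_def)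
    ultimately show "\<exists>y\<in>Dom2. dist y v < e" by blast
  qed
  then show ?thesis by blast
qed

lemma S_Dom2: "v \<in> Dom2 \<Longrightarrow> 0 \<le> t \<Longrightarrow> S t v \<in> Dom2"
  using S_Dom by (auto simp: Dom2_def)

text \<open>\<open>\<delta> t\<^sup>3 E(A S(t) v) + E(S(t) v)\<close> is a Lyapunov function on \<open>[0, 1]\<close>.\<close>

lemma A_S_bound:
  "\<exists>C>0. \<forall>v t. v \<in> Dom2 \<longrightarrow> 0 < t \<longrightarrow> t \<le> 1 \<longrightarrow> t ^ 3 * (norm (A (S t v)))\<^sup>2 \<le> C * (norm v)\<^sup>2"
proof -
  obtain K where K: "K > 0" and interp: "\<And>v \<delta>. v \<in> Dom \<Longrightarrow> A v \<in> Dom \<Longrightarrow> 0 < \<delta> \<Longrightarrow> \<delta> \<le> 1 \<Longrightarrow>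
     (norm (A v))\<^sup>2 \<le> K * ((norm (wderiv 2 v))\<^sup>2 / \<delta> ^ 4 + \<delta>\<^sup>2 * (norm (wderiv 2 (A v)))\<^sup>2)"
    using kawahara_op_interpolation by blast
  \<comment> \<open>First \<open>\<epsilon>\<close> is made so small that the dissipation of the
    term with \<open>s ^ 3\<close> absorbs the second derivative of \<open>?w\<close>; then
    \<open>\<delta>\<close> is fixed so that the dissipation of
    \<open>energy \<kappa> (S s v)\<close> exactly balances what interpolation costs in the second
    derivative of \<open>?z\<close>.\<close>
  define \<epsilon> where "\<epsilon> = min 1 (5 * \<kappa> / (6 * K))"
  define \<delta> where "\<delta> = 5 * \<kappa> * \<epsilon>\<^sup>2 / (6 * K)"
  have \<epsilon>: "0 < \<epsilon>" "\<epsilon> \<le> 1" "6 * K * \<epsilon> \<le> 5 * \<kappa>"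
  proof -
    show "0 < \<epsilon>" "\<epsilon> \<le> 1" using K \<kappa> by (auto simp: \<epsilon>_def)
    have "\<epsilon> \<le> 5 * \<kappa> / (6 * K)" by (simp add: \<epsilon>_def)
    then show "6 * K * \<epsilon> \<le> 5 * \<kappa>" using K by (simp add: field_simps)
  qed
  have \<delta>: "0 < \<delta>" "6 * \<delta> * K / \<epsilon>\<^sup>2 = 5 * \<kappa>" using \<epsilon> K \<kappa> by (simp_all add: \<delta>_def)
  have bound: "t ^ 3 * (norm (A (S t v)))\<^sup>2 \<le> 2 / \<delta> * (norm v)\<^sup>2" if v: "v \<in> Dom2" and t: "0 < t" "t \<le> 1" for v t
  proof -
    have v1: "v \<in> Dom" and v2: "A v \<in> Dom" using v by (auto simp: Dom2_def)
    let ?f = "\<lambda>s. - (\<delta> * s ^ 3 * energy \<kappa> (S s (A v)) + energy \<kappa> (S s v))"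
    have "?f 0 \<le> ?f t"
    proof (rule DERIV_nonneg_imp_increasing_open[where f = ?f])
      fix s assume s: "0 < s" "s < t"
      let ?z = "S s v" and ?w = "S s (A v)"
      let ?p = "norm (wderiv 2 ?z)" and ?q = "norm (wderiv 2 ?w)"
      have z: "?z \<in> Dom" "?w \<in> Dom" "A ?z = ?w" using S_Dom[OF v1] S_Dom[OF v2] s by simp_all
      \<comment> \<open>The scale balances the powers of time: \<open>s\<^sup>2\<close> from
        differentiating \<open>s ^ 3\<close> meets \<open>1 / s\<^sup>2\<close> in one term of the
        interpolation and \<open>s\<close> in the other.\<close>
      define \<eta> where "\<eta> = sqrt (\<epsilon> * s)"
      have es: "0 < \<epsilon> * s" "\<epsilon> * s \<le> 1" using \<epsilon> s t by (auto intro: mult_le_one)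
      have \<eta>: "0 < \<eta>" "\<eta> \<le> 1" "\<eta>\<^sup>2 = \<epsilon> * s" using es by (auto simp: \<eta>_def)
      have \<eta>4: "\<eta> ^ 4 = (\<epsilon> * s)\<^sup>2" using \<eta>(3) power_mult[of \<eta> 2 2] by simp
      have "(norm ?w)\<^sup>2 \<le> K * (?p\<^sup>2 / (\<epsilon> * s)\<^sup>2 + (\<epsilon> * s) * ?q\<^sup>2)"
        using interp[OF z(1) _ \<eta>(1,2)] z by (simp add: \<eta>(3) \<eta>4)
      then have "6 * \<delta> * s\<^sup>2 * (norm ?w)\<^sup>2 \<le> 6 * \<delta> * s\<^sup>2 * (K * (?p\<^sup>2 / (\<epsilon> * s)\<^sup>2 + (\<epsilon> * s) * ?q\<^sup>2))"
        using \<delta>(1) by (intro mult_left_mono) auto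
      also have "\<dots> = (6 * \<delta> * K / \<epsilon>\<^sup>2) * ?p\<^sup>2 + \<delta> * s ^ 3 * (6 * K * \<epsilon>) * ?q\<^sup>2"
        using s \<epsilon> by (simp add: power_mult_distrib field_simps power2_eq_square power3_eq_cube)
      also have "\<dots> \<le> 5 * \<kappa> * ?p\<^sup>2 + \<delta> * s ^ 3 * (5 * \<kappa>) * ?q\<^sup>2"
        unfolding \<delta>(2) using \<epsilon>(3) \<delta>(1) s by (intro add_left_mono mult_right_mono mult_left_mono) auto
      finally have key: "6 * \<delta> * s\<^sup>2 * (norm ?w)\<^sup>2 \<le> 5 * \<kappa> * ?p\<^sup>2 + \<delta> * s ^ 3 * (5 * \<kappa> * ?q\<^sup>2)" by (simp add: mult.assoc)
      have d: "(?f has_real_derivative - (\<delta> * (3 * s\<^sup>2) * energy \<kappa> ?w + 2 * inner (A ?w) (B ?w) * (\<delta> * s ^ 3) + 2 * inner (A ?z) (B ?z))) (at s)"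
        by (rule derivative_eq_intros energy_derivative v1 v2 s refl)+ (simp_all add: algebra_simps)
      have "\<delta> * (3 * s\<^sup>2) * energy \<kappa> ?w \<le> \<delta> * (3 * s\<^sup>2) * (2 * (norm ?w)\<^sup>2)"
        using \<delta>(1) \<kappa> by (intro mult_left_mono energy_le) auto
      moreover have "2 * inner (A ?w) (B ?w) * (\<delta> * s ^ 3) \<le> - (5 * \<kappa> * ?q\<^sup>2) * (\<delta> * s ^ 3)"
        using \<delta>(1) s by (intro mult_right_mono energy_dissipation z) auto
      moreover have "2 * inner (A ?z) (B ?z) \<le> - (5 * \<kappa> * ?p\<^sup>2)" by (rule energy_dissipation[OF z(1)])
      ultimately have "0 \<le> - (\<delta> * (3 * s\<^sup>2) * energy \<kappa> ?w + 2 * inner (A ?w) (B ?w) * (\<delta> * s ^ 3) + 2 * inner (A ?z) (B ?z))"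
        using key by (simp add: algebra_simps)
      with d show "\<exists>y. (?f has_real_derivative y) (at s) \<and> 0 \<le> y" by blast
    qed (use t in \<open>auto intro!: continuous_intros energy_continuous\<close>)
    then have "\<delta> * t ^ 3 * energy \<kappa> (S t (A v)) + energy \<kappa> (S t v) \<le> energy \<kappa> v" by (simp add: S_0)
    moreover have "0 \<le> energy \<kappa> (S t v)" using order_trans[OF zero_le_power2 energy_ge[OF \<kappa>(2)]] .
    moreover have "\<delta> * t ^ 3 * (norm (S t (A v)))\<^sup>2 \<le> \<delta> * t ^ 3 * energy \<kappa> (S t (A v))"
      using \<delta>(1) t by (intro mult_left_mono energy_ge \<kappa>) auto
    moreover have "energy \<kappa> v \<le> 2 * (norm v)\<^sup>2" by (rule energy_le) (use \<kappa> in auto)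
    ultimately have "\<delta> * t ^ 3 * (norm (S t (A v)))\<^sup>2 \<le> 2 * (norm v)\<^sup>2" by linarith
    then show ?thesis using S_Dom(2)[OF v1] t \<delta>(1) by (simp add: field_simps)
  qed
  show ?thesis using bound \<delta>(1) by (intro exI[of _ "2 / \<delta>"]) auto
qed

text \<open>The semigroup with values in \<open>h2\<close>. The value has its intended meaning only
  when \<open>S t v\<close> lies in \<open>sobolev 2\<close>, which the smoothing estimate shows for
  every \<open>t > 0\<close> and every \<open>v\<close>.\<close>

definition T :: "real \<Rightarrow> l2 \<Rightarrow> h2" where "T t v = abs_h2 (S t v)"

lemma norm_h2_Dom:
  assumes "v \<in> Dom" shows "rep_h2 (abs_h2 v) = v" "norm (abs_h2 v) \<le> 3 * norm (wderiv 2 v)"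
proof -
  have s: "v \<in> sobolev 2" using sobolev_mono[OF kawahara_dom_sobolev[OF assms], of 2] by simp
  then show 1: "rep_h2 (abs_h2 v) = v" by (rule abs_h2_inverse)
  show "norm (abs_h2 v) \<le> 3 * norm (wderiv 2 v)"
    using norm_h2_le[of "abs_h2 v"] kawahara_dom_poincare[OF assms] by (simp add: 1)
qed

text \<open>The squared norm of the second derivative is at most the product of the norms of
  \<open>A (S t v)\<close> and \<open>v\<close>, divided by \<kappa>. The rate -3/2 of the former is
  thereby halved to -3/4.\<close>

lemma smoothing_small:
  "\<exists>M>0. \<forall>v t. v \<in> Dom2 \<longrightarrow> 0 < t \<longrightarrow> t \<le> 1 \<longrightarrow> norm (T t v) \<le> M * t powr (-3/4) * norm v"
proof -
  obtain C where C: "C > 0" and AS: "\<And>v t. v \<in> Dom2 \<Longrightarrow> 0 < t \<Longrightarrow> t \<le> 1 \<Longrightarrow> t ^ 3 * (norm (A (S t v)))\<^sup>2 \<le> C * (norm v)\<^sup>2"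
    using A_S_bound by blast
  \<comment> \<open>The estimate is carried out for fourth powers to avoid roots. Since
    \<open>M\<close> is at least 1, \<open>M ^ 4\<close> bounds \<open>C / \<kappa>\<^sup>2\<close>
    and a fourth root of the constant need not be taken.\<close>
  define M where "M = 1 + C / \<kappa>\<^sup>2"
  have M: "M \<ge> 1" using C by (simp add: M_def)
  have bound: "norm (T t v) \<le> 3 * M * t powr (-3/4) * norm v" if v: "v \<in> Dom2" and t: "0 < t" "t \<le> 1" for v t
  proof -
    have z: "S t v \<in> Dom" using S_Dom(1) v t by (simp add: Dom2_def)
    let ?p = "norm (wderiv 2 (S t v))"
    have "\<kappa> * ?p\<^sup>2 \<le> norm (A (S t v)) * norm (S t v)"
      unfolding \<kappa>_def by (rule kawahara_wderiv2_bound[OF \<alpha> z])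
    also have "\<dots> \<le> norm (A (S t v)) * norm v" using t by (intro mult_left_mono S_norm) auto
    finally have "(\<kappa> * ?p\<^sup>2)\<^sup>2 \<le> (norm (A (S t v)) * norm v)\<^sup>2" using \<kappa> by (intro power_mono) auto
    then have "t ^ 3 * (\<kappa> * ?p\<^sup>2)\<^sup>2 \<le> t ^ 3 * (norm (A (S t v)) * norm v)\<^sup>2" using t by (intro mult_left_mono) auto
    also have "\<dots> = t ^ 3 * (norm (A (S t v)))\<^sup>2 * (norm v)\<^sup>2" by (simp add: power_mult_distrib)
    also have "\<dots> \<le> C * (norm v)\<^sup>2 * (norm v)\<^sup>2" by (intro mult_right_mono AS v t) auto
    finally have 1: "t ^ 3 * ?p ^ 4 \<le> C / \<kappa>\<^sup>2 * norm v ^ 4"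
      using \<kappa> by (simp add: power_mult_distrib field_simps flip: power_mult power_add)
    have "C / \<kappa>\<^sup>2 \<le> M" by (simp add: M_def)
    also have "M \<le> M ^ 4" using M by (simp add: self_le_power)
    finally have 2: "C / \<kappa>\<^sup>2 * norm v ^ 4 \<le> M ^ 4 * norm v ^ 4" by (intro mult_right_mono) auto
    have "(t powr (3/4)) ^ 4 = t powr (3/4 * real 4)" using t by (subst powr_power) auto
    also have "\<dots> = t ^ 3" using t by simp
    finally have "(t powr (3/4)) ^ 4 = t ^ 3" .
    then have "(t powr (3/4) * ?p) ^ 4 \<le> (M * norm v) ^ 4" using 1 2 by (simp add: power_mult_distrib)
    then have "t powr (3/4) * ?p \<le> M * norm v"
      using M power_mono_iff[of "t powr (3/4) * ?p" "M * norm v" 4] by simp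
    then have "t powr (-3/4) * (t powr (3/4) * ?p) \<le> t powr (-3/4) * (M * norm v)" by (intro mult_left_mono) auto
    moreover have "t powr (-3/4) * t powr (3/4) = 1" using t by (simp flip: powr_add)
    ultimately have "?p \<le> M * t powr (-3/4) * norm v" by (simp add: mult.assoc[symmetric]) (simp add: mult_ac)
    moreover have "norm (T t v) \<le> 3 * ?p" unfolding T_def by (rule norm_h2_Dom[OF z])
    ultimately show ?thesis by simp
  qed
  show ?thesis using bound M by (intro exI[of _ "3 * M"]) auto
qed

lemma exp_decay_le: "c > 0 \<Longrightarrow> 1 \<le> t \<Longrightarrow> exp (- (c * (t - 1))) \<le> (2 + 4 / c\<^sup>2) * (1 / t\<^sup>2)" for c t :: real
proof -
  assume c: "c > 0" and t: "1 \<le> t"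
  let ?x = "c * (t - 1)"
  have e: "1 + ?x + ?x\<^sup>2 / 2 \<le> exp ?x" using c t by (intro exp_lower_Taylor_quadratic) auto
  have x0: "0 \<le> ?x" using c t by simp
  have "t\<^sup>2 \<le> 2 * 1 + 2 * (t - 1)\<^sup>2"
    using zero_le_power2[of "t - 2"] by (simp add: power2_eq_square algebra_simps)
  also have "(t - 1)\<^sup>2 = ?x\<^sup>2 / c\<^sup>2" using c by (simp add: power_mult_distrib)
  also have "2 * 1 + 2 * (?x\<^sup>2 / c\<^sup>2) \<le> 2 * exp ?x + 2 * (2 * exp ?x / c\<^sup>2)"
  proof -
    have "1 \<le> exp ?x" "?x\<^sup>2 \<le> 2 * exp ?x" using e x0 zero_le_power2[of ?x] by linarith+
    then show ?thesis using c by (intro add_mono mult_left_mono divide_right_mono) auto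
  qed
  also have "\<dots> = (2 + 4 / c\<^sup>2) * exp ?x" by (simp add: algebra_simps)
  finally have "t\<^sup>2 * exp (- ?x) \<le> (2 + 4 / c\<^sup>2) * exp ?x * exp (- ?x)" by (intro mult_right_mono) auto
  also have "\<dots> = 2 + 4 / c\<^sup>2" by (simp add: mult.assoc flip: exp_add)
  finally show ?thesis using t by (simp add: field_simps)
qed

text \<open>For large times the orbit is split as \<open>S 1\<close> after \<open>S (t - 1)\<close>:
  the last unit of time smooths and the remaining time decays.\<close>

lemma smoothing_Dom2:
  "\<exists>M>0. \<forall>v t. v \<in> Dom2 \<longrightarrow> 0 < t \<longrightarrow> norm (T t v) \<le> M * kernel t * norm v"
proof -
  obtain M where M: "M > 0" and small: "\<And>v t. v \<in> Dom2 \<Longrightarrow> 0 < t \<Longrightarrow> t \<le> 1 \<Longrightarrow> norm (T t v) \<le> M * t powr (-3/4) * norm v"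
    using smoothing_small by blast
  \<comment> \<open>Half the rate of the squared norm, since the norm itself is estimated.\<close>
  define c where "c = 5/4 * \<kappa>"
  have c: "c > 0" using \<kappa> by (simp add: c_def)
  define L where "L = 2 * (2 + 4 / c\<^sup>2)"
  have L: "L \<ge> 1" using c by (simp add: L_def)
  have bound: "norm (T t v) \<le> 16 * M * L * kernel t * norm v" if v: "v \<in> Dom2" and t: "0 < t" for v t
  proof (cases "t \<le> 1")
    case True
    have "norm (T t v) \<le> M * t powr (-3/4) * norm v" by (rule small[OF v t True])
    also have "\<dots> \<le> M * (16 * kernel t) * norm v"
      using M by (intro mult_right_mono mult_left_mono kernel_lower_small t True) auto
    also have "\<dots> = (16 * M * kernel t * norm v) * 1" by simp
    also have "\<dots> \<le> (16 * M * kernel t * norm v) * L"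
      using M L kernel_nonneg[of t] by (intro mult_left_mono) auto
    finally show ?thesis by (simp add: mult_ac)
  next
    case False
    then have t1: "1 \<le> t" by simp
    let ?w = "S (t - 1) v"
    have "T t v = T 1 ?w" using S_add[of 1 "t - 1" v] t1 by (simp add: T_def)
    then have 1: "norm (T t v) \<le> M * norm ?w" using small[OF S_Dom2[OF v], of "t - 1" 1] t1 by simp
    have "(norm ?w)\<^sup>2 \<le> 2 * exp (- (5/2 * \<kappa> * (t - 1))) * (norm v)\<^sup>2" by (rule S_decay) (use t1 in simp)
    also have "exp (- (5/2 * \<kappa> * (t - 1))) = (exp (- (c * (t - 1))))\<^sup>2"
      by (simp add: c_def power2_eq_square flip: exp_add)
    also have "2 * (exp (- (c * (t - 1))))\<^sup>2 * (norm v)\<^sup>2 \<le> (2 * exp (- (c * (t - 1))) * norm v)\<^sup>2"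
      by (simp add: power_mult_distrib)
    finally have "norm ?w \<le> 2 * exp (- (c * (t - 1))) * norm v" by (rule power2_le_imp_le) simp
    also have "\<dots> \<le> 2 * ((2 + 4 / c\<^sup>2) * (1 / t\<^sup>2)) * norm v"
      by (intro mult_right_mono mult_left_mono exp_decay_le c t1) auto
    also have "\<dots> = L * (1 / t\<^sup>2) * norm v" by (simp add: L_def)
    also have "\<dots> \<le> L * (16 * kernel t) * norm v"
      using L by (intro mult_right_mono mult_left_mono kernel_lower_large t1) auto
    finally have "M * norm ?w \<le> M * (L * (16 * kernel t) * norm v)" using M by (intro mult_left_mono) auto
    with 1 show ?thesis by (simp add: mult_ac)
  qed
  show ?thesis using bound M L by (intro exI[of _ "16 * M * L"]) auto
qed

text \<open>For approximations of \<open>v\<close> from \<open>Dom2\<close> the estimate makes the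
  images Cauchy in \<open>h2\<close>. Their limit must be \<open>S t v\<close>, which therefore lies
  in the Sobolev space.\<close>

lemma smoothing:
  "\<exists>M>0. \<forall>v t. 0 < t \<longrightarrow> S t v \<in> sobolev 2 \<and> norm (T t v) \<le> M * kernel t * norm v"
proof -
  obtain M where M: "M > 0" and D2: "\<And>v t. v \<in> Dom2 \<Longrightarrow> 0 < t \<Longrightarrow> norm (T t v) \<le> M * kernel t * norm v"
    using smoothing_Dom2 by blast
  have "S t v \<in> sobolev 2 \<and> norm (T t v) \<le> M * kernel t * norm v" if t: "0 < t" for v t
  proof -
    obtain x where x: "\<And>n. x n \<in> Dom2" "x \<longlonglongrightarrow> v" using Dom2_dense closure_sequential[of v Dom2] by auto
    have rep: "rep_h2 (T t w) = S t w" if "w \<in> Dom2" for w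
      unfolding T_def using S_Dom2[OF that, of t] t by (intro norm_h2_Dom(1)) (simp add: Dom2_def)
    have diff: "T t (x m - x n) = T t (x m) - T t (x n)" for m n
    proof -
      have "x m - x n \<in> Dom2" by (rule subspace_diff[OF subspace_Dom2 x(1) x(1)])
      then have "rep_h2 (T t (x m - x n)) = rep_h2 (T t (x m) - T t (x n))"
        using t by (simp add: rep x(1) minus_h2.rep_eq linear_diff[OF S_linear])
      then show ?thesis by (simp add: rep_h2_inject)
    qed
    have "Cauchy (\<lambda>n. T t (x n))"
    proof (rule metric_CauchyI)
      fix e :: real assume e: "e > 0"
      define k where "k = M * kernel t + 1"
      have k: "k > 0" using M kernel_nonneg[of t] by (simp add: k_def add_nonneg_pos)
      have "Cauchy x" using x(2) by (rule LIMSEQ_imp_Cauchy)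
      then obtain N where N: "\<And>m n. m \<ge> N \<Longrightarrow> n \<ge> N \<Longrightarrow> dist (x m) (x n) < e / k"
        using metric_CauchyD[of x "e / k"] e k by auto
      have "dist (T t (x m)) (T t (x n)) < e" if "m \<ge> N" "n \<ge> N" for m n
      proof -
        have "dist (T t (x m)) (T t (x n)) \<le> M * kernel t * norm (x m - x n)"
          using D2[OF subspace_diff[OF subspace_Dom2 x(1)[of m] x(1)[of n]] t] by (simp add: dist_norm diff)
        also have "\<dots> \<le> k * norm (x m - x n)" by (intro mult_right_mono) (auto simp: k_def)
        also have "\<dots> < k * (e / k)" using N[OF that] k by (intro mult_strict_left_mono) (auto simp: dist_norm)
        finally show ?thesis using k by simp
      qed
      then show "\<exists>N. \<forall>m\<ge>N. \<forall>n\<ge>N. dist (T t (x m)) (T t (x n)) < e" by blast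
    qed
    then obtain X where X: "(\<lambda>n. T t (x n)) \<longlonglongrightarrow> X" using Cauchy_convergent_iff convergent_def by blast
    from bounded_linear.tendsto[OF bounded_linear_rep_h2 X] have "(\<lambda>n. S t (x n)) \<longlonglongrightarrow> rep_h2 X" by (simp add: rep x(1))
    moreover have "(\<lambda>n. S t (x n)) \<longlonglongrightarrow> S t v" using t by (intro bounded_linear.tendsto[OF S_bounded_linear] x(2)) auto
    ultimately have eq: "S t v = rep_h2 X" by (rule LIMSEQ_unique[rotated])
    have "norm X \<le> M * kernel t * norm v"
    proof (rule LIMSEQ_le)
      show "(\<lambda>n. norm (T t (x n))) \<longlonglongrightarrow> norm X" by (intro tendsto_intros X)
      show "(\<lambda>n. M * kernel t * norm (x n)) \<longlonglongrightarrow> M * kernel t * norm v" by (intro tendsto_intros x(2))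
      show "\<exists>N. \<forall>n\<ge>N. norm (T t (x n)) \<le> M * kernel t * norm (x n)" using D2[OF x(1) t] by blast
    qed
    then show ?thesis using rep_h2[of X] by (simp add: eq T_def rep_h2_inverse)
  qed
  then show ?thesis using M by blast
qed

end

subsection \<open>Bounded solutions of the inhomogeneous linear problem\<close>

lemma integral_shift_reflect:
  fixes f :: "real \<Rightarrow> 'a::banach"
  assumes that: "continuous_on {a..b} f" "a \<le> b"
  shows "integral {0..b - a} (\<lambda>s. f (b - s)) = integral {a..b} f"
proof -
  have "(f has_integral (integral {a..b} f)) (cbox a b)"
    using that by (simp add: integrable_integral integrable_continuous_real)
  from has_integral_affinity[OF this, of "-1" b]
  have "((\<lambda>x. f (b - x)) has_integral integral {a..b} f) ((\<lambda>x. b - x) ` {a..b})"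
    by (simp add: algebra_simps)
  moreover have "(\<lambda>x. b - x) ` {a..b} = {0..b - a}"
    using image_diff_atLeastAtMost[of b a b] by simp
  ultimately show ?thesis by (simp add: integral_unique)
qed

lemma integral_shift_real:
  fixes f :: "real \<Rightarrow> 'a::banach"
  assumes "continuous_on {c..b + c} f" "0 \<le> b"
  shows "integral {0..b} (\<lambda>s. f (s + c)) = integral {c..b + c} f"
proof -
  have "(f has_integral (integral {c..b + c} f)) (cbox c (b + c))"
    using assms by (simp add: integrable_integral integrable_continuous_real)
  from has_integral_affinity'[OF this, of 1 c]
  have "((\<lambda>x. f (x + c)) has_integral integral {c..b + c} f) {0..b}" by simp
  then show ?thesis by (rule integral_unique)
qed

context kawahara
begin

definition M :: real where
  "M = (SOME M. M > 0 \<and> (\<forall>v t. 0 < t \<longrightarrow> S t v \<in> sobolev 2 \<and> norm (T t v) \<le> M * kernel t * norm v))"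

lemma M: "M > 0" "0 < t \<Longrightarrow> S t v \<in> sobolev 2" "0 < t \<Longrightarrow> norm (T t v) \<le> M * kernel t * norm v"
  using someI_ex[OF smoothing] unfolding M_def[symmetric] by blast+

lemma rep_T: "0 < t \<Longrightarrow> rep_h2 (T t v) = S t v"
  unfolding T_def by (rule abs_h2_inverse[OF M(2)])

lemma bounded_linear_T: "0 < t \<Longrightarrow> bounded_linear (T t)"
proof (rule bounded_linear_intro[where K = "M * kernel t"])
  assume t: "0 < t"
  show "T t (u + v) = T t u + T t v" for u v
    using t by (simp add: rep_h2_inject[symmetric] rep_T plus_h2.rep_eq linear_add[OF S_linear])
  show "T t (c *\<^sub>R u) = c *\<^sub>R T t u" for c u
    using t by (simp add: rep_h2_inject[symmetric] rep_T scaleR_h2.rep_eq linear_scale[OF S_linear])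
  show "norm (T t v) \<le> norm v * (M * kernel t)" for v using M(3)[OF t, of v] by (simp add: mult.commute)
qed

lemma T_add: "0 < s \<Longrightarrow> 0 \<le> t \<Longrightarrow> T (s + t) v = T s (S t v)"
  by (simp add: T_def S_add)

text \<open>Strong continuity is known in \<open>l2\<close> only. Splitting off the fixed factor
  \<open>T a\<close>, which is bounded into \<open>h2\<close>, transfers it to \<open>h2\<close> as
  long as the time stays above \<open>a > 0\<close>.\<close>

lemma T_continuous_on:
  fixes f :: "'b::topological_space \<Rightarrow> l2"
  assumes \<sigma>: "continuous_on X \<sigma>" "\<And>x. x \<in> X \<Longrightarrow> a \<le> \<sigma> x" and a: "0 < a" and f: "continuous_on X f"
  shows "continuous_on X (\<lambda>x. T (\<sigma> x) (f x))"
proof -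
  have "continuous_on X (\<lambda>x. T a (S (\<sigma> x - a) (f x)))"
    by (intro bounded_linear.continuous_on[OF bounded_linear_T[OF a]] S_continuous_on continuous_intros \<sigma>(1) f)
      (use \<sigma>(2) in simp)
  moreover have "T a (S (\<sigma> x - a) (f x)) = T (\<sigma> x) (f x)" if "x \<in> X" for x
    using T_add[OF a, of "\<sigma> x - a" "f x"] \<sigma>(2)[OF that] by simp
  ultimately show ?thesis by (simp cong: continuous_on_cong)
qed

lemma T_integrand_continuous:
  assumes f: "continuous_on UNIV f" and a: "0 < a"
  shows "continuous_on {a..b} (\<lambda>s. T s (f (t - s)))"
  by (rule T_continuous_on[where a = a])
    (use a in \<open>auto intro!: continuous_intros continuous_on_compose2[OF f]\<close>)

lemma S_integrand_continuous:
  assumes f: "continuous_on UNIV f"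
  shows "continuous_on {0..b} (\<lambda>s. S s (f (t - s)))"
  by (rule S_continuous_on) (auto intro!: continuous_intros continuous_on_compose2[OF f])

lemma integral_T_bound:
  assumes f: "continuous_on UNIV f" and F: "\<And>s. norm (f s) \<le> F" and ab: "0 < a" "a \<le> b"
  shows "norm (integral {a..b} (\<lambda>s. T s (f (t - s)))) \<le> M * F * (kernel_int b - kernel_int a)"
proof -
  have k: "(kernel has_integral (kernel_int b - kernel_int a)) {a..b}"
  proof (rule fundamental_theorem_of_calculus[OF ab(2)])
    fix s assume "s \<in> {a..b}"
    then have "(kernel_int has_real_derivative kernel s) (at s)" using ab by (intro kernel_int_deriv) auto
    then show "(kernel_int has_vector_derivative kernel s) (at s within {a..b})"
      by (simp add: has_real_derivative_iff_has_vector_derivative has_vector_derivative_at_within)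
  qed
  then have kF: "((\<lambda>s. M * F * kernel s) has_integral M * F * (kernel_int b - kernel_int a)) {a..b}"
    by (rule has_integral_mult_right)
  have "norm (integral {a..b} (\<lambda>s. T s (f (t - s)))) \<le> integral {a..b} (\<lambda>s. M * F * kernel s)"
  proof (rule Henstock_Kurzweil_Integration.integral_norm_bound_integral)
    show "(\<lambda>s. T s (f (t - s))) integrable_on {a..b}"
      by (rule integrable_continuous_real[OF T_integrand_continuous[OF f ab(1)]])
    show "(\<lambda>s. M * F * kernel s) integrable_on {a..b}" using kF by blast
    fix s assume "s \<in> {a..b}"
    then have "norm (T s (f (t - s))) \<le> M * kernel s * norm (f (t - s))" using ab by (intro M(3)) auto
    also have "\<dots> \<le> M * kernel s * F" using M(1) kernel_nonneg[of s] by (intro mult_left_mono F) auto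
    finally show "norm (T s (f (t - s))) \<le> M * F * kernel s" by (simp add: mult_ac)
  qed
  then show ?thesis unfolding integral_unique[OF kF] .
qed

section \<open>The convolution with the semigroup\<close>

text \<open>Both ends are cut off: the integrand is continuous into \<open>h2\<close> on compact
  intervals away from 0, and the kernel bounds what is lost at the singularity and at infinity.
  \<open>tail\<close> is the kernel mass outside the interval.\<close>

definition trunc_conv :: "real \<Rightarrow> (real \<Rightarrow> l2) \<Rightarrow> real \<Rightarrow> h2" where
  "trunc_conv N f t = integral {1 / N..N} (\<lambda>s. T s (f (t - s)))"

definition tail :: "real \<Rightarrow> real" where
  "tail N = kernel_int (1 / N) + (1 - kernel_int N)"

definition semigroup_conv :: "(real \<Rightarrow> l2) \<Rightarrow> real \<Rightarrow> h2" where
  "semigroup_conv f t = lim (\<lambda>n. trunc_conv (real (Suc n)) f t)"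

lemma tail_tendsto: "(tail \<longlongrightarrow> 0) at_top"
proof -
  have "((\<lambda>N. kernel_int (1 / N) + (1 - kernel_int N)) \<longlongrightarrow> 0 + (1 - 1)) at_top"
    by (intro tendsto_intros kernel_int_at_0 kernel_int_at_top)
  then show ?thesis by (simp add: tail_def[abs_def])
qed

lemma one_div_le: "1 \<le> N \<Longrightarrow> 1 / N \<le> (N::real)"
  by (meson divide_le_eq_1_pos order_trans zero_less_one order_less_le_trans)

lemma trunc_conv_diff:
  assumes f: "continuous_on UNIV f" and F: "\<And>s. norm (f s) \<le> F" and N: "1 \<le> N" "N \<le> N'"
  shows "norm (trunc_conv N' f t - trunc_conv N f t) \<le> M * F * tail N"
proof -
  let ?g = "\<lambda>s. T s (f (t - s))"
  have le: "1 / N' \<le> 1 / N" "1 / N \<le> N" "0 < 1 / N'" using N one_div_le[OF N(1)] by (auto simp: frac_le)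
  have i: "?g integrable_on {a..b}" if "0 < a" for a b
    by (rule integrable_continuous_real[OF T_integrand_continuous[OF f that]])
  have e1: "integral {1 / N'..1 / N} ?g + integral {1 / N..N'} ?g = integral {1 / N'..N'} ?g"
    by (rule Henstock_Kurzweil_Integration.integral_combine) (use le N i in auto)
  have e2: "integral {1 / N..N} ?g + integral {N..N'} ?g = integral {1 / N..N'} ?g"
    by (rule Henstock_Kurzweil_Integration.integral_combine) (use le N i in auto)
  have "trunc_conv N' f t - trunc_conv N f t = integral {1 / N'..1 / N} ?g + integral {N..N'} ?g"
    unfolding trunc_conv_def e1[symmetric, unfolded e2[symmetric]] by simp
  also have "norm \<dots> \<le> norm (integral {1 / N'..1 / N} ?g) + norm (integral {N..N'} ?g)" by (rule norm_triangle_ineq)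
  also have "\<dots> \<le> M * F * (kernel_int (1 / N) - kernel_int (1 / N')) + M * F * (kernel_int N' - kernel_int N)"
    using le N by (intro add_mono integral_T_bound f F) auto
  also have "\<dots> = M * F * ((kernel_int (1 / N) - kernel_int (1 / N')) + (kernel_int N' - kernel_int N))"
    by (simp add: algebra_simps)
  also have "\<dots> \<le> M * F * tail N"
  proof (rule mult_left_mono)
    show "0 \<le> M * F" using M(1) order_trans[OF norm_ge_zero F] by simp
  qed (use kernel_int_bounds(1)[of "1 / N'"] kernel_int_bounds(2)[of N'] in \<open>simp add: tail_def\<close>)
  finally show ?thesis .
qed

lemma real_Suc_at_top: "filterlim (\<lambda>n. real (Suc n)) at_top sequentially"
  by (rule filterlim_compose[OF filterlim_real_sequentially filterlim_Suc])

lemma trunc_conv_lim: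
  assumes f: "continuous_on UNIV f" and F: "\<And>s. norm (f s) \<le> F"
  shows "(\<lambda>n. trunc_conv (real (Suc n)) f t) \<longlonglongrightarrow> semigroup_conv f t"
proof -
  have F0: "0 \<le> F" by (rule order_trans[OF norm_ge_zero F])
  have lim: "(\<lambda>n. M * F * tail (real (Suc n))) \<longlonglongrightarrow> M * F * 0"
    by (intro tendsto_intros filterlim_compose[OF tail_tendsto real_Suc_at_top])
  have "Cauchy (\<lambda>n. trunc_conv (real (Suc n)) f t)"
  proof (rule metric_CauchyI)
    fix e :: real assume e: "e > 0"
    obtain N where N: "M * F * tail (real (Suc N)) < e / 2"
      using order_tendstoD(2)[OF lim, of "e/2"] e by (auto simp: eventually_sequentially)
    have "dist (trunc_conv (real (Suc m)) f t) (trunc_conv (real (Suc n)) f t) < e" if "m \<ge> N" "n \<ge> N" for m n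
    proof -
      have "dist (trunc_conv (real (Suc k)) f t) (trunc_conv (real (Suc N)) f t) < e / 2" if "k \<ge> N" for k
        unfolding dist_norm by (rule le_less_trans[OF trunc_conv_diff[OF f F] N]) (use that in auto)
      then show ?thesis using that dist_triangle_half_r[of "trunc_conv (real (Suc N)) f t"] by (metis dist_commute)
    qed
    then show "\<exists>N. \<forall>m\<ge>N. \<forall>n\<ge>N. dist (trunc_conv (real (Suc m)) f t) (trunc_conv (real (Suc n)) f t) < e" by blast
  qed
  then show ?thesis unfolding semigroup_conv_def using Cauchy_convergent_iff convergent_LIMSEQ_iff by blast
qed

lemma semigroup_conv_tail:
  assumes f: "continuous_on UNIV f" and F: "\<And>s. norm (f s) \<le> F" and N: "1 \<le> N"
  shows "norm (semigroup_conv f t - trunc_conv N f t) \<le> M * F * tail N"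
proof (rule LIMSEQ_le_const2)
  show "(\<lambda>n. norm (trunc_conv (real (Suc n)) f t - trunc_conv N f t)) \<longlonglongrightarrow> norm (semigroup_conv f t - trunc_conv N f t)"
    by (intro tendsto_intros trunc_conv_lim[OF f F])
  have "norm (trunc_conv (real (Suc n)) f t - trunc_conv N f t) \<le> M * F * tail N" if "n \<ge> nat \<lceil>N\<rceil>" for n
  proof (rule trunc_conv_diff[OF f F N])
    show "N \<le> real (Suc n)" using that by linarith
  qed
  then show "\<exists>n0. \<forall>n\<ge>n0. norm (trunc_conv (real (Suc n)) f t - trunc_conv N f t) \<le> M * F * tail N" by blast
qed

text \<open>The kernel has total mass at most 1, so the constant is \<open>M\<close>, uniformly in
  time. The a priori bound, the contraction and the comparison with translates are all instances of
  this estimate.\<close>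

lemma semigroup_conv_diff_le:
  assumes f: "continuous_on UNIV f" "\<And>s. norm (f s) \<le> F" and g: "continuous_on UNIV g" "\<And>s. norm (g s) \<le> F'"
    and d: "\<And>s. norm (f s - g s) \<le> d"
  shows "norm (semigroup_conv f t - semigroup_conv g t) \<le> M * d"
proof (rule LIMSEQ_le_const2)
  show "(\<lambda>n. norm (trunc_conv (real (Suc n)) f t - trunc_conv (real (Suc n)) g t)) \<longlonglongrightarrow> norm (semigroup_conv f t - semigroup_conv g t)"
    by (intro tendsto_intros trunc_conv_lim[OF f] trunc_conv_lim[OF g])
  have d0: "0 \<le> d" by (rule order_trans[OF norm_ge_zero d])
  have "norm (trunc_conv N f t - trunc_conv N g t) \<le> M * d" if N: "1 \<le> N" for N
  proof -
    have i: "(\<lambda>s. T s (h (t - s))) integrable_on {1 / N..N}" if "continuous_on UNIV h" for h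
      using N by (intro integrable_continuous_real T_integrand_continuous that) auto
    have "trunc_conv N f t - trunc_conv N g t = integral {1 / N..N} (\<lambda>s. T s (f (t - s)) - T s (g (t - s)))"
      unfolding trunc_conv_def by (rule Henstock_Kurzweil_Integration.integral_diff[OF i[OF f(1)] i[OF g(1)], symmetric])
    also have "\<dots> = integral {1 / N..N} (\<lambda>s. T s ((\<lambda>r. f r - g r) (t - s)))"
    proof (rule Henstock_Kurzweil_Integration.integral_cong)
      fix s assume "s \<in> {1 / N..N}"
      moreover have "0 < 1 / N" using N by simp
      ultimately have "0 < s" unfolding atLeastAtMost_iff by linarith
      then show "T s (f (t - s)) - T s (g (t - s)) = T s (f (t - s) - g (t - s))"
        by (simp add: linear_diff[OF bounded_linear.linear[OF bounded_linear_T]])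
    qed
    also have "norm \<dots> \<le> M * d * (kernel_int N - kernel_int (1 / N))"
      using N by (intro integral_T_bound continuous_intros f(1) g(1) d one_div_le) auto
    also have "\<dots> \<le> M * d * 1"
      using M(1) d0 kernel_int_bounds(1)[of "1 / N"] kernel_int_bounds(2)[of N] by (intro mult_left_mono) auto
    finally show ?thesis by simp
  qed
  then show "\<exists>n0. \<forall>n\<ge>n0. norm (trunc_conv (real (Suc n)) f t - trunc_conv (real (Suc n)) g t) \<le> M * d" by simp
qed

lemma semigroup_conv_zero: "semigroup_conv (\<lambda>s. 0) t = 0"
proof -
  have "trunc_conv (real (Suc n)) (\<lambda>s. 0) t = integral {1 / real (Suc n)..real (Suc n)} (\<lambda>s. 0)" for n
    unfolding trunc_conv_def
  proof (rule Henstock_Kurzweil_Integration.integral_cong)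
    fix s assume "s \<in> {1 / real (Suc n)..real (Suc n)}"
    moreover have "0 < 1 / real (Suc n)" by simp
    ultimately have "0 < s" unfolding atLeastAtMost_iff by linarith
    then show "T s 0 = 0" by (rule linear_0[OF bounded_linear.linear[OF bounded_linear_T]])
  qed
  then show ?thesis by (simp add: semigroup_conv_def)
qed

lemma norm_semigroup_conv_le:
  assumes f: "continuous_on UNIV f" "\<And>s. norm (f s) \<le> F"
  shows "norm (semigroup_conv f t) \<le> M * F"
  using semigroup_conv_diff_le[OF f, of "\<lambda>s. 0" 0 F t] f(2) by (simp add: semigroup_conv_zero)

lemma continuous_semigroup_conv:
  assumes f: "continuous_on UNIV f" "\<And>s. norm (f s) \<le> F"
  shows "continuous_on UNIV (semigroup_conv f)"
proof (rule uniform_limit_theorem)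
  show "\<forall>\<^sub>F n in sequentially. continuous_on UNIV (\<lambda>t. trunc_conv (real (Suc n)) f t)"
  proof (rule always_eventually, rule allI)
    fix n
    let ?N = "real (Suc n)"
    have "continuous_on (UNIV \<times> cbox (1 / ?N) ?N) (\<lambda>p. T (snd p) (f (fst p - snd p)))"
      by (rule T_continuous_on[where a = "1 / ?N"])
        (auto intro!: continuous_intros continuous_on_compose2[OF f(1)])
    then have "continuous_on (UNIV \<times> cbox (1 / ?N) ?N) (\<lambda>(t, s). T s (f (t - s)))"
      by (simp add: split_def)
    from integral_continuous_on_param[OF this] show "continuous_on UNIV (\<lambda>t. trunc_conv ?N f t)"
      by (simp add: trunc_conv_def)
  qed
  show "uniform_limit UNIV (\<lambda>n t. trunc_conv (real (Suc n)) f t) (semigroup_conv f) sequentially"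
  proof (rule uniform_limitI)
    fix e :: real assume e: "e > 0"
    have "(\<lambda>n. M * F * tail (real (Suc n))) \<longlonglongrightarrow> M * F * 0"
      by (intro tendsto_intros filterlim_compose[OF tail_tendsto real_Suc_at_top])
    then have "\<forall>\<^sub>F n in sequentially. M * F * tail (real (Suc n)) < e" using e by (intro order_tendstoD) auto
    then show "\<forall>\<^sub>F n in sequentially. \<forall>t\<in>UNIV. dist (trunc_conv (real (Suc n)) f t) (semigroup_conv f t) < e"
    proof eventually_elim
      case (elim n)
      have "dist (trunc_conv (real (Suc n)) f t) (semigroup_conv f t) < e" for t
        using le_less_trans[OF semigroup_conv_tail[OF f, of "real (Suc n)" t] elim] by (simp add: dist_norm norm_minus_commute)
      then show ?case by blast
    qed
  qed
qed simp

lemma semigroup_conv_shift: "semigroup_conv (\<lambda>s. f (s + \<tau>)) t = semigroup_conv f (t + \<tau>)"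
  by (simp add: semigroup_conv_def trunc_conv_def algebra_simps)

text \<open>The contribution of the last \<open>R\<close> units of time, integrated in
  \<open>l2\<close>, where the integrand is continuous up to \<open>s = 0\<close>.\<close>

definition Duhamel :: "(real \<Rightarrow> l2) \<Rightarrow> real \<Rightarrow> real \<Rightarrow> l2" where
  "Duhamel f t R = integral {0..R} (\<lambda>s. S s (f (t - s)))"

text \<open>The same \<open>R\<close> serves as length of the history and as truncation parameter.
  Only the piece over \<open>[0, 1 / R]\<close> separates the two integrals, and contractivity
  bounds it by \<open>F / R\<close>.\<close>

lemma Duhamel_tendsto:
  assumes f: "continuous_on UNIV f" "\<And>s. norm (f s) \<le> F"
  shows "(Duhamel f t \<longlongrightarrow> rep_h2 (semigroup_conv f t)) at_top"
proof -
  have "((\<lambda>R. Duhamel f t R - rep_h2 (semigroup_conv f t)) \<longlongrightarrow> 0) at_top"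
  proof (rule Lim_null_comparison)
    show "\<forall>\<^sub>F R in at_top. norm (Duhamel f t R - rep_h2 (semigroup_conv f t)) \<le> F * (1 / R) + M * F * tail R"
      using eventually_ge_at_top[of 1]
    proof eventually_elim
      case (elim R)
      let ?g = "\<lambda>s. S s (f (t - s))"
      have i: "?g integrable_on {0..R}" by (rule integrable_continuous_real[OF S_integrand_continuous[OF f(1)]])
      have "rep_h2 (trunc_conv R f t) = integral {1 / R..R} (\<lambda>s. rep_h2 (T s (f (t - s))))"
      proof -
        have "(\<lambda>s. T s (f (t - s))) integrable_on {1 / R..R}"
          using elim by (intro integrable_continuous_real T_integrand_continuous f) auto
        from integral_linear[OF this bounded_linear_rep_h2] show ?thesis by (simp add: trunc_conv_def o_def)
      qed
      also have "\<dots> = integral {1 / R..R} ?g"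
      proof (rule Henstock_Kurzweil_Integration.integral_cong)
        fix s assume "s \<in> {1 / R..R}"
        moreover have "0 < 1 / R" using elim by simp
        ultimately have "0 < s" unfolding atLeastAtMost_iff by linarith
        then show "rep_h2 (T s (f (t - s))) = ?g s" by (rule rep_T)
      qed
      finally have K: "rep_h2 (trunc_conv R f t) = integral {1 / R..R} ?g" .
      have "integral {0..1 / R} ?g + integral {1 / R..R} ?g = Duhamel f t R"
        unfolding Duhamel_def by (rule Henstock_Kurzweil_Integration.integral_combine) (use elim one_div_le[OF elim] i in auto)
      then have "Duhamel f t R - rep_h2 (trunc_conv R f t) = integral {0..1 / R} ?g" by (simp add: K algebra_simps)
      also have "norm \<dots> \<le> F * (1 / R - 0)"
      proof (rule integral_bound)
        show "0 \<le> 1 / R" using elim by simp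
        show "continuous_on {0..1 / R} ?g" by (rule S_integrand_continuous[OF f(1)])
        show "\<And>s. s \<in> {0..1 / R} \<Longrightarrow> norm (?g s) \<le> F" using S_norm f(2) order_trans by (metis atLeastAtMost_iff)
      qed
      finally have 1: "norm (Duhamel f t R - rep_h2 (trunc_conv R f t)) \<le> F * (1 / R)" by simp
      have "norm (rep_h2 (trunc_conv R f t) - rep_h2 (semigroup_conv f t)) \<le> norm (trunc_conv R f t - semigroup_conv f t)"
        using wderiv_rep_h2_le[of 0 "trunc_conv R f t - semigroup_conv f t"] by (simp add: wderiv_0 minus_h2.rep_eq)
      also have "\<dots> \<le> M * F * tail R" using semigroup_conv_tail[OF f elim, of t] by (simp add: norm_minus_commute)
      finally have 2: "norm (rep_h2 (trunc_conv R f t) - rep_h2 (semigroup_conv f t)) \<le> M * F * tail R" .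
      show ?case
        using norm_triangle_ineq[of "Duhamel f t R - rep_h2 (trunc_conv R f t)" "rep_h2 (trunc_conv R f t) - rep_h2 (semigroup_conv f t)"] 1 2 by simp
    qed
    have "((\<lambda>R. F * (1 / R) + M * F * tail R) \<longlongrightarrow> F * 0 + M * F * 0) at_top"
      by (intro tendsto_intros tail_tendsto)
        (use tendsto_inverse_0_at_top[OF filterlim_ident] in \<open>simp add: divide_inverse\<close>)
    then show "((\<lambda>R. F * (1 / R) + M * F * tail R) \<longlongrightarrow> 0) at_top" by simp
  qed
  then show ?thesis by (rule LIM_zero_cancel)
qed

lemma Duhamel_mild_integral:
  assumes f: "continuous_on UNIV f" and rt: "r \<le> t"
  shows "Duhamel f t (t - r) = integral {r..t} (\<lambda>s. S (t - s) (f s))"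
    and "(\<lambda>s. S (t - s) (f s)) integrable_on {r..t}"
proof -
  have c: "continuous_on {r..t} (\<lambda>s. S (t - s) (f s))"
    by (rule S_continuous_on) (auto intro!: continuous_intros continuous_on_subset[OF f])
  then show "(\<lambda>s. S (t - s) (f s)) integrable_on {r..t}" by (rule integrable_continuous_real)
  show "Duhamel f t (t - r) = integral {r..t} (\<lambda>s. S (t - s) (f s))"
    using integral_shift_reflect[OF c rt] by (simp add: Duhamel_def)
qed

text \<open>Whatever happened before time \<open>r\<close> reaches time \<open>t\<close> through
  \<open>S (t - r)\<close>. Letting the history become infinitely long turns this identity into the
  mild equation.\<close>

lemma Duhamel_split:
  assumes f: "continuous_on UNIV f" and rt: "r \<le> t" and R: "0 \<le> R"
  shows "Duhamel f t (R + (t - r)) = Duhamel f t (t - r) + S (t - r) (Duhamel f r R)"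
proof -
  let ?g = "\<lambda>s. S s (f (t - s))" and ?h = "t - r"
  have c: "continuous_on {0..R + ?h} ?g" by (rule S_integrand_continuous[OF f])
  have "Duhamel f t (R + ?h) = integral {0..?h} ?g + integral {?h..R + ?h} ?g"
    unfolding Duhamel_def
    by (rule Henstock_Kurzweil_Integration.integral_combine[symmetric]) (use rt R in \<open>auto intro!: integrable_continuous_real c\<close>)
  also have "integral {?h..R + ?h} ?g = integral {0..R} (\<lambda>s. ?g (s + ?h))"
    by (rule integral_shift_real[symmetric]) (use rt R in \<open>auto intro!: continuous_on_subset[OF c]\<close>)
  also have "\<dots> = integral {0..R} (\<lambda>s. S ?h (S s (f (r - s))))"
  proof (rule Henstock_Kurzweil_Integration.integral_cong)
    fix s assume "s \<in> {0..R}"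
    then show "?g (s + ?h) = S ?h (S s (f (r - s)))"
      using S_add[of ?h s "f (r - s)"] rt by (simp add: algebra_simps)
  qed
  also have "\<dots> = S ?h (Duhamel f r R)"
    unfolding Duhamel_def
    using integral_linear[OF integrable_continuous_real[OF S_integrand_continuous[OF f, of R r]] S_bounded_linear[of ?h]] rt
    by (simp add: o_def)
  finally show ?thesis by (simp add: Duhamel_def)
qed

theorem semigroup_conv_mild:
  assumes f: "continuous_on UNIV f" "\<And>s. norm (f s) \<le> F" and rt: "r \<le> t"
  shows "((\<lambda>s. S (t - s) (f s)) has_integral (rep_h2 (semigroup_conv f t) - S (t - r) (rep_h2 (semigroup_conv f r)))) {r..t}"
proof -
  have "((\<lambda>R. Duhamel f t (R + (t - r))) \<longlongrightarrow> rep_h2 (semigroup_conv f t)) at_top"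
    by (rule filterlim_compose[OF Duhamel_tendsto[OF f]], subst add.commute)
      (rule filterlim_tendsto_add_at_top[OF tendsto_const filterlim_ident])
  moreover have "\<forall>\<^sub>F R in at_top. Duhamel f t (R + (t - r)) = Duhamel f t (t - r) + S (t - r) (Duhamel f r R)"
    using eventually_ge_at_top[of 0] by eventually_elim (rule Duhamel_split[OF f(1) rt])
  ultimately have "((\<lambda>R. Duhamel f t (t - r) + S (t - r) (Duhamel f r R)) \<longlongrightarrow> rep_h2 (semigroup_conv f t)) at_top"
    by (rule Lim_transform_eventually)
  moreover have "((\<lambda>R. Duhamel f t (t - r) + S (t - r) (Duhamel f r R)) \<longlongrightarrow> Duhamel f t (t - r) + S (t - r) (rep_h2 (semigroup_conv f r))) at_top"
    using rt by (intro tendsto_intros bounded_linear.tendsto[OF S_bounded_linear] Duhamel_tendsto[OF f]) auto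
  ultimately have "rep_h2 (semigroup_conv f t) = Duhamel f t (t - r) + S (t - r) (rep_h2 (semigroup_conv f r))"
    by (rule tendsto_unique[rotated]) simp
  then show ?thesis
    using Duhamel_mild_integral[OF f(1) rt] by (simp add: has_integral_integrable_integral)
qed

text \<open>The vector varies with \<open>R\<close> because it will be the state of a solution at
  time \<open>t - R\<close>; a uniform bound is enough, since the decay holds in operator
  norm.\<close>

lemma S_tendsto_0:
  assumes Y: "\<And>R. norm (y R) \<le> Y"
  shows "((\<lambda>R. S R (y R)) \<longlongrightarrow> 0) at_top"
proof -
  have "((\<lambda>R. (norm (S R (y R)))\<^sup>2) \<longlongrightarrow> 0) at_top"
  proof (rule Lim_null_comparison)
    show "\<forall>\<^sub>F R in at_top. norm ((norm (S R (y R)))\<^sup>2) \<le> 2 * exp (- (5/2 * \<kappa> * R)) * Y\<^sup>2"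
      using eventually_ge_at_top[of 0]
    proof eventually_elim
      case (elim R)
      have "(norm (S R (y R)))\<^sup>2 \<le> 2 * exp (- (5/2 * \<kappa> * R)) * (norm (y R))\<^sup>2" by (rule S_decay[OF elim])
      also have "\<dots> \<le> 2 * exp (- (5/2 * \<kappa> * R)) * Y\<^sup>2" by (intro mult_left_mono power_mono Y) auto
      finally show ?case by simp
    qed
    have "filterlim (\<lambda>R. 5/2 * \<kappa> * R) at_top at_top"
      using \<kappa> by (intro filterlim_tendsto_pos_mult_at_top[OF tendsto_const _ filterlim_ident]) auto
    then have "filterlim (\<lambda>R. - (5/2 * \<kappa> * R)) at_bot at_top" by (simp add: filterlim_uminus_at_bot)
    from filterlim_compose[OF exp_at_bot this]
    have "((\<lambda>R. 2 * exp (- (5/2 * \<kappa> * R)) * Y\<^sup>2) \<longlongrightarrow> 2 * 0 * Y\<^sup>2) at_top" by (intro tendsto_intros)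
    then show "((\<lambda>R. 2 * exp (- (5/2 * \<kappa> * R)) * Y\<^sup>2) \<longlongrightarrow> 0) at_top" by simp
  qed
  from tendsto_real_sqrt[OF this] have "((\<lambda>R. norm (S R (y R))) \<longlongrightarrow> 0) at_top" by simp
  then show ?thesis by (rule tendsto_norm_zero_cancel)
qed

text \<open>In the mild equation the initial time \<open>t - R\<close> is sent to -\<infinity>. The
  state there is bounded and its contribution decays, so the solution is determined by the
  right-hand side alone.\<close>

theorem mild_unique:
  assumes f: "continuous_on UNIV f" "\<And>s. norm (f s) \<le> F" and Y: "\<And>t. norm (y t) \<le> Y"
    and mild: "\<And>r t. r \<le> t \<Longrightarrow> ((\<lambda>s. S (t - s) (f s)) has_integral (y t - S (t - r) (y r))) {r..t}"
  shows "y t = rep_h2 (semigroup_conv f t)"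
proof -
  have "((\<lambda>R. y t - S R (y (t - R))) \<longlongrightarrow> y t - 0) at_top" by (intro tendsto_intros S_tendsto_0[OF Y])
  moreover have "\<forall>\<^sub>F R in at_top. y t - S R (y (t - R)) = Duhamel f t R"
    using eventually_ge_at_top[of 0]
  proof eventually_elim
    case (elim R)
    show ?case
      using Duhamel_mild_integral(1)[OF f(1), of "t - R" t] integral_unique[OF mild[of "t - R" t]] elim by simp
  qed
  ultimately have "(Duhamel f t \<longlongrightarrow> y t - 0) at_top" by (rule Lim_transform_eventually)
  then have "y t - 0 = rep_h2 (semigroup_conv f t)"
    by (rule tendsto_unique[OF trivial_limit_at_top_linorder _ Duhamel_tendsto[OF f]])
  then show ?thesis by simp
qed

end

subsection \<open>The nonlinearity\<close>

lemma bounded_bilinear_scaleC: "bounded_bilinear scaleC_l2"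
proof
  fix a b :: complex and u v :: l2 and r :: real
  show "scaleC_l2 (a + b) u = scaleC_l2 a u + scaleC_l2 b u"
    using abs_l2_add[OF sq_int_cmult[OF sq_int_rep] sq_int_cmult[OF sq_int_rep], of a u b u]
    by (simp add: abs_l2_scaleC[symmetric] sq_int_rep abs_rep_l2 abs_l2_scaleC distrib_right[symmetric])
  show "scaleC_l2 a (u + v) = scaleC_l2 a u + scaleC_l2 a v" by (rule scaleC_add)
  show "scaleC_l2 (r *\<^sub>R a) u = r *\<^sub>R scaleC_l2 a u"
    using abs_l2_scaleR[OF sq_int_cmult[OF sq_int_rep], of r a u] abs_l2_scaleC[OF sq_int_rep, of "r *\<^sub>R a" u]
    by (simp add: abs_l2_scaleC sq_int_rep abs_rep_l2)
  show "scaleC_l2 a (r *\<^sub>R u) = r *\<^sub>R scaleC_l2 a u" by (rule scaleC_scaleR)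
  show "\<exists>K. \<forall>a b. norm (scaleC_l2 a b) \<le> norm a * norm b * K"
    by (intro exI[of _ 1]) (simp add: norm_scaleC)
qed

lemma mult_l2_cong:
  assumes "continuous_on {0..1} g" "continuous_on {0..1} h" "\<And>x. x \<in> {0<..<1} \<Longrightarrow> g x = h x"
  shows "mult_l2 g u = mult_l2 h u"
  unfolding mult_l2_def
  by (intro abs_l2_cong sq_int_mult_bounded(1) assms(1,2) sq_int_rep AE_I2) (simp add: assms(3))

lemma mult_l2_const_l2: "continuous_on {0..1} g \<Longrightarrow> mult_l2 g (const_l2 c) = abs_l2 (\<lambda>x. g x * c)"
  unfolding const_l2_def by (rule mult_l2_abs_l2[OF _ sq_int_const])

lemma is_wderiv_const_l2: "is_wderiv 1 (const_l2 c) 0"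
  using is_wderiv_const_l2_prim_l2[of c 0] by (simp add: linear_0[OF bounded_linear.linear[OF bounded_linear_prim_l2]])

text \<open>The first factor enters through its continuous representative, which is bounded in terms
  of the \<open>H^2\<close> norm, so the product with an \<open>L^2\<close> function stays in
  \<open>L^2\<close>.\<close>

definition bil :: "h2 \<Rightarrow> h2 \<Rightarrow> l2" where
  "bil u v = mult_l2 (point_value (rep_h2 u)) (wderiv 1 (rep_h2 v))"

lemma continuous_point_value_h2: "continuous_on {0..1} (point_value (rep_h2 u))"
  by (rule abs_l2_point_value(1)[OF rep_h2_wderiv_1(1)])

lemma norm_bil_le: "norm (bil u v) \<le> 3 * norm u * norm v"
proof -
  have "norm (bil u v) \<le> (3 * norm u) * norm (wderiv 1 (rep_h2 v))"
    unfolding bil_def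
  proof (rule norm_mult_l2_le[OF continuous_point_value_h2])
    fix x :: real assume "x \<in> {0<..<1}"
    then show "norm (point_value (rep_h2 u) x) \<le> 3 * norm u"
      using norm_point_value_le[OF rep_h2_wderiv_1(1), of x u] wderiv_rep_h2_le[of 0 u] wderiv_rep_h2_le[of 1 u]
      by (simp add: wderiv_0)
  qed
  also have "\<dots> \<le> (3 * norm u) * norm v" by (intro mult_left_mono wderiv_rep_h2_le) auto
  finally show ?thesis .
qed

lemma bounded_bilinear_bil: "bounded_bilinear bil"
proof
  fix u v w :: h2 and r :: real
  have D1: "bounded_linear (\<lambda>v. wderiv 1 (rep_h2 v))" by (rule bounded_linear_wderiv_h2) simp
  have M: "bounded_linear (mult_l2 (point_value (rep_h2 u)))" for u
    by (rule bounded_linear_mult_l2[OF continuous_point_value_h2])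
  note lin = bounded_linear.linear[OF bounded_linear_compose[OF M D1]]
  show "bil u (v + w) = bil u v + bil u w" using linear_add[OF lin, of u v w] by (simp only: bil_def)
  show "bil u (r *\<^sub>R v) = r *\<^sub>R bil u v" using linear_scale[OF lin, of u r v] by (simp only: bil_def)
  show "bil (u + v) w = bil u w + bil v w"
    unfolding bil_def mult_l2_add_left[OF continuous_point_value_h2 continuous_point_value_h2, symmetric]
    by (rule mult_l2_cong[OF continuous_point_value_h2 continuous_on_add[OF continuous_point_value_h2 continuous_point_value_h2]])
      (simp add: plus_h2.rep_eq point_value_add[OF rep_h2_wderiv_1(1) rep_h2_wderiv_1(1)])
  have "bil (r *\<^sub>R u) w = mult_l2 (\<lambda>x. complex_of_real r * point_value (rep_h2 u) x) (wderiv 1 (rep_h2 w))"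
    unfolding bil_def
    by (rule mult_l2_cong[OF continuous_point_value_h2 continuous_on_mult_left[OF continuous_point_value_h2]])
      (simp add: scaleR_h2.rep_eq point_value_scaleC[OF rep_h2_wderiv_1(1)] flip: scaleC_of_real)
  then show "bil (r *\<^sub>R u) w = r *\<^sub>R bil u w"
    by (simp add: mult_l2_cmult_left[OF continuous_point_value_h2] bil_def scaleC_of_real)
  show "\<exists>K. \<forall>a b. norm (bil a b) \<le> norm a * norm b * K"
    by (intro exI[of _ 3]) (use norm_bil_le in \<open>simp add: mult_ac\<close>)
qed

interpretation bil: bounded_bilinear bil by (rule bounded_bilinear_bil)
interpretation scaleC: bounded_bilinear scaleC_l2 by (rule bounded_bilinear_scaleC)

section \<open>The right-hand side as a function of state and boundary data\<close>

context kawahara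
begin

abbreviation "cA \<equiv> \<lambda>x. complex_of_real (lift_A \<alpha> x)"
abbreviation "cA' \<equiv> \<lambda>x. complex_of_real (deriv (lift_A \<alpha>) x)"

lemma smooth_lift_A: "smooth (lift_A \<alpha>)"
proof -
  have "smooth (\<lambda>x. (\<alpha> - 1) / (\<alpha> + 1) * (x * x) + 2 / (\<alpha> + 1) * x + (- 1))"
    by (intro smooth_add smooth_mult smooth_const smooth_ident)
  moreover have "lift_A \<alpha> = (\<lambda>x. (\<alpha> - 1) / (\<alpha> + 1) * (x * x) + 2 / (\<alpha> + 1) * x + (- 1))"
    by (simp add: fun_eq_iff lift_A_def power2_eq_square)
  ultimately show ?thesis by simp
qed

lemma continuous_cA: "continuous_on {0..1} cA" and continuous_cA': "continuous_on {0..1} cA'"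
  by (intro continuous_on_of_real smooth_continuous smooth_deriv smooth_lift_A)+

lemma continuous_cAA': "continuous_on {0..1} (\<lambda>x. cA x * cA' x)"
  by (intro continuous_intros continuous_cA continuous_cA')

definition lift_h2 :: "complex \<Rightarrow> h2" where "lift_h2 c = abs_h2 (mult_l2 cA (const_l2 c))"

lemma lift_h2:
  shows "rep_h2 (lift_h2 c) = abs_l2 (\<lambda>x. cA x * c)" and "bounded_linear lift_h2"
proof -
  define g2 where "g2 = (\<lambda>x. complex_of_real (deriv (deriv (lift_A \<alpha>)) x))"
  have c2: "continuous_on {0..1} g2"
    unfolding g2_def by (intro continuous_on_of_real smooth_continuous smooth_deriv smooth_lift_A)
  have z: "mult_l2 g 0 = 0" if "continuous_on {0..1} g" for g
    by (rule linear_0[OF bounded_linear.linear[OF bounded_linear_mult_l2[OF that]]])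
  have "is_wderiv 1 (mult_l2 cA (const_l2 c)) (mult_l2 cA' (const_l2 c))"
    "is_wderiv 1 (mult_l2 cA' (const_l2 c)) (mult_l2 g2 (const_l2 c))" for c
    using is_wderiv_1_mult_l2[OF smooth_lift_A is_wderiv_const_l2, of c]
      is_wderiv_1_mult_l2[OF smooth_deriv[OF smooth_lift_A] is_wderiv_const_l2, of c]
    by (simp_all add: z[OF continuous_cA] z[OF continuous_cA'] g2_def)
  note ch = abs_h2_chain[OF this]
  have rep: "rep_h2 (lift_h2 c) = mult_l2 cA (const_l2 c)" for c by (simp add: lift_h2_def ch)
  then show "rep_h2 (lift_h2 c) = abs_l2 (\<lambda>x. cA x * c)" by (simp add: mult_l2_const_l2[OF continuous_cA])
  have bl: "bounded_linear (\<lambda>c. mult_l2 g (const_l2 c))" if "continuous_on {0..1} g" for g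
    by (rule bounded_linear_compose[OF bounded_linear_mult_l2[OF that] bounded_linear_const_l2])
  obtain B0 B1 B2 where B: "\<And>c. norm (mult_l2 cA (const_l2 c)) \<le> norm c * B0"
    "\<And>c. norm (mult_l2 cA' (const_l2 c)) \<le> norm c * B1" "\<And>c. norm (mult_l2 g2 (const_l2 c)) \<le> norm c * B2"
    using bounded_linear.bounded[OF bl[OF continuous_cA]] bounded_linear.bounded[OF bl[OF continuous_cA']]
      bounded_linear.bounded[OF bl[OF c2]] by blast
  show "bounded_linear lift_h2"
  proof (rule bounded_linear_intro[where K = "B0 + B1 + B2"])
    show "lift_h2 (c + d) = lift_h2 c + lift_h2 d" for c d
      using linear_add[OF bounded_linear.linear[OF bl[OF continuous_cA]], of c d]
      by (simp add: rep_h2_inject[symmetric] plus_h2.rep_eq rep)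
    show "lift_h2 (r *\<^sub>R c) = r *\<^sub>R lift_h2 c" for r c
      using linear_scale[OF bounded_linear.linear[OF bl[OF continuous_cA]], of r c]
      by (simp add: rep_h2_inject[symmetric] scaleR_h2.rep_eq rep)
    show "norm (lift_h2 c) \<le> norm c * (B0 + B1 + B2)" for c
      using norm_h2_le[of "lift_h2 c"] B[of c] by (simp add: rep ch distrib_left del: One_nat_def)
  qed
qed

definition lin :: "h2 \<Rightarrow> l2" where
  "lin u = mult_l2 cA (wderiv 1 (rep_h2 u)) + mult_l2 cA' (rep_h2 u)"

lemma bounded_linear_lin: "bounded_linear lin"
  unfolding lin_def[abs_def]
  by (intro bounded_linear_add bounded_linear_compose[OF bounded_linear_mult_l2[OF continuous_cA]]
      bounded_linear_compose[OF bounded_linear_mult_l2[OF continuous_cA']] bounded_linear_rep_h2 bounded_linear_wderiv_h2) simp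

definition e1 :: "complex \<Rightarrow> l2" where "e1 d = mult_l2 cA (const_l2 d)"
definition e2 :: "complex \<Rightarrow> l2" where "e2 d = mult_l2 (\<lambda>x. cA x * cA' x) (const_l2 d)"

lemma bounded_linear_e1: "bounded_linear e1" and bounded_linear_e2: "bounded_linear e2"
  unfolding e1_def[abs_def] e2_def[abs_def]
  by (rule bounded_linear_compose[OF bounded_linear_mult_l2[OF continuous_cA] bounded_linear_const_l2]
      bounded_linear_compose[OF bounded_linear_mult_l2[OF continuous_cAA'] bounded_linear_const_l2])+

definition NL :: "h2 \<Rightarrow> complex \<Rightarrow> complex \<Rightarrow> l2" where
  "NL y c d = - bil y y + scaleC_l2 c (lin y) + (e1 d - e2 (c\<^sup>2))"

text \<open>The right-hand side is written with an arbitrary representative of the state, the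
  bilinear form with the continuous one. They agree almost everywhere; the remaining work is to see
  that both expressions are square-integrable, without which their classes carry no meaning.\<close>

lemma rhs_eq_NL:
  assumes "y s = rep_h2 u"
  shows "rhs \<alpha> \<phi> y s = NL u (\<phi> s) (vector_derivative \<phi> (at s))"
proof -
  let ?r = "rep_l2 (rep_h2 u)" and ?p = "point_value (rep_h2 u)" and ?r1 = "rep_l2 (wderiv 1 (rep_h2 u))"
  define c where "c = \<phi> s"
  define d where "d = vector_derivative \<phi> (at s)"
  let ?f = "\<lambda>q x. - (q x * ?r1 x) + c * (cA x * ?r1 x + cA' x * ?r x) + (cA x * d - cA x * cA' x * c\<^sup>2)"
  have s1: "sq_int (\<lambda>x. ?p x * ?r1 x)" "sq_int (\<lambda>x. cA x * ?r1 x)" "sq_int (\<lambda>x. cA' x * ?r x)"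
    by (rule sq_int_mult_bounded(1)[OF continuous_point_value_h2 sq_int_rep]
        sq_int_mult_bounded(1)[OF continuous_cA sq_int_rep] sq_int_mult_bounded(1)[OF continuous_cA' sq_int_rep])+
  have s2: "sq_int (\<lambda>x. cA x * d)" "sq_int (\<lambda>x. cA x * cA' x * c\<^sup>2)"
    by (intro sq_int_continuous continuous_intros continuous_cA continuous_cA')+
  have sp: "sq_int (?f ?p)"
    by (intro sq_int_add sq_int_uminus sq_int_diff sq_int_cmult s1 s2)
  have AE: "AE x in I_leb. ?f ?r x = ?f ?p x"
    using AE_rep_point_value[OF rep_h2_wderiv_1(1), of u] by eventually_elim simp
  \<comment> \<open>A product of two \<open>L^2\<close> representatives is square-integrable here
    only because it coincides almost everywhere with the version built from the continuous
    representative.\<close>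
  have sr: "sq_int (?f ?r)"
  proof -
    have m: "(\<lambda>x. ?r x * ?r1 x) \<in> borel_measurable I_leb"
      using sq_int_rep[of "rep_h2 u"] sq_int_rep[of "wderiv 1 (rep_h2 u)"] by (auto simp: sq_int_def)
    have "(\<lambda>x. c * (cA x * ?r1 x + cA' x * ?r x) + (cA x * d - cA x * cA' x * c\<^sup>2)) \<in> borel_measurable I_leb"
      using sq_int_add[OF sq_int_cmult[OF sq_int_add[OF s1(2,3)]] sq_int_diff[OF s2], of c] by (simp add: sq_int_def)
    from borel_measurable_add[OF borel_measurable_uminus[OF m] this]
    have mr: "?f ?r \<in> borel_measurable I_leb" by (simp only: add.assoc)
    have "integrable I_leb (\<lambda>x. (norm (?f ?r x))\<^sup>2)"
    proof (rule integrable_cong_AE_imp)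
      show "integrable I_leb (\<lambda>x. (norm (?f ?p x))\<^sup>2)" using sp by (simp only: sq_int_def)
      show "(\<lambda>x. (norm (?f ?r x))\<^sup>2) \<in> borel_measurable I_leb"
        by (intro borel_measurable_power measurable_compose[OF mr borel_measurable_norm])
      show "AE x in I_leb. (norm (?f ?p x))\<^sup>2 = (norm (?f ?r x))\<^sup>2" using AE by eventually_elim (simp only:)
    qed
    with mr show ?thesis by (simp only: sq_int_def)
  qed
  have e: "e1 d = abs_l2 (\<lambda>x. cA x * d)" "e2 (c\<^sup>2) = abs_l2 (\<lambda>x. cA x * cA' x * c\<^sup>2)"
    unfolding e1_def e2_def by (rule mult_l2_const_l2[OF continuous_cA] mult_l2_const_l2[OF continuous_cAA'])+
  have "rhs \<alpha> \<phi> y s = abs_l2 (?f ?r)"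
    unfolding rhs_def assms coeff_a_def coeff_b_def source_f_def c_def d_def
    by (rule arg_cong[of _ _ abs_l2]) (simp add: fun_eq_iff algebra_simps)
  also have "\<dots> = abs_l2 (?f ?p)" by (rule abs_l2_cong[OF sr sp AE])
  also have "\<dots> = NL u c d"
    by (simp only: NL_def bil_def lin_def e mult_l2_def abs_l2_add[OF sq_int_add[OF sq_int_uminus[OF s1(1)] sq_int_cmult[OF sq_int_add[OF s1(2,3)]]] sq_int_diff[OF s2]]
        abs_l2_add[OF sq_int_uminus[OF s1(1)] sq_int_cmult[OF sq_int_add[OF s1(2,3)]]]
        abs_l2_diff[OF s2] abs_l2_uminus[OF s1(1)] abs_l2_scaleC[OF sq_int_add[OF s1(2,3)]] abs_l2_add[OF s1(2,3)])
  finally show ?thesis by (simp add: c_def d_def)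
qed

lemma lifted_eq: "lifted \<alpha> \<phi> u t = rep_h2 (apply_bcontfun u t + lift_h2 (\<phi> t))"
  by (simp add: lifted_def plus_h2.rep_eq lift_h2(1))

lemma NL_constants:
  "\<exists>Q\<ge>1. (\<forall>u v. norm (bil u v) \<le> Q * norm u * norm v) \<and> (\<forall>u. norm (lin u) \<le> Q * norm u) \<and>
     (\<forall>c. norm (e1 c) \<le> Q * norm c) \<and> (\<forall>c. norm (e2 c) \<le> Q * norm c) \<and> (\<forall>c. norm (lift_h2 c) \<le> Q * norm c)"
proof -
  obtain B1 B2 B3 B4 where B: "\<And>u. norm (lin u) \<le> norm u * B1" "\<And>c. norm (e1 c) \<le> norm c * B2"
    "\<And>c. norm (e2 c) \<le> norm c * B3" "\<And>c. norm (lift_h2 c) \<le> norm c * B4"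
    using bounded_linear.bounded[OF bounded_linear_lin] bounded_linear.bounded[OF bounded_linear_e1]
      bounded_linear.bounded[OF bounded_linear_e2] bounded_linear.bounded[OF lift_h2(2)] by blast
  define Q where "Q = max 3 (max (max B1 B2) (max B3 B4))"
  have Q: "3 \<le> Q" "B1 \<le> Q" "B2 \<le> Q" "B3 \<le> Q" "B4 \<le> Q" by (auto simp: Q_def)
  have *: "x \<le> Q * b" if "x \<le> b * K" "K \<le> Q" "0 \<le> b" for x b K :: real
    using mult_left_mono[OF that(2,3)] that(1) by (simp add: mult.commute)
  have "norm (bil u v) \<le> Q * norm u * norm v" for u v
    using *[of "norm (bil u v)" "norm u * norm v" 3] norm_bil_le[of u v] Q(1) by (simp add: mult_ac)
  then show ?thesis
    using *[OF B(1) Q(2)] *[OF B(2) Q(3)] *[OF B(3) Q(4)] *[OF B(4) Q(5)] Q(1) by (intro exI[of _ Q]) auto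
qed

definition Q :: real where
  "Q = (SOME Q. Q \<ge> 1 \<and> (\<forall>u v. norm (bil u v) \<le> Q * norm u * norm v) \<and> (\<forall>u. norm (lin u) \<le> Q * norm u) \<and>
     (\<forall>c. norm (e1 c) \<le> Q * norm c) \<and> (\<forall>c. norm (e2 c) \<le> Q * norm c) \<and> (\<forall>c. norm (lift_h2 c) \<le> Q * norm c))"

lemma Q: "1 \<le> Q" "norm (bil u v) \<le> Q * norm u * norm v" "norm (lin u) \<le> Q * norm u"
  "norm (e1 c) \<le> Q * norm c" "norm (e2 c) \<le> Q * norm c" "norm (lift_h2 c) \<le> Q * norm c"
  using someI_ex[OF NL_constants] unfolding Q_def[symmetric] by blast+

lemma NL_bound:
  assumes y: "norm y \<le> \<rho>" and c: "norm c \<le> \<epsilon>" and d: "norm d \<le> \<epsilon>" and \<epsilon>: "0 \<le> \<epsilon>" "\<epsilon> \<le> 1"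
  shows "norm (NL y c d) \<le> Q * (\<rho>\<^sup>2 + \<epsilon> * \<rho> + 2 * \<epsilon>)"
proof -
  have \<rho>: "0 \<le> \<rho>" using y norm_ge_zero[of y] by linarith
  have Q0: "0 \<le> Q" using Q(1) by simp
  have 1: "norm (bil y y) \<le> Q * \<rho> * \<rho>"
    by (rule order_trans[OF Q(2)]) (use y \<rho> Q0 in \<open>auto intro!: mult_mono\<close>)
  have 2: "norm (scaleC_l2 c (lin y)) \<le> \<epsilon> * (Q * \<rho>)"
    unfolding norm_scaleC
    by (rule mult_mono[OF c order_trans[OF Q(3) mult_left_mono[OF y Q0]]]) (use \<epsilon> in auto)
  have 3: "norm (e1 d) \<le> Q * \<epsilon>" by (rule order_trans[OF Q(4) mult_left_mono[OF d Q0]])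
  have "norm (c\<^sup>2) \<le> \<epsilon>"
  proof -
    have "norm (c\<^sup>2) = norm c * norm c" by (simp add: power2_eq_square norm_mult)
    also have "\<dots> \<le> 1 * \<epsilon>" using c \<epsilon> by (intro mult_mono) auto
    finally show ?thesis by simp
  qed
  then have 4: "norm (e2 (c\<^sup>2)) \<le> Q * \<epsilon>" by (intro order_trans[OF Q(5) mult_left_mono] Q0)
  have "norm (NL y c d) \<le> norm (- bil y y + scaleC_l2 c (lin y)) + norm (e1 d - e2 (c\<^sup>2))"
    unfolding NL_def by (rule norm_triangle_ineq)
  also have "\<dots> \<le> (norm (bil y y) + norm (scaleC_l2 c (lin y))) + (norm (e1 d) + norm (e2 (c\<^sup>2)))"
    by (intro add_mono norm_triangle_ineq4) (use norm_triangle_ineq[of "- bil y y"] in simp)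
  also have "\<dots> \<le> Q * \<rho> * \<rho> + \<epsilon> * (Q * \<rho>) + (Q * \<epsilon> + Q * \<epsilon>)" using 1 2 3 4 by linarith
  also have "\<dots> = Q * (\<rho>\<^sup>2 + \<epsilon> * \<rho> + 2 * \<epsilon>)" by (simp add: power2_eq_square algebra_simps)
  finally show ?thesis .
qed

text \<open>State and boundary data vary together: equal data give the contraction estimate, and a
  state compared with its own translate gives the estimate for almost periods.\<close>

lemma NL_lipschitz:
  assumes y: "norm y \<le> \<rho>" "norm y' \<le> \<rho>" and c: "norm c \<le> \<epsilon>" "norm c' \<le> \<epsilon>"
  shows "norm (NL y c d - NL y' c' d') \<le>
    Q * (2 * \<rho> + \<epsilon>) * norm (y - y') + Q * ((\<rho> + 2 * \<epsilon>) * norm (c - c') + norm (d - d'))"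
proof -
  have \<rho>: "0 \<le> \<rho>" using y norm_ge_zero[of y] by linarith
  have \<epsilon>: "0 \<le> \<epsilon>" using c norm_ge_zero[of c] by linarith
  have Q0: "0 \<le> Q" using Q(1) by simp
  let ?t1 = "bil (y - y') y" and ?t2 = "bil y' (y - y')" and ?t3 = "scaleC_l2 c (lin (y - y'))"
    and ?t4 = "scaleC_l2 (c - c') (lin y')" and ?t5 = "e1 (d - d')" and ?t6 = "e2 ((c - c') * (c + c'))"
  note linD = linear_diff[OF bounded_linear.linear[OF bounded_linear_lin]]
    linear_diff[OF bounded_linear.linear[OF bounded_linear_e1]] linear_diff[OF bounded_linear.linear[OF bounded_linear_e2]]
  \<comment> \<open>Factoring the difference of squares keeps the difference of the data as a
    factor, so the linear map \<open>e2\<close> contributes a Lipschitz term.\<close>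
  have sq: "(c - c') * (c + c') = c\<^sup>2 - c'\<^sup>2" by (simp add: power2_eq_square algebra_simps)
  have eq: "NL y c d - NL y' c' d' = (- ?t1) + (- ?t2) + ?t3 + ?t4 + ?t5 + (- ?t6)"
    unfolding NL_def sq by (simp add: linD bil.diff_left bil.diff_right scaleC.diff_left scaleC.diff_right)
  have "norm (NL y c d - NL y' c' d') \<le> norm (- ?t1) + norm (- ?t2) + norm ?t3 + norm ?t4 + norm ?t5 + norm (- ?t6)"
    unfolding eq by (intro norm_triangle_le add_right_mono norm_triangle_ineq)
  moreover have "norm ?t1 \<le> Q * norm (y - y') * \<rho>"
    by (rule order_trans[OF Q(2)]) (intro mult_left_mono y mult_nonneg_nonneg Q0 norm_ge_zero)
  moreover have "norm ?t2 \<le> Q * \<rho> * norm (y - y')"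
    by (rule order_trans[OF Q(2)]) (intro mult_right_mono mult_left_mono y Q0 norm_ge_zero)
  moreover have "norm ?t3 \<le> \<epsilon> * (Q * norm (y - y'))"
    unfolding norm_scaleC by (intro mult_mono c Q(3) \<epsilon> norm_ge_zero)
  moreover have "norm ?t4 \<le> norm (c - c') * (Q * \<rho>)"
    unfolding norm_scaleC by (intro mult_left_mono order_trans[OF Q(3) mult_left_mono[OF y(2) Q0]] norm_ge_zero)
  moreover have "norm ?t5 \<le> Q * norm (d - d')" by (rule Q(4))
  moreover have "norm ?t6 \<le> Q * (norm (c - c') * (2 * \<epsilon>))"
  proof (rule order_trans[OF Q(5)], intro mult_left_mono Q0)
    have "norm (c + c') \<le> 2 * \<epsilon>" using norm_triangle_ineq[of c c'] c by linarith
    then show "norm ((c - c') * (c + c')) \<le> norm (c - c') * (2 * \<epsilon>)"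
      unfolding norm_mult by (intro mult_left_mono) auto
  qed
  ultimately have "norm (NL y c d - NL y' c' d') \<le> Q * norm (y - y') * \<rho> + Q * \<rho> * norm (y - y') + \<epsilon> * (Q * norm (y - y')) +
      norm (c - c') * (Q * \<rho>) + Q * norm (d - d') + Q * (norm (c - c') * (2 * \<epsilon>))"
    unfolding norm_minus_cancel by linarith
  also have "\<dots> = Q * (2 * \<rho> + \<epsilon>) * norm (y - y') + Q * ((\<rho> + 2 * \<epsilon>) * norm (c - c') + norm (d - d'))"
    by (simp add: algebra_simps)
  finally show ?thesis .
qed

lemma continuous_NL:
  assumes "continuous_on X y" "continuous_on X c" "continuous_on X d"
  shows "continuous_on X (\<lambda>s. NL (y s) (c s) (d s))"
  unfolding NL_def
  by (intro continuous_intros bil.continuous_on scaleC.continuous_on assms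
      bounded_linear.continuous_on[OF bounded_linear_lin] bounded_linear.continuous_on[OF bounded_linear_e1]
      bounded_linear.continuous_on[OF bounded_linear_e2])

end

subsection \<open>Almost periodic functions\<close>

lemma almost_periodicD:
  assumes "almost_periodic g" "\<delta> > 0"
  obtains l where "l > 0" "\<And>a. \<exists>\<tau>\<in>{a..a + l}. \<forall>t. dist (g (t + \<tau>)) (g t) < \<delta>"
proof -
  obtain l where l: "l > 0" "\<And>a. \<exists>\<tau>\<in>{a..a + l}. (SUP t. ereal (dist (g (t + \<tau>)) (g t))) < ereal \<delta>"
    using assms unfolding almost_periodic_def by blast
  have "\<exists>\<tau>\<in>{a..a + l}. \<forall>t. dist (g (t + \<tau>)) (g t) < \<delta>" for a
  proof -
    obtain \<tau> where \<tau>: "\<tau> \<in> {a..a + l}" "(SUP t. ereal (dist (g (t + \<tau>)) (g t))) < ereal \<delta>" using l(2) by blast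
    have "ereal (dist (g (t + \<tau>)) (g t)) < ereal \<delta>" for t
      by (rule le_less_trans[OF SUP_upper \<tau>(2)]) simp
    then show ?thesis using \<tau>(1) by (intro bexI[of _ \<tau>]) auto
  qed
  then show ?thesis using l(1) that by blast
qed

lemma almost_periodicI:
  assumes "continuous_on UNIV g"
    and "\<And>\<delta>. \<delta> > 0 \<Longrightarrow> \<exists>l>0. \<forall>a. \<exists>\<tau>\<in>{a..a + l}. \<forall>t. dist (g (t + \<tau>)) (g t) \<le> \<delta>"
  shows "almost_periodic g"
  unfolding almost_periodic_def
proof (intro conjI allI impI assms(1))
  fix \<delta> :: real assume "\<delta> > 0"
  \<comment> \<open>Halving \<delta> turns pointwise bounds that need not be strict into a strict
    bound on the supremum.\<close>
  then obtain l where l: "l > 0" "\<And>a. \<exists>\<tau>\<in>{a..a + l}. \<forall>t. dist (g (t + \<tau>)) (g t) \<le> \<delta> / 2" using assms(2)[of "\<delta>/2"] by auto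
  have "\<exists>\<tau>\<in>{a..a + l}. (SUP t. ereal (dist (g (t + \<tau>)) (g t))) < ereal \<delta>" for a
  proof -
    obtain \<tau> where \<tau>: "\<tau> \<in> {a..a + l}" "\<And>t. dist (g (t + \<tau>)) (g t) \<le> \<delta> / 2" using l(2) by blast
    have "(SUP t. ereal (dist (g (t + \<tau>)) (g t))) \<le> ereal (\<delta> / 2)" by (rule SUP_least) (simp only: ereal_less_eq \<tau>(2))
    also have "\<dots> < ereal \<delta>" using \<open>\<delta> > 0\<close> by simp
    finally show ?thesis using \<tau>(1) by blast
  qed
  then show "\<exists>l>0. \<forall>a. \<exists>\<tau>\<in>{a..a + l}. (SUP t. ereal (dist (g (t + \<tau>)) (g t))) < ereal \<delta>" using l(1) by blast
qed

text \<open>An almost period moves any two close points into one fixed compact interval, where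
  continuity is uniform, at the cost of two small errors.\<close>

lemma almost_periodic_uniformly_continuous:
  fixes g :: "real \<Rightarrow> 'a::metric_space"
  assumes g: "almost_periodic g" and e: "e > 0"
  shows "\<exists>d>0. \<forall>x y. dist x y < d \<longrightarrow> dist (g x) (g y) < e"
proof -
  obtain l where l: "l > 0" "\<And>a. \<exists>\<tau>\<in>{a..a + l}. \<forall>t. dist (g (t + \<tau>)) (g t) < e / 3"
    using almost_periodicD[OF g, of "e/3"] e by (metis zero_less_divide_iff zero_less_numeral)
  have "continuous_on {-1..l + 1} g" using g by (auto simp: almost_periodic_def intro: continuous_on_subset)
  then have "uniformly_continuous_on {-1..l + 1} g" by (rule compact_uniformly_continuous) simp
  then obtain d where d: "d > 0" "\<And>x y. x \<in> {-1..l + 1} \<Longrightarrow> y \<in> {-1..l + 1} \<Longrightarrow> dist y x < d \<Longrightarrow> dist (g y) (g x) < e / 3"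
    unfolding uniformly_continuous_on_def using e by (metis zero_less_divide_iff zero_less_numeral)
  have "dist (g x) (g y) < e" if xy: "dist x y < min d 1" for x y
  proof -
    \<comment> \<open>Such a shift brings \<open>x\<close> into \<open>[0, l]\<close> and
      \<open>y\<close>, which is less than 1 away, into \<open>[-1, l + 1]\<close>.\<close>
    obtain \<tau> where \<tau>: "\<tau> \<in> {- x..- x + l}" "\<And>t. dist (g (t + \<tau>)) (g t) < e / 3" using l(2) by blast
    have "dist (g (x + \<tau>)) (g (y + \<tau>)) < e / 3"
      using \<tau>(1) xy by (intro d(2)) (auto simp: dist_real_def)
    moreover have "dist (g x) (g y) \<le> dist (g (x + \<tau>)) (g x) + dist (g (x + \<tau>)) (g (y + \<tau>)) + dist (g (y + \<tau>)) (g y)"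
      using dist_triangle[of "g x" "g y" "g (x + \<tau>)"] dist_triangle[of "g (x + \<tau>)" "g y" "g (y + \<tau>)"]
      by (simp add: dist_commute)
    ultimately show ?thesis using \<tau>(2)[of x] \<tau>(2)[of y] by linarith
  qed
  then show ?thesis using d(1) by (intro exI[of _ "min d 1"]) auto
qed

text \<open>An interpolation of Landau--Kolmogorov type: almost periods of \<open>\<phi>\<close> are almost periods of \<open>\<phi>'\<close>, so
  that no common almost periods of two almost periodic functions have to be found.\<close>

lemma almost_period_derivative:
  fixes \<phi> :: "real \<Rightarrow> 'a::real_normed_vector"
  assumes \<phi>: "\<And>t. (\<phi> has_vector_derivative \<phi>' t) (at t)" and ap: "almost_periodic \<phi>'" and e: "e > 0"
  shows "\<exists>\<eta>>0. \<forall>\<tau>. (\<forall>t. norm (\<phi> (t + \<tau>) - \<phi> t) \<le> \<eta>) \<longrightarrow> (\<forall>t. norm (\<phi>' (t + \<tau>) - \<phi>' t) \<le> e)"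
proof -
  obtain d where d: "d > 0" "\<And>x y. dist x y < d \<Longrightarrow> dist (\<phi>' x) (\<phi>' y) < e / 4"
    using almost_periodic_uniformly_continuous[OF ap, of "e/4"] e by auto
  define h where "h = d / 2"
  have h: "h > 0" "h < d" using d(1) by (auto simp: h_def)
  \<comment> \<open>A first-order expansion over the step \<open>h\<close> of the difference between
    \<phi> and its translate: the remainder and the two end values are each allowed to contribute
    half of \<open>h * e\<close>, whence the threshold \<open>h * e / 4\<close> for each end
    value.\<close>
  have "norm (\<phi>' (t + \<tau>) - \<phi>' t) \<le> e" if \<tau>: "\<And>t. norm (\<phi> (t + \<tau>) - \<phi> t) \<le> h * e / 4" for t \<tau>
  proof -
    define \<psi> where "\<psi> s = \<phi> (t + s + \<tau>) - \<phi> (t + s)" for s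
    define \<psi>' where "\<psi>' s = \<phi>' (t + s + \<tau>) - \<phi>' (t + s)" for s
    have "norm ((\<psi> h - h *\<^sub>R \<psi>' 0) - (\<psi> 0 - 0 *\<^sub>R \<psi>' 0)) \<le> h * (e / 2)"
    proof (rule vector_mvt_bound)
      fix s assume s: "s \<in> {0..h}"
      have D: "((\<lambda>s. \<phi> (t + s + c)) has_vector_derivative \<phi>' (t + s + c)) (at s within {0..h})" for c
      proof -
        have "((\<lambda>s. t + s + c) has_real_derivative 1) (at s within {0..h})" by (auto intro!: derivative_eq_intros)
        from vector_diff_chain_within[OF this[unfolded has_real_derivative_iff_has_vector_derivative]
            has_vector_derivative_at_within[OF \<phi>]]
        show ?thesis by (simp add: o_def)
      qed
      show "((\<lambda>s. \<psi> s - s *\<^sub>R \<psi>' 0) has_vector_derivative \<psi>' s - \<psi>' 0) (at s within {0..h})"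
        unfolding \<psi>_def
        by (rule derivative_eq_intros D D[of 0, simplified] refl)+ (simp add: \<psi>'_def)
      have "dist (\<phi>' (t + s + \<tau>)) (\<phi>' (t + 0 + \<tau>)) < e / 4" "dist (\<phi>' (t + s)) (\<phi>' (t + 0)) < e / 4"
        by (rule d(2); use s h in \<open>simp add: dist_real_def\<close>)+
      then have "norm ((\<phi>' (t + s + \<tau>) - \<phi>' (t + 0 + \<tau>)) - (\<phi>' (t + s) - \<phi>' (t + 0))) \<le> e / 4 + e / 4"
        unfolding dist_norm by (intro norm_triangle_le_diff) linarith
      moreover have "(\<phi>' (t + s + \<tau>) - \<phi>' (t + 0 + \<tau>)) - (\<phi>' (t + s) - \<phi>' (t + 0)) = \<psi>' s - \<psi>' 0"
        by (simp add: \<psi>'_def)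
      ultimately show "norm (\<psi>' s - \<psi>' 0) \<le> e / 2" by simp
    qed (use h in simp)
    then have "norm (\<psi> h - \<psi> 0 - h *\<^sub>R \<psi>' 0) \<le> h * (e / 2)" by (simp add: algebra_simps)
    moreover have "norm (\<psi> h) \<le> h * e / 4" "norm (\<psi> 0) \<le> h * e / 4"
      using \<tau>[of "t + h"] \<tau>[of "t + 0"] by (simp_all add: \<psi>_def)
    moreover have "h *\<^sub>R \<psi>' 0 = (\<psi> h - \<psi> 0) - (\<psi> h - \<psi> 0 - h *\<^sub>R \<psi>' 0)" by simp
    then have "norm (h *\<^sub>R \<psi>' 0) \<le> (norm (\<psi> h) + norm (\<psi> 0)) + norm (\<psi> h - \<psi> 0 - h *\<^sub>R \<psi>' 0)"
      by (metis add_right_mono norm_triangle_ineq4 order_trans)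
    ultimately have "norm (h *\<^sub>R \<psi>' 0) \<le> h * e" by (simp add: field_simps)
    then have "norm (\<psi>' 0) \<le> e" using h by simp
    then show ?thesis by (simp add: \<psi>'_def)
  qed
  then show ?thesis using h e by (intro exI[of _ "h * e / 4"]) auto
qed

subsection \<open>The fixed point\<close>

lemma C1_normD:
  assumes "C1_norm \<phi> \<le> ereal \<epsilon>"
  shows "norm (\<phi> t) \<le> \<epsilon>" "norm (vector_derivative \<phi> (at t)) \<le> \<epsilon>"
proof -
  let ?a = "SUP t. ereal (norm (\<phi> t))" and ?b = "SUP t. ereal (norm (vector_derivative \<phi> (at t)))"
  have a: "ereal (norm (\<phi> t)) \<le> ?a" for t by (rule SUP_upper) simp
  have b: "ereal (norm (vector_derivative \<phi> (at t))) \<le> ?b" for t by (rule SUP_upper) simp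
  have "0 \<le> ?a" by (rule order_trans[OF _ a[of 0]]) simp
  moreover have "0 \<le> ?b" by (rule order_trans[OF _ b[of 0]]) simp
  ultimately have "?a \<le> ?a + ?b" "?b \<le> ?a + ?b" by (simp_all add: add_increasing add_increasing2)
  then have "ereal (norm (\<phi> t)) \<le> ereal \<epsilon>" "ereal (norm (vector_derivative \<phi> (at t))) \<le> ereal \<epsilon>"
    using assms a[of t] b[of t] unfolding C1_norm_def by (meson order_trans)+
  then show "norm (\<phi> t) \<le> \<epsilon>" "norm (vector_derivative \<phi> (at t)) \<le> \<epsilon>" by simp_all
qed

context kawahara
begin

definition q :: real where "q = 1 + Q + M * Q"

lemma q: "1 \<le> q" "Q \<le> q" "M * Q \<le> q"
proof -
  have "0 \<le> M * Q" using M(1) Q(1) by simp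
  then show "1 \<le> q" "Q \<le> q" "M * Q \<le> q" using Q(1) by (simp_all add: q_def)
qed

text \<open>Three nested radii are in play: \<open>4 * q * \<epsilon>\<close> for the image of the
  fixed point map, \<open>5 * q * \<epsilon>\<close> for \<open>u\<close>, and
  \<open>6 * q * \<epsilon>\<close> for \<open>y\<close>, each step leaving room for the lift of
  norm at most \<open>q * \<epsilon>\<close>. The number 26 comes from the contraction condition,
  where \<open>13 * q\<^sup>2 * \<epsilon>\<close> must not exceed 1/2.\<close>

lemma small_constants:
  assumes \<epsilon>: "0 < \<epsilon>" "\<epsilon> \<le> 1 / (26 * q\<^sup>2)"
  shows "\<epsilon> \<le> 1" "q * ((6 * q * \<epsilon>)\<^sup>2 + \<epsilon> * (6 * q * \<epsilon>) + 2 * \<epsilon>) \<le> 4 * q * \<epsilon>" "q * (2 * (6 * q * \<epsilon>) + \<epsilon>) \<le> 1 / 2"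
proof -
  have q2: "1 \<le> q\<^sup>2" "q \<le> q\<^sup>2" using q(1) by (simp_all add: self_le_power)
  have "0 < 26 * q\<^sup>2" using q2 by linarith
  then have "\<epsilon> * (26 * q\<^sup>2) \<le> 1" using \<epsilon>(2) by (simp only: pos_le_divide_eq)
  then have 26: "26 * (q\<^sup>2 * \<epsilon>) \<le> 1" by (simp add: mult_ac)
  have "1 * \<epsilon> \<le> q\<^sup>2 * \<epsilon>" using q2 \<epsilon> by (intro mult_right_mono) auto
  then show "\<epsilon> \<le> 1" using 26 by linarith
  have qe: "q * \<epsilon> \<le> q\<^sup>2 * \<epsilon>" using q2 \<epsilon> by (intro mult_right_mono) auto
  show "q * (2 * (6 * q * \<epsilon>) + \<epsilon>) \<le> 1 / 2"
  proof -
    have "q * (2 * (6 * q * \<epsilon>) + \<epsilon>) = 12 * (q\<^sup>2 * \<epsilon>) + q * \<epsilon>" by (simp add: power2_eq_square algebra_simps)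
    then show ?thesis using 26 qe by linarith
  qed
  have "q * ((6 * q * \<epsilon>)\<^sup>2 + \<epsilon> * (6 * q * \<epsilon>) + 2 * \<epsilon>) = (q * \<epsilon>) * (36 * (q\<^sup>2 * \<epsilon>) + 6 * (q * \<epsilon>) + 2)"
    by (simp add: power2_eq_square algebra_simps)
  also have "\<dots> \<le> (q * \<epsilon>) * 4"
  proof (rule mult_left_mono)
    show "36 * (q\<^sup>2 * \<epsilon>) + 6 * (q * \<epsilon>) + 2 \<le> 4" using 26 qe by linarith
  qed (use q(1) \<epsilon> in simp)
  finally show "q * ((6 * q * \<epsilon>)\<^sup>2 + \<epsilon> * (6 * q * \<epsilon>) + 2 * \<epsilon>) \<le> 4 * q * \<epsilon>" by simp
qed

end

section \<open>The contraction for small boundary data\<close>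

locale kawahara_small = kawahara +
  fixes \<epsilon> :: real and \<phi> :: "real \<Rightarrow> complex"
  assumes \<epsilon>: "0 < \<epsilon>" "\<epsilon> \<le> 1 / (26 * q\<^sup>2)"
    and \<phi>_C1: "\<phi> C1_differentiable_on UNIV" and \<phi>_small: "C1_norm \<phi> \<le> ereal \<epsilon>"
begin

definition \<phi>' :: "real \<Rightarrow> complex" where "\<phi>' t = vector_derivative \<phi> (at t)"

lemma \<phi>_deriv: "(\<phi> has_vector_derivative \<phi>' t) (at t)"
  using \<phi>_C1 by (auto simp: C1_differentiable_on_eq \<phi>'_def vector_derivative_works)

lemma continuous_\<phi>: "continuous_on UNIV \<phi>" and continuous_\<phi>': "continuous_on UNIV \<phi>'"
proof -
  show "continuous_on UNIV \<phi>"
    using \<phi>_deriv by (auto simp: continuous_on_eq_continuous_at intro: has_vector_derivative_continuous)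
  show "continuous_on UNIV \<phi>'"
    using \<phi>_C1 by (auto simp: C1_differentiable_on_eq \<phi>'_def[abs_def])
qed

lemma \<phi>_le: "norm (\<phi> t) \<le> \<epsilon>" "norm (\<phi>' t) \<le> \<epsilon>"
  using C1_normD[OF \<phi>_small] by (simp_all add: \<phi>'_def)

definition \<rho> :: real where "\<rho> = 6 * q * \<epsilon>"

lemma \<rho>: "0 \<le> \<rho>" using q(1) \<epsilon> by (simp add: \<rho>_def)

definition G :: "(real \<Rightarrow>\<^sub>C h2) \<Rightarrow> real \<Rightarrow> l2" where
  "G y s = NL (y s) (\<phi> s) (\<phi>' s)"

lemma continuous_G: "continuous_on UNIV (G y)"
  unfolding G_def[abs_def]
  by (intro continuous_NL continuous_on_apply_bcontfun continuous_\<phi> continuous_\<phi>')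

lemma G_bounded: "norm y \<le> r \<Longrightarrow> norm (G y s) \<le> Q * (r\<^sup>2 + \<epsilon> * r + 2 * \<epsilon>)"
  unfolding G_def
  by (rule NL_bound[OF order_trans[OF norm_bounded] \<phi>_le]) (use \<epsilon> small_constants(1) in auto)

definition \<Gamma> :: "(real \<Rightarrow>\<^sub>C h2) \<Rightarrow> (real \<Rightarrow>\<^sub>C h2)" where
  "\<Gamma> y = Bcontfun (semigroup_conv (G y))"

lemma \<Gamma>: "apply_bcontfun (\<Gamma> y) = semigroup_conv (G y)"
  unfolding \<Gamma>_def
  by (rule Bcontfun_inverse[OF bcontfun_normI[OF continuous_semigroup_conv[OF continuous_G G_bounded[OF order_refl]]
          norm_semigroup_conv_le[OF continuous_G G_bounded[OF order_refl]]]])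

lemma \<Gamma>_bound:
  assumes "norm y \<le> \<rho>" shows "norm (\<Gamma> y) \<le> 4 * q * \<epsilon>"
proof (rule norm_bound)
  fix t
  have "norm (semigroup_conv (G y) t) \<le> M * (Q * (\<rho>\<^sup>2 + \<epsilon> * \<rho> + 2 * \<epsilon>))"
    by (rule norm_semigroup_conv_le[OF continuous_G G_bounded[OF assms]])
  also have "\<dots> = (M * Q) * (\<rho>\<^sup>2 + \<epsilon> * \<rho> + 2 * \<epsilon>)" by simp
  also have "\<dots> \<le> q * (\<rho>\<^sup>2 + \<epsilon> * \<rho> + 2 * \<epsilon>)"
    using \<rho> \<epsilon> by (intro mult_right_mono q) auto
  also have "\<dots> \<le> 4 * q * \<epsilon>" unfolding \<rho>_def by (rule small_constants(2)[OF \<epsilon>])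
  finally show "norm (apply_bcontfun (\<Gamma> y) t) \<le> 4 * q * \<epsilon>" by (simp add: \<Gamma>)
qed

text \<open>With \<open>\<tau> = 0\<close> this is the Lipschitz bound for the contraction; with
  \<open>z = y\<close> it compares a solution with its translate.\<close>

lemma G_translation_lipschitz:
  assumes "norm y \<le> \<rho>" "norm z \<le> \<rho>"
  shows "norm (G y (s + \<tau>) - G z s) \<le> Q * (2 * \<rho> + \<epsilon>) * norm (y (s + \<tau>) - z s) +
    Q * ((\<rho> + 2 * \<epsilon>) * norm (\<phi> (s + \<tau>) - \<phi> s) + norm (\<phi>' (s + \<tau>) - \<phi>' s))"
  unfolding G_def by (intro NL_lipschitz order_trans[OF norm_bounded] assms \<phi>_le)

lemma contraction_le: "0 \<le> x \<Longrightarrow> M * (Q * (2 * \<rho> + \<epsilon>) * x) \<le> 1 / 2 * x"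
proof -
  assume x: "0 \<le> x"
  have "M * Q * (2 * \<rho> + \<epsilon>) \<le> q * (2 * \<rho> + \<epsilon>)" using \<rho> \<epsilon> by (intro mult_right_mono q) auto
  also have "\<dots> \<le> 1 / 2" unfolding \<rho>_def by (rule small_constants(3)[OF \<epsilon>])
  finally have "(M * Q * (2 * \<rho> + \<epsilon>)) * x \<le> 1 / 2 * x" using x by (rule mult_right_mono)
  then show ?thesis by (simp add: mult_ac)
qed

lemma \<Gamma>_contraction:
  assumes "norm y \<le> \<rho>" "norm z \<le> \<rho>" shows "dist (\<Gamma> y) (\<Gamma> z) \<le> 1 / 2 * dist y z"
proof (rule dist_bound)
  fix t
  have Q0: "0 \<le> Q" using Q(1) by simp
  have "norm (G y s - G z s) \<le> Q * (2 * \<rho> + \<epsilon>) * norm (y - z)" for s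
  proof -
    have "norm (G y s - G z s) \<le> Q * (2 * \<rho> + \<epsilon>) * norm (y s - z s)"
      using G_translation_lipschitz[OF assms, of s 0] by simp
    also have "\<dots> \<le> Q * (2 * \<rho> + \<epsilon>) * norm (y - z)"
      using norm_bounded[of "y - z" s] Q0 \<rho> \<epsilon> by (intro mult_left_mono mult_nonneg_nonneg) auto
    finally show ?thesis .
  qed
  then have "norm (semigroup_conv (G y) t - semigroup_conv (G z) t) \<le> M * (Q * (2 * \<rho> + \<epsilon>) * norm (y - z))"
    by (intro semigroup_conv_diff_le[OF continuous_G G_bounded[OF assms(1)] continuous_G G_bounded[OF assms(2)]])
  also have "\<dots> \<le> 1 / 2 * norm (y - z)" by (rule contraction_le) simp
  finally show "dist (apply_bcontfun (\<Gamma> y) t) (apply_bcontfun (\<Gamma> z) t) \<le> 1 / 2 * dist y z"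
    by (simp add: \<Gamma> dist_norm)
qed

lemma fixed_point: "\<exists>!y. norm y \<le> \<rho> \<and> \<Gamma> y = y"
proof -
  have "4 * q * \<epsilon> \<le> \<rho>" using q(1) \<epsilon> by (simp add: \<rho>_def)
  have "\<exists>!y\<in>cball 0 \<rho>. \<Gamma> y = y"
  proof (rule Banach_fix)
    show "complete (cball (0 :: real \<Rightarrow>\<^sub>C h2) \<rho>)" by (simp add: complete_eq_closed)
    show "cball (0 :: real \<Rightarrow>\<^sub>C h2) \<rho> \<noteq> {}" using \<rho> by simp
    show "\<Gamma> ` cball 0 \<rho> \<subseteq> cball 0 \<rho>"
      using order_trans[OF \<Gamma>_bound \<open>4 * q * \<epsilon> \<le> \<rho>\<close>] by auto
    show "dist (\<Gamma> y) (\<Gamma> z) \<le> 1 / 2 * dist y z" if "y \<in> cball 0 \<rho>" "z \<in> cball 0 \<rho>" for y z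
      using that by (intro \<Gamma>_contraction) auto
  qed auto
  then show ?thesis by simp
qed

definition lift_bc :: "real \<Rightarrow>\<^sub>C h2" where "lift_bc = Bcontfun (\<lambda>t. lift_h2 (\<phi> t))"

lemma lift_bc: "apply_bcontfun lift_bc t = lift_h2 (\<phi> t)" "norm lift_bc \<le> q * \<epsilon>"
proof -
  have le: "norm (lift_h2 (\<phi> t)) \<le> q * \<epsilon>" for t
  proof -
    have "norm (lift_h2 (\<phi> t)) \<le> Q * norm (\<phi> t)" by (rule Q(6))
    also have "\<dots> \<le> q * \<epsilon>" using q \<phi>_le(1)[of t] by (intro mult_mono) auto
    finally show ?thesis .
  qed
  have "(\<lambda>t. lift_h2 (\<phi> t)) \<in> bcontfun"
    by (rule bcontfun_normI[OF bounded_linear.continuous_on[OF lift_h2(2) continuous_\<phi>] le])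
  then have *: "apply_bcontfun lift_bc = (\<lambda>t. lift_h2 (\<phi> t))" by (simp add: lift_bc_def Bcontfun_inverse)
  show "apply_bcontfun lift_bc t = lift_h2 (\<phi> t)" by (simp add: *)
  show "norm lift_bc \<le> q * \<epsilon>" by (rule norm_bound) (simp add: * le)
qed

text \<open>After the lift a solution is a bounded mild solution with bounded continuous right-hand
  side, hence equal to the convolution by uniqueness on the whole line. Conversely the convolution
  satisfies the mild equation.\<close>

lemma mild_iff_fixed_point: "mild_solution \<alpha> \<phi> u \<longleftrightarrow> \<Gamma> (u + lift_bc) = u + lift_bc"
proof -
  define y where "y = u + lift_bc"
  have lifted: "lifted \<alpha> \<phi> u = (\<lambda>t. rep_h2 (y t))"
    by (rule ext) (simp add: lifted_eq y_def lift_bc)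
  have rhs: "rhs \<alpha> \<phi> (lifted \<alpha> \<phi> u) s = G y s" for s
    unfolding G_def \<phi>'_def lifted by (rule rhs_eq_NL) (rule refl)
  note g = continuous_G[of y] G_bounded[OF order_refl, of y]
  show ?thesis
    unfolding y_def[symmetric]
  proof
    assume "mild_solution \<alpha> \<phi> u"
    then have m: "((\<lambda>s. S (t - s) (G y s)) has_integral (rep_h2 (y t) - S (t - r) (rep_h2 (y r)))) {r..t}" if "r \<le> t" for r t
      using that unfolding mild_solution_def rhs unfolding lifted by blast
    have "norm (rep_h2 (y t)) \<le> norm y" for t
      using order_trans[OF wderiv_rep_h2_le[of 0] norm_bounded, of y t] by (simp add: wderiv_0)
    from mild_unique[OF g this m] have "rep_h2 (y t) = rep_h2 (semigroup_conv (G y) t)" for t by blast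
    then show "\<Gamma> y = y" by (intro bcontfun_eqI) (simp add: \<Gamma> rep_h2_inject)
  next
    assume "\<Gamma> y = y"
    then have "semigroup_conv (G y) = apply_bcontfun y" using \<Gamma>[of y] by simp
    then show "mild_solution \<alpha> \<phi> u"
      unfolding mild_solution_def rhs unfolding lifted using semigroup_conv_mild[OF g] by simp
  qed
qed

text \<open>The translate solves the same fixed point equation with translated boundary data. The
  Lipschitz estimate bounds the supremum \<open>D\<close> of the difference by half of itself plus
  the data term, and \<open>D\<close> is finite because \<open>y\<close> is bounded, so it can be
  absorbed.\<close>

lemma fixed_point_translation:
  assumes y: "norm y \<le> \<rho>" "\<Gamma> y = y"
    and \<eta>: "\<And>t. norm (\<phi> (t + \<tau>) - \<phi> t) \<le> \<eta>" "\<And>t. norm (\<phi>' (t + \<tau>) - \<phi>' t) \<le> \<eta>"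
  shows "norm (y (t + \<tau>) - y t) \<le> 2 * (q * ((\<rho> + 2 * \<epsilon> + 1) * \<eta>))"
proof -
  let ?d = "\<lambda>t. norm (y (t + \<tau>) - y t)" and ?E = "q * ((\<rho> + 2 * \<epsilon> + 1) * \<eta>)"
  have Q0: "0 \<le> Q" using Q(1) by simp
  have \<eta>0: "0 \<le> \<eta>" by (rule order_trans[OF norm_ge_zero \<eta>(1)])
  have bdd: "bdd_above (range ?d)"
  proof (rule bdd_aboveI2)
    fix t show "?d t \<le> norm y + norm y"
      by (rule order_trans[OF norm_triangle_ineq4]) (intro add_mono norm_bounded)
  qed
  define D where "D = (SUP t. ?d t)"
  have d_le: "?d t \<le> D" for t unfolding D_def by (rule cSUP_upper[OF _ bdd]) simp
  have D0: "0 \<le> D" by (rule order_trans[OF norm_ge_zero d_le])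
  have y_eq: "apply_bcontfun y = semigroup_conv (G y)" using \<Gamma>[of y] y(2) by simp
  have "?d t \<le> 1 / 2 * D + ?E" for t
  proof -
    have "norm (G y (s + \<tau>) - G y s) \<le> Q * (2 * \<rho> + \<epsilon>) * D + Q * ((\<rho> + 2 * \<epsilon> + 1) * \<eta>)" for s
    proof -
      have "(\<rho> + 2 * \<epsilon>) * norm (\<phi> (s + \<tau>) - \<phi> s) + norm (\<phi>' (s + \<tau>) - \<phi>' s) \<le> (\<rho> + 2 * \<epsilon>) * \<eta> + \<eta>"
        using \<rho> \<epsilon> by (intro add_mono mult_left_mono \<eta>) auto
      also have "\<dots> = (\<rho> + 2 * \<epsilon> + 1) * \<eta>" by (simp add: algebra_simps)
      finally have 1: "Q * ((\<rho> + 2 * \<epsilon>) * norm (\<phi> (s + \<tau>) - \<phi> s) + norm (\<phi>' (s + \<tau>) - \<phi>' s)) \<le> Q * ((\<rho> + 2 * \<epsilon> + 1) * \<eta>)"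
        using Q0 by (rule mult_left_mono)
      have 2: "Q * (2 * \<rho> + \<epsilon>) * norm (y (s + \<tau>) - y s) \<le> Q * (2 * \<rho> + \<epsilon>) * D"
        using Q0 \<rho> \<epsilon> by (intro mult_left_mono d_le mult_nonneg_nonneg) auto
      show ?thesis using G_translation_lipschitz[OF y(1) y(1), of s \<tau>] 1 2 by linarith
    qed
    then have "norm (semigroup_conv (\<lambda>s. G y (s + \<tau>)) t - semigroup_conv (G y) t) \<le> M * (Q * (2 * \<rho> + \<epsilon>) * D + Q * ((\<rho> + 2 * \<epsilon> + 1) * \<eta>))"
      by (intro semigroup_conv_diff_le[OF _ G_bounded[OF y(1)] continuous_G G_bounded[OF y(1)]]
          continuous_on_compose2[OF continuous_G]) (auto intro!: continuous_intros)
    also have "\<dots> = M * (Q * (2 * \<rho> + \<epsilon>) * D) + (M * Q) * ((\<rho> + 2 * \<epsilon> + 1) * \<eta>)" by (simp add: algebra_simps)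
    also have "\<dots> \<le> 1 / 2 * D + ?E"
      using \<rho> \<epsilon> \<eta>0 by (intro add_mono contraction_le D0 mult_right_mono q) auto
    finally show ?thesis by (simp add: y_eq semigroup_conv_shift)
  qed
  then have "D \<le> 1 / 2 * D + ?E" unfolding D_def by (intro cSUP_least) auto
  then show ?thesis using d_le[of t] by linarith
qed

lemma almost_periodic_solution:
  assumes y: "norm y \<le> \<rho>" "\<Gamma> y = y" and ap: "almost_periodic \<phi>" "almost_periodic \<phi>'"
  shows "almost_periodic (apply_bcontfun (y - lift_bc))"
proof (rule almost_periodicI)
  show "continuous_on UNIV (apply_bcontfun (y - lift_bc))" by (rule continuous_on_apply_bcontfun)
  fix \<delta> :: real assume \<delta>: "\<delta> > 0"
  \<comment> \<open>Collects the factor for the fixed point \<open>y\<close> and the factor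
    \<open>q\<close> for the lift, so that data errors of size \<open>\<delta> / L\<close> add up to
    exactly \<delta>.\<close>
  define L where "L = 2 * (q * (\<rho> + 2 * \<epsilon> + 1)) + q"
  have Lx: "2 * (q * ((\<rho> + 2 * \<epsilon> + 1) * x)) + q * x = L * x" for x by (simp add: L_def algebra_simps)
  have L: "L > 0" using q(1) \<rho> \<epsilon> by (auto simp: L_def intro!: add_nonneg_pos mult_nonneg_nonneg)
  \<comment> \<open>Below the tolerance \<open>\<eta>0\<close> an almost period of \<phi>
    automatically serves the derivative as well, so almost periods of \<phi> alone are
    enough.\<close>
  obtain \<eta>0 where \<eta>0: "\<eta>0 > 0" "\<And>\<tau> t. (\<And>t. norm (\<phi> (t + \<tau>) - \<phi> t) \<le> \<eta>0) \<Longrightarrow> norm (\<phi>' (t + \<tau>) - \<phi>' t) \<le> \<delta> / L"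
    using almost_period_derivative[OF \<phi>_deriv ap(2), of "\<delta> / L"] \<delta> L by (auto simp: divide_pos_pos)
  have "min \<eta>0 (\<delta> / L) > 0" using \<eta>0(1) \<delta> L by simp
  then obtain l where l: "l > 0" "\<And>a. \<exists>\<tau>\<in>{a..a + l}. \<forall>t. dist (\<phi> (t + \<tau>)) (\<phi> t) < min \<eta>0 (\<delta> / L)"
    using almost_periodicD[OF ap(1)] by metis
  have "\<exists>\<tau>\<in>{a..a + l}. \<forall>t. dist (apply_bcontfun (y - lift_bc) (t + \<tau>)) (apply_bcontfun (y - lift_bc) t) \<le> \<delta>" for a
  proof -
    obtain \<tau> where \<tau>: "\<tau> \<in> {a..a + l}" "\<And>t. norm (\<phi> (t + \<tau>) - \<phi> t) < min \<eta>0 (\<delta> / L)"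
      using l(2)[of a] by (auto simp: dist_norm)
    have 1: "norm (\<phi> (t + \<tau>) - \<phi> t) \<le> \<delta> / L" "norm (\<phi> (t + \<tau>) - \<phi> t) \<le> \<eta>0" for t using \<tau>(2)[of t] by auto
    have 2: "norm (\<phi>' (t + \<tau>) - \<phi>' t) \<le> \<delta> / L" for t by (rule \<eta>0(2)[OF 1(2)])
    have "dist (apply_bcontfun (y - lift_bc) (t + \<tau>)) (apply_bcontfun (y - lift_bc) t) \<le> \<delta>" for t
    proof -
      have "dist (apply_bcontfun (y - lift_bc) (t + \<tau>)) (apply_bcontfun (y - lift_bc) t) =
          norm ((y (t + \<tau>) - y t) - lift_h2 (\<phi> (t + \<tau>) - \<phi> t))"
        by (simp add: dist_norm lift_bc linear_diff[OF bounded_linear.linear[OF lift_h2(2)]] algebra_simps)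
      also have "\<dots> \<le> norm (y (t + \<tau>) - y t) + norm (lift_h2 (\<phi> (t + \<tau>) - \<phi> t))" by (rule norm_triangle_ineq4)
      also have "\<dots> \<le> 2 * (q * ((\<rho> + 2 * \<epsilon> + 1) * (\<delta> / L))) + q * (\<delta> / L)"
        using q(1,2) by (intro add_mono fixed_point_translation[OF y 1(1) 2] order_trans[OF Q(6)] mult_mono 1) auto
      also have "\<dots> = L * (\<delta> / L)" by (rule Lx)
      also have "\<dots> = \<delta>" using L by simp
      finally show ?thesis .
    qed
    then show ?thesis using \<tau>(1) by blast
  qed
  then show "\<exists>l>0. \<forall>a. \<exists>\<tau>\<in>{a..a + l}. \<forall>t. dist (apply_bcontfun (y - lift_bc) (t + \<tau>)) (apply_bcontfun (y - lift_bc) t) \<le> \<delta>"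
    using l(1) by blast
qed

text \<open>The same radius works for existence and uniqueness: the fixed point has norm at most
  \<open>4 * q * \<epsilon>\<close>, so removing the lift gives at most
  \<open>5 * q * \<epsilon>\<close>, while adding the lift to any competitor in that ball lands in
  the ball of radius \<rho>, where the fixed point is unique.\<close>

lemma unique_solution:
  "\<exists>u :: real \<Rightarrow>\<^sub>C h2. mild_solution \<alpha> \<phi> u \<and> norm u \<le> 5 * q * \<epsilon> \<and>
     (\<forall>v. mild_solution \<alpha> \<phi> v \<and> norm v \<le> 5 * q * \<epsilon> \<longrightarrow> v = u) \<and>
     (almost_periodic \<phi> \<and> almost_periodic (\<lambda>t. vector_derivative \<phi> (at t)) \<longrightarrow> almost_periodic (apply_bcontfun u))"
proof -
  obtain y where y: "norm y \<le> \<rho>" "\<Gamma> y = y" and uniq: "\<And>z. norm z \<le> \<rho> \<Longrightarrow> \<Gamma> z = z \<Longrightarrow> z = y"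
    using fixed_point by blast
  define u where "u = y - lift_bc"
  have yu: "u + lift_bc = y" by (simp add: u_def)
  have "norm y \<le> 4 * q * \<epsilon>" using \<Gamma>_bound[OF y(1)] y(2) by simp
  then have "norm u \<le> 4 * q * \<epsilon> + q * \<epsilon>"
    unfolding u_def by (intro order_trans[OF norm_triangle_ineq4] add_mono lift_bc(2))
  also have "\<dots> = 5 * q * \<epsilon>" by (simp add: algebra_simps)
  finally have "norm u \<le> 5 * q * \<epsilon>" .
  moreover have "mild_solution \<alpha> \<phi> u" unfolding mild_iff_fixed_point yu by (rule y(2))
  moreover have "v = u" if "mild_solution \<alpha> \<phi> v" "norm v \<le> 5 * q * \<epsilon>" for v
  proof -
    have "norm (v + lift_bc) \<le> 5 * q * \<epsilon> + q * \<epsilon>"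
      by (intro order_trans[OF norm_triangle_ineq] add_mono lift_bc(2) that)
    also have "\<dots> = \<rho>" by (simp add: \<rho>_def algebra_simps)
    finally have "norm (v + lift_bc) \<le> \<rho>" .
    then have "v + lift_bc = y" using that(1) unfolding mild_iff_fixed_point by (rule uniq)
    then show ?thesis by (simp only: u_def eq_diff_eq)
  qed
  moreover have "almost_periodic (apply_bcontfun u)"
    if "almost_periodic \<phi>" "almost_periodic (\<lambda>t. vector_derivative \<phi> (at t))"
    unfolding u_def by (rule almost_periodic_solution[OF y that[folded \<phi>'_def[abs_def]]])
  ultimately show ?thesis by blast
qed

end

theorem theorem1p5:
  fixes \<alpha> :: real
  assumes "\<bar>\<alpha>\<bar> < 1"
  shows "\<exists>C>0. \<exists>\<epsilon>\<^sub>0>0. \<forall>\<epsilon>. 0 < \<epsilon> \<and> \<epsilon> \<le> \<epsilon>\<^sub>0 \<longrightarrow>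
    (\<forall>\<phi> :: real \<Rightarrow> complex. \<phi> C1_differentiable_on UNIV \<and> C1_norm \<phi> \<le> ereal \<epsilon> \<longrightarrow>
      (\<exists>u :: real \<Rightarrow>\<^sub>C h2.
        mild_solution \<alpha> \<phi> u \<and> norm u \<le> C * \<epsilon> \<and>
        (\<forall>v. mild_solution \<alpha> \<phi> v \<and> norm v \<le> C * \<epsilon> \<longrightarrow> v = u) \<and>
        (almost_periodic \<phi> \<and> almost_periodic (\<lambda>t. vector_derivative \<phi> (at t)) \<longrightarrow>
          almost_periodic (apply_bcontfun u))))"
proof -
  interpret kawahara \<alpha> by unfold_locales (rule assms)
  \<comment> \<open>The witnesses for \<open>C\<close> and \<open>\<epsilon>\<^sub>0\<close>;
    \<open>q\<close> is built from the smoothing constant and the bounds on the nonlinearity and the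
    lift, hence depends on \<alpha> only.\<close>
  have "0 < 5 * q" "0 < 1 / (26 * q\<^sup>2)" using q(1) by auto
  moreover have "\<exists>u :: real \<Rightarrow>\<^sub>C h2. mild_solution \<alpha> \<phi> u \<and> norm u \<le> 5 * q * \<epsilon> \<and>
     (\<forall>v. mild_solution \<alpha> \<phi> v \<and> norm v \<le> 5 * q * \<epsilon> \<longrightarrow> v = u) \<and>
     (almost_periodic \<phi> \<and> almost_periodic (\<lambda>t. vector_derivative \<phi> (at t)) \<longrightarrow> almost_periodic (apply_bcontfun u))"
    if "0 < \<epsilon>" "\<epsilon> \<le> 1 / (26 * q\<^sup>2)" "\<phi> C1_differentiable_on UNIV" "C1_norm \<phi> \<le> ereal \<epsilon>" for \<epsilon> \<phi>
  proof -
    interpret kawahara_small \<alpha> \<epsilon> \<phi> by unfold_locales (use that in auto)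
    show ?thesis by (rule unique_solution)
  qed
  ultimately show ?thesis by blast
qed

end
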